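(* For each $n\in\{23,71,1091,1092\}$, the orientable hyperbolic $4$-manifold $W_n$ (the orientation double cover of the non-orientable hyperbolic $4$-manifold $N_n$) does not contain a closed embedded totally geodesic hyperbolic $3$-manifold.
   Context: Closed means compact without boundary. The manifolds $N_n$. Work in the unit ball model of hyperbolic $4$-space $\mathbb{H}^4$, with coordinates $(x_1,x_2,x_3,x_4)$ and standard basis $e_1,\dots,e_4$ of $\mathbb{R}^4$. Let $Q^4$ be the regular ideal $24$-cell (all dihedral angles $\pi/2$) with ideal vertices $\pm e_1,\pm e_2,\pm e_3,\pm e_4$ and $(\pm\frac12,\pm\frac12,\pm\frac12,\pm\frac12)$. Its $24$ sides are the sides $S_v$, for $v=\pm e_i\pm e_j$ with $1\le i<j\le 4$, where $S_v$ lies on the Euclidean sphere of radius $1$ centred at $v$. For a hexadecimal digit $d=b_1+2b_2+4b_3+8b_4$ with $b_i\in\{0,1\}$ (so $A=10$, $B=11$, $C=12$, $E=14$, $F=15$), let $k_d=\mathrm{diag}((-1)^{b_1},(-1)^{b_2},(-1)^{b_3},(-1)^{b_4})$. A six-digit code $d_{12}d_{13}d_{23}d_{14}d_{24}d_{34}$ encodes the side-pairing of $Q^4$ in which, for each $i<j$ and each of the four vectors $v=\pm e_i\pm e_j$, the side $S_v$ is glued to the side $S_{k_{d}v}$, $d=d_{ij}$, by $x\mapsto k_{d}x$ (the corresponding isometry of $\mathbb{H}^4$ is $k_d$ followed by the reflection in the side $S_{k_dv}$). The non-orientable, cusped, finite volume hyperbolic $4$-manifolds $N_n$ are the manifolds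 obtained from $Q^4$ by the side-pairings with codes $$N_{23}: \texttt{1569A4},\quad N_{71}: \texttt{13EB34},\quad N_{1091}: \texttt{53FF35},\quad N_{1092}: \texttt{53FFCA}.$$ They belong to the Ratcliffe–Tschantz census of integral congruence two hyperbolic $4$-manifolds, and $\chi(N_n)=1$. $p_n:W_n\to N_n$ denotes the orientation double covering, so $\chi(W_n)=2$. It is known (Ivanšić–Ratcliffe–Tschantz) that each $W_n$ is the complement of a link of $2$-tori in a manifold homeomorphic to $S^4$. *)

theory Defs
  imports "HOL-Analysis.Analysis"
begin

section \<open>The unit ball model of hyperbolic 4-space\<close>

abbreviation H4 :: "(real^4) set" where
  "H4 \<equiv> ball 0 1"

definition hdist :: "real^4 \<Rightarrow> real^4 \<Rightarrow> real" where
  "hdist x y = arcosh (1 + 2 * (norm (x - y))^2 / ((1 - (norm x)^2) * (1 - (norm y)^2)))"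

text \<open>Only the values on the ball matter; the maps are total because HOL functions are.\<close>

definition hyp_isometry :: "(real^4 \<Rightarrow> real^4) \<Rightarrow> bool" where
  "hyp_isometry g \<longleftrightarrow>
     bij_betw g H4 H4 \<and> (\<forall>x\<in>H4. \<forall>y\<in>H4. hdist (g x) (g y) = hdist x y)"

definition orientation_preserving :: "(real^4 \<Rightarrow> real^4) \<Rightarrow> bool" where
  "orientation_preserving g \<longleftrightarrow>
     (\<forall>x\<in>H4. \<exists>g'. (g has_derivative g') (at x) \<and> det (matrix g') > 0)"

text \<open>The totally geodesic copies of hyperbolic 3-space: the intersections with the ball of
  linear hyperplanes and of spheres orthogonal to the unit sphere.\<close>

definition hyp_hyperplane :: "(real^4) set \<Rightarrow> bool" where
  "hyp_hyperplane P \<longleftrightarrow>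
     (\<exists>a. a \<noteq> 0 \<and> P = H4 \<inter> {x. a \<bullet> x = 0}) \<or>
     (\<exists>c r. 0 < r \<and> (norm c)^2 = 1 + r^2 \<and> P = H4 \<inter> sphere c r)"


section \<open>Hyperbolic 4-manifolds, orientation double cover, totally geodesic hypersurfaces\<close>

text \<open>A hyperbolic structure is given by charts \<open>(U, \<phi>)\<close>: \<open>\<phi>\<close> maps the open set \<open>U\<close>
  homeomorphically onto an open subset of hyperbolic 4-space, and coordinate changes agree locally
  with hyperbolic isometries.  The record only holds the data.\<close>

type_synonym 'a hchart = "'a set \<times> ('a \<Rightarrow> real^4)"

record 'a hyp4 =
  htop :: "'a topology"
  hcharts :: "'a hchart set"

text \<open>Two charts around \<open>p\<close> define the same orientation at \<open>p\<close> if the coordinate change is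
  orientation preserving near \<open>p\<close>; a local orientation at \<open>p\<close> is a class of such charts.\<close>

definition co_oriented :: "'a hyp4 \<Rightarrow> 'a \<Rightarrow> 'a hchart \<Rightarrow> 'a hchart \<Rightarrow> bool" where
  "co_oriented N p c c' \<longleftrightarrow>
     (\<exists>V g. openin (htop N) V \<and> p \<in> V \<and> V \<subseteq> fst c \<inter> fst c' \<and>
        hyp_isometry g \<and> orientation_preserving g \<and> (\<forall>q\<in>V. snd c' q = g (snd c q)))"

definition local_orientation :: "'a hyp4 \<Rightarrow> 'a hchart \<Rightarrow> 'a \<Rightarrow> 'a hchart set" where
  "local_orientation N c p = {c' \<in> hcharts N. p \<in> fst c' \<and> co_oriented N p c c'}"

text \<open>The points of the orientation double cover are the pairs of a point and a local orientation
  at that point, the covering projection is \<open>fst\<close>.  The sheet of a chart \<open>c\<close> over an open subset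
  \<open>V\<close> of its domain consists of the points over \<open>V\<close> with the orientation given by \<open>c\<close>.  The sheets
  form a basis of the topology, and the chart of a sheet is \<open>c\<close> composed with the projection.\<close>

definition sheet :: "'a hyp4 \<Rightarrow> 'a hchart \<Rightarrow> 'a set \<Rightarrow> ('a \<times> 'a hchart set) set" where
  "sheet N c V = (\<lambda>p. (p, local_orientation N c p)) ` V"

definition orientation_double_cover :: "'a hyp4 \<Rightarrow> ('a \<times> 'a hchart set) hyp4" where
  "orientation_double_cover N =
     \<lparr> htop = topology_generated_by
         {sheet N c V | c V. c \<in> hcharts N \<and> openin (htop N) V \<and> V \<subseteq> fst c},
       hcharts =
         {(sheet N c V, snd c \<circ> fst) | c V. c \<in> hcharts N \<and> openin (htop N) V \<and> V \<subseteq> fst c} \<rparr>"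

text \<open>A closed embedded totally geodesic hyperbolic 3-manifold, identified with its image: a
  nonempty compact subset that appears, in some chart around each of its points, as a hyperplane.
  Connectedness is not required; each component of such a subset is again one.\<close>

definition closed_embedded_totally_geodesic :: "'a hyp4 \<Rightarrow> 'a set \<Rightarrow> bool" where
  "closed_embedded_totally_geodesic W M \<longleftrightarrow>
     M \<noteq> {} \<and> compactin (htop W) M \<and>
     (\<forall>p\<in>M. \<exists>(U, \<phi>)\<in>hcharts W. p \<in> U \<and>
        (\<exists>P. hyp_hyperplane P \<and> \<phi> ` (M \<inter> U) = P \<inter> \<phi> ` U))"


section \<open>The ideal 24-cell and its side-pairings\<close>

text \<open>Used for \<open>1 \<le> i \<le> 4\<close> only.  In the index type \<open>4\<close> the numeral \<open>4\<close> is \<open>0\<close>, so the order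
  \<open>i < j\<close> of the indices has to be taken in the natural numbers.\<close>

definition e :: "nat \<Rightarrow> real^4" where
  "e i = axis (of_nat i) 1"

definition index_pairs :: "(nat \<times> nat) set" where
  "index_pairs = {(i, j). 1 \<le> i \<and> i < j \<and> j \<le> 4}"

definition centres :: "nat \<times> nat \<Rightarrow> (real^4) set" where
  "centres = (\<lambda>(i, j). {s *\<^sub>R e i + t *\<^sub>R e j | s t. s \<in> {1, -1} \<and> t \<in> {1, -1}})"

definition Q :: "(real^4) set" where
  "Q = {x \<in> H4. \<forall>ij\<in>index_pairs. \<forall>v\<in>centres ij. 1 \<le> dist x v}"

definition side :: "real^4 \<Rightarrow> (real^4) set" where
  "side v = Q \<inter> sphere v 1"

definition kdiag :: "nat \<Rightarrow> real^4 \<Rightarrow> real^4" where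
  "kdiag d x = (\<Sum>i=1..4. ((-1) ^ (d div 2 ^ (i - 1) mod 2) * (x \<bullet> e i)) *\<^sub>R e i)"

text \<open>A code is the list of its six digits.\<close>

definition code_digit :: "nat list \<Rightarrow> nat \<times> nat \<Rightarrow> nat" where
  "code_digit code ij =
     the (map_of (zip [(1,2), (1,3), (2,3), (1,4), (2,4), (3,4)] code) ij)"

text \<open>The side \<open>side v\<close> is glued by \<open>kdiag d\<close> to \<open>side (kdiag d v)\<close>.\<close>

definition glue_step :: "nat list \<Rightarrow> ((real^4) \<times> (real^4)) set" where
  "glue_step code =
     {(x, kdiag (code_digit code ij) x) | x ij v. ij \<in> index_pairs \<and> v \<in> centres ij \<and> x \<in> side v}"

definition glue :: "nat list \<Rightarrow> ((real^4) \<times> (real^4)) set" where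
  "glue code = (glue_step code \<union> (glue_step code)\<inverse>)\<^sup>* \<inter> Q \<times> Q"

definition glue_proj :: "nat list \<Rightarrow> real^4 \<Rightarrow> (real^4) set" where
  "glue_proj code x = glue code `` {x}"

definition glued_top :: "nat list \<Rightarrow> (real^4) set topology" where
  "glued_top code = topology (\<lambda>U. U \<subseteq> Q // glue code \<and>
     openin (top_of_set Q) {x \<in> Q. glue_proj code x \<in> U})"

lemma openin_glued_top:
  "openin (glued_top code) U \<longleftrightarrow>
     U \<subseteq> Q // glue code \<and> openin (top_of_set Q) {x \<in> Q. glue_proj code x \<in> U}"
proof -
  let ?f = "glue_proj code"
  have "istopology (\<lambda>U. U \<subseteq> Q // glue code \<and> openin (top_of_set Q) {x \<in> Q. ?f x \<in> U})"
    unfolding istopology_def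
  proof (intro conjI allI impI)
    fix S T
    assume S: "S \<subseteq> Q // glue code \<and> openin (top_of_set Q) {x \<in> Q. ?f x \<in> S}"
      and T: "T \<subseteq> Q // glue code \<and> openin (top_of_set Q) {x \<in> Q. ?f x \<in> T}"
    have "{x \<in> Q. ?f x \<in> S \<inter> T} = {x \<in> Q. ?f x \<in> S} \<inter> {x \<in> Q. ?f x \<in> T}" by auto
    then show "openin (top_of_set Q) {x \<in> Q. ?f x \<in> S \<inter> T}" using S T by auto
  next
    fix K
    assume K: "\<forall>S\<in>K. S \<subseteq> Q // glue code \<and> openin (top_of_set Q) {x \<in> Q. ?f x \<in> S}"
    have "{x \<in> Q. ?f x \<in> \<Union>K} = \<Union>((\<lambda>S. {x \<in> Q. ?f x \<in> S}) ` K)" by auto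
    then show "openin (top_of_set Q) {x \<in> Q. ?f x \<in> \<Union>K}" using K by (auto intro!: openin_Union)
  qed auto
  then show ?thesis
    unfolding glued_top_def by (simp add: topology_inverse')
qed

text \<open>The hyperbolic structure of the glued space: its charts are the homeomorphisms from open
  sets onto open subsets of hyperbolic 4-space which, pulled back to the polytope, agree locally with
  hyperbolic isometries.  Near a point of a side, injectivity forces the isometries on the two
  copies of the polytope meeting there to differ by \<open>kdiag d\<close> followed by the reflection in the
  paired side (and not by \<open>kdiag d\<close> alone, which would fold one copy onto the other).\<close>

definition glued_manifold :: "nat list \<Rightarrow> (real^4) set hyp4" where
  "glued_manifold code =
     \<lparr> htop = glued_top code,
       hcharts = {(U, \<phi>). openin (glued_top code) U \<and> \<phi> ` U \<subseteq> H4 \<and> open (\<phi> ` U) \<and>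
         homeomorphic_map (subtopology (glued_top code) U) (top_of_set (\<phi> ` U)) \<phi> \<and>
         (\<forall>x\<in>Q. glue_proj code x \<in> U \<longrightarrow>
            (\<exists>g V. hyp_isometry g \<and> open V \<and> x \<in> V \<and>
               (\<forall>z\<in>V \<inter> Q. glue_proj code z \<in> U \<longrightarrow> \<phi> (glue_proj code z) = g z)))} \<rparr>"

definition census_code :: "nat \<Rightarrow> nat list" where
  "census_code n =
     (if n = 23 then [0x1, 0x5, 0x6, 0x9, 0xA, 0x4]
      else if n = 71 then [0x1, 0x3, 0xE, 0xB, 0x3, 0x4]
      else if n = 1091 then [0x5, 0x3, 0xF, 0xF, 0x3, 0x5]
      else if n = 1092 then [0x5, 0x3, 0xF, 0xF, 0xC, 0xA]
      else undefined)"

definition N_mfd :: "nat \<Rightarrow> (real^4) set hyp4" where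
  "N_mfd n = glued_manifold (census_code n)"

definition W_mfd :: "nat \<Rightarrow> ((real^4) set \<times> (real^4) set hchart set) hyp4" where
  "W_mfd n = orientation_double_cover (N_mfd n)"

end

theory Submission
  imports Defs
begin

text \<open>The orientation double cover is assembled from two copies of the 24-cell \<open>Q\<close>, and a closed
  totally geodesic hypersurface \<open>M\<close> becomes a family of hyperplanes in the two copies
  which match across the sides and of which no two in the same copy cross.  Since \<open>M\<close> is compact,
  the height above the horospheres at the ideal vertices, weighted by a function \<open>wt\<close> on the vertices,
  attains a maximum on \<open>M\<close>.  In upper half-space coordinates with the maximizing vertex \<open>u\<close> at
  infinity, \<open>Q\<close> lies over a unit cube and \<open>M\<close> contains a hemisphere whose top is over that cube.
  Maximality gives an inequality for each pair of vertices separated by the hemisphere; together with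
  the combinatorics of the cube these bound its radius from below.  The side-pairings then provide a
  translation by at most \<open>2\<close> units in some direction (or along a diagonal) that carries the hemisphere
  to another part of \<open>M\<close> crossing it, a contradiction.  Constant weights suffice except for \<open>n = 23\<close>.\<close>

section \<open>Isometries of the ball and their orientation\<close>

text \<open>A conflict needs two pieces of \<open>M\<close> in the same copy of the cell. Crossing a
  side applies the reflection in it and then its label, so the copy changes exactly when the label
  preserves orientation; every translation is composed so that its pieces end in one copy. A
  translation by l makes a hemisphere of squared radius R meet its image at squared height R -
  l^2/4. Asking for height 1/2, above which only vertical walls bound the cell, gives the thresholds
  5/4 (l = 2), 1/2 (l = 1) and 9/4 (diagonal, l^2 = 8). At an axis vertex opposite walls share an
  index pair and hence a label. At a half-integral vertex they belong to complementary pairs, and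
  code 23 has no equal digits there. Its labels do satisfy k_9 k_5 = k_6 k_A, which gives the
  diagonal translation but needs R > 9/4. The weight 19/10 at the axis vertices 2 and 4 handles the
  smaller radii: the two such vertices next to \<open>u\<close> lie so deep inside the hemisphere
  that the fold of length 1 at one of them applies. Weight ratios below 2 keep the maximum off the
  sides that do not pass through \<open>u\<close>.\<close>

definition hratio :: "real^4 \<Rightarrow> real^4 \<Rightarrow> real" where
  "hratio x y = (x - y) \<bullet> (x - y) / ((1 - x \<bullet> x) * (1 - y \<bullet> y))"

lemma mem_H4: "x \<in> H4 \<longleftrightarrow> x \<bullet> x < 1"
  by (simp add: norm_lt_square)

lemma hratio_nonneg: "x \<in> H4 \<Longrightarrow> y \<in> H4 \<Longrightarrow> 0 \<le> hratio x y"
  unfolding hratio_def mem_H4 by simp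

text \<open>Since \<open>cosh (hdist x y) = 1 + 2 * hratio x y\<close>, the quantity
  \<open>hratio\<close> is the square of sinh of half the distance. Isometries are tested on this
  rational function from here on.\<close>

lemma hdist_eq_iff:
  assumes "x \<in> H4" "y \<in> H4" "x' \<in> H4" "y' \<in> H4"
  shows "hdist x y = hdist x' y' \<longleftrightarrow> hratio x y = hratio x' y'"
proof -
  have h: "hdist a b = arcosh (1 + 2 * hratio a b)" for a b
    by (simp add: hdist_def hratio_def power2_norm_eq_inner)
  have "cosh (hdist a b) = 1 + 2 * hratio a b" if "a \<in> H4" "b \<in> H4" for a b
    using hratio_nonneg[OF that] unfolding h by (subst cosh_arcosh_real) auto
  then show ?thesis
    using assms h by (metis add_left_cancel mult_left_cancel zero_neq_numeral)
qed

lemma hratio_eq_0: "x \<in> H4 \<Longrightarrow> y \<in> H4 \<Longrightarrow> hratio x y = 0 \<longleftrightarrow> x = y"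
  unfolding hratio_def mem_H4 by auto

lemma hyp_isometry_hratio:
  assumes "hyp_isometry g" "x \<in> H4" "y \<in> H4"
  shows "hratio (g x) (g y) = hratio x y" "g x \<in> H4"
proof -
  have m: "g z \<in> H4" if "z \<in> H4" for z
    using assms(1) that unfolding hyp_isometry_def bij_betw_def by blast
  show "g x \<in> H4" using m assms by blast
  have "hdist (g x) (g y) = hdist x y"
    using assms unfolding hyp_isometry_def by blast
  then show "hratio (g x) (g y) = hratio x y"
    using hdist_eq_iff m assms(2,3) by blast
qed

lemma hyp_isometryI:
  assumes "\<And>x. x \<in> H4 \<Longrightarrow> g x \<in> H4"
    and "\<And>x y. x \<in> H4 \<Longrightarrow> y \<in> H4 \<Longrightarrow> hratio (g x) (g y) = hratio x y"
    and "\<And>y. y \<in> H4 \<Longrightarrow> \<exists>x\<in>H4. g x = y"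
  shows "hyp_isometry g"
proof -
  have "inj_on g H4"
  proof (rule inj_onI)
    fix x y assume xy: "x \<in> H4" "y \<in> H4" "g x = g y"
    have "hratio (g x) (g y) = 0" using hratio_eq_0[OF assms(1)[OF xy(1)] assms(1)[OF xy(2)]] xy(3) by simp
    then show "x = y" using assms(2)[OF xy(1,2)] hratio_eq_0[OF xy(1,2)] by simp
  qed
  moreover have "g ` H4 = H4"
    using assms(1,3) by blast
  moreover have "hdist (g x) (g y) = hdist x y" if "x \<in> H4" "y \<in> H4" for x y
    using hdist_eq_iff[OF assms(1)[OF that(1)] assms(1)[OF that(2)] that] assms(2)[OF that] by simp
  ultimately show ?thesis
    unfolding hyp_isometry_def bij_betw_def by blast
qed

lemma hyp_isometry_inj: "hyp_isometry g \<Longrightarrow> inj_on g H4"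
  unfolding hyp_isometry_def bij_betw_def by blast

lemma hyp_isometry_surj: "hyp_isometry g \<Longrightarrow> y \<in> H4 \<Longrightarrow> \<exists>x\<in>H4. g x = y"
  unfolding hyp_isometry_def bij_betw_def by (metis imageE)

lemma hyp_isometry_comp: "hyp_isometry f \<Longrightarrow> hyp_isometry g \<Longrightarrow> hyp_isometry (f \<circ> g)"
proof (rule hyp_isometryI)
  assume f: "hyp_isometry f" and g: "hyp_isometry g"
  note m = hyp_isometry_hratio(2)
  show "(f \<circ> g) x \<in> H4" if "x \<in> H4" for x
    using m[OF f] m[OF g] that unfolding comp_apply by blast
  show "hratio ((f \<circ> g) x) ((f \<circ> g) y) = hratio x y" if "x \<in> H4" "y \<in> H4" for x y
    using hyp_isometry_hratio(1)[OF f m[OF g that(1,1)] m[OF g that(2,2)]]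
      hyp_isometry_hratio(1)[OF g that] by (simp only: comp_apply)
  show "\<exists>x\<in>H4. (f \<circ> g) x = y" if "y \<in> H4" for y
    using hyp_isometry_surj[OF f that] hyp_isometry_surj[OF g] unfolding comp_apply by metis
qed

lemma hyp_isometry_inv:
  assumes "hyp_isometry g"
  shows "hyp_isometry (inv_into H4 g)"
    "\<And>x. x \<in> H4 \<Longrightarrow> inv_into H4 g (g x) = x" "\<And>x. x \<in> H4 \<Longrightarrow> g (inv_into H4 g x) = x"
proof -
  have im: "g ` H4 = H4" using assms unfolding hyp_isometry_def bij_betw_def by blast
  show a: "\<And>x. x \<in> H4 \<Longrightarrow> inv_into H4 g (g x) = x"
    using hyp_isometry_inj[OF assms] by (simp add: inv_into_f_f)
  show b: "\<And>x. x \<in> H4 \<Longrightarrow> g (inv_into H4 g x) = x"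
    using im by (metis f_inv_into_f)
  have m: "\<And>x. x \<in> H4 \<Longrightarrow> inv_into H4 g x \<in> H4"
    using im by (metis inv_into_into)
  show "hyp_isometry (inv_into H4 g)"
  proof (rule hyp_isometryI)
    fix x y assume "x \<in> H4" "y \<in> H4"
    then show "hratio (inv_into H4 g x) (inv_into H4 g y) = hratio x y"
      using hyp_isometry_hratio(1)[OF assms m m, of x y] b by metis
  next
    fix y assume "y \<in> H4"
    then show "\<exists>x\<in>H4. inv_into H4 g x = y"
      using a hyp_isometry_hratio(2)[OF assms] by blast
  qed (rule m)
qed

lemma orthogonal_hyp_isometry:
  assumes "orthogonal_transformation (A :: real^4 \<Rightarrow> real^4)"
  shows "hyp_isometry A"
proof (rule hyp_isometryI)
  have i: "A x \<bullet> A y = x \<bullet> y" for x y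
    using assms unfolding orthogonal_transformation_def by blast
  show "A x \<in> H4" if "x \<in> H4" for x using that unfolding mem_H4 by (simp add: i)
  have "A x - A y = A (x - y)" for x y
    using assms by (simp add: orthogonal_transformation_linear linear_diff)
  then show "hratio (A x) (A y) = hratio x y" for x y
    by (simp add: hratio_def i)
  fix y :: "real^4" assume y: "y \<in> H4"
  obtain x where "A x = y" using orthogonal_transformation_surj[OF assms] by (metis surjD)
  then show "\<exists>x\<in>H4. A x = y" using y i[of x x] by (intro bexI[of _ x]) (auto simp: mem_H4 simp del: mem_ball_0 mem_ball)
qed

text \<open>The inversion in the sphere with centre \<open>c\<close> orthogonal to the unit sphere.\<close>

definition inversion :: "real^4 \<Rightarrow> real^4 \<Rightarrow> real^4" where
  "inversion c x = c + ((c \<bullet> c - 1) / ((x - c) \<bullet> (x - c))) *\<^sub>R (x - c)"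

lemma H4_centre_ne:
  assumes "x \<in> H4" "1 < c \<bullet> c"
  shows "0 < (x - c) \<bullet> (x - c)"
  using assms unfolding mem_H4 by (metis inner_gt_zero_iff less_asym right_minus_eq)

text \<open>The defect \<open>1 - x \<bullet> x\<close> scales by the conformal factor of the
  inversion at \<open>x\<close>. In \<open>inversion_dist\<close> squared distances scale by the
  product of the factors at both points, so the factors cancel in \<open>hratio\<close>.\<close>

lemma inversion_norm:
  assumes "(x - c) \<bullet> (x - c) \<noteq> 0"
  shows "1 - inversion c x \<bullet> inversion c x = (1 - x \<bullet> x) * (c \<bullet> c - 1) / ((x - c) \<bullet> (x - c))"
proof -
  define N where "N = (x - c) \<bullet> (x - c)"
  define k where "k = c \<bullet> c - 1"
  have N: "N = x \<bullet> x - 2 * (c \<bullet> (x - c)) - c \<bullet> c"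
    by (simp add: N_def inner_diff inner_commute algebra_simps)
  have "inversion c x \<bullet> inversion c x = c \<bullet> c + 2 * (k / N) * (c \<bullet> (x - c)) + (k / N)^2 * N"
    unfolding inversion_def N_def[symmetric] k_def[symmetric]
    by (simp only: inner_add inner_scaleR_left inner_scaleR_right inner_commute[of "x - c" c] N_def[symmetric])
      (simp add: power2_eq_square algebra_simps diff_divide_distrib)
  also have "\<dots> = c \<bullet> c + (k / N) * (x \<bullet> x - N - c \<bullet> c) + (k / N) * k"
  proof -
    have xx: "x \<bullet> x - N - c \<bullet> c = 2 * (c \<bullet> (x - c))" using N by simp
    show ?thesis using assms unfolding N_def[symmetric] xx by (simp add: power2_eq_square)
  qed
  also have "\<dots> = 1 - (1 - x \<bullet> x) * k / N"
    using assms unfolding N_def[symmetric] by (simp add: k_def field_simps)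
  finally show ?thesis by (simp add: N_def k_def)
qed

lemma inversion_dist:
  assumes "(x - c) \<bullet> (x - c) \<noteq> 0" "(y - c) \<bullet> (y - c) \<noteq> 0"
  shows "(inversion c x - inversion c y) \<bullet> (inversion c x - inversion c y) =
    (c \<bullet> c - 1)^2 * ((x - y) \<bullet> (x - y)) / (((x - c) \<bullet> (x - c)) * ((y - c) \<bullet> (y - c)))"
proof -
  define a where "a = x - c"
  define b where "b = y - c"
  define k where "k = c \<bullet> c - 1"
  have xy: "x - y = a - b" by (simp add: a_def b_def)
  have "inversion c x - inversion c y = (k / (a \<bullet> a)) *\<^sub>R a - (k / (b \<bullet> b)) *\<^sub>R b"
    by (simp add: inversion_def a_def b_def k_def)
  then show ?thesis
    unfolding xy a_def[symmetric] b_def[symmetric] k_def[symmetric]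
    using assms unfolding a_def[symmetric] b_def[symmetric]
    by (simp only: inner_diff inner_commute[of b a] inner_scaleR_left inner_scaleR_right)
      (simp add: field_simps power2_eq_square)
qed

lemma inversion_inversion:
  assumes "(x - c) \<bullet> (x - c) \<noteq> 0" "1 < c \<bullet> c"
  shows "inversion c (inversion c x) = x"
  using assms unfolding inversion_def by (simp add: divide_simps)

lemma inversion_hyp_isometry:
  assumes "1 < c \<bullet> c"
  shows "hyp_isometry (inversion c)"
proof (rule hyp_isometryI)
  show m: "inversion c x \<in> H4" if "x \<in> H4" for x
  proof -
    have "0 < (1 - x \<bullet> x) * (c \<bullet> c - 1) / ((x - c) \<bullet> (x - c))"
      using that assms H4_centre_ne[OF that assms] unfolding mem_H4 by simp
    then show ?thesis
      using inversion_norm[of x c] H4_centre_ne[OF that assms] unfolding mem_H4 by linarith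
  qed
  show "hratio (inversion c x) (inversion c y) = hratio x y" if "x \<in> H4" "y \<in> H4" for x y
    using H4_centre_ne[OF that(1) assms] H4_centre_ne[OF that(2) assms] assms
    by (simp add: hratio_def inversion_norm inversion_dist divide_simps power2_eq_square)
  show "\<exists>x\<in>H4. inversion c x = y" if "y \<in> H4" for y
    using m[OF that] inversion_inversion[of y c] H4_centre_ne[OF that assms] assms
    by (intro bexI[of _ "inversion c y"]) auto
qed

text \<open>Composing with the inversion that swaps \<open>b\<close> and the origin reduces every
  isometry to one fixing 0. The centre is the mirror image of \<open>b\<close> in the unit
  sphere.\<close>

lemma inversion_0:
  assumes "b \<in> H4" "b \<noteq> 0"
  defines "c \<equiv> (1 / (b \<bullet> b)) *\<^sub>R b"
  shows "1 < c \<bullet> c" "inversion c b = 0"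
proof -
  have b: "0 < b \<bullet> b" "b \<bullet> b < 1" using assms unfolding mem_H4 by auto
  show "1 < c \<bullet> c" using b by (simp add: c_def divide_simps)
  define B where "B = b \<bullet> b"
  have cc: "c \<bullet> c = 1 / B" using b by (simp add: c_def B_def)
  have bc: "b - c = (1 - 1 / B) *\<^sub>R b" by (simp add: c_def B_def algebra_simps)
  have N: "(b - c) \<bullet> (b - c) = (1 - 1 / B)^2 * B"
    unfolding bc by (simp only: inner_scaleR_left inner_scaleR_right B_def[symmetric] power2_eq_square mult.assoc)
  have "inversion c b = (1 / B) *\<^sub>R b + (((1 / B - 1) / ((1 - 1 / B)^2 * B)) * (1 - 1 / B)) *\<^sub>R b"
    unfolding inversion_def cc N unfolding bc by (simp add: c_def flip: B_def)
  also have "\<dots> = (1 / B + ((1 / B - 1) / ((1 - 1 / B)^2 * B)) * (1 - 1 / B)) *\<^sub>R b"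
    by (simp add: scaleR_add_left)
  also have "1 / B + ((1 / B - 1) / ((1 - 1 / B)^2 * B)) * (1 - 1 / B) = 0"
  proof -
    define t where "t = 1 - 1 / B"
    have t: "t \<noteq> 0" using b by (auto simp: B_def t_def)
    have eq: "1 / B - 1 = - t" by (simp add: t_def)
    show ?thesis unfolding eq t_def[symmetric] using t by (simp add: power2_eq_square)
  qed
  finally show "inversion c b = 0" by simp
qed

text \<open>Distances to 0 give norms, and then distances between points give inner products, so
  \<open>g\<close> is determined by its values on multiples of a basis.\<close>

lemma hyp_isometry_fix0:
  assumes g: "hyp_isometry g" and 0: "g 0 = 0"
  shows "\<exists>A. orthogonal_transformation A \<and> (\<forall>x\<in>H4. g x = A x)"
proof -
  have n: "g x \<bullet> g x = x \<bullet> x" if "x \<in> H4" for x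
  proof -
    have "hratio (g x) (g 0) = hratio x 0"
      by (rule hyp_isometry_hratio(1)[OF g that]) simp
    moreover have "x \<bullet> x < 1" "g x \<bullet> g x < 1"
      using that hyp_isometry_hratio(2)[OF g that that] unfolding mem_H4 by blast+
    ultimately show ?thesis by (simp add: 0 hratio_def divide_simps split: if_splits) (simp add: algebra_simps)
  qed
  have i: "g x \<bullet> g y = x \<bullet> y" if "x \<in> H4" "y \<in> H4" for x y
  proof -
    have "hratio (g x) (g y) = hratio x y" using hyp_isometry_hratio(1)[OF g that] .
    moreover have "x \<bullet> x < 1" "y \<bullet> y < 1" using that unfolding mem_H4 by blast+
    ultimately have "(g x - g y) \<bullet> (g x - g y) = (x - y) \<bullet> (x - y)"
      by (simp add: hratio_def n[OF that(1)] n[OF that(2)])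
    then show ?thesis by (simp add: inner_diff inner_commute n[OF that(1)] n[OF that(2)])
  qed
  \<comment> \<open>The basis vectors lie on the unit sphere, outside the ball, so \<open>g\<close>
    is evaluated at their halves and rescaled.\<close>
  define w where "w b = 2 *\<^sub>R g ((1/2) *\<^sub>R b)" for b
  have bh: "(1/2) *\<^sub>R b \<in> H4" if "b \<in> Basis" for b :: "real^4"
    using that unfolding mem_H4 by simp
  have ww: "w b \<bullet> w b' = (if b = b' then 1 else 0)" if "b \<in> Basis" "b' \<in> Basis" for b b'
    using i[OF bh[OF that(1)] bh[OF that(2)]] that by (auto simp: w_def inner_Basis)
  define A where "A x = (\<Sum>b\<in>Basis. (x \<bullet> b) *\<^sub>R w b)" for x :: "real^4"
  have lin: "linear A"
    unfolding A_def by (rule linearI) (simp_all add: inner_add_left algebra_simps sum.distrib scaleR_sum_right)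
  have Ab: "A x \<bullet> w b = x \<bullet> b" if "b \<in> Basis" for x b
    using that by (simp add: A_def inner_sum_left ww if_distrib cong: if_cong)
  have AA: "A x \<bullet> A y = x \<bullet> y" for x y
  proof -
    have "A x \<bullet> A y = (\<Sum>b\<in>Basis. (y \<bullet> b) * (A x \<bullet> w b))"
      by (simp add: A_def[of y] inner_sum_right)
    also have "\<dots> = x \<bullet> y"
      by (simp add: Ab euclidean_inner[of x y] mult.commute)
    finally show ?thesis .
  qed
  have "g x = A x" if x: "x \<in> H4" for x
  proof -
    have gA: "g x \<bullet> A y = x \<bullet> y" for y
    proof -
      have "g x \<bullet> w b = x \<bullet> b" if "b \<in> Basis" for b
        using i[OF x bh[OF that]] by (simp add: w_def)
      then have "g x \<bullet> A y = (\<Sum>b\<in>Basis. (y \<bullet> b) * (x \<bullet> b))"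
        by (simp add: A_def inner_sum_right)
      then show ?thesis by (simp add: euclidean_inner[of x y] mult.commute)
    qed
    have "(g x - A x) \<bullet> (g x - A x) = 0"
      by (simp add: inner_diff n[OF x] gA AA inner_commute[of "A x" "g x"])
    then show ?thesis by simp
  qed
  then show ?thesis using lin AA unfolding orthogonal_transformation_def by blast
qed

lemma hyp_isometry_cases:
  assumes g: "hyp_isometry g"
  obtains A where "orthogonal_transformation A" "\<forall>x\<in>H4. g x = A x"
  | A c where "orthogonal_transformation A" "1 < c \<bullet> c" "\<forall>x\<in>H4. g x = inversion c (A x)"
proof (cases "g 0 = 0")
  case True
  then show ?thesis using hyp_isometry_fix0[OF g] that(1) by blast
next
  case False
  have b: "g 0 \<in> H4" using hyp_isometry_hratio(2)[OF g, of 0 0] by simp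
  obtain c where c: "1 < c \<bullet> c" "inversion c (g 0) = 0"
    using inversion_0[OF b False] by blast
  have "hyp_isometry (inversion c \<circ> g)"
    by (rule hyp_isometry_comp[OF inversion_hyp_isometry[OF c(1)] g])
  then obtain A where A: "orthogonal_transformation A" "\<forall>x\<in>H4. (inversion c \<circ> g) x = A x"
    using hyp_isometry_fix0 c(2) by (metis comp_apply)
  have "g x = inversion c (A x)" if "x \<in> H4" for x
  proof -
    have gx: "g x \<in> H4" using hyp_isometry_hratio(2)[OF g that that] .
    have "A x = inversion c (g x)" using A(2) that by auto
    then show ?thesis
      using inversion_inversion[of "g x" c] H4_centre_ne[OF gx c(1)] c(1) by auto
  qed
  then show ?thesis using that(2) A(1) c(1) by blast
qed

text \<open>The negation of \<open>orientation_preserving\<close> only says that positivity fails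
  somewhere. That an isometry is of one kind everywhere is a theorem,
  \<open>orientation_cases\<close>, which rests on the normal form
  \<open>hyp_isometry_cases\<close>.\<close>

definition orientation_reversing :: "(real^4 \<Rightarrow> real^4) \<Rightarrow> bool" where
  "orientation_reversing g \<longleftrightarrow>
     (\<forall>x\<in>H4. \<exists>g'. (g has_derivative g') (at x) \<and> det (matrix g') < 0)"

lemma has_derivative_H4_cong:
  assumes "\<forall>x\<in>H4. f x = g x" "x \<in> H4"
  shows "(f has_derivative D) (at x) \<longleftrightarrow> (g has_derivative D) (at x)"
  using assms has_derivative_transform_within_open[of f D x UNIV H4 g]
    has_derivative_transform_within_open[of g D x UNIV H4 f]
  by auto

lemma orientation_H4_cong:
  assumes "\<forall>x\<in>H4. f x = g x"
  shows "orientation_preserving f = orientation_preserving g"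
    "orientation_reversing f = orientation_reversing g"
  unfolding orientation_preserving_def orientation_reversing_def
  using has_derivative_H4_cong[OF assms] by simp_all

lemma orientation_exclusive: "\<not> (orientation_preserving f \<and> orientation_reversing f)"
proof
  assume a: "orientation_preserving f \<and> orientation_reversing f"
  have 0: "(0::real^4) \<in> H4" by simp
  obtain D D' where "(f has_derivative D) (at 0)" "det (matrix D) > 0"
    "(f has_derivative D') (at 0)" "det (matrix D') < 0"
    using a 0 unfolding orientation_preserving_def orientation_reversing_def by meson
  then show False using has_derivative_unique less_asym by metis
qed

lemma det_matrix_comp:
  fixes f g :: "real^4 \<Rightarrow> real^4"
  assumes "linear f" "linear g"
  shows "det (matrix (f \<circ> g)) = det (matrix f) * det (matrix g)"
  using matrix_compose[OF assms(2) assms(1)] by (simp add: det_mul)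

lemma orientation_comp:
  assumes g: "hyp_isometry g"
  shows "orientation_preserving f \<Longrightarrow> orientation_preserving g \<Longrightarrow> orientation_preserving (f \<circ> g)"
    "orientation_preserving f \<Longrightarrow> orientation_reversing g \<Longrightarrow> orientation_reversing (f \<circ> g)"
    "orientation_reversing f \<Longrightarrow> orientation_preserving g \<Longrightarrow> orientation_reversing (f \<circ> g)"
    "orientation_reversing f \<Longrightarrow> orientation_reversing g \<Longrightarrow> orientation_preserving (f \<circ> g)"
proof -
  have key: "((f \<circ> g) has_derivative (F \<circ> G)) (at x) \<and> det (matrix (F \<circ> G)) = det (matrix F) * det (matrix G)"
    if "(g has_derivative G) (at x)" "(f has_derivative F) (at (g x))" for x F G
    using diff_chain_at[OF that] has_derivative_linear[OF that(1)] has_derivative_linear[OF that(2)]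
      det_matrix_comp by blast
  note m = hyp_isometry_hratio(2)[OF g]
  show "orientation_preserving f \<Longrightarrow> orientation_preserving g \<Longrightarrow> orientation_preserving (f \<circ> g)"
    unfolding orientation_preserving_def orientation_reversing_def
    by (metis key m mult_pos_pos)
  show "orientation_preserving f \<Longrightarrow> orientation_reversing g \<Longrightarrow> orientation_reversing (f \<circ> g)"
    unfolding orientation_preserving_def orientation_reversing_def
    by (metis key m mult_pos_neg)
  show "orientation_reversing f \<Longrightarrow> orientation_preserving g \<Longrightarrow> orientation_reversing (f \<circ> g)"
    unfolding orientation_preserving_def orientation_reversing_def
    by (metis key m mult_neg_pos)
  show "orientation_reversing f \<Longrightarrow> orientation_reversing g \<Longrightarrow> orientation_preserving (f \<circ> g)"
    unfolding orientation_preserving_def orientation_reversing_def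
    by (metis key m mult_neg_neg)
qed

lemma det_hyperplane_reflection:
  fixes n :: "real^4"
  assumes "n \<bullet> n = 1"
  shows "det (matrix (\<lambda>h. h - (2 * (n \<bullet> h)) *\<^sub>R n)) = -1"
proof -
  let ?R = "\<lambda>n h. h - (2 * (n \<bullet> h)) *\<^sub>R (n::real^4)"
  have lin: "linear (?R m)" for m
    by (rule linearI) (simp_all add: inner_add_right algebra_simps)
  obtain A where A: "orthogonal_transformation A" "A (axis 1 1 :: real^4) = n"
    using orthogonal_transformation_exists_1[of "axis 1 1 :: real^4" n] assms
    by (auto simp: norm_eq_1)
  have lA: "linear A" using A(1) by (rule orthogonal_transformation_linear)
  have "(?R n \<circ> A) h = (A \<circ> ?R (axis 1 1)) h" for h
  proof -
    have "n \<bullet> A h = axis 1 1 \<bullet> h"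
      using A unfolding orthogonal_transformation_def by metis
    then show ?thesis
      by (simp add: linear_diff[OF lA] linear_scale[OF lA] A(2))
  qed
  then have eq: "?R n \<circ> A = A \<circ> ?R (axis 1 1)" by blast
  have dA: "det (matrix A) \<noteq> 0"
    using A(1) lA by (metis det_orthogonal_matrix orthogonal_transformation_matrix zero_neq_neg_one zero_neq_one)
  have "det (matrix (?R n)) * det (matrix A) = det (matrix A) * det (matrix (?R (axis 1 1)))"
    using arg_cong[OF eq, of "\<lambda>f. det (matrix f)"] det_matrix_comp[OF lin lA] det_matrix_comp[OF lA lin]
    by simp
  then have "det (matrix (?R n)) = det (matrix (?R (axis 1 1)))" using dA by simp
  also have "\<dots> = -1"
  proof -
    have d: "matrix (?R (axis 1 1)) $ i $ j = (if i = j then if i = 1 then -1 else 1 else 0)" for i j :: 4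
    proof -
      have "axis 1 1 \<bullet> (axis j 1 :: real^4) = (if j = 1 then 1 else 0)" by (simp add: inner_axis_axis)
      then show ?thesis by (simp add: matrix_def) (simp add: axis_def)
    qed
    have "det (matrix (?R (axis 1 1))) = (\<Prod>i\<in>UNIV. matrix (?R (axis 1 1)) $ i $ i)"
      by (rule det_diagonal) (simp add: d)
    also have "\<dots> = (\<Prod>i\<in>(UNIV :: 4 set). if i = 1 then -1 else 1)" by (simp add: d)
    also have "\<dots> = -1" by simp
    finally show ?thesis .
  qed
  finally show ?thesis .
qed

text \<open>The derivative at \<open>x\<close> is a positive multiple of the Euclidean reflection in
  the hyperplane orthogonal to \<open>x - c\<close>.\<close>

lemma inversion_reversing:
  assumes "1 < c \<bullet> c"
  shows "orientation_reversing (inversion c)"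
  unfolding orientation_reversing_def
proof
  fix x :: "real^4" assume x: "x \<in> H4"
  define N where "N = (x - c) \<bullet> (x - c)"
  define n where "n = (1 / sqrt N) *\<^sub>R (x - c)"
  have N: "0 < N" unfolding N_def by (rule H4_centre_ne[OF x assms])
  have nn: "n \<bullet> n = 1" using N by (simp add: n_def flip: N_def)
  define k where "k = c \<bullet> c - 1"
  have k: "0 < k" using assms by (simp add: k_def)
  let ?D = "\<lambda>h. (k / N) *\<^sub>R (h - (2 * (n \<bullet> h)) *\<^sub>R n)"
  have "(inversion c has_derivative
      (\<lambda>h. (k / N) *\<^sub>R h - (k * (2 * ((x - c) \<bullet> h)) / (N * N)) *\<^sub>R (x - c))) (at x)"
    unfolding inversion_def k_def[symmetric]
    apply (rule has_derivative_eq_rhs)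
     apply (rule derivative_intros)+
    using N
    by (auto intro!: derivative_eq_intros simp: inner_commute field_simps simp flip: N_def)
  moreover have "(\<lambda>h. (k / N) *\<^sub>R h - (k * (2 * ((x - c) \<bullet> h)) / (N * N)) *\<^sub>R (x - c)) = ?D"
  proof
    fix h
    have "2 * (n \<bullet> h) * (1 / sqrt N) = 2 * ((x - c) \<bullet> h) / N"
      using N by (simp add: n_def)
    then have "(2 * (n \<bullet> h)) *\<^sub>R n = (2 * ((x - c) \<bullet> h) / N) *\<^sub>R (x - c)"
      unfolding n_def scaleR_scaleR by metis
    then show "(k / N) *\<^sub>R h - (k * (2 * ((x - c) \<bullet> h)) / (N * N)) *\<^sub>R (x - c) = ?D h"
      by (simp add: scaleR_right_diff_distrib)
  qed
  ultimately have "(inversion c has_derivative ?D) (at x)" by simp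
  moreover have "det (matrix ?D) = (k / N)^4 * det (matrix (\<lambda>h. h - (2 * (n \<bullet> h)) *\<^sub>R n))"
  proof -
    let ?R = "\<lambda>h. h - (2 * (n \<bullet> h)) *\<^sub>R n"
    have l1: "linear ?R" by (rule linearI) (simp_all add: inner_add_right algebra_simps)
    have l2: "linear ((*\<^sub>R) (k / N) :: real^4 \<Rightarrow> real^4)"
      by (rule linearI) (simp_all add: algebra_simps)
    have "?D = (*\<^sub>R) (k / N) \<circ> ?R" by (simp add: comp_def)
    then show ?thesis
      using det_matrix_comp[OF l2 l1] det_matrix_scaleR[of "k / N", where 'n=4] by simp
  qed
  then have "det (matrix ?D) < 0"
    using k N by (simp add: det_hyperplane_reflection[OF nn])
  ultimately show "\<exists>g'. (inversion c has_derivative g') (at x) \<and> det (matrix g') < 0" by blast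
qed

lemma orthogonal_orientation:
  assumes "orthogonal_transformation A"
  shows "orientation_preserving A \<longleftrightarrow> det (matrix A) > 0"
    "orientation_reversing A \<longleftrightarrow> det (matrix A) < 0"
    "det (matrix A) = 1 \<or> det (matrix A) = -1"
proof -
  have l: "linear A" using assms by (rule orthogonal_transformation_linear)
  have D: "(A has_derivative D) (at x) \<longleftrightarrow> D = A" for D x
    using linear_imp_has_derivative[OF l] has_derivative_unique by blast
  have "(0::real^4) \<in> H4" by simp
  then show "orientation_preserving A \<longleftrightarrow> det (matrix A) > 0"
    "orientation_reversing A \<longleftrightarrow> det (matrix A) < 0"
    unfolding orientation_preserving_def orientation_reversing_def D by blast+
  show "det (matrix A) = 1 \<or> det (matrix A) = -1"
    using assms by (metis det_orthogonal_matrix orthogonal_transformation_matrix)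
qed

lemma orientation_cases:
  assumes "hyp_isometry g"
  shows "orientation_preserving g \<or> orientation_reversing g"
proof -
  have o: "orientation_preserving A \<or> orientation_reversing A" if "orthogonal_transformation A" for A
    using orthogonal_orientation[OF that] by auto
  from assms show ?thesis
  proof (cases rule: hyp_isometry_cases)
    case (1 A)
    then show ?thesis using o[OF 1(1)] orientation_H4_cong[OF 1(2)] by blast
  next
    case (2 A c)
    have "\<forall>x\<in>H4. g x = (inversion c \<circ> A) x" using 2(3) by simp
    then show ?thesis
      using o[OF 2(1)] orientation_H4_cong inversion_reversing[OF 2(2)]
        orientation_comp[OF orthogonal_hyp_isometry[OF 2(1)]] by metis
  qed
qed

lemma orientation_comp_iff:
  assumes "hyp_isometry f" "hyp_isometry g"
  shows "orientation_preserving (f \<circ> g) \<longleftrightarrow> (orientation_preserving f \<longleftrightarrow> orientation_preserving g)"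
  using orientation_comp[OF assms(2), of f] orientation_cases[OF assms(1)] orientation_cases[OF assms(2)]
    orientation_exclusive by blast

section \<open>Hyperplanes\<close>

text \<open>The hyperplanes are the zero sets of the functions \<open>Fn a b\<close> with \<open>unitfn a b\<close>, and \<open>(a, b)\<close> is
  determined up to sign.\<close>

definition Fn :: "real^4 \<Rightarrow> real \<Rightarrow> real^4 \<Rightarrow> real" where
  "Fn a b x = 2 * (a \<bullet> x) - b * (1 + x \<bullet> x)"

text \<open>In the hyperboloid model \<open>(a, b)\<close> is a unit spacelike normal for the
  Lorentz form, and on the ball \<open>Fn a b x\<close> is a positive multiple of its Lorentz
  product with the point \<open>x\<close>.\<close>

definition unitfn :: "real^4 \<Rightarrow> real \<Rightarrow> bool" where
  "unitfn a b \<longleftrightarrow> a \<bullet> a - b^2 = 1"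

lemma Fn_neg: "Fn (- a) (- b) x = - Fn a b x"
  by (simp add: Fn_def)

lemma Fn_scale: "Fn (k *\<^sub>R a) (k * b) x = k * Fn a b x"
  by (simp add: Fn_def algebra_simps)

lemma unitfn_neg: "unitfn (- a) (- b) = unitfn a b"
  by (simp add: unitfn_def)

lemma unitfn_ne_0: "unitfn a b \<Longrightarrow> a \<noteq> 0"
  by (auto simp: unitfn_def) (smt (verit) zero_le_power2)

lemma bisector_eq:
  assumes "x \<in> H4" "y \<in> H4" "z \<in> H4"
  shows "hratio z x = hratio z y \<longleftrightarrow>
    Fn ((1 - x \<bullet> x) *\<^sub>R y - (1 - y \<bullet> y) *\<^sub>R x) (y \<bullet> y - x \<bullet> x) z = 0"
proof -
  define p where "p = 1 - x \<bullet> x"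
  define q where "q = 1 - y \<bullet> y"
  define s where "s = 1 - z \<bullet> z"
  have pos: "0 < p" "0 < q" "0 < s" using assms unfolding mem_H4 p_def q_def s_def by simp_all
  have "hratio z x = hratio z y \<longleftrightarrow> (z - x) \<bullet> (z - x) * q = (z - y) \<bullet> (z - y) * p"
    unfolding hratio_def p_def[symmetric] q_def[symmetric] s_def[symmetric]
    using pos by (simp add: divide_simps)
  also have "\<dots> \<longleftrightarrow> (z \<bullet> z - 2 * (x \<bullet> z) + 1 - p) * q = (z \<bullet> z - 2 * (y \<bullet> z) + 1 - q) * p"
    by (simp add: inner_diff inner_commute p_def q_def algebra_simps)
  also have "\<dots> \<longleftrightarrow> Fn (p *\<^sub>R y - q *\<^sub>R x) (p - q) z = 0"
    by (simp add: Fn_def inner_diff_left algebra_simps)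
  finally show ?thesis by (simp add: p_def q_def)
qed

lemma bisector_fn:
  assumes "x \<in> H4" "y \<in> H4" "x \<noteq> y"
  obtains a b k where "unitfn a b" "0 < k"
    "k *\<^sub>R a = (1 - x \<bullet> x) *\<^sub>R y - (1 - y \<bullet> y) *\<^sub>R x" "k * b = y \<bullet> y - x \<bullet> x"
    "\<And>z. z \<in> H4 \<Longrightarrow> hratio z x = hratio z y \<longleftrightarrow> Fn a b z = 0"
proof -
  define a0 where "a0 = (1 - x \<bullet> x) *\<^sub>R y - (1 - y \<bullet> y) *\<^sub>R x"
  define b0 where "b0 = y \<bullet> y - x \<bullet> x"
  have "a0 \<bullet> a0 - b0^2 = (1 - x \<bullet> x) * (1 - y \<bullet> y) * ((x - y) \<bullet> (x - y))"
    unfolding a0_def b0_def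
    by (simp add: inner_diff inner_commute power2_eq_square algebra_simps)
  also have "\<dots> > 0" using assms unfolding mem_H4 by simp
  finally have pos: "0 < a0 \<bullet> a0 - b0^2" .
  define k where "k = sqrt (a0 \<bullet> a0 - b0^2)"
  have k: "0 < k" "k^2 = a0 \<bullet> a0 - b0^2" using pos by (simp_all add: k_def)
  define a where "a = (1 / k) *\<^sub>R a0"
  define b where "b = b0 / k"
  have ab: "k *\<^sub>R a = a0" "k * b = b0" using k by (simp_all add: a_def b_def)
  have "a \<bullet> a - b^2 = (a0 \<bullet> a0 - b0^2) / k^2"
    using k by (simp add: a_def b_def power2_eq_square field_simps)
  then have "unitfn a b" using k pos by (simp add: unitfn_def)
  moreover have "hratio z x = hratio z y \<longleftrightarrow> Fn a b z = 0" if "z \<in> H4" for z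
    using bisector_eq[OF assms(1,2) that] Fn_scale[of k a b z] k(1)
    by (simp add: ab a0_def[symmetric] b0_def[symmetric])
  ultimately show ?thesis using that k(1) ab a0_def b0_def by blast
qed

text \<open>As bisectors, hyperplanes are metric objects, so isometries transport them without any
  explicit formula; see \<open>hyperplane_pullback\<close>.\<close>

lemma hyp_hyperplane_bisector:
  assumes "hyp_hyperplane P"
  obtains x y where "x \<in> H4" "y \<in> H4" "x \<noteq> y" "P = {z \<in> H4. hratio z x = hratio z y}"
proof -
  from assms consider (lin) a where "a \<noteq> 0" "P = H4 \<inter> {x. a \<bullet> x = 0}"
    | (sph) c r where "0 < r" "(norm c)^2 = 1 + r^2" "P = H4 \<inter> sphere c r"
    unfolding hyp_hyperplane_def by blast
  then show ?thesis
  proof cases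
    case lin
    define x where "x = (1 / (2 * norm a)) *\<^sub>R a"
    have xx: "x \<bullet> x = 1 / 4" using lin(1) by (simp add: x_def dot_square_norm power2_eq_square)
    have x: "x \<in> H4" "- x \<in> H4" unfolding mem_H4 by (simp_all add: xx)
    have "x \<noteq> - x"
    proof
      assume "x = - x"
      then have "x \<bullet> x = x \<bullet> (- x)" by (rule arg_cong)
      then show False by (simp add: xx)
    qed
    moreover have "hratio z x = hratio z (- x) \<longleftrightarrow> a \<bullet> z = 0" if "z \<in> H4" for z
      unfolding bisector_eq[OF x that] using lin(1) by (simp add: xx Fn_def) (simp add: x_def)
    then have "P = {z \<in> H4. hratio z x = hratio z (- x)}" unfolding lin(2) by blast
    ultimately show ?thesis using that x by blast
  next
    case sph
    define C where "C = c \<bullet> c"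
    have C: "C = 1 + r^2" "1 < C" using sph(1,2) by (simp_all add: C_def power2_norm_eq_inner)
    \<comment> \<open>The image of 0 under the inversion in the given sphere.\<close>
    define y where "y = (1 / C) *\<^sub>R c"
    have yy: "y \<bullet> y = 1 / C" using C(2) by (simp add: y_def C_def[symmetric])
    have y: "0 \<in> H4" "y \<in> H4" using C(2) unfolding mem_H4 by (simp_all add: yy)
    have "0 \<noteq> y" using yy C(2) by auto
    moreover have "hratio z 0 = hratio z y \<longleftrightarrow> z \<in> sphere c r" if "z \<in> H4" for z
    proof -
      have "hratio z 0 = hratio z y \<longleftrightarrow> 2 * (c \<bullet> z) = 1 + z \<bullet> z"
        unfolding bisector_eq[OF y that] using C(2) by (simp add: yy Fn_def) (simp add: y_def field_simps)
      also have "\<dots> \<longleftrightarrow> (z - c) \<bullet> (z - c) = r^2"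
        using C by (simp add: inner_diff inner_commute C_def[symmetric]) argo
      also have "\<dots> \<longleftrightarrow> norm (z - c) = r"
        using sph(1) by (simp add: dot_square_norm power2_eq_iff_nonneg)
      finally show ?thesis by (simp add: dist_norm norm_minus_commute)
    qed
    then have "P = {z \<in> H4. hratio z 0 = hratio z y}" unfolding sph(3) by blast
    ultimately show ?thesis using that y by blast
  qed
qed

lemma hyperplane_pullback:
  assumes g: "hyp_isometry g" and P: "hyp_hyperplane P"
  obtains a b where "unitfn a b" "\<And>z. z \<in> H4 \<Longrightarrow> g z \<in> P \<longleftrightarrow> Fn a b z = 0"
proof -
  obtain x y where xy: "x \<in> H4" "y \<in> H4" "x \<noteq> y" "P = {z \<in> H4. hratio z x = hratio z y}"
    using hyp_hyperplane_bisector[OF P] .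
  obtain x' y' where x': "x' \<in> H4" "g x' = x" and y': "y' \<in> H4" "g y' = y"
    using hyp_isometry_surj[OF g xy(1)] hyp_isometry_surj[OF g xy(2)] by blast
  have "x' \<noteq> y'" using x' y' xy(3) by auto
  then obtain a b where ab: "unitfn a b"
    "\<And>z. z \<in> H4 \<Longrightarrow> hratio z x' = hratio z y' \<longleftrightarrow> Fn a b z = 0"
    using bisector_fn[OF x'(1) y'(1)] by metis
  have "g z \<in> P \<longleftrightarrow> Fn a b z = 0" if z: "z \<in> H4" for z
  proof -
    have "g z \<in> P \<longleftrightarrow> hratio (g z) (g x') = hratio (g z) (g y')"
      using hyp_isometry_hratio(2)[OF g z z] unfolding xy(4) x' y' by blast
    then show ?thesis
      using ab(2)[OF z] hyp_isometry_hratio(1)[OF g z x'(1)] hyp_isometry_hratio(1)[OF g z y'(1)] by simp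
  qed
  then show ?thesis using that ab(1) by blast
qed

text \<open>The change to the projective model, in which hyperplanes and the cell are affine.\<close>

definition klein :: "real^4 \<Rightarrow> real^4" where
  "klein x = (2 / (1 + x \<bullet> x)) *\<^sub>R x"

definition unklein :: "real^4 \<Rightarrow> real^4" where
  "unklein y = (1 / (1 + sqrt (1 - y \<bullet> y))) *\<^sub>R y"

lemma one_plus_inner_pos: "0 < 1 + x \<bullet> (x::real^4)"
  by (simp add: add_pos_nonneg)

lemma Fn_klein: "Fn a b x = (1 + x \<bullet> x) * (a \<bullet> klein x - b)"
  using one_plus_inner_pos[of x] by (simp add: Fn_def klein_def field_simps)

lemma Fn_klein_iff:
  "Fn a b x = 0 \<longleftrightarrow> a \<bullet> klein x = b" "Fn a b x < 0 \<longleftrightarrow> a \<bullet> klein x < b"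
  "Fn a b x \<le> 0 \<longleftrightarrow> a \<bullet> klein x \<le> b"
  using one_plus_inner_pos[of x] unfolding Fn_klein
  by (simp_all add: mult_less_0_iff mult_le_0_iff)

lemma klein_in: "x \<in> H4 \<Longrightarrow> klein x \<in> H4"
proof -
  assume "x \<in> H4"
  then have "x \<bullet> x < 1" unfolding mem_H4 .
  then have "0 < (1 - x \<bullet> x)^2" by simp
  then have "4 * (x \<bullet> x) < (1 + x \<bullet> x)^2" by (simp add: power2_eq_square algebra_simps)
  moreover have kk: "klein x \<bullet> klein x = 4 * (x \<bullet> x) / (1 + x \<bullet> x)^2"
    by (simp add: klein_def power2_eq_square)
  ultimately have kk: "klein x \<bullet> klein x < 1" using one_plus_inner_pos[of x] by simp
  then show ?thesis
    using one_plus_inner_pos[of x] kk unfolding mem_H4 by simp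
qed

lemma unklein_in: "y \<in> H4 \<Longrightarrow> unklein y \<in> H4"
proof -
  assume "y \<in> H4"
  then have y: "y \<bullet> y < 1" unfolding mem_H4 .
  define s where "s = sqrt (1 - y \<bullet> y)"
  have s: "0 < s" "y \<bullet> y = 1 - s^2" using y by (simp_all add: s_def)
  have "unklein y \<bullet> unklein y = (1 - s^2) / (1 + s)^2"
    unfolding unklein_def s_def[symmetric] by (simp add: s(2) power2_eq_square)
  also have "\<dots> < 1" using s(1) by (simp add: field_simps power2_eq_square add_strict_increasing)
  finally show ?thesis unfolding mem_H4 .
qed

lemma klein_unklein: "y \<in> H4 \<Longrightarrow> klein (unklein y) = y"
proof -
  assume "y \<in> H4"
  then have y: "y \<bullet> y < 1" unfolding mem_H4 .
  define s where "s = sqrt (1 - y \<bullet> y)"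
  have s: "0 < s" "y \<bullet> y = 1 - s^2" using y by (simp_all add: s_def)
  have u: "unklein y \<bullet> unklein y = (1 - s^2) / (1 + s)^2"
    unfolding unklein_def s_def[symmetric] by (simp add: s(2) power2_eq_square)
  have "2 / (1 + unklein y \<bullet> unklein y) * (1 / (1 + s)) = 1"
    unfolding u using s(1) by (simp add: divide_simps) (simp add: power2_eq_square algebra_simps add_pos_pos)
  then show ?thesis
    unfolding klein_def by (simp add: unklein_def s_def[symmetric])
qed

lemma unklein_klein: "x \<in> H4 \<Longrightarrow> unklein (klein x) = x"
proof -
  assume "x \<in> H4"
  then have x: "x \<bullet> x < 1" unfolding mem_H4 .
  define n where "n = x \<bullet> x"
  have n: "0 \<le> n" "n < 1" using x by (simp_all add: n_def)
  have "1 - klein x \<bullet> klein x = ((1 - n) / (1 + n))^2"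
    using n by (simp add: klein_def n_def[symmetric] power2_eq_square divide_simps) (simp add: algebra_simps)
  then have "sqrt (1 - klein x \<bullet> klein x) = (1 - n) / (1 + n)" using n by simp
  moreover have "1 + (1 - n) / (1 + n) = 2 / (1 + n)" using n by (simp add: divide_simps)
  ultimately have eq: "1 + sqrt (1 - klein x \<bullet> klein x) = 2 / (1 + n)" by metis
  have e: "1 / (2 / (1 + n)) * (2 / (1 + n)) = 1" using n by simp
  show ?thesis unfolding unklein_def eq unfolding klein_def n_def[symmetric] scaleR_scaleR e by (rule scaleR_one)
qed

lemma continuous_unklein: "continuous_on H4 unklein"
proof -
  have "1 + sqrt (1 - y \<bullet> y) \<noteq> 0" if "y \<in> H4" for y :: "real^4"
  proof -
    have "0 \<le> sqrt (1 - y \<bullet> y)" using that unfolding mem_H4 by simp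
    then show ?thesis by linarith
  qed
  then show ?thesis unfolding unklein_def by (intro continuous_intros) auto
qed

text \<open>Straight segments of the projective model, pulled back to the ball, serve as test curves
  inside an arbitrary neighbourhood.\<close>

lemma klein_path_near:
  assumes x: "x \<in> H4" and V: "open V" "x \<in> V"
  obtains \<delta> where "0 < \<delta>" "\<And>t. \<bar>t\<bar> < \<delta> \<Longrightarrow> klein x + t *\<^sub>R w \<in> H4 \<and> unklein (klein x + t *\<^sub>R w) \<in> V"
proof -
  let ?f = "\<lambda>t::real. klein x + t *\<^sub>R w"
  have c: "continuous_on UNIV ?f" by (intro continuous_intros)
  have o1: "open (?f -` H4)" using c open_ball continuous_on_open_vimage[of UNIV ?f] by auto
  have "continuous_on (?f -` H4) (\<lambda>t. unklein (?f t))"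
    by (rule continuous_on_compose2[OF continuous_unklein continuous_on_subset[OF c]]) auto
  then have "open ((\<lambda>t. unklein (?f t)) -` V \<inter> (?f -` H4))"
    using V(1) o1 continuous_on_open_vimage by blast
  moreover have "0 \<in> (\<lambda>t. unklein (?f t)) -` V \<inter> (?f -` H4)"
    using V(2) klein_in[OF x] unklein_klein[OF x] by simp
  ultimately obtain \<delta> where d: "0 < \<delta>" "ball 0 \<delta> \<subseteq> (\<lambda>t. unklein (?f t)) -` V \<inter> (?f -` H4)"
    using open_contains_ball by metis
  have "?f t \<in> H4 \<and> unklein (?f t) \<in> V" if "\<bar>t\<bar> < \<delta>" for t
  proof -
    have "t \<in> ball 0 \<delta>" using that by simp
    then show ?thesis using d(2) by blast
  qed
  then show ?thesis using that d(1) by blast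
qed

text \<open>Testing along segments of the projective model shows that every direction orthogonal to
  \<open>a\<close> is orthogonal to \<open>a'\<close>. Hence \<open>(a', b')\<close> is a multiple
  of \<open>(a, b)\<close>, and the normalization leaves only the sign.\<close>

lemma hyperplane_germ_unique:
  assumes "unitfn a b" "unitfn a' b'" "open V" "x \<in> V" "x \<in> H4" "Fn a b x = 0"
    and sub: "\<And>z. z \<in> V \<Longrightarrow> z \<in> H4 \<Longrightarrow> Fn a b z = 0 \<Longrightarrow> Fn a' b' z = 0"
  shows "a' = a \<and> b' = b \<or> a' = - a \<and> b' = - b"
proof -
  have ab: "a \<bullet> klein x = b" "a' \<bullet> klein x = b'"
    using assms(6) sub[OF assms(4,5,6)] by (simp_all add: Fn_klein_iff)
  have perp: "a' \<bullet> w = 0" if w: "a \<bullet> w = 0" for w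
  proof -
    obtain \<delta> where d: "0 < \<delta>" "\<And>t. \<bar>t\<bar> < \<delta> \<Longrightarrow> klein x + t *\<^sub>R w \<in> H4 \<and> unklein (klein x + t *\<^sub>R w) \<in> V"
      using klein_path_near[OF assms(5,3,4), of w] by auto
    define y where "y = klein x + (\<delta> / 2) *\<^sub>R w"
    have y: "y \<in> H4" "unklein y \<in> V" using d(2)[of "\<delta>/2"] d(1) unfolding y_def by auto
    have "a \<bullet> y = b" using ab w by (simp add: y_def inner_add_right)
    then have "Fn a' b' (unklein y) = 0"
      using sub[OF y(2) unklein_in[OF y(1)]] by (simp add: Fn_klein_iff klein_unklein[OF y(1)])
    then have "a' \<bullet> y = b'" by (simp add: Fn_klein_iff klein_unklein[OF y(1)])
    then show ?thesis using ab d(1) by (simp add: y_def inner_add_right)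
  qed
  have a0: "a \<bullet> a \<noteq> 0" using unitfn_ne_0[OF assms(1)] by simp
  define l where "l = (a' \<bullet> a) / (a \<bullet> a)"
  define w where "w = a' - l *\<^sub>R a"
  have aw: "a \<bullet> w = 0" using a0 by (simp add: w_def l_def inner_diff_right inner_commute)
  then have "w \<bullet> w = 0" using perp[OF aw] by (simp add: w_def inner_diff_left inner_diff_right inner_commute)
  then have al: "a' = l *\<^sub>R a" by (simp add: w_def)
  then have bl: "b' = l * b" using ab by simp
  have "l^2 * (a \<bullet> a - b^2) = 1"
    using assms(2) unfolding unitfn_def al bl by (simp add: power2_eq_square algebra_simps)
  then have "l^2 = 1" using assms(1) by (simp add: unitfn_def)
  then have "l = 1 \<or> l = -1" by (simp add: power2_eq_1_iff)
  then show ?thesis using al bl by auto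
qed

lemma hyperplane_not_open:
  assumes "unitfn a b" "open V" "x \<in> V" "x \<in> H4"
  shows "\<exists>z\<in>V. z \<in> H4 \<and> Fn a b z \<noteq> 0"
proof (rule ccontr)
  assume n: "\<not> ?thesis"
  obtain \<delta> where d: "0 < \<delta>" "\<And>t. \<bar>t\<bar> < \<delta> \<Longrightarrow> klein x + t *\<^sub>R a \<in> H4 \<and> unklein (klein x + t *\<^sub>R a) \<in> V"
    using klein_path_near[OF assms(4,2,3), of a] by auto
  define y where "y = klein x + (\<delta> / 2) *\<^sub>R a"
  have y: "y \<in> H4" "unklein y \<in> V" using d(2)[of "\<delta>/2"] d(1) unfolding y_def by auto
  have "a \<bullet> y = b" using n y(2) unklein_in[OF y(1)] klein_unklein[OF y(1)] Fn_klein_iff(1) by metis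
  moreover have "a \<bullet> klein x = b" using n assms(3,4) Fn_klein_iff(1) by metis
  ultimately have "a \<bullet> a = 0" using d(1) by (simp add: y_def inner_add_right)
  then show False using unitfn_ne_0[OF assms(1)] by simp
qed

text \<open>If \<open>f x\<close> and \<open>g x\<close> differ, let \<open>y\<close> be the point
  that \<open>f\<close> sends to \<open>g x\<close>. All points of \<open>V\<close> in the ball are
  then equidistant from \<open>x\<close> and \<open>y\<close>, but a bisector contains no open
  set.\<close>

lemma isometry_eq_open:
  assumes f: "hyp_isometry f" and g: "hyp_isometry g" and V: "open V" "x0 \<in> V" "x0 \<in> H4"
    and eq: "\<And>z. z \<in> V \<Longrightarrow> z \<in> H4 \<Longrightarrow> f z = g z"
  shows "\<forall>x\<in>H4. f x = g x"
proof (rule ccontr)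
  assume "\<not> ?thesis"
  then obtain x where x: "x \<in> H4" "f x \<noteq> g x" by blast
  obtain y where y: "y \<in> H4" "f y = g x"
    using hyp_isometry_surj[OF f hyp_isometry_hratio(2)[OF g x(1,1)]] by blast
  have "x \<noteq> y" using x(2) y(2) by auto
  then obtain a b where ab: "unitfn a b"
    "\<And>z. z \<in> H4 \<Longrightarrow> hratio z x = hratio z y \<longleftrightarrow> Fn a b z = 0"
    using bisector_fn[OF x(1) y(1)] by metis
  obtain z where z: "z \<in> V" "z \<in> H4" "Fn a b z \<noteq> 0"
    using hyperplane_not_open[OF ab(1) V] by blast
  have "hratio z x = hratio (g z) (g x)" using hyp_isometry_hratio(1)[OF g z(2) x(1)] by simp
  also have "\<dots> = hratio (f z) (f y)" using y eq[OF z(1,2)] by simp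
  also have "\<dots> = hratio z y" using hyp_isometry_hratio(1)[OF f z(2) y(1)] .
  finally show False using ab(2)[OF z(2)] z(3) by blast
qed

lemma Fn_sphere:
  assumes "v \<bullet> v = 2"
  shows "Fn v 1 x = 1 - (x - v) \<bullet> (x - v)"
  using assms by (simp add: Fn_def inner_diff inner_commute)

lemma inversion_fixed: "v \<bullet> v = 2 \<Longrightarrow> Fn v 1 x = 0 \<Longrightarrow> inversion v x = x"
  by (simp add: Fn_sphere inversion_def)

text \<open>The new coefficients are the Lorentz reflection of \<open>(a, b)\<close> in the unit
  vector \<open>(v, 1)\<close>. The denominator is a squared norm, so zero sets are transported by
  this reflection.\<close>

lemma Fn_inversion:
  assumes "v \<bullet> v = 2" "(x - v) \<bullet> (x - v) \<noteq> 0"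
  shows "Fn a b (inversion v x) = Fn (a - (2 * (a \<bullet> v - b)) *\<^sub>R v) (b - 2 * (a \<bullet> v - b)) x / ((x - v) \<bullet> (x - v))"
proof -
  define N where "N = (x - v) \<bullet> (x - v)"
  define X where "X = x \<bullet> x"
  have N0: "N \<noteq> 0" using assms(2) by (simp add: N_def)
  have N: "v \<bullet> x = (X + 2 - N) / 2"
    using assms(1) by (simp add: N_def X_def inner_diff inner_commute)
  have i: "inversion v x = v + (1 / N) *\<^sub>R (x - v)"
    using assms by (simp add: inversion_def N_def)
  have n: "inversion v x \<bullet> inversion v x = 1 - (1 - X) / N"
    using inversion_norm[OF assms(2)] assms(1) by (simp add: N_def X_def)
  have "Fn a b (inversion v x) = 2 * (a \<bullet> v) + 2 * (a \<bullet> x - a \<bullet> v) / N - b * (2 - (1 - X) / N)"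
    unfolding Fn_def n unfolding i
    by (simp add: inner_add_right inner_diff_right algebra_simps diff_divide_distrib)
  also have "\<dots> = (2 * (a \<bullet> x) - 4 * (a \<bullet> v - b) * ((X + 2 - N) / 2) - (b - 2 * (a \<bullet> v - b)) * (1 + X)) / N"
  proof -
    have "(2 * V + 2 * (A - V) / N - b * (2 - (1 - X) / N)) * N = 2 * V * N + 2 * (A - V) - b * (2 * N - (1 - X))"
      for A V :: real
    proof -
      have "(2 * V + P - b * (2 - R)) * N = 2 * V * N + P * N - b * (2 * N - R * N)" for P R by algebra
      then show ?thesis using N0 by simp
    qed
    moreover have "2 * V * N + 2 * (A - V) - b * (2 * N - (1 - X)) =
      2 * A - 4 * (V - b) * ((X + 2 - N) / 2) - (b - 2 * (V - b)) * (1 + X)" for A V :: real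
      by algebra
    ultimately show ?thesis unfolding eq_divide_eq using N0 by metis
  qed
  also have "\<dots> = Fn (a - (2 * (a \<bullet> v - b)) *\<^sub>R v) (b - 2 * (a \<bullet> v - b)) x / N"
  proof -
    have num: "2 * A - 4 * s * w - B = 2 * (A - 2 * s * w) - B" for A s w B :: real by algebra
    show ?thesis unfolding Fn_def inner_diff_left inner_scaleR_left N X_def[symmetric] num ..
  qed
  finally show ?thesis by (simp add: N_def)
qed

lemma unitfn_reflect:
  assumes "v \<bullet> v = 2" "unitfn a b"
  shows "unitfn (a - (2 * (a \<bullet> v - b)) *\<^sub>R v) (b - 2 * (a \<bullet> v - b))"
  using assms unfolding unitfn_def by (simp add: inner_diff inner_commute power2_eq_square algebra_simps)

text \<open>For every moved point \<open>x\<close>, all fixed points of \<open>f\<close> lie on the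
  bisector of \<open>x\<close> and \<open>f x\<close>. They contain a piece of the sphere of
  \<open>v\<close>, so the bisector is that sphere, and \<open>f x\<close> is the mirror image of
  \<open>x\<close>.\<close>

lemma isometry_fixing_sphere:
  assumes f: "hyp_isometry f" and v: "v \<bullet> v = 2" and V: "open V" "x0 \<in> V" "x0 \<in> H4" "Fn v 1 x0 = 0"
    and fix_: "\<And>z. z \<in> V \<Longrightarrow> z \<in> H4 \<Longrightarrow> Fn v 1 z = 0 \<Longrightarrow> f z = z"
  shows "(\<forall>x\<in>H4. f x = x) \<or> (\<forall>x\<in>H4. f x = inversion v x)"
proof -
  have uv: "unitfn v 1" using v by (simp add: unitfn_def)
  have moved: "f x = inversion v x \<and> (\<forall>z\<in>H4. f z = z \<longrightarrow> Fn v 1 z = 0)" if x: "x \<in> H4" "f x \<noteq> x" for x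
  proof -
    define y where "y = f x"
    have y: "y \<in> H4" using hyp_isometry_hratio(2)[OF f x(1,1)] by (simp only: y_def)
    obtain a b k where ab: "unitfn a b" "0 < k"
      "k *\<^sub>R a = (1 - x \<bullet> x) *\<^sub>R y - (1 - y \<bullet> y) *\<^sub>R x" "k * b = y \<bullet> y - x \<bullet> x"
      "\<And>z. z \<in> H4 \<Longrightarrow> hratio z x = hratio z y \<longleftrightarrow> Fn a b z = 0"
      using bisector_fn[OF x(1) y] x(2) y_def by metis
    have fp: "Fn a b z = 0" if "z \<in> H4" "f z = z" for z
      using ab(5)[OF that(1)] hyp_isometry_hratio(1)[OF f that(1) x(1)] by (simp add: that(2) y_def)
    have "a = v \<and> b = 1 \<or> a = - v \<and> b = - 1"
      by (rule hyperplane_germ_unique[OF uv ab(1) V]) (use fix_ fp in blast)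
    then obtain s where s: "a = s *\<^sub>R v" "b = s" "s \<noteq> 0" by force
    have fpv: "\<forall>z\<in>H4. f z = z \<longrightarrow> Fn v 1 z = 0"
      using fp s Fn_scale[of s v 1] by auto
    define l where "l = k * s"
    have l0: "l \<noteq> 0" using ab(2) s(3) by (simp add: l_def)
    define p where "p = 1 - x \<bullet> x"
    have p: "0 < p" using x(1) unfolding mem_H4 p_def by simp
    have yy: "y \<bullet> y = 1 - p + l" using ab(4) s(2) by (simp add: l_def p_def)
    have "l *\<^sub>R v = p *\<^sub>R y - (p - l) *\<^sub>R x"
      using ab(3) s(1) by (simp add: l_def p_def[symmetric] yy)
    then have py: "p *\<^sub>R y = (p - l) *\<^sub>R x + l *\<^sub>R v" by (simp add: algebra_simps)
    define X where "X = x \<bullet> v"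
    define N where "N = (x - v) \<bullet> (x - v)"
    have N: "N = 3 - p - 2 * X" using v by (simp add: N_def X_def p_def inner_diff inner_commute)
    have N0: "0 < N" unfolding N_def by (rule H4_centre_ne[OF x(1)]) (simp add: v)
    have "(p *\<^sub>R y) \<bullet> (p *\<^sub>R y) = (p - l)^2 * (1 - p) + l^2 * 2 + 2 * l * (p - l) * X"
      unfolding py using v by (simp add: inner_add inner_commute X_def p_def power2_eq_square algebra_simps)
    \<comment> \<open>Both sides are the squared norm of \<open>p *\<^sub>R y\<close>. Cancelling
      the root \<open>l = 0\<close> determines the multiplier \<open>l\<close>.\<close>
    then have "p^2 * (1 - p + l) = (p - l)^2 * (1 - p) + l^2 * 2 + 2 * l * (p - l) * X"
      by (simp add: yy power2_eq_square)
    then have "l * (l * N - p * (N - 1)) = 0"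
      unfolding N by (simp add: power2_eq_square algebra_simps)
    then have "l * N = p * (N - 1)" using l0 by simp
    then have l: "l = p * (1 - 1 / N)" using N0 by (simp add: field_simps)
    have "p *\<^sub>R y = p *\<^sub>R ((1 / N) *\<^sub>R x + (1 - 1 / N) *\<^sub>R v)"
      unfolding py l by (simp add: algebra_simps)
    then have "y = (1 / N) *\<^sub>R x + (1 - 1 / N) *\<^sub>R v" using p by simp
    also have "\<dots> = inversion v x"
      unfolding inversion_def N_def[symmetric] v by (simp add: algebra_simps)
    finally show ?thesis using fpv by (simp add: y_def)
  qed
  show ?thesis
  proof (cases "\<exists>x\<in>H4. f x \<noteq> x")
    case True
    then obtain x1 where x1: "x1 \<in> H4" "f x1 \<noteq> x1" by blast
    have "f x = inversion v x" if x: "x \<in> H4" for x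
    proof (cases "f x = x")
      case True
      then have "Fn v 1 x = 0" using moved[OF x1] x by blast
      then show ?thesis using True inversion_fixed[OF v] by simp
    next
      case False
      then show ?thesis using moved[OF x] by blast
    qed
    then show ?thesis by blast
  qed blast
qed

section \<open>The 24-cell and its gluing\<close>

definition all_centres :: "(real^4) set" where
  "all_centres = (\<Union>ij\<in>index_pairs. centres ij)"

lemma index_pairs_eq: "index_pairs = {(1,2),(1,3),(1,4),(2,3),(2,4),(3,4)}"
  unfolding index_pairs_def by auto

lemma centresE:
  assumes "ij \<in> index_pairs" "v \<in> centres ij"
  obtains s t p q where "v = s *\<^sub>R axis p 1 + t *\<^sub>R axis q 1" "s \<in> {1,-1}" "t \<in> {1,-1}" "p \<noteq> q"
    "p = of_nat (fst ij)" "q = of_nat (snd ij)"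
proof -
  obtain i j where ij: "ij = (i, j)" by fastforce
  then have ne: "(of_nat i :: 4) \<noteq> of_nat j" using assms(1) unfolding index_pairs_eq by auto
  obtain s t where "v = s *\<^sub>R e i + t *\<^sub>R e j" "s \<in> {1,-1}" "t \<in> {1,-1}"
    using assms(2) unfolding ij centres_def by auto
  then show ?thesis using that ne unfolding e_def ij by simp
qed

lemma centre_inner:
  assumes "v \<in> all_centres"
  shows "v \<bullet> v = 2"
proof -
  obtain s t p q where "v = s *\<^sub>R axis p 1 + t *\<^sub>R axis q 1" "s \<in> {1,-1}" "t \<in> {1,-1}" "p \<noteq> (q::4)"
    using assms centresE unfolding all_centres_def by (metis UN_E)
  then show ?thesis by (auto simp: inner_add_left inner_add_right inner_axis_axis)
qed

lemma centre_Ints: "v \<in> all_centres \<Longrightarrow> v $ i \<in> \<int>"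
proof -
  assume "v \<in> all_centres"
  then obtain s t p q where "v = s *\<^sub>R axis p 1 + t *\<^sub>R axis q 1" "s \<in> {1,-1}" "t \<in> {1,-1}" "p \<noteq> (q::4)"
    using centresE unfolding all_centres_def by (metis UN_E)
  then show ?thesis by (auto simp: axis_def)
qed

text \<open>Centres are integer vectors, so distinct ones are at distance at least 1. The bound puts
  half of \<open>v\<close> strictly inside the half-spaces of all other sides in the projective
  model.\<close>

lemma centre_inner_le:
  assumes "v \<in> all_centres" "w \<in> all_centres" "v \<noteq> w"
  shows "v \<bullet> w \<le> 3/2"
proof -
  obtain i where i: "v $ i \<noteq> w $ i" using assms(3) by (auto simp: vec_eq_iff)
  have "v $ i - w $ i \<in> \<int>" using centre_Ints assms by auto
  then have "1 \<le> \<bar>(v - w) $ i\<bar>" using i Ints_nonzero_abs_ge1 by force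
  also have "\<dots> \<le> norm (v - w)" by (rule component_le_norm_cart)
  finally have "1 \<le> (norm (v - w))^2" by simp
  then show ?thesis
    using centre_inner assms by (simp add: power2_norm_eq_inner inner_diff inner_commute)
qed

lemma finite_all_centres: "finite all_centres"
proof -
  have "finite (centres ij)" for ij
  proof -
    have "centres ij \<subseteq> (\<lambda>(s, t). s *\<^sub>R e (fst ij) + t *\<^sub>R e (snd ij)) ` ({1,-1} \<times> {1,-1})"
      unfolding centres_def by (auto split: prod.splits)
    then show ?thesis using finite_subset by blast
  qed
  then show ?thesis unfolding all_centres_def index_pairs_eq by blast
qed

lemma mem_Q: "x \<in> Q \<longleftrightarrow> x \<in> H4 \<and> (\<forall>v\<in>all_centres. Fn v 1 x \<le> 0)"
proof -
  have "1 \<le> dist x v \<longleftrightarrow> Fn v 1 x \<le> 0" if "v \<in> all_centres" for v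
  proof -
    have "1 \<le> dist x v \<longleftrightarrow> 1 \<le> (dist x v)^2"
      using abs_le_square_iff[of 1 "dist x v"] by simp
    also have "\<dots> \<longleftrightarrow> Fn v 1 x \<le> 0"
      using Fn_sphere[OF centre_inner[OF that]] by (simp add: dist_norm power2_norm_eq_inner)
    finally show ?thesis .
  qed
  then show ?thesis unfolding Q_def all_centres_def by blast
qed

lemma Q_in_H4: "x \<in> Q \<Longrightarrow> x \<in> H4"
  unfolding mem_Q by (rule conjunct1)

lemma mem_side: "v \<in> all_centres \<Longrightarrow> x \<in> side v \<longleftrightarrow> x \<in> Q \<and> Fn v 1 x = 0"
proof -
  assume v: "v \<in> all_centres"
  have "x \<in> sphere v 1 \<longleftrightarrow> (x - v) \<bullet> (x - v) = 1"
    by (metis dist_commute dist_norm mem_sphere norm_eq_1)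
  then show ?thesis
    unfolding side_def using Fn_sphere[OF centre_inner[OF v], of x] by auto
qed

definition interior_Q :: "(real^4) set" where
  "interior_Q = {x \<in> H4. \<forall>v\<in>all_centres. Fn v 1 x < 0}"

lemma interior_Q_subset: "x \<in> interior_Q \<Longrightarrow> x \<in> Q"
  unfolding mem_Q interior_Q_def by force

lemma interior_Q_H4: "x \<in> interior_Q \<Longrightarrow> x \<in> H4"
  unfolding interior_Q_def by blast

lemma zero_interior_Q: "0 \<in> interior_Q"
  by (simp add: interior_Q_def Fn_def)

lemma continuous_Fn: "continuous_on S (Fn a b)"
  unfolding Fn_def by (intro continuous_intros)

lemma open_interior_Q: "open interior_Q"
proof -
  have "open {x. Fn v 1 x < 0}" for v
    by (rule open_Collect_less) (auto intro: continuous_Fn)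
  then have "open (H4 \<inter> (\<Inter>v\<in>all_centres. {x. Fn v 1 x < 0}))"
    using finite_all_centres by (intro open_Int open_INT) auto
  moreover have "interior_Q = H4 \<inter> (\<Inter>v\<in>all_centres. {x. Fn v 1 x < 0})"
    unfolding interior_Q_def by blast
  ultimately show ?thesis by simp
qed

lemma klein_segment_near:
  assumes "x \<in> H4" "y \<in> H4" "open V" "x \<in> V"
  obtains t z where "0 < t" "t < 1" "z \<in> V" "z \<in> H4" "klein z = (1 - t) *\<^sub>R klein x + t *\<^sub>R y"
proof -
  obtain \<delta> where d: "0 < \<delta>"
    "\<And>t. \<bar>t\<bar> < \<delta> \<Longrightarrow> klein x + t *\<^sub>R (y - klein x) \<in> H4 \<and> unklein (klein x + t *\<^sub>R (y - klein x)) \<in> V"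
    using klein_path_near[OF assms(1,3,4)] by blast
  define t where "t = min \<delta> 1 / 2"
  have t: "0 < t" "t < 1" "\<bar>t\<bar> < \<delta>" using d(1) by (auto simp: t_def)
  have eq: "klein x + t *\<^sub>R (y - klein x) = (1 - t) *\<^sub>R klein x + t *\<^sub>R y" by (simp add: algebra_simps)
  have "(1 - t) *\<^sub>R klein x + t *\<^sub>R y \<in> H4" "unklein ((1 - t) *\<^sub>R klein x + t *\<^sub>R y) \<in> V"
    using d(2)[OF t(3)] unfolding eq by blast+
  then show ?thesis using that t klein_unklein unklein_in by blast
qed

lemma convex_comb_less: "0 < t \<Longrightarrow> t < 1 \<Longrightarrow> p \<le> (c::real) \<Longrightarrow> q < c \<Longrightarrow> (1 - t) * p + t * q < c"
proof -
  assume a: "0 < t" "t < 1" "p \<le> c" "q < c"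
  have "(1 - t) * p \<le> (1 - t) * c" "t * q < t * c" using a by simp_all
  then show ?thesis by (simp add: algebra_simps)
qed

text \<open>The cell is convex in the projective model: a segment from \<open>x\<close> to the
  interior point \<open>y\<close> enters the interior at once and stays on every hyperplane through
  both ends. This is the standard passage from boundary points to interior points.\<close>

lemma interior_Q_near:
  assumes x: "x \<in> Q" and y: "y \<in> interior_Q" and V: "open V" "x \<in> V"
  obtains z where "z \<in> V" "z \<in> interior_Q" "\<And>a b. Fn a b x = 0 \<Longrightarrow> Fn a b y = 0 \<Longrightarrow> Fn a b z = 0"
proof -
  obtain t z where z: "0 < t" "t < 1" "z \<in> V" "z \<in> H4"
    "klein z = (1 - t) *\<^sub>R klein x + t *\<^sub>R klein y"
    using klein_segment_near[OF Q_in_H4[OF x] klein_in[OF interior_Q_H4[OF y]] V] .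
  have "Fn v 1 z < 0" if v: "v \<in> all_centres" for v
  proof -
    have "v \<bullet> klein x \<le> 1" "v \<bullet> klein y < 1"
      using x y v unfolding mem_Q interior_Q_def Fn_klein_iff[symmetric] by blast+
    then show ?thesis unfolding Fn_klein_iff z(5)
      by (simp add: inner_add_right convex_comb_less[OF z(1,2)])
  qed
  then have "z \<in> interior_Q" unfolding interior_Q_def using z(4) by blast
  moreover have "Fn a b z = 0" if "Fn a b x = 0" "Fn a b y = 0" for a b
    using that unfolding Fn_klein_iff z(5) by (simp add: inner_add_right algebra_simps)
  ultimately show ?thesis using that z(3) by blast
qed

text \<open>Moving slightly towards the centre of the side leaves all other sides behind; around the
  new point the sphere of \<open>v\<close> belongs to the cell.\<close>

lemma side_contains_disc:
  assumes v: "v \<in> all_centres" and x: "x \<in> Q" "Fn v 1 x = 0" and V: "open V" "x \<in> V"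
  obtains V1 x1 where "open V1" "x1 \<in> V1" "x1 \<in> H4" "Fn v 1 x1 = 0" "V1 \<subseteq> V"
    "\<And>z. z \<in> V1 \<Longrightarrow> z \<in> H4 \<Longrightarrow> Fn v 1 z = 0 \<Longrightarrow> z \<in> Q"
proof -
  \<comment> \<open>In the projective model half of \<open>v\<close> is the centre of the side,
    since its inner product with \<open>v\<close> is 1.\<close>
  have y: "(1/2) *\<^sub>R v \<in> H4" unfolding mem_H4 using centre_inner[OF v] by simp
  obtain t z where z: "0 < t" "t < 1" "z \<in> V" "z \<in> H4"
    "klein z = (1 - t) *\<^sub>R klein x + t *\<^sub>R ((1/2) *\<^sub>R v)"
    using klein_segment_near[OF Q_in_H4[OF x(1)] y V] .
  have less: "Fn w 1 z < 0" if w: "w \<in> all_centres" "w \<noteq> v" for w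
  proof -
    have "w \<bullet> klein x \<le> 1" "(w \<bullet> v) / 2 < 1"
      using x w centre_inner_le[OF w(1) v w(2)] unfolding mem_Q Fn_klein_iff[symmetric] by auto
    then show ?thesis unfolding Fn_klein_iff z(5)
      using convex_comb_less[OF z(1,2), of "w \<bullet> klein x" 1 "(w \<bullet> v) / 2"] by (simp add: inner_add_right)
  qed
  have vz: "Fn v 1 z = 0"
    using x(2) centre_inner[OF v] unfolding Fn_klein_iff z(5) by (simp add: inner_add_right)
  define V1 where "V1 = V \<inter> (\<Inter>w\<in>all_centres - {v}. {x. Fn w 1 x < 0})"
  have "open {x. Fn w 1 x < 0}" for w
    by (rule open_Collect_less) (auto intro: continuous_Fn)
  then have "open V1" unfolding V1_def using finite_all_centres V(1) by (intro open_Int open_INT) auto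
  moreover have "z \<in> V1" using less z(3) unfolding V1_def by blast
  moreover have "u \<in> Q" if "u \<in> V1" "u \<in> H4" "Fn v 1 u = 0" for u
    unfolding mem_Q
  proof (intro conjI ballI that(2))
    fix w assume w: "w \<in> all_centres"
    show "Fn w 1 u \<le> 0"
    proof (cases "w = v")
      case False
      then show ?thesis using that(1) w unfolding V1_def by (auto intro: less_imp_le)
    qed (simp add: that(3))
  qed
  moreover have "V1 \<subseteq> V" unfolding V1_def by blast
  ultimately show ?thesis using that z(4) vz by blast
qed

text \<open>In the projective model the set is convex.\<close>

lemma connected_plane_interior: "connected {x \<in> interior_Q. Fn a b x = 0}"
proof -
  define K where "K = {y \<in> H4. a \<bullet> y = b \<and> (\<forall>v\<in>all_centres. v \<bullet> y < 1)}"
  have "K = H4 \<inter> {y. a \<bullet> y = b} \<inter> (\<Inter>v\<in>all_centres. {y. v \<bullet> y < 1})"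
    unfolding K_def by blast
  then have "convex K"
    by (simp only:) (intro convex_Int convex_INT convex_ball convex_hyperplane convex_halfspace_lt)
  moreover have "continuous_on K unklein"
    by (rule continuous_on_subset[OF continuous_unklein]) (auto simp: K_def)
  ultimately have "connected (unklein ` K)"
    by (intro connected_continuous_image convex_connected)
  moreover have "unklein ` K = {x \<in> interior_Q. Fn a b x = 0}"
  proof (intro equalityI subsetI)
    fix x assume "x \<in> unklein ` K"
    then obtain y where y: "y \<in> K" "x = unklein y" by blast
    then have H: "y \<in> H4" unfolding K_def by blast
    then show "x \<in> {x \<in> interior_Q. Fn a b x = 0}"
      using y unklein_in[OF H] klein_unklein[OF H] unfolding K_def interior_Q_def by (simp add: Fn_klein_iff del: mem_ball mem_ball_0)
  next
    fix x assume x: "x \<in> {x \<in> interior_Q. Fn a b x = 0}"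
    then have H: "x \<in> H4" using interior_Q_H4 by blast
    have "klein x \<in> K"
      using x klein_in[OF H] unfolding K_def interior_Q_def by (simp add: Fn_klein_iff del: mem_ball mem_ball_0)
    then show "x \<in> unklein ` K" using unklein_klein[OF H] by (metis imageI)
  qed
  ultimately show ?thesis by simp
qed

section \<open>Sign changes of the coordinates, among them all gluing labels\<close>

definition sign_maps :: "(real^4 \<Rightarrow> real^4) set" where
  "sign_maps = {k. \<exists>s::4 \<Rightarrow> bool. k = (\<lambda>x. \<chi> i. (if s i then -1 else 1) * x $ i)}"

text \<open>Words in the labels stay in this finite group. Gluing classes are therefore finite,
  which separates them in the quotient, and functions invariant under sign changes descend to
  it.\<close>

lemma finite_sign_maps: "finite sign_maps"
proof -
  have eq: "sign_maps = range (\<lambda>(s :: 4 \<Rightarrow> bool) x. \<chi> i. (if s i then -1 else 1) * x $ i)"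
    unfolding sign_maps_def by blast
  show ?thesis unfolding eq by (rule finite_imageI) (rule finite_class.finite_UNIV)
qed

lemma sign_maps_id: "(\<lambda>x. x) \<in> sign_maps"
  unfolding sign_maps_def by (rule CollectI, rule exI[of _ "\<lambda>_. False"]) simp

lemma sign_maps_comp: "k \<in> sign_maps \<Longrightarrow> l \<in> sign_maps \<Longrightarrow> (\<lambda>x. k (l x)) \<in> sign_maps"
proof -
  assume "k \<in> sign_maps" "l \<in> sign_maps"
  then obtain s t where k: "k = (\<lambda>x. \<chi> i. (if s i then -1 else 1) * x $ i)"
    and l: "l = (\<lambda>x. \<chi> i. (if t i then -1 else 1) * x $ i)"
    unfolding sign_maps_def by blast
  have "(\<lambda>x. k (l x)) = (\<lambda>x. \<chi> i. (if s i \<noteq> t i then -1 else 1) * x $ i)"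
    by (rule ext) (auto simp: k l vec_eq_iff)
  then show ?thesis unfolding sign_maps_def by (intro CollectI exI[of _ "\<lambda>i. s i \<noteq> t i"])
qed

lemma sign_maps_invol: "k \<in> sign_maps \<Longrightarrow> k (k x) = x"
  unfolding sign_maps_def by (auto simp: vec_eq_iff)

lemma sign_maps_inner: "k \<in> sign_maps \<Longrightarrow> k x \<bullet> k y = x \<bullet> y"
  unfolding sign_maps_def by (auto simp: inner_vec_def intro!: sum.cong)

lemma sign_maps_linear: "k \<in> sign_maps \<Longrightarrow> linear k"
  unfolding sign_maps_def by (auto intro!: linearI simp: vec_eq_iff algebra_simps)

lemma sign_maps_orthogonal: "k \<in> sign_maps \<Longrightarrow> orthogonal_transformation k"
  unfolding orthogonal_transformation_def using sign_maps_linear sign_maps_inner by blast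

lemma sign_maps_axis:
  assumes "k \<in> sign_maps"
  shows "k (axis i 1) = axis i 1 \<or> k (axis i 1) = - axis i 1"
  using assms unfolding sign_maps_def by (auto simp: vec_eq_iff axis_def)

lemma sign_maps_centres:
  assumes "k \<in> sign_maps" "v \<in> centres ij"
  shows "k v \<in> centres ij"
proof -
  obtain i j where ij: "ij = (i, j)" by fastforce
  obtain s t where v: "v = s *\<^sub>R e i + t *\<^sub>R e j" and st: "s \<in> {1,-1}" "t \<in> {1,-1}"
    using assms(2) unfolding ij centres_def by auto
  obtain s' t' where s': "k (e i) = s' *\<^sub>R e i" "s' \<in> {1,-1}" and t': "k (e j) = t' *\<^sub>R e j" "t' \<in> {1,-1}"
    using sign_maps_axis[OF assms(1)] unfolding e_def
    by (metis insertI1 insert_iff scaleR_minus1_left scaleR_one)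
  have "k v = (s * s') *\<^sub>R e i + (t * t') *\<^sub>R e j"
    using sign_maps_linear[OF assms(1)] by (simp add: v linear_add linear_scale s' t')
  moreover have "s * s' \<in> {1,-1}" "t * t' \<in> {1,-1}" using st s'(2) t'(2) by auto
  ultimately show ?thesis unfolding ij centres_def by auto
qed

lemma sign_maps_all_centres: "k \<in> sign_maps \<Longrightarrow> v \<in> all_centres \<Longrightarrow> k v \<in> all_centres"
  unfolding all_centres_def using sign_maps_centres by blast

lemma sign_maps_Fn: "k \<in> sign_maps \<Longrightarrow> Fn (k a) b (k x) = Fn a b x"
  by (simp add: Fn_def sign_maps_inner)

lemma sign_maps_Fn2: "k \<in> sign_maps \<Longrightarrow> Fn (k a) b x = Fn a b (k x)"
  using sign_maps_Fn[of k a b "k x"] by (simp add: sign_maps_invol)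

lemma sign_maps_H4: "k \<in> sign_maps \<Longrightarrow> k x \<in> H4 \<longleftrightarrow> x \<in> H4"
  unfolding mem_H4 by (simp add: sign_maps_inner)

lemma sign_maps_Q: "k \<in> sign_maps \<Longrightarrow> x \<in> Q \<Longrightarrow> k x \<in> Q"
  unfolding mem_Q using sign_maps_H4[of k x] sign_maps_Fn2[of k _ 1 x] sign_maps_all_centres by metis

lemma sign_maps_interior_Q: "k \<in> sign_maps \<Longrightarrow> x \<in> interior_Q \<Longrightarrow> k x \<in> interior_Q"
  unfolding interior_Q_def mem_Collect_eq
  using sign_maps_H4[of k x] sign_maps_Fn2[of k _ 1 x] sign_maps_all_centres by metis

lemma sign_maps_continuous: "k \<in> sign_maps \<Longrightarrow> continuous_on S k"
  using sign_maps_linear linear_continuous_on linear_conv_bounded_linear by blast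

lemma e_inner: "i \<in> {1..4} \<Longrightarrow> j \<in> {1..4} \<Longrightarrow> e i \<bullet> e j = (if i = j then 1 else 0)"
proof -
  assume "i \<in> {1..4}" "j \<in> {1..4}"
  then have "i \<in> {1,2,3,4}" "j \<in> {1,2,3,4}" by auto
  then show ?thesis by (auto simp: e_def inner_axis_axis)
qed

lemma kdiag_nth:
  "kdiag d x $ 1 = (if odd d then -1 else 1) * x $ 1"
  "kdiag d x $ 2 = (if odd (d div 2) then -1 else 1) * x $ 2"
  "kdiag d x $ 3 = (if odd (d div 4) then -1 else 1) * x $ 3"
  "kdiag d x $ 4 = (if odd (d div 8) then -1 else 1) * x $ 4"
proof -
  have m: "(-1::real) ^ (n mod 2) = (if odd n then -1 else 1)" for n :: nat
    by (cases "even n") (auto simp: odd_iff_mod_2_eq_one)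
  have s: "{1..4} = {1, 2, 3, 4::nat}" by auto
  have "kdiag d x = ((if odd d then -1 else 1) * x $ 1) *\<^sub>R axis 1 1
    + ((if odd (d div 2) then -1 else 1) * x $ 2) *\<^sub>R axis 2 1
    + ((if odd (d div 4) then -1 else 1) * x $ 3) *\<^sub>R axis 3 1
    + ((if odd (d div 8) then -1 else 1) * x $ 4) *\<^sub>R axis 4 1"
    unfolding kdiag_def s by (simp add: e_def m inner_axis add.assoc)
  then show "kdiag d x $ 1 = (if odd d then -1 else 1) * x $ 1"
  "kdiag d x $ 2 = (if odd (d div 2) then -1 else 1) * x $ 2"
  "kdiag d x $ 3 = (if odd (d div 4) then -1 else 1) * x $ 3"
  "kdiag d x $ 4 = (if odd (d div 8) then -1 else 1) * x $ 4"
    by (simp_all add: axis_def)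
qed

lemma kdiag_sign_maps: "kdiag d \<in> sign_maps"
proof -
  let ?s = "\<lambda>i::4. if i = 1 then odd d else if i = 2 then odd (d div 2) else if i = 3 then odd (d div 4) else odd (d div 8)"
  have "kdiag d x = (\<chi> i. (if ?s i then -1 else 1) * x $ i)" for x
    by (simp add: vec_eq_iff forall_4 kdiag_nth)
  then have "kdiag d = (\<lambda>x. \<chi> i. (if ?s i then -1 else 1) * x $ i)" by (rule ext)
  then show ?thesis unfolding sign_maps_def by (intro CollectI exI[of _ ?s])
qed

section \<open>Faces through a point and the gluing relation\<close>

definition faces :: "real^4 \<Rightarrow> (real^4) set" where
  "faces x = {v \<in> all_centres. Fn v 1 x = 0}"

lemma faces_near:
  assumes "x \<in> Q"
  obtains V where "open V" "x \<in> V" "\<And>y. y \<in> V \<Longrightarrow> faces y \<subseteq> faces x"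
proof -
  define V where "V = (\<Inter>v\<in>all_centres - faces x. {y. Fn v 1 y < 0})"
  have "open {y. Fn v 1 y < 0}" for v
    by (rule open_Collect_less) (auto intro: continuous_Fn)
  then have "open V" unfolding V_def using finite_all_centres by (intro open_INT) auto
  moreover have "x \<in> V" using assms unfolding V_def faces_def mem_Q by force
  moreover have "faces y \<subseteq> faces x" if "y \<in> V" for y
    using that unfolding V_def faces_def by force
  ultimately show ?thesis using that by blast
qed

lemma faces_sign_map: "k \<in> sign_maps \<Longrightarrow> faces (k x) = k ` faces x"
proof -
  assume k: "k \<in> sign_maps"
  have "v \<in> faces (k x) \<longleftrightarrow> k v \<in> faces x" for v
    unfolding faces_def using sign_maps_all_centres[OF k] sign_maps_invol[OF k]
    by (metis (mono_tags, lifting) k mem_Collect_eq sign_maps_Fn2)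
  then show ?thesis using sign_maps_invol[OF k] by (auto simp: image_iff) metis
qed

lemma faces_interior: "x \<in> Q \<Longrightarrow> x \<in> interior_Q \<longleftrightarrow> faces x = {}"
  unfolding faces_def interior_Q_def mem_Q by force

lemma glue_stepE:
  assumes "(x, y) \<in> glue_step code"
  obtains ij v where "ij \<in> index_pairs" "v \<in> centres ij" "v \<in> faces x" "x \<in> Q" "y = kdiag (code_digit code ij) x"
proof -
  obtain ij v where ij: "ij \<in> index_pairs" "v \<in> centres ij" "x \<in> side v" "y = kdiag (code_digit code ij) x"
    using assms unfolding glue_step_def by blast
  then have "v \<in> all_centres" unfolding all_centres_def by blast
  then show ?thesis using that ij mem_side unfolding faces_def by blast
qed

lemma glue_stepI:
  assumes "ij \<in> index_pairs" "v \<in> centres ij" "v \<in> faces x" "x \<in> Q"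
  shows "(x, kdiag (code_digit code ij) x) \<in> glue_step code"
proof -
  have "x \<in> side v" using assms mem_side unfolding faces_def by blast
  then show ?thesis unfolding glue_step_def using assms by blast
qed

text \<open>Labels are involutions that permute the centres of each index pair, so the inverse of a
  gluing step is a gluing step with the same label.\<close>

lemma glue_sym_step:
  assumes "(x, y) \<in> glue_step code \<union> (glue_step code)\<inverse>"
  obtains ij v where "ij \<in> index_pairs" "v \<in> centres ij" "v \<in> faces x" "x \<in> Q" "y = kdiag (code_digit code ij) x"
proof (cases "(x, y) \<in> glue_step code")
  case True
  then show ?thesis using glue_stepE that by blast
next
  case False
  then have "(y, x) \<in> glue_step code" using assms by blast
  then obtain ij v where ij: "ij \<in> index_pairs" "v \<in> centres ij" "v \<in> faces y" "y \<in> Q"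
    "x = kdiag (code_digit code ij) y" by (rule glue_stepE)
  let ?k = "kdiag (code_digit code ij)"
  note k = kdiag_sign_maps[of "code_digit code ij"]
  have "?k v \<in> faces x" unfolding ij(5) faces_sign_map[OF k] using ij(3) by blast
  moreover have "y = ?k x" unfolding ij(5) by (simp add: sign_maps_invol[OF k])
  moreover have "x \<in> Q" unfolding ij(5) by (rule sign_maps_Q[OF k ij(4)])
  ultimately show ?thesis using that ij(1) sign_maps_centres[OF k ij(2)] by blast
qed

text \<open>The gluing class of a point depends only on the faces containing it; this makes the
  gluing relation closed.\<close>

lemma glue_transport:
  assumes "(x, y) \<in> glue code"
  obtains k where "k \<in> sign_maps" "y = k x" "\<And>z. z \<in> Q \<Longrightarrow> faces x \<subseteq> faces z \<Longrightarrow> (z, k z) \<in> glue code"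
proof -
  let ?R = "glue_step code \<union> (glue_step code)\<inverse>"
  have "(x, y) \<in> ?R\<^sup>*" using assms unfolding glue_def by blast
  then have "\<exists>k\<in>sign_maps. y = k x \<and> (\<forall>z\<in>Q. faces x \<subseteq> faces z \<longrightarrow> (z, k z) \<in> ?R\<^sup>*)"
  proof (induction rule: rtrancl_induct)
    case base
    then show ?case using sign_maps_id by (intro bexI[of _ "\<lambda>x. x"]) auto
  next
    case (step y y')
    then obtain k where k: "k \<in> sign_maps" "y = k x" "\<forall>z\<in>Q. faces x \<subseteq> faces z \<longrightarrow> (z, k z) \<in> ?R\<^sup>*" by blast
    obtain ij v where ij: "ij \<in> index_pairs" "v \<in> centres ij" "v \<in> faces y" "y' = kdiag (code_digit code ij) y"
      using glue_sym_step[OF step(2)] by metis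
    let ?l = "kdiag (code_digit code ij)"
    have "(z, ?l (k z)) \<in> ?R\<^sup>*" if z: "z \<in> Q" "faces x \<subseteq> faces z" for z
    proof -
      have "v \<in> faces (k z)" using ij(3) z(2) unfolding k(2) faces_sign_map[OF k(1)] by blast
      then have "(k z, ?l (k z)) \<in> ?R" using glue_stepI[OF ij(1,2)] sign_maps_Q[OF k(1) z(1)] by blast
      then show ?thesis using k(3) z by (meson rtrancl.rtrancl_into_rtrancl)
    qed
    then show ?case using sign_maps_comp[OF kdiag_sign_maps k(1), of "code_digit code ij"] ij(4) k(2)
      by (intro bexI[of _ "\<lambda>x. ?l (k x)"]) auto
  qed
  then obtain k where k: "k \<in> sign_maps" "y = k x" "\<forall>z\<in>Q. faces x \<subseteq> faces z \<longrightarrow> (z, k z) \<in> ?R\<^sup>*" by blast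
  have "(z, k z) \<in> glue code" if "z \<in> Q" "faces x \<subseteq> faces z" for z
    using k(3) that sign_maps_Q[OF k(1) that(1)] unfolding glue_def by blast
  then show ?thesis using that k by blast
qed

lemma equiv_glue: "equiv Q (glue code)"
proof (rule equivI)
  let ?R = "glue_step code \<union> (glue_step code)\<inverse>"
  show "glue code \<subseteq> Q \<times> Q" unfolding glue_def by blast
  show "refl_on Q (glue code)" unfolding refl_on_def glue_def by blast
  have "sym (?R\<^sup>*)" by (rule sym_rtrancl) (auto simp: sym_def)
  then show "sym (glue code)" unfolding glue_def sym_def by blast
  show "trans (glue code)" unfolding glue_def trans_def by (blast intro: rtrancl_trans)
qed

lemma glue_proj_eq: "x \<in> Q \<Longrightarrow> y \<in> Q \<Longrightarrow> glue_proj code x = glue_proj code y \<longleftrightarrow> (x, y) \<in> glue code"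
  unfolding glue_proj_def by (rule eq_equiv_class_iff[OF equiv_glue])

lemma glue_proj_in: "x \<in> Q \<Longrightarrow> glue_proj code x \<in> Q // glue code"
  unfolding glue_proj_def by (rule quotientI)

lemma glue_proj_surj: "p \<in> Q // glue code \<Longrightarrow> \<exists>x\<in>Q. p = glue_proj code x"
  unfolding glue_proj_def by (auto elim: quotientE)

lemma glue_interior: "x \<in> interior_Q \<Longrightarrow> (x, y) \<in> glue code \<Longrightarrow> y = x"
proof -
  assume x: "x \<in> interior_Q" and xy: "(x, y) \<in> glue code"
  have "faces x = {}" using faces_interior interior_Q_subset x by blast
  moreover have "(x, y) \<in> (glue_step code \<union> (glue_step code)\<inverse>)\<^sup>*" using xy unfolding glue_def by blast
  ultimately show "y = x" by (metis converse_rtranclE empty_iff glue_sym_step)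
qed

lemma glue_side:
  assumes "ij \<in> index_pairs" "v \<in> centres ij" "x \<in> Q" "Fn v 1 x = 0"
  shows "glue_proj code (kdiag (code_digit code ij) x) = glue_proj code x"
proof -
  have v: "v \<in> all_centres" using assms unfolding all_centres_def by blast
  then have "(x, kdiag (code_digit code ij) x) \<in> glue_step code"
    by (intro glue_stepI[OF assms(1,2)]) (use assms v in \<open>auto simp: faces_def\<close>)
  moreover have "kdiag (code_digit code ij) x \<in> Q" by (rule sign_maps_Q[OF kdiag_sign_maps assms(3)])
  ultimately have "(x, kdiag (code_digit code ij) x) \<in> glue code"
    unfolding glue_def using assms(3) by blast
  then show ?thesis using glue_proj_eq assms(3) equiv_glue by (metis equiv_class_eq glue_proj_def)
qed

lemma openin_Q_iff:
  "openin (top_of_set Q) S \<longleftrightarrow> S \<subseteq> Q \<and> (\<forall>x\<in>S. \<exists>V. open V \<and> x \<in> V \<and> V \<inter> Q \<subseteq> S)"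
proof
  assume "openin (top_of_set Q) S"
  then show "S \<subseteq> Q \<and> (\<forall>x\<in>S. \<exists>V. open V \<and> x \<in> V \<and> V \<inter> Q \<subseteq> S)"
    unfolding openin_open by blast
next
  assume S: "S \<subseteq> Q \<and> (\<forall>x\<in>S. \<exists>V. open V \<and> x \<in> V \<and> V \<inter> Q \<subseteq> S)"
  have "S = Q \<inter> \<Union>{V. open V \<and> V \<inter> Q \<subseteq> S}" using S by blast
  moreover have "open (\<Union>{V. open V \<and> V \<inter> Q \<subseteq> S})" by blast
  ultimately show "openin (top_of_set Q) S" unfolding openin_open by blast
qed

text \<open>A side with trivial label would be glued to itself pointwise and become a boundary.
  Excluding this is what forces charts to continue across a side by reflection, in
  \<open>chart_germ_side\<close>.\<close>

locale cell_gluing =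
  fixes code :: "nat list"
  assumes nontrivial: "ij \<in> index_pairs \<Longrightarrow> kdiag (code_digit code ij) \<noteq> (\<lambda>x. x)"
begin

abbreviation "N \<equiv> glued_manifold code"
abbreviation "NT \<equiv> glued_top code"
abbreviation "proj \<equiv> glue_proj code"
abbreviation "lab ij \<equiv> kdiag (code_digit code ij)"

lemma htop_N [simp]: "htop N = NT"
  by (simp add: glued_manifold_def)

lemma openin_NT_iff:
  "openin NT U \<longleftrightarrow> U \<subseteq> Q // glue code \<and> (\<forall>x\<in>Q. proj x \<in> U \<longrightarrow> (\<exists>V. open V \<and> x \<in> V \<and> (\<forall>z\<in>V \<inter> Q. proj z \<in> U)))"
proof -
  have eq: "V \<inter> Q \<subseteq> {x \<in> Q. proj x \<in> U} \<longleftrightarrow> (\<forall>z\<in>V \<inter> Q. proj z \<in> U)" for V by blast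
  show ?thesis unfolding openin_glued_top openin_Q_iff eq by (simp add: Ball_def imp_conjL)
qed

lemma openin_NT_near:
  assumes "openin NT U" "x \<in> Q" "proj x \<in> U"
  obtains V where "open V" "x \<in> V" "\<And>z. z \<in> V \<Longrightarrow> z \<in> Q \<Longrightarrow> proj z \<in> U"
proof -
  have "\<exists>V. open V \<and> x \<in> V \<and> (\<forall>z\<in>V \<inter> Q. proj z \<in> U)"
    using conjunct2[OF assms(1)[unfolded openin_NT_iff]] assms(2,3) by (metis (no_types, lifting))
  then show ?thesis using that by (meson IntI)
qed

lemma openin_NT_class: "openin NT U \<Longrightarrow> p \<in> U \<Longrightarrow> \<exists>x\<in>Q. p = proj x"
  unfolding openin_NT_iff using glue_proj_surj by blast

text \<open>The class of \<open>x\<close> lies in its finite orbit under \<open>sign_maps\<close>,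
  so some closed ball about \<open>z\<close> avoids it. The classes missing this ball form an open
  set: by \<open>glue_transport\<close>, a sign map that moves a nearby point within its class also
  moves the given point within its own.\<close>

lemma glue_proj_hausdorff:
  assumes x: "x \<in> Q" and z: "z \<in> Q" and ne: "proj x \<noteq> proj z"
  obtains U V where "openin NT U" "proj x \<in> U" "open V" "z \<in> V" "\<And>y. y \<in> V \<Longrightarrow> y \<in> Q \<Longrightarrow> proj y \<notin> U"
proof -
  have "finite ((\<lambda>k. k x) ` sign_maps)" using finite_sign_maps by simp
  then obtain d where d: "0 < d" "\<And>k. k \<in> sign_maps \<Longrightarrow> k x \<noteq> z \<Longrightarrow> d \<le> dist z (k x)"
    using finite_set_avoid[of "(\<lambda>k. k x) ` sign_maps" z] by auto
  define C where "C = cball z (d / 2)"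
  define U where "U = {p \<in> Q // glue code. p \<inter> C = {}}"
  have pU: "proj y \<in> U \<longleftrightarrow> (\<forall>y'. (y, y') \<in> glue code \<longrightarrow> y' \<notin> C)" if "y \<in> Q" for y
    using glue_proj_in[OF that, of code] unfolding U_def by (auto simp: glue_proj_def)
  have "y' \<notin> C" if xy: "(x, y') \<in> glue code" for y'
  proof -
    obtain k where k: "k \<in> sign_maps" "y' = k x" using glue_transport[OF xy] by metis
    have "y' \<in> Q" using k sign_maps_Q x by blast
    then have "y' \<noteq> z" using xy ne glue_proj_eq[OF x] by metis
    then have "d \<le> dist z y'" using d(2)[OF k(1)] k(2) by blast
    then show ?thesis using d(1) unfolding C_def by simp
  qed
  then have xU: "proj x \<in> U" using pU[OF x] by blast
  have "openin NT U"
    unfolding openin_NT_iff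
  proof (intro conjI ballI impI)
    show "U \<subseteq> Q // glue code" unfolding U_def by blast
    fix y assume y: "y \<in> Q" "proj y \<in> U"
    obtain V where V: "open V" "y \<in> V" "\<And>u. u \<in> V \<Longrightarrow> faces u \<subseteq> faces y" by (rule faces_near[OF y(1)]) blast
    define K where "K = {k \<in> sign_maps. (y, k y) \<in> glue code}"
    define V' where "V' = V \<inter> (\<Inter>k\<in>K. k -` (- C))"
    have "open (k -` (- C))" if "k \<in> K" for k
      using sign_maps_continuous[of k UNIV] that unfolding K_def C_def
      by (intro open_vimage) auto
    moreover have "finite K" using finite_sign_maps unfolding K_def by simp
    ultimately have "open V'" unfolding V'_def using V(1) by (intro open_Int open_INT) auto
    moreover have "y \<in> V'" using V(2) y pU[OF y(1)] unfolding V'_def K_def by blast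
    moreover have "proj u \<in> U" if u: "u \<in> V' \<inter> Q" for u
    proof -
      have uQ: "u \<in> Q" and f: "faces u \<subseteq> faces y" using u V(3) unfolding V'_def by blast+
      have "u' \<notin> C" if "(u, u') \<in> glue code" for u'
      proof -
        obtain k where k: "k \<in> sign_maps" "u' = k u" "\<And>z. z \<in> Q \<Longrightarrow> faces u \<subseteq> faces z \<Longrightarrow> (z, k z) \<in> glue code"
          using glue_transport[OF \<open>(u, u') \<in> glue code\<close>] by metis
        then have "k \<in> K" using y(1) f unfolding K_def by blast
        then show ?thesis using u k(2) unfolding V'_def by blast
      qed
      then show ?thesis using pU[OF uQ] by blast
    qed
    ultimately show "\<exists>V. open V \<and> y \<in> V \<and> (\<forall>z\<in>V \<inter> Q. proj z \<in> U)" by blast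
  qed
  moreover have "proj y \<notin> U" if "y \<in> ball z (d/2)" "y \<in> Q" for y
  proof -
    have "(y, y) \<in> glue code" using that(2) unfolding glue_def by blast
    moreover have "y \<in> C" using that(1) unfolding C_def by simp
    ultimately show ?thesis using pU[OF that(2)] by blast
  qed
  moreover have "z \<in> ball z (d/2)" using d(1) by simp
  ultimately show ?thesis using that xU open_ball by blast
qed

lemma chartD:
  assumes "c \<in> hcharts N"
  shows "openin NT (fst c)" "inj_on (snd c) (fst c)"
    "\<And>x. x \<in> Q \<Longrightarrow> proj x \<in> fst c \<Longrightarrow> \<exists>g V. hyp_isometry g \<and> open V \<and> x \<in> V \<and>
      (\<forall>z\<in>V \<inter> Q. proj z \<in> fst c \<longrightarrow> snd c (proj z) = g z)"
proof -
  have c: "openin NT (fst c)" "homeomorphic_map (subtopology NT (fst c)) (top_of_set (snd c ` fst c)) (snd c)"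
     "\<forall>x\<in>Q. proj x \<in> fst c \<longrightarrow> (\<exists>g V. hyp_isometry g \<and> open V \<and> x \<in> V \<and>
      (\<forall>z\<in>V \<inter> Q. proj z \<in> fst c \<longrightarrow> snd c (proj z) = g z))"
    using assms unfolding glued_manifold_def by auto
  show "openin NT (fst c)" by (rule c(1))
  have "topspace (subtopology NT (fst c)) = fst c"
    using openin_subset[OF c(1)] by auto
  then show "inj_on (snd c) (fst c)"
    using homeomorphic_imp_injective_map[OF c(2)] by simp
  show "\<And>x. x \<in> Q \<Longrightarrow> proj x \<in> fst c \<Longrightarrow> \<exists>g V. hyp_isometry g \<and> open V \<and> x \<in> V \<and>
      (\<forall>z\<in>V \<inter> Q. proj z \<in> fst c \<longrightarrow> snd c (proj z) = g z)"
    using c(3) by blast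
qed

text \<open>The isometry through which the chart reads the cell near \<open>x\<close>. A boundary
  point of the cell shares its class with other points, each with a germ of its own; the next lemmas
  compare these germs.\<close>

definition chart_germ :: "(real^4) set hchart \<Rightarrow> real^4 \<Rightarrow> (real^4 \<Rightarrow> real^4) \<Rightarrow> bool" where
  "chart_germ c x g \<longleftrightarrow> c \<in> hcharts N \<and> x \<in> Q \<and> hyp_isometry g \<and>
     (\<exists>V. open V \<and> x \<in> V \<and> (\<forall>z\<in>V \<inter> Q. proj z \<in> fst c \<and> snd c (proj z) = g z))"

lemma chart_germD:
  assumes "chart_germ c x g"
  shows "c \<in> hcharts N" "x \<in> Q" "hyp_isometry g" "proj x \<in> fst c" "snd c (proj x) = g x"
  using assms unfolding chart_germ_def by blast+

lemma chart_germ_exists: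
  assumes "c \<in> hcharts N" "x \<in> Q" "proj x \<in> fst c"
  shows "\<exists>g. chart_germ c x g"
proof -
  obtain g V where g: "hyp_isometry g" "open V" "x \<in> V"
      "\<forall>z\<in>V \<inter> Q. proj z \<in> fst c \<longrightarrow> snd c (proj z) = g z"
    using chartD(3)[OF assms] by blast
  obtain V' where V': "open V'" "x \<in> V'" "\<And>z. z \<in> V' \<Longrightarrow> z \<in> Q \<Longrightarrow> proj z \<in> fst c"
    by (rule openin_NT_near[OF chartD(1)[OF assms(1)] assms(2,3)]) blast
  have "chart_germ c x g"
    unfolding chart_germ_def using assms g V' by (intro conjI exI[of _ "V \<inter> V'"]) auto
  then show ?thesis by blast
qed

lemma chart_germ_near:
  assumes "chart_germ c x g"
  obtains V where "open V" "x \<in> V" "\<And>z. z \<in> V \<Longrightarrow> z \<in> Q \<Longrightarrow> chart_germ c z g"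
  using assms unfolding chart_germ_def by blast

lemma chart_germ_unique:
  assumes "chart_germ c x g" "chart_germ c x g'"
  shows "\<forall>y\<in>H4. g y = g' y"
proof -
  obtain V where V: "open V" "x \<in> V" "\<And>z. z \<in> V \<Longrightarrow> z \<in> Q \<Longrightarrow> chart_germ c z g"
    by (rule chart_germ_near[OF assms(1)]) blast
  obtain V' where V': "open V'" "x \<in> V'" "\<And>z. z \<in> V' \<Longrightarrow> z \<in> Q \<Longrightarrow> chart_germ c z g'"
    by (rule chart_germ_near[OF assms(2)]) blast
  have VV: "open (V \<inter> V')" "x \<in> V \<inter> V'" using V V' by auto
  obtain z where z: "z \<in> V \<inter> V'" "z \<in> interior_Q"
    using interior_Q_near[OF chart_germD(2)[OF assms(1)] zero_interior_Q VV] by metis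
  show ?thesis
  proof (rule isometry_eq_open[OF chart_germD(3)[OF assms(1)] chart_germD(3)[OF assms(2)], of "V \<inter> V' \<inter> interior_Q"])
    show "open (V \<inter> V' \<inter> interior_Q)" using VV open_interior_Q by blast
    show "z \<in> V \<inter> V' \<inter> interior_Q" using z by blast
    show "z \<in> H4" by (rule interior_Q_H4[OF z(2)])
    fix y assume "y \<in> V \<inter> V' \<inter> interior_Q"
    then have "chart_germ c y g" "chart_germ c y g'"
      using V(3) V'(3) interior_Q_subset by blast+
    then show "g y = g' y" using chart_germD(5) by metis
  qed
qed

text \<open>The two germs agree on the common side, so \<open>g' \<circ> lab ij\<close> followed by
  the inverse of \<open>g\<close> fixes a piece of it pointwise and is the identity or the
  inversion. The identity would give \<open>z\<close> and \<open>lab ij z\<close> the same chart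
  value for interior points \<open>z\<close>; injectivity of the chart then makes the label
  trivial.\<close>

lemma chart_germ_side:
  assumes ij: "ij \<in> index_pairs" and v: "v \<in> centres ij" and x: "Fn v 1 x = 0"
    and g: "chart_germ c x g" and g': "chart_germ c (lab ij x) g'"
  shows "\<forall>y\<in>H4. g' (lab ij y) = g (inversion v y)"
proof -
  let ?k = "lab ij"
  note k = kdiag_sign_maps[of "code_digit code ij"]
  have va: "v \<in> all_centres" using ij v unfolding all_centres_def by blast
  note v2 = centre_inner[OF va]
  note xQ = chart_germD(2)[OF g]
  note gi = chart_germD(3)[OF g] and gi' = chart_germD(3)[OF g']
  have hk: "hyp_isometry ?k" by (rule orthogonal_hyp_isometry[OF sign_maps_orthogonal[OF k]])
  have hgk: "hyp_isometry (g' \<circ> ?k)" by (rule hyp_isometry_comp[OF gi' hk])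
  obtain V where V: "open V" "x \<in> V" "\<And>z. z \<in> V \<Longrightarrow> z \<in> Q \<Longrightarrow> chart_germ c z g"
    by (rule chart_germ_near[OF g]) blast
  obtain V' where V': "open V'" "?k x \<in> V'" "\<And>z. z \<in> V' \<Longrightarrow> z \<in> Q \<Longrightarrow> chart_germ c z g'"
    by (rule chart_germ_near[OF g']) blast
  define W where "W = V \<inter> ?k -` V'"
  have W: "open W" "x \<in> W"
    using V V' open_vimage[OF V'(1) sign_maps_continuous[OF k]] unfolding W_def by blast+
  have Wg: "chart_germ c z g" "chart_germ c (?k z) g'" if "z \<in> W" "z \<in> Q" for z
    using that V(3) V'(3) sign_maps_Q[OF k] unfolding W_def by blast+
  obtain V1 x1 where V1: "open V1" "x1 \<in> V1" "x1 \<in> H4" "Fn v 1 x1 = 0" "V1 \<subseteq> W"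
    "\<And>z. z \<in> V1 \<Longrightarrow> z \<in> H4 \<Longrightarrow> Fn v 1 z = 0 \<Longrightarrow> z \<in> Q"
    using side_contains_disc[OF va xQ x W] by metis
  define f where "f = inv_into H4 g \<circ> (g' \<circ> ?k)"
  have hf: "hyp_isometry f" unfolding f_def
    by (rule hyp_isometry_comp[OF hyp_isometry_inv(1)[OF gi] hgk])
  have gf: "g (f y) = g' (?k y)" if "y \<in> H4" for y
    using hyp_isometry_inv(3)[OF gi hyp_isometry_hratio(2)[OF hgk that that]] by (simp add: f_def)
  have "f z = z" if z: "z \<in> V1" "z \<in> H4" "Fn v 1 z = 0" for z
  proof -
    have zQ: "z \<in> Q" using V1(6) z by blast
    have "g' (?k z) = snd c (proj (?k z))" using chart_germD(5) Wg(2) V1(5) z(1) zQ by (metis subsetD)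
    also have "\<dots> = snd c (proj z)" using glue_side[OF ij v zQ z(3)] by simp
    also have "\<dots> = g z" using chart_germD(5) Wg(1) V1(5) z(1) zQ by (metis subsetD)
    finally show ?thesis using hyp_isometry_inv(2)[OF gi z(2)] by (simp add: f_def)
  qed
  then have "(\<forall>y\<in>H4. f y = y) \<or> (\<forall>y\<in>H4. f y = inversion v y)"
    by (rule isometry_fixing_sphere[OF hf v2 V1(1-4)])
  then show ?thesis
  proof
    assume "\<forall>y\<in>H4. f y = inversion v y"
    then show ?thesis using gf by simp
  next
    assume fid: "\<forall>y\<in>H4. f y = y"
    obtain z0 where z0: "z0 \<in> W" "z0 \<in> interior_Q"
      using interior_Q_near[OF xQ zero_interior_Q W] by metis
    have fix_: "?k z = z" if z: "z \<in> W \<inter> interior_Q" for z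
    proof -
      have zQ: "z \<in> Q" and zH: "z \<in> H4" using z interior_Q_subset interior_Q_H4 by blast+
      have "snd c (proj (?k z)) = g' (?k z)" using chart_germD(5) Wg(2) z zQ by blast
      also have "\<dots> = g z" using gf[OF zH] fid zH by simp
      also have "\<dots> = snd c (proj z)" using chart_germD(5) Wg(1) z zQ by (metis IntD1)
      finally have eq: "snd c (proj (?k z)) = snd c (proj z)" .
      have in1: "proj (?k z) \<in> fst c" using chart_germD(4) Wg(2) z zQ by blast
      have in2: "proj z \<in> fst c" using chart_germD(4) Wg(1) z zQ by blast
      have "proj z = proj (?k z)"
        using inj_onD[OF chartD(2)[OF chart_germD(1)[OF g]] eq in1 in2] by simp
      then have "(z, ?k z) \<in> glue code" using glue_proj_eq[OF zQ sign_maps_Q[OF k zQ]] by blast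
      then show ?thesis using glue_interior z by blast
    qed
    have "open (W \<inter> interior_Q)" using W open_interior_Q by blast
    \<comment> \<open>A linear map that fixes a ball pointwise is the identity; \<open>w\<close> is
      a point of the ball in direction \<open>y\<close> from its centre.\<close>
    then have "?k y = y" for y
    proof -
      assume o: "open (W \<inter> interior_Q)"
      obtain d where d: "0 < d" "ball z0 d \<subseteq> W \<inter> interior_Q"
        using o z0 open_contains_ball by blast
      define w where "w = z0 + (d / (2 * (norm y + 1))) *\<^sub>R y"
      have pos: "0 < norm y + 1" by (simp add: add_nonneg_pos)
      have "norm ((d / (2 * (norm y + 1))) *\<^sub>R y) = d * norm y / (2 * (norm y + 1))" using d(1) pos by simp
      also have "\<dots> < d" using d(1) pos by (simp add: divide_simps algebra_simps add_nonneg_pos)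
      finally have "w \<in> ball z0 d" by (simp add: w_def dist_norm)
      then have kw: "?k w = w" "?k z0 = z0" using fix_ d(2) z0 by blast+
      have lk: "linear ?k" by (rule sign_maps_linear[OF k])
      have "(d / (2 * (norm y + 1))) *\<^sub>R ?k y = (d / (2 * (norm y + 1))) *\<^sub>R y"
        using kw unfolding w_def linear_add[OF lk] linear_scale[OF lk] by simp
      then show ?thesis using d(1) pos by simp
    qed
    then have "?k = (\<lambda>x. x)" by (rule ext)
    then show ?thesis using nontrivial[OF ij] by blast
  qed
qed

text \<open>Across a side the germs of both charts are precomposed with the same map, the label
  followed by the inversion. The coordinate change \<open>h\<close> is therefore the same at every
  representative of a class.\<close>

lemma glue_germ_transition:
  assumes "(x, y) \<in> glue code" "chart_germ c1 x g1" "chart_germ c2 x g2"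
    and "chart_germ c1 y g1'" "chart_germ c2 y g2'" and h: "\<forall>z\<in>H4. g2 z = h (g1 z)"
  shows "\<forall>z\<in>H4. g2' z = h (g1' z)"
proof -
  let ?R = "glue_step code \<union> (glue_step code)\<inverse>"
  have "(x, y) \<in> ?R\<^sup>*" using assms(1) unfolding glue_def by blast
  then have "y \<in> Q \<and> proj y = proj x \<and>
    (\<forall>g1' g2'. chart_germ c1 y g1' \<longrightarrow> chart_germ c2 y g2' \<longrightarrow> (\<forall>z\<in>H4. g2' z = h (g1' z)))"
  proof (induction rule: rtrancl_induct)
    case base
    have "\<forall>z\<in>H4. g2' z = h (g1' z)" if "chart_germ c1 x g1'" "chart_germ c2 x g2'" for g1' g2'
      using h chart_germ_unique[OF assms(2) that(1)] chart_germ_unique[OF assms(3) that(2)] by simp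
    then show ?case using chart_germD(2)[OF assms(2)] by blast
  next
    case (step y y')
    obtain ij v where ij: "ij \<in> index_pairs" "v \<in> centres ij" "v \<in> faces y" "y' = lab ij y"
      using glue_sym_step[OF step(2)] by metis
    note k = kdiag_sign_maps[of "code_digit code ij"]
    have va: "v \<in> all_centres" "Fn v 1 y = 0" using ij(3) unfolding faces_def by blast+
    have yQ: "y \<in> Q" "proj y = proj x" using step(3) by blast+
    have y': "y' \<in> Q" "proj y' = proj y"
      using glue_side[OF ij(1,2) yQ(1) va(2)] sign_maps_Q[OF k yQ(1)] unfolding ij(4) by blast+
    obtain f1 where f1: "chart_germ c1 y f1"
      using chart_germ_exists[OF chart_germD(1)[OF assms(2)] yQ(1)] chart_germD(4)[OF assms(2)] yQ(2) by auto
    obtain f2 where f2: "chart_germ c2 y f2"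
      using chart_germ_exists[OF chart_germD(1)[OF assms(3)] yQ(1)] chart_germD(4)[OF assms(3)] yQ(2) by auto
    have f: "\<forall>z\<in>H4. f2 z = h (f1 z)" using step(3) f1 f2 by blast
    have "g2' z = h (g1' z)" if g: "chart_germ c1 y' g1'" "chart_germ c2 y' g2'" and z: "z \<in> H4" for g1' g2' z
    proof -
      define u where "u = lab ij z"
      have u: "u \<in> H4" "lab ij u = z"
        unfolding u_def using sign_maps_H4[OF k, of z] z sign_maps_invol[OF k] by blast+
      have iu: "inversion v u \<in> H4"
        using hyp_isometry_hratio(2)[OF inversion_hyp_isometry u(1) u(1)] centre_inner[OF va(1)] by simp
      have "g1' z = f1 (inversion v u)"
        using chart_germ_side[OF ij(1,2) va(2) f1] g(1) u unfolding ij(4) by metis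
      moreover have "g2' z = f2 (inversion v u)"
        using chart_germ_side[OF ij(1,2) va(2) f2] g(2) u unfolding ij(4) by metis
      ultimately show ?thesis using f iu by simp
    qed
    then show ?case using y' yQ by simp
  qed
  then show ?thesis using assms(4,5) by blast
qed

lemma co_oriented_iff:
  assumes g: "chart_germ c x g" and g': "chart_germ c' x g'"
  shows "co_oriented N (proj x) c c' \<longleftrightarrow> (orientation_preserving g \<longleftrightarrow> orientation_preserving g')"
proof -
  note gi = chart_germD(3)[OF g] and gi' = chart_germD(3)[OF g'] and xQ = chart_germD(2)[OF g]
  obtain V where V: "open V" "x \<in> V" "\<And>z. z \<in> V \<Longrightarrow> z \<in> Q \<Longrightarrow> chart_germ c z g"
    by (rule chart_germ_near[OF g]) blast
  obtain V' where V': "open V'" "x \<in> V'" "\<And>z. z \<in> V' \<Longrightarrow> z \<in> Q \<Longrightarrow> chart_germ c' z g'"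
    by (rule chart_germ_near[OF g']) blast
  show ?thesis
  proof
    assume "co_oriented N (proj x) c c'"
    then obtain U h where U: "openin NT U" "proj x \<in> U" "hyp_isometry h" "orientation_preserving h"
      "\<forall>q\<in>U. snd c' q = h (snd c q)"
      unfolding co_oriented_def by auto
    obtain V2 where V2: "open V2" "x \<in> V2" "\<And>z. z \<in> V2 \<Longrightarrow> z \<in> Q \<Longrightarrow> proj z \<in> U"
      by (rule openin_NT_near[OF U(1) xQ U(2)]) blast
    have o: "open (V \<inter> V' \<inter> V2)" "x \<in> V \<inter> V' \<inter> V2" using V V' V2 by auto
    obtain z where z: "z \<in> V \<inter> V' \<inter> V2" "z \<in> interior_Q"
      using interior_Q_near[OF xQ zero_interior_Q o] by metis
    have "\<forall>y\<in>H4. g' y = (h \<circ> g) y"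
    proof (rule isometry_eq_open[OF gi' hyp_isometry_comp[OF U(3) gi], of "V \<inter> V' \<inter> V2 \<inter> interior_Q" z])
      show "open (V \<inter> V' \<inter> V2 \<inter> interior_Q)" using o open_interior_Q by blast
      show "z \<in> H4" by (rule interior_Q_H4[OF z(2)])
      fix y assume y: "y \<in> V \<inter> V' \<inter> V2 \<inter> interior_Q"
      then have yQ: "y \<in> Q" using interior_Q_subset by blast
      have "g' y = snd c' (proj y)" using chart_germD(5) V'(3) y yQ by (metis IntD1 IntD2)
      also have "\<dots> = h (snd c (proj y))" using U(5) V2(3) y yQ by blast
      also have "snd c (proj y) = g y" using chart_germD(5) V(3) y yQ by blast
      finally show "g' y = (h \<circ> g) y" by simp
    qed (use z in blast)
    then show "orientation_preserving g \<longleftrightarrow> orientation_preserving g'"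
      using orientation_comp_iff[OF U(3) gi] U(4) orientation_H4_cong(1) by metis
  next
    assume op: "orientation_preserving g \<longleftrightarrow> orientation_preserving g'"
    define h where "h = g' \<circ> inv_into H4 g"
    have hi: "hyp_isometry h" unfolding h_def
      by (rule hyp_isometry_comp[OF gi' hyp_isometry_inv(1)[OF gi]])
    have hg: "\<forall>y\<in>H4. g' y = h (g y)"
      using hyp_isometry_inv(2)[OF gi] by (simp add: h_def)
    then have "\<forall>y\<in>H4. g' y = (h \<circ> g) y" by simp
    then have hp: "orientation_preserving h"
      using orientation_comp_iff[OF hi gi] op orientation_H4_cong(1) by metis
    \<comment> \<open>The classes at which the coordinate change is \<open>h\<close>. By
      \<open>glue_germ_transition\<close> this does not depend on the representative, which makes
      the set open.\<close>
    define U where "U = {q. \<exists>y\<in>Q. q = proj y \<and>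
      (\<exists>f f'. chart_germ c y f \<and> chart_germ c' y f' \<and> (\<forall>z\<in>H4. f' z = h (f z)))}"
    have "openin NT U"
      unfolding openin_NT_iff
    proof (intro conjI ballI impI)
      show "U \<subseteq> Q // glue code" using glue_proj_in unfolding U_def by blast
      fix y assume y: "y \<in> Q" "proj y \<in> U"
      then obtain y1 f1 f1' where y1: "y1 \<in> Q" "proj y = proj y1" "chart_germ c y1 f1" "chart_germ c' y1 f1'"
        "\<forall>z\<in>H4. f1' z = h (f1 z)" unfolding U_def by blast
      obtain f where f: "chart_germ c y f"
        using chart_germ_exists[OF chart_germD(1)[OF g] y(1)] chart_germD(4)[OF y1(3)] y1(2) by auto
      obtain f' where f': "chart_germ c' y f'"
        using chart_germ_exists[OF chart_germD(1)[OF g'] y(1)] chart_germD(4)[OF y1(4)] y1(2) by auto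
      have "(y1, y) \<in> glue code" using glue_proj_eq[OF y1(1) y(1)] y1(2) by metis
      then have ff: "\<forall>z\<in>H4. f' z = h (f z)" by (rule glue_germ_transition[OF _ y1(3,4) f f' y1(5)])
      obtain V where V: "open V" "y \<in> V" "\<And>z. z \<in> V \<Longrightarrow> z \<in> Q \<Longrightarrow> chart_germ c z f"
        by (rule chart_germ_near[OF f]) blast
      obtain V' where V': "open V'" "y \<in> V'" "\<And>z. z \<in> V' \<Longrightarrow> z \<in> Q \<Longrightarrow> chart_germ c' z f'"
        by (rule chart_germ_near[OF f']) blast
      have "\<forall>z\<in>(V \<inter> V') \<inter> Q. proj z \<in> U" using V(3) V'(3) ff unfolding U_def by blast
      then show "\<exists>V. open V \<and> y \<in> V \<and> (\<forall>z\<in>V \<inter> Q. proj z \<in> U)" using V V' by (intro exI[of _ "V \<inter> V'"]) auto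
    qed
    moreover have "proj x \<in> U" using g g' hg xQ unfolding U_def by blast
    moreover have "U \<subseteq> fst c \<inter> fst c'" using chart_germD(4) unfolding U_def by blast
    moreover have "\<forall>q\<in>U. snd c' q = h (snd c q)"
      using chart_germD(5) Q_in_H4 unfolding U_def by (clarify, metis)
    ultimately show "co_oriented N (proj x) c c'"
      unfolding co_oriented_def htop_N using hi hp by blast
  qed
qed

text \<open>The orientation double cover consists of two copies of the cell, indexed by the sign with
  which the charts of the orientation pull back to the cell.\<close>

definition lift :: "bool \<Rightarrow> real^4 \<Rightarrow> (real^4) set \<times> (real^4) set hchart set" where
  "lift \<epsilon> x = (proj x, {c. \<exists>g. chart_germ c x g \<and> orientation_preserving g = \<epsilon>})"

lemma local_orientation_lift:
  assumes "chart_germ c x g"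
  shows "(proj x, local_orientation N c (proj x)) = lift (orientation_preserving g) x"
proof -
  have "c' \<in> local_orientation N c (proj x) \<longleftrightarrow>
    (\<exists>g'. chart_germ c' x g' \<and> orientation_preserving g' = orientation_preserving g)" for c'
  proof
    assume "c' \<in> local_orientation N c (proj x)"
    then have c': "c' \<in> hcharts N" "proj x \<in> fst c'" "co_oriented N (proj x) c c'"
      unfolding local_orientation_def by blast+
    obtain g' where "chart_germ c' x g'" using chart_germ_exists[OF c'(1) chart_germD(2)[OF assms] c'(2)] ..
    then show "\<exists>g'. chart_germ c' x g' \<and> orientation_preserving g' = orientation_preserving g"
      using co_oriented_iff[OF assms] c'(3) by blast
  next
    assume "\<exists>g'. chart_germ c' x g' \<and> orientation_preserving g' = orientation_preserving g"
    then show "c' \<in> local_orientation N c (proj x)"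
      unfolding local_orientation_def using co_oriented_iff[OF assms] chart_germD by blast
  qed
  then show ?thesis unfolding lift_def by blast
qed

lemma lift_inj:
  assumes "chart_germ c x g" "lift \<epsilon> x = lift \<epsilon>' x"
  shows "\<epsilon> = \<epsilon>'"
proof (rule ccontr)
  assume ne: "\<epsilon> \<noteq> \<epsilon>'"
  have mem: "c \<in> snd (lift b x) \<longleftrightarrow> b = orientation_preserving g" for b
    using assms(1) orientation_H4_cong(1)[OF chart_germ_unique[OF assms(1)]] unfolding lift_def snd_conv mem_Collect_eq by metis
  then show False using mem[of \<epsilon>] mem[of \<epsilon>'] ne unfolding assms(2) by argo
qed

lemma lift_in_sheet:
  assumes "chart_germ c x g"
  shows "lift \<epsilon> x \<in> sheet N c V \<longleftrightarrow> proj x \<in> V \<and> \<epsilon> = orientation_preserving g"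
proof
  assume "lift \<epsilon> x \<in> sheet N c V"
  then obtain p where p0: "p \<in> V" "lift \<epsilon> x = (p, local_orientation N c p)" unfolding sheet_def by blast
  moreover have "fst (lift \<epsilon> x) = proj x" by (simp only: lift_def fst_conv)
  ultimately have "p = proj x" by simp
  then have p: "proj x \<in> V" "lift \<epsilon> x = (proj x, local_orientation N c (proj x))" using p0 by simp_all
  then show "proj x \<in> V \<and> \<epsilon> = orientation_preserving g"
    using local_orientation_lift[OF assms] lift_inj[OF assms] by metis
next
  assume "proj x \<in> V \<and> \<epsilon> = orientation_preserving g"
  then show "lift \<epsilon> x \<in> sheet N c V"
    using local_orientation_lift[OF assms] unfolding sheet_def by (intro image_eqI[of _ _ "proj x"]) simp_all
qed

text \<open>The gluing isometry is an inversion followed by the label, and inversions reverse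
  orientation. Crossing a side thus keeps the copy of the cell if its label reverses orientation and
  changes the copy otherwise.\<close>

lemma orientation_lab_iff:
  assumes "ij \<in> index_pairs" "v \<in> centres ij" "Fn v 1 x = 0" "chart_germ c x g" "chart_germ c (lab ij x) g'"
  shows "orientation_preserving g' \<longleftrightarrow> (orientation_preserving (lab ij) \<longleftrightarrow> \<not> orientation_preserving g)"
proof -
  have "v \<in> all_centres" using assms(1,2) unfolding all_centres_def by blast
  then have v2: "1 < v \<bullet> v" using centre_inner[of v] by simp
  note k = kdiag_sign_maps[of "code_digit code ij"]
  have hk: "hyp_isometry (lab ij)" by (rule orthogonal_hyp_isometry[OF sign_maps_orthogonal[OF k]])
  have "\<forall>y\<in>H4. (g' \<circ> lab ij) y = (g \<circ> inversion v) y"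
    using chart_germ_side[OF assms] by simp
  then have "orientation_preserving (g' \<circ> lab ij) = orientation_preserving (g \<circ> inversion v)"
    by (rule orientation_H4_cong(1))
  moreover have "\<not> orientation_preserving (inversion v)"
    using inversion_reversing[OF v2] orientation_exclusive by blast
  ultimately show ?thesis
    using orientation_comp_iff[OF chart_germD(3)[OF assms(5)] hk]
      orientation_comp_iff[OF chart_germD(3)[OF assms(4)] inversion_hyp_isometry[OF v2]] by blast
qed

end

section \<open>Hypersurfaces in the double cover\<close>

locale closed_geodesic = cell_gluing +
  fixes M :: "((real^4) set \<times> (real^4) set hchart set) set"
  assumes geodesic: "closed_embedded_totally_geodesic (orientation_double_cover N) M"
begin

text \<open>Charts are injective, so the equality of images in the definition of a totally geodesic
  subset turns into a pointwise criterion for membership in \<open>M\<close> on a sheet.\<close>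

lemma M_chart:
  assumes "m \<in> M"
  obtains c V x g P where "openin NT V" "V \<subseteq> fst c" "chart_germ c x g" "proj x \<in> V"
    "m = lift (orientation_preserving g) x" "hyp_hyperplane P"
    "\<And>m'. m' \<in> sheet N c V \<Longrightarrow> m' \<in> M \<longleftrightarrow> snd c (fst m') \<in> P"
proof -
  obtain U \<phi> P where U: "(U, \<phi>) \<in> hcharts (orientation_double_cover N)" "m \<in> U" "hyp_hyperplane P"
    "\<phi> ` (M \<inter> U) = P \<inter> \<phi> ` U"
    using geodesic assms unfolding closed_embedded_totally_geodesic_def by blast
  obtain c V where c: "c \<in> hcharts N" "openin NT V" "V \<subseteq> fst c" "U = sheet N c V" "\<phi> = snd c \<circ> fst"
    using U(1) unfolding orientation_double_cover_def by auto
  obtain p where p: "p \<in> V" "m = (p, local_orientation N c p)"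
    using U(2) unfolding c(4) sheet_def by blast
  obtain x where x: "x \<in> Q" "p = proj x" using openin_NT_class[OF c(2) p(1)] by blast
  obtain g where g: "chart_germ c x g" using chart_germ_exists[OF c(1) x(1)] p(1) c(3) x(2) by blast
  have mg: "m = lift (orientation_preserving g) x"
    using local_orientation_lift[OF g] p(2) x(2) by simp
  have "m' \<in> M \<longleftrightarrow> snd c (fst m') \<in> P" if m': "m' \<in> sheet N c V" for m'
  proof
    assume "m' \<in> M"
    then have "\<phi> m' \<in> P \<inter> \<phi> ` U" using m' U(4) unfolding c(4) by blast
    then show "snd c (fst m') \<in> P" unfolding c(5) by simp
  next
    assume "snd c (fst m') \<in> P"
    then have "\<phi> m' \<in> P \<inter> \<phi> ` U" using m' unfolding c(4,5) by auto
    then have "\<phi> m' \<in> \<phi> ` (M \<inter> U)" unfolding U(4) .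
    then obtain m'' where m'': "m'' \<in> M" "m'' \<in> U" "\<phi> m' = \<phi> m''" by blast
    have "fst m' \<in> V" "fst m'' \<in> V" using m' m''(2) unfolding c(4) sheet_def by auto
    then have "fst m' = fst m''"
      using inj_onD[OF chartD(2)[OF c(1)], of "fst m'" "fst m''"] m''(3) c(3) unfolding c(5) by auto
    then have "m' = m''" using m' m''(2) unfolding c(4) sheet_def by auto
    then show "m' \<in> M" using m''(1) by simp
  qed
  then show ?thesis using that c(2,3) g p(1) x(2) mg U(3) by metis
qed

text \<open>Compactness of \<open>M\<close> enters only here. It is applied with \<open>R\<close>
  saying that a sheet keeps away from a given point of the cell, or that a function on it stays
  below some value taken on \<open>M\<close>.\<close>

lemma M_finite_cover:
  assumes "\<And>m. m \<in> M \<Longrightarrow> \<exists>c V. c \<in> hcharts N \<and> openin NT V \<and> V \<subseteq> fst c \<and> m \<in> sheet N c V \<and> R (sheet N c V)"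
  shows "\<exists>F. finite F \<and> M \<subseteq> \<Union>F \<and> (\<forall>S\<in>F. R S)"
proof -
  let ?B = "{sheet N c V | c V. c \<in> hcharts N \<and> openin NT V \<and> V \<subseteq> fst c}"
  let ?W = "htop (orientation_double_cover N)"
  have W: "?W = topology_generated_by ?B"
    unfolding orientation_double_cover_def by simp
  have c: "compactin ?W M"
    using geodesic unfolding closed_embedded_totally_geodesic_def by blast
  let ?C = "{S \<in> ?B. R S}"
  have "openin ?W S" if "S \<in> ?C" for S
    unfolding W using that by (intro topology_generated_by_Basis) blast
  moreover have "M \<subseteq> \<Union>?C"
  proof
    fix m assume "m \<in> M"
    then obtain c V where "c \<in> hcharts N" "openin NT V" "V \<subseteq> fst c" "m \<in> sheet N c V" "R (sheet N c V)"
      using assms by blast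
    then show "m \<in> \<Union>?C" by blast
  qed
  ultimately obtain F where "finite F" "F \<subseteq> ?C" "M \<subseteq> \<Union>F"
    using c unfolding compactin_def by meson
  then show ?thesis by blast
qed

text \<open>Compact subsets of a Hausdorff space are closed; the separation is done by hand. A point
  of \<open>M\<close> over the class of \<open>z\<close> carries the opposite orientation, so its
  sheet avoids the copy \<epsilon> near \<open>z\<close>; all other points of \<open>M\<close> are
  separated from \<open>z\<close> after projection.\<close>

lemma lift_closed:
  assumes z: "z \<in> Q" and near: "\<And>V. open V \<Longrightarrow> z \<in> V \<Longrightarrow> \<exists>z'\<in>V. z' \<in> Q \<and> lift \<epsilon> z' \<in> M"
  shows "lift \<epsilon> z \<in> M"
proof (rule ccontr)
  assume n: "lift \<epsilon> z \<notin> M"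
  define R where "R S \<longleftrightarrow> (\<exists>V. open V \<and> z \<in> V \<and> (\<forall>z'\<in>V. z' \<in> Q \<longrightarrow> lift \<epsilon> z' \<notin> S))" for S
  have cov: "\<exists>c V. c \<in> hcharts N \<and> openin NT V \<and> V \<subseteq> fst c \<and> m \<in> sheet N c V \<and> R (sheet N c V)" if m: "m \<in> M" for m
  proof -
    obtain c V x g where c: "openin NT V" "V \<subseteq> fst c" "chart_germ c x g" "proj x \<in> V"
      "m = lift (orientation_preserving g) x" by (rule M_chart[OF m]) blast
    note cN = chart_germD(1)[OF c(3)] and xQ = chart_germD(2)[OF c(3)]
    show ?thesis
    proof (cases "proj x = proj z")
      case True
      then obtain h where h: "chart_germ c z h"
        using chart_germ_exists[OF cN z] c(2,4) by auto
      have "m = (proj x, local_orientation N c (proj x))"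
        using local_orientation_lift[OF c(3)] c(5) by simp
      then have "m = lift (orientation_preserving h) z"
        using local_orientation_lift[OF h] True by simp
      then have ne: "\<epsilon> \<noteq> orientation_preserving h" using m n by blast
      obtain W where W: "open W" "z \<in> W" "\<And>y. y \<in> W \<Longrightarrow> y \<in> Q \<Longrightarrow> chart_germ c y h"
        by (rule chart_germ_near[OF h]) blast
      have "lift \<epsilon> z' \<notin> sheet N c V" if "z' \<in> W" "z' \<in> Q" for z'
        using lift_in_sheet[OF W(3)[OF that]] ne by blast
      then have "R (sheet N c V)" unfolding R_def using W(1,2) by blast
      moreover have "m \<in> sheet N c V" using lift_in_sheet[OF c(3)] c(4,5) by blast
      ultimately show ?thesis using cN c(1,2) by blast
    next
      case False
      obtain U W where U: "openin NT U" "proj x \<in> U" "open W" "z \<in> W"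
        "\<And>y. y \<in> W \<Longrightarrow> y \<in> Q \<Longrightarrow> proj y \<notin> U"
        by (rule glue_proj_hausdorff[OF xQ z False]) blast
      have o: "openin NT (U \<inter> V)" using U(1) c(1) by blast
      have "lift \<epsilon> z' \<notin> sheet N c (U \<inter> V)" if "z' \<in> W" "z' \<in> Q" for z'
        using U(5)[OF that] unfolding lift_def sheet_def by auto
      then have "R (sheet N c (U \<inter> V))" unfolding R_def using U(3,4) by blast
      moreover have "m \<in> sheet N c (U \<inter> V)" using lift_in_sheet[OF c(3)] c(4,5) U(2) by blast
      ultimately show ?thesis using cN c(2) o by blast
    qed
  qed
  obtain F where F: "finite F" "M \<subseteq> \<Union>F" "\<And>S. S \<in> F \<Longrightarrow> R S"
    using M_finite_cover[of R, OF cov] by metis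
  have "\<exists>V. open V \<and> z \<in> V \<and> (\<forall>z'\<in>V. z' \<in> Q \<longrightarrow> lift \<epsilon> z' \<notin> S)" if "S \<in> F" for S
    using F(3)[OF that] unfolding R_def .
  then obtain W where W: "\<And>S. S \<in> F \<Longrightarrow> open (W S) \<and> z \<in> W S \<and> (\<forall>z'\<in>W S. z' \<in> Q \<longrightarrow> lift \<epsilon> z' \<notin> S)"
    by metis
  have "open (\<Inter>S\<in>F. W S)" "z \<in> (\<Inter>S\<in>F. W S)" using W F(1) by auto
  then obtain z' where z': "z' \<in> (\<Inter>S\<in>F. W S)" "z' \<in> Q" "lift \<epsilon> z' \<in> M" using near by blast
  then obtain S where "S \<in> F" "lift \<epsilon> z' \<in> S" using F(2) by blast
  then show False using W z' by blast
qed

text \<open>Invariance makes \<open>H\<close> a function on the quotient. Without a maximum, every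
  point of \<open>M\<close> has a sheet on which \<open>H\<close> stays below some value taken on
  \<open>M\<close>; finitely many sheets suffice, and the point with the largest of these values
  lies in none of them.\<close>

lemma invariant_attains_max:
  fixes H :: "real^4 \<Rightarrow> real"
  assumes cont: "continuous_on Q H" and inv: "\<And>k x. k \<in> sign_maps \<Longrightarrow> x \<in> Q \<Longrightarrow> H (k x) = H x"
  obtains \<epsilon> z where "z \<in> Q" "lift \<epsilon> z \<in> M" "\<And>\<epsilon>' z'. z' \<in> Q \<Longrightarrow> lift \<epsilon>' z' \<in> M \<Longrightarrow> H z' \<le> H z"
proof (rule ccontr)
  assume no: "\<not> thesis"
  note goal = that
  have Hp: "H x = H y" if "x \<in> Q" "y \<in> Q" "proj x = proj y" for x y
  proof -
    have "(x, y) \<in> glue code" using glue_proj_eq[OF that(1,2)] that(3) by blast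
    then obtain k where "k \<in> sign_maps" "y = k x" using glue_transport by metis
    then show ?thesis using inv that(1) by metis
  qed
  define R where "R S \<longleftrightarrow> (\<exists>\<epsilon>' z'. z' \<in> Q \<and> lift \<epsilon>' z' \<in> M \<and>
      (\<forall>\<epsilon>'' z''. z'' \<in> Q \<longrightarrow> lift \<epsilon>'' z'' \<in> S \<longrightarrow> H z'' < H z'))" for S
  have cov: "\<exists>c V. c \<in> hcharts N \<and> openin NT V \<and> V \<subseteq> fst c \<and> m \<in> sheet N c V \<and> R (sheet N c V)" if m: "m \<in> M" for m
  proof -
    obtain c V x g where c: "openin NT V" "V \<subseteq> fst c" "chart_germ c x g" "proj x \<in> V"
      "m = lift (orientation_preserving g) x" by (rule M_chart[OF m]) blast
    note cN = chart_germD(1)[OF c(3)] and xQ = chart_germD(2)[OF c(3)]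
    have "\<exists>\<epsilon>' z'. z' \<in> Q \<and> lift \<epsilon>' z' \<in> M \<and> H x < H z'"
    proof (rule ccontr)
      assume "\<not> ?thesis"
      then have le: "H z' \<le> H x" if "z' \<in> Q" "lift \<epsilon>' z' \<in> M" for \<epsilon>' z' using that by (meson not_less)
      have thesis by (rule goal[OF xQ m[unfolded c(5)] le])
      then show False using no by blast
    qed
    then obtain \<epsilon>' z' where z': "z' \<in> Q" "lift \<epsilon>' z' \<in> M" "H x < H z'" by blast
    define U where "U = {q \<in> V. \<forall>y\<in>Q. q = proj y \<longrightarrow> H y < H z'}"
    have pU: "proj y \<in> U \<longleftrightarrow> proj y \<in> V \<and> H y < H z'" if "y \<in> Q" for y
      using Hp that unfolding U_def by (smt (verit) mem_Collect_eq)
    have "openin NT U"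
      unfolding openin_NT_iff
    proof (intro conjI ballI impI)
      show "U \<subseteq> Q // glue code" using c(1) unfolding openin_NT_iff U_def by blast
      fix y assume y: "y \<in> Q" "proj y \<in> U"
      then have yV: "proj y \<in> V" "H y < H z'" using pU by blast+
      obtain V1 where V1: "open V1" "y \<in> V1" "\<And>u. u \<in> V1 \<Longrightarrow> u \<in> Q \<Longrightarrow> proj u \<in> V"
        by (rule openin_NT_near[OF c(1) y(1) yV(1)]) blast
      have "openin (top_of_set Q) (Q \<inter> H -` {..<H z'})"
        by (rule continuous_openin_preimage_gen[OF cont open_lessThan])
      then obtain V2 where V2: "open V2" "Q \<inter> H -` {..<H z'} = Q \<inter> V2"
        unfolding openin_open by blast
      have yV2: "y \<in> V2" using V2(2) y(1) yV(2) by blast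
      have "proj u \<in> U" if "u \<in> (V1 \<inter> V2) \<inter> Q" for u
      proof -
        have "H u < H z'" using that V2(2) by blast
        then show ?thesis using pU[of u] V1(3) that by blast
      qed
      then show "\<exists>V. open V \<and> y \<in> V \<and> (\<forall>z\<in>V \<inter> Q. proj z \<in> U)"
        using V1 V2(1) yV2 by (intro exI[of _ "V1 \<inter> V2"]) auto
    qed
    moreover have "U \<subseteq> fst c" using c(2) unfolding U_def by blast
    moreover have "m \<in> sheet N c U" using lift_in_sheet[OF c(3)] c(5) pU[OF xQ] z'(3) c(4) by blast
    moreover have "H z'' < H z'" if z'': "z'' \<in> Q" "lift \<epsilon>'' z'' \<in> sheet N c U" for \<epsilon>'' z''
    proof -
      have "proj z'' \<in> U" using z''(2) unfolding lift_def sheet_def by auto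
      then show ?thesis using pU[OF z''(1)] by blast
    qed
    then have "R (sheet N c U)" unfolding R_def using z' by blast
    ultimately show ?thesis using cN by blast
  qed
  obtain F where F: "finite F" "M \<subseteq> \<Union>F" "\<And>S. S \<in> F \<Longrightarrow> R S"
    using M_finite_cover[of R, OF cov] by metis
  have "\<exists>z' \<epsilon>'. z' \<in> Q \<and> lift \<epsilon>' z' \<in> M \<and>
      (\<forall>\<epsilon>'' z''. z'' \<in> Q \<longrightarrow> lift \<epsilon>'' z'' \<in> S \<longrightarrow> H z'' < H z')" if "S \<in> F" for S
    using F(3)[OF that] unfolding R_def by blast
  then obtain w where w: "\<And>S. S \<in> F \<Longrightarrow> w S \<in> Q \<and> (\<exists>\<epsilon>'. lift \<epsilon>' (w S) \<in> M) \<and>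
      (\<forall>\<epsilon>'' z''. z'' \<in> Q \<longrightarrow> lift \<epsilon>'' z'' \<in> S \<longrightarrow> H z'' < H (w S))"
    by metis
  have "M \<noteq> {}" using geodesic unfolding closed_embedded_totally_geodesic_def by blast
  then have "F \<noteq> {}" using F(2) by blast
  let ?h = "\<lambda>S. H (w S)"
  have "Max (?h ` F) \<in> ?h ` F" using F(1) \<open>F \<noteq> {}\<close> by (intro Max_in) auto
  then obtain S where S0: "S \<in> F" "Max (?h ` F) = ?h S" by blast
  have "H (w S') \<le> H (w S)" if "S' \<in> F" for S'
    using Max_ge[OF finite_imageI[OF F(1)] imageI[OF that], of ?h] unfolding S0(2) .
  note S = S0(1) this
  obtain \<epsilon>' where e: "lift \<epsilon>' (w S) \<in> M" using w[OF S(1)] by blast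
  then obtain S' where S': "S' \<in> F" "lift \<epsilon>' (w S) \<in> S'" using F(2) by blast
  then have "H (w S) < H (w S')" using w[OF S'(1)] w[OF S(1)] by blast
  then show False using S(2)[OF S'(1)] by simp
qed

text \<open>The condition concerns a whole sheet and not only the cell near \<open>z\<close>: at a
  boundary point it also controls \<open>M\<close> in the neighbouring cells, so the plane can be
  continued across a side. The point \<open>z\<close> itself may lie off the plane.\<close>

definition plane_germ :: "bool \<Rightarrow> real^4 \<Rightarrow> real \<Rightarrow> real^4 \<Rightarrow> bool" where
  "plane_germ \<epsilon> a b z \<longleftrightarrow> unitfn a b \<and> (\<exists>c V g. openin NT V \<and> V \<subseteq> fst c \<and> proj z \<in> V \<and>
     chart_germ c z g \<and> orientation_preserving g = \<epsilon> \<and>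
     (\<forall>m\<in>sheet N c V. m \<in> M \<longleftrightarrow> (\<exists>y\<in>H4. Fn a b y = 0 \<and> snd c (fst m) = g y)))"

lemma plane_germ_neg: "plane_germ \<epsilon> a b z \<Longrightarrow> plane_germ \<epsilon> (- a) (- b) z"
  unfolding plane_germ_def Fn_neg unitfn_neg by simp

lemma plane_germ_Q: "plane_germ \<epsilon> a b z \<Longrightarrow> z \<in> Q"
  unfolding plane_germ_def using chart_germD(2) by blast

lemma plane_germ_near:
  assumes "plane_germ \<epsilon> a b z"
  obtains V where "open V" "z \<in> V" "\<And>y. y \<in> V \<Longrightarrow> y \<in> Q \<Longrightarrow> lift \<epsilon> y \<in> M \<longleftrightarrow> Fn a b y = 0"
proof -
  obtain c V g where c: "openin NT V" "V \<subseteq> fst c" "proj z \<in> V" "chart_germ c z g" "orientation_preserving g = \<epsilon>"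
     "\<And>m. m \<in> sheet N c V \<Longrightarrow> m \<in> M \<longleftrightarrow> (\<exists>y\<in>H4. Fn a b y = 0 \<and> snd c (fst m) = g y)"
    using assms unfolding plane_germ_def by blast
  obtain V1 where V1: "open V1" "z \<in> V1" "\<And>u. u \<in> V1 \<Longrightarrow> u \<in> Q \<Longrightarrow> proj u \<in> V"
    by (rule openin_NT_near[OF c(1) chart_germD(2)[OF c(4)] c(3)]) blast
  obtain V2 where V2: "open V2" "z \<in> V2" "\<And>u. u \<in> V2 \<Longrightarrow> u \<in> Q \<Longrightarrow> chart_germ c u g"
    by (rule chart_germ_near[OF c(4)]) blast
  have "lift \<epsilon> y \<in> M \<longleftrightarrow> Fn a b y = 0" if y: "y \<in> V1 \<inter> V2" "y \<in> Q" for y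
  proof -
    have g: "chart_germ c y g" using V2(3) y by blast
    have "lift \<epsilon> y \<in> sheet N c V" using lift_in_sheet[OF g] V1(3) y c(5) by blast
    then have "lift \<epsilon> y \<in> M \<longleftrightarrow> (\<exists>u\<in>H4. Fn a b u = 0 \<and> snd c (fst (lift \<epsilon> y)) = g u)"
      by (rule c(6))
    also have "snd c (fst (lift \<epsilon> y)) = g y" using chart_germD(5)[OF g] by (simp add: lift_def)
    also have "(\<exists>u\<in>H4. Fn a b u = 0 \<and> g y = g u) \<longleftrightarrow> Fn a b y = 0"
      using inj_onD[OF hyp_isometry_inj[OF chart_germD(3)[OF g]]] Q_in_H4[OF y(2)] by metis
    finally show ?thesis .
  qed
  moreover have "open (V1 \<inter> V2)" "z \<in> V1 \<inter> V2" using V1 V2 by auto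
  ultimately show ?thesis using that by blast
qed

lemma plane_germ_exists:
  assumes z: "z \<in> Q" "lift \<epsilon> z \<in> M"
  obtains a b where "plane_germ \<epsilon> a b z" "Fn a b z = 0"
proof -
  obtain c V x g0 P where c: "openin NT V" "V \<subseteq> fst c" "chart_germ c x g0" "proj x \<in> V"
    "lift \<epsilon> z = lift (orientation_preserving g0) x" "hyp_hyperplane P"
    "\<And>m'. m' \<in> sheet N c V \<Longrightarrow> m' \<in> M \<longleftrightarrow> snd c (fst m') \<in> P" by (rule M_chart[OF z(2)]) blast
  have p: "proj z = proj x" using c(5) by (simp add: lift_def)
  obtain g where g: "chart_germ c z g"
    using chart_germ_exists[OF chart_germD(1)[OF c(3)] z(1)] p c(2,4) by auto
  have zS: "lift \<epsilon> z \<in> sheet N c V" using lift_in_sheet[OF c(3)] c(4,5) by simp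
  then have e: "orientation_preserving g = \<epsilon>" using lift_in_sheet[OF g] by blast
  obtain a b where ab: "unitfn a b" "\<And>y. y \<in> H4 \<Longrightarrow> g y \<in> P \<longleftrightarrow> Fn a b y = 0"
    by (rule hyperplane_pullback[OF chart_germD(3)[OF g] c(6)]) blast
  have mem: "m \<in> M \<longleftrightarrow> (\<exists>y\<in>H4. Fn a b y = 0 \<and> snd c (fst m) = g y)" if m: "m \<in> sheet N c V" for m
  proof -
    have "P \<subseteq> H4" using c(6) unfolding hyp_hyperplane_def by blast
    have "\<exists>y\<in>H4. Fn a b y = 0 \<and> snd c (fst m) = g y" if "snd c (fst m) \<in> P"
    proof -
      have "snd c (fst m) \<in> H4" using \<open>P \<subseteq> H4\<close> that by (rule subsetD)
      then obtain y where y: "y \<in> H4" "g y = snd c (fst m)"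
        using hyp_isometry_surj[OF chart_germD(3)[OF g]] by metis
      then have "Fn a b y = 0" using ab(2)[OF y(1)] that by simp
      then show ?thesis using y by (intro bexI[of _ y]) simp_all
    qed
    moreover have "snd c (fst m) \<in> P" if ex: "\<exists>y\<in>H4. Fn a b y = 0 \<and> snd c (fst m) = g y"
    proof -
      obtain y where y: "y \<in> H4" "Fn a b y = 0" "snd c (fst m) = g y" using ex by blast
      show ?thesis using ab(2)[OF y(1)] y(2,3) by simp
    qed
    ultimately show ?thesis unfolding c(7)[OF m] by argo
  qed
  have "proj z \<in> V" using p c(4) by simp
  then have "openin NT V \<and> V \<subseteq> fst c \<and> proj z \<in> V \<and> chart_germ c z g \<and> orientation_preserving g = \<epsilon> \<and>
     (\<forall>m\<in>sheet N c V. m \<in> M \<longleftrightarrow> (\<exists>y\<in>H4. Fn a b y = 0 \<and> snd c (fst m) = g y))"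
    using c(1,2) g e mem by (intro conjI ballI) blast+
  then have germ: "plane_germ \<epsilon> a b z"
    unfolding plane_germ_def using ab(1) by (intro conjI exI[of _ c] exI[of _ V] exI[of _ g]) blast+
  obtain V' where "open V'" "z \<in> V'" "\<And>y. y \<in> V' \<Longrightarrow> y \<in> Q \<Longrightarrow> lift \<epsilon> y \<in> M \<longleftrightarrow> Fn a b y = 0"
    by (rule plane_germ_near[OF germ]) blast
  then have "Fn a b z = 0" using z by blast
  then show ?thesis using that germ by blast
qed

text \<open>One chart reads the same piece of \<open>M\<close> through its germs at \<open>z\<close>
  and at \<open>lab ij z\<close>. These differ by the inversion and the label, so the plane at the
  second point is the reflected plane moved by the label.\<close>

lemma plane_germ_side:
  assumes germ: "plane_germ \<epsilon> a b z" and ij: "ij \<in> index_pairs" and v: "v \<in> centres ij" and zv: "Fn v 1 z = 0"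
  shows "plane_germ (orientation_preserving (lab ij) \<longleftrightarrow> \<not> \<epsilon>)
    (lab ij (a - (2 * (a \<bullet> v - b)) *\<^sub>R v)) (b - 2 * (a \<bullet> v - b)) (lab ij z)"
proof -
  let ?k = "lab ij"
  note k = kdiag_sign_maps[of "code_digit code ij"]
  define a' where "a' = a - (2 * (a \<bullet> v - b)) *\<^sub>R v"
  define b' where "b' = b - 2 * (a \<bullet> v - b)"
  have va: "v \<in> all_centres" using ij v unfolding all_centres_def by blast
  note v2 = centre_inner[OF va]
  obtain c V g where c: "openin NT V" "V \<subseteq> fst c" "proj z \<in> V" "chart_germ c z g" "orientation_preserving g = \<epsilon>"
     "\<And>m. m \<in> sheet N c V \<Longrightarrow> m \<in> M \<longleftrightarrow> (\<exists>y\<in>H4. Fn a b y = 0 \<and> snd c (fst m) = g y)"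
    and u: "unitfn a b"
    using germ unfolding plane_germ_def by blast
  note zQ = chart_germD(2)[OF c(4)]
  have kz: "?k z \<in> Q" "proj (?k z) = proj z"
    using sign_maps_Q[OF k zQ] glue_side[OF ij v zQ zv] by blast+
  obtain g' where g': "chart_germ c (?k z) g'"
    using chart_germ_exists[OF chart_germD(1)[OF c(4)] kz(1)] kz(2) c(2,3) by auto
  note side = chart_germ_side[OF ij v zv c(4) g']
  have v2': "1 < v \<bullet> v" using v2 by simp
  note iH = hyp_isometry_hratio(2)[OF inversion_hyp_isometry[OF v2']]
  have ii: "inversion v (inversion v y) = y" if "y \<in> H4" for y
    using inversion_inversion[OF _ v2'] H4_centre_ne[OF that v2'] by simp
  have Fi: "Fn a b (inversion v y) = 0 \<longleftrightarrow> Fn a' b' y = 0" if "y \<in> H4" for y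
    using Fn_inversion[OF v2, of y a b] H4_centre_ne[OF that v2'] by (simp add: a'_def b'_def)
  have eq: "(\<exists>y\<in>H4. Fn a b y = 0 \<and> q = g y) \<longleftrightarrow> (\<exists>y\<in>H4. Fn (?k a') b' y = 0 \<and> q = g' y)" for q
  proof
    assume "\<exists>y\<in>H4. Fn a b y = 0 \<and> q = g y"
    then obtain y where y: "y \<in> H4" "Fn a b y = 0" "q = g y" by blast
    define w where "w = inversion v y"
    have w: "w \<in> H4" "inversion v w = y" unfolding w_def using iH[OF y(1,1)] ii[OF y(1)] by blast+
    have "Fn (?k a') b' (?k w) = 0" unfolding sign_maps_Fn[OF k] using Fi[OF w(1)] w(2) y(2) by simp
    moreover have "q = g' (?k w)" using side w y(3) by simp
    moreover have "?k w \<in> H4" using sign_maps_H4[OF k] w(1) by blast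
    ultimately show "\<exists>y\<in>H4. Fn (?k a') b' y = 0 \<and> q = g' y" by blast
  next
    assume "\<exists>y\<in>H4. Fn (?k a') b' y = 0 \<and> q = g' y"
    then obtain y where y: "y \<in> H4" "Fn (?k a') b' y = 0" "q = g' y" by blast
    define w where "w = ?k y"
    have w: "w \<in> H4" "?k w = y" unfolding w_def using sign_maps_H4[OF k] y(1) sign_maps_invol[OF k] by blast+
    have "Fn a' b' w = 0" using y(2) unfolding sign_maps_Fn2[OF k] w_def .
    then have "Fn a b (inversion v w) = 0" using Fi[OF w(1)] by blast
    moreover have "q = g (inversion v w)" using side w y(3) by metis
    ultimately show "\<exists>y\<in>H4. Fn a b y = 0 \<and> q = g y" using iH[OF w(1,1)] by blast
  qed
  have "unitfn (?k a') b'"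
    using unitfn_reflect[OF v2 u] unfolding a'_def[symmetric] b'_def[symmetric] unitfn_def sign_maps_inner[OF k] .
  moreover have "orientation_preserving g' = (orientation_preserving ?k \<longleftrightarrow> \<not> \<epsilon>)"
    using orientation_lab_iff[OF ij v zv c(4) g'] c(5) by blast
  ultimately show ?thesis
    unfolding plane_germ_def a'_def[symmetric] b'_def[symmetric]
    using c(1,2,3,6) kz(2) g' unfolding eq by metis
qed

text \<open>The hyperplanes that occur in \<open>M\<close> within the copy \<open>\<epsilon>\<close> of the cell.\<close>

definition in_M :: "bool \<Rightarrow> real^4 \<Rightarrow> real \<Rightarrow> bool" where
  "in_M \<epsilon> a b \<longleftrightarrow> unitfn a b \<and> (\<exists>x\<in>interior_Q. Fn a b x = 0) \<and>
     (\<forall>x\<in>interior_Q. Fn a b x = 0 \<longrightarrow> lift \<epsilon> x \<in> M)"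

text \<open>The point \<open>y\<close> provides interior points of the plane \<open>(a', b')\<close>
  arbitrarily close to \<open>z\<close>. There \<open>M\<close> is also described by
  \<open>(a, b)\<close>, and uniqueness of hyperplane germs identifies the two planes up to
  sign.\<close>

lemma plane_germ_determined:
  assumes germ: "plane_germ \<epsilon> a b z" and ab: "unitfn a' b'" and y: "y \<in> interior_Q" "Fn a' b' y = 0" "Fn a' b' z = 0"
    and V: "open V" "z \<in> V" and sub: "\<And>x. x \<in> V \<Longrightarrow> x \<in> interior_Q \<Longrightarrow> Fn a' b' x = 0 \<Longrightarrow> lift \<epsilon> x \<in> M"
  shows "plane_germ \<epsilon> a' b' z"
proof -
  obtain V' where V': "open V'" "z \<in> V'" "\<And>y. y \<in> V' \<Longrightarrow> y \<in> Q \<Longrightarrow> lift \<epsilon> y \<in> M \<longleftrightarrow> Fn a b y = 0"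
    by (rule plane_germ_near[OF germ]) blast
  have VV: "open (V \<inter> V')" "z \<in> V \<inter> V'" using V V' by auto
  obtain x where x: "x \<in> V \<inter> V'" "x \<in> interior_Q" "Fn a' b' x = 0"
    using interior_Q_near[OF plane_germ_Q[OF germ] y(1) VV] y(2,3) by metis
  have "a = a' \<and> b = b' \<or> a = - a' \<and> b = - b'"
  proof (rule hyperplane_germ_unique[OF ab, of _ _ "V \<inter> V' \<inter> interior_Q" x])
    show "unitfn a b" using germ unfolding plane_germ_def by blast
    show "open (V \<inter> V' \<inter> interior_Q)" using VV open_interior_Q by blast
    show "x \<in> H4" by (rule interior_Q_H4[OF x(2)])
    fix u assume "u \<in> V \<inter> V' \<inter> interior_Q" "Fn a' b' u = 0"
    then show "Fn a b u = 0" using sub V'(3) interior_Q_subset by blast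
  qed (use x in auto)
  then have "a' = a \<and> b' = b \<or> a' = - a \<and> b' = - b" by auto
  then show ?thesis using germ plane_germ_neg by metis
qed

lemma in_M_germ:
  assumes "in_M \<epsilon> a b" "z \<in> Q" "Fn a b z = 0"
  shows "plane_germ \<epsilon> a b z"
proof -
  obtain y where y: "y \<in> interior_Q" "Fn a b y = 0" using assms(1) unfolding in_M_def by blast
  have "lift \<epsilon> z \<in> M"
  proof (rule lift_closed[OF assms(2)])
    fix V assume "open V" "z \<in> V"
    then obtain x where "x \<in> V" "x \<in> interior_Q" "Fn a b x = 0"
      using interior_Q_near[OF assms(2) y(1)] y(2) assms(3) by metis
    then show "\<exists>z'\<in>V. z' \<in> Q \<and> lift \<epsilon> z' \<in> M"
      using assms(1) interior_Q_subset unfolding in_M_def by blast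
  qed
  then obtain a' b' where germ: "plane_germ \<epsilon> a' b' z" using plane_germ_exists[OF assms(2)] by metis
  show ?thesis
    by (rule plane_germ_determined[OF germ _ y assms(3) open_UNIV UNIV_I]) (use assms(1) in \<open>auto simp: in_M_def\<close>)
qed

text \<open>Continuation along a connected set: the points near which the plane lies in
  \<open>M\<close> form an open and closed part of its slice through the interior.\<close>

lemma germ_in_M:
  assumes germ: "plane_germ \<epsilon> a b z" and z: "Fn a b z = 0" and y: "y \<in> interior_Q" "Fn a b y = 0"
  shows "in_M \<epsilon> a b"
proof -
  have u: "unitfn a b" using germ unfolding plane_germ_def by blast
  let ?P = "{x \<in> interior_Q. Fn a b x = 0}"
  define Y where "Y = {x \<in> ?P. \<exists>V. open V \<and> x \<in> V \<and> (\<forall>x'\<in>V. x' \<in> ?P \<longrightarrow> lift \<epsilon> x' \<in> M)}"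
  obtain V where V: "open V" "z \<in> V" "\<And>y. y \<in> V \<Longrightarrow> y \<in> Q \<Longrightarrow> lift \<epsilon> y \<in> M \<longleftrightarrow> Fn a b y = 0"
    by (rule plane_germ_near[OF germ]) blast
  obtain x0 where x0: "x0 \<in> V" "x0 \<in> interior_Q" "Fn a b x0 = 0"
    using interior_Q_near[OF plane_germ_Q[OF germ] y(1) V(1,2)] y(2) z by metis
  have "x0 \<in> Y" unfolding Y_def using x0 V interior_Q_subset by blast
  then have ne: "Y \<noteq> {}" by blast
  have "openin (top_of_set ?P) Y"
  proof -
    have "Y = ?P \<inter> \<Union>{V. open V \<and> (\<forall>x'\<in>V. x' \<in> ?P \<longrightarrow> lift \<epsilon> x' \<in> M)}"
      unfolding Y_def by blast
    moreover have "open (\<Union>{V. open V \<and> (\<forall>x'\<in>V. x' \<in> ?P \<longrightarrow> lift \<epsilon> x' \<in> M)})" by blast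
    ultimately show ?thesis unfolding openin_open by blast
  qed
  moreover have "closedin (top_of_set ?P) Y"
  proof -
    \<comment> \<open>A limit \<open>x\<close> of \<open>Y\<close> belongs to \<open>M\<close>
      because \<open>M\<close> is closed. The plane of \<open>M\<close> at \<open>x\<close> has the
      germ of the given plane at a nearby point of \<open>Y\<close>, so the two coincide.\<close>
    have inY: "x \<in> Y" if x: "x \<in> ?P" and cl: "\<And>V. open V \<Longrightarrow> x \<in> V \<Longrightarrow> \<exists>x'\<in>V. x' \<in> Y" for x
    proof -
      have xI: "x \<in> interior_Q" and xQ: "x \<in> Q" using x interior_Q_subset by blast+
      have YM: "lift \<epsilon> x' \<in> M" "x' \<in> Q" if "x' \<in> Y" for x'
        using that interior_Q_subset unfolding Y_def by blast+
      have "lift \<epsilon> x \<in> M"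
      proof (rule lift_closed[OF xQ])
        fix V assume "open V" "x \<in> V"
        then obtain x' where "x' \<in> V" "x' \<in> Y" using cl by blast
        then show "\<exists>z'\<in>V. z' \<in> Q \<and> lift \<epsilon> z' \<in> M" using YM by blast
      qed
      then obtain a' b' where g': "plane_germ \<epsilon> a' b' x" using plane_germ_exists[OF xQ] by metis
      obtain V' where V': "open V'" "x \<in> V'" "\<And>y. y \<in> V' \<Longrightarrow> y \<in> Q \<Longrightarrow> lift \<epsilon> y \<in> M \<longleftrightarrow> Fn a' b' y = 0"
        by (rule plane_germ_near[OF g']) blast
      obtain x' where x': "x' \<in> V'" "x' \<in> Y" using cl V'(1,2) by blast
      obtain V2 where V2: "open V2" "x' \<in> V2" "\<forall>w\<in>V2. w \<in> ?P \<longrightarrow> lift \<epsilon> w \<in> M"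
        using x'(2) unfolding Y_def by blast
      have x'P: "x' \<in> interior_Q" "Fn a b x' = 0" using x'(2) unfolding Y_def by blast+
      have "a' = a \<and> b' = b \<or> a' = - a \<and> b' = - b"
      proof (rule hyperplane_germ_unique[OF u, of _ _ "V' \<inter> V2 \<inter> interior_Q" x'])
        show "unitfn a' b'" using g' unfolding plane_germ_def by blast
        show "open (V' \<inter> V2 \<inter> interior_Q)" using V'(1) V2(1) open_interior_Q by blast
        show "x' \<in> H4" by (rule interior_Q_H4[OF x'P(1)])
        fix w assume w: "w \<in> V' \<inter> V2 \<inter> interior_Q" "Fn a b w = 0"
        then have "lift \<epsilon> w \<in> M" using V2(3) by blast
        then show "Fn a' b' w = 0" using V'(3) w interior_Q_subset by blast
      qed (use x' V2 x'P in auto)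
      then have eq: "Fn a' b' w = 0 \<longleftrightarrow> Fn a b w = 0" for w using Fn_neg[of a b w] by auto
      have "\<forall>w\<in>V'. w \<in> ?P \<longrightarrow> lift \<epsilon> w \<in> M" using V'(3) eq interior_Q_subset by blast
      then show ?thesis unfolding Y_def using x V'(1,2) by blast
    qed
    have "\<exists>V. open V \<and> x \<in> V \<and> (\<forall>x'\<in>V. x' \<notin> Y)" if x: "x \<in> ?P - Y" for x
    proof (rule ccontr)
      assume n: "\<not> ?thesis"
      have "\<exists>x'\<in>V. x' \<in> Y" if "open V" "x \<in> V" for V using n that by meson
      then have "x \<in> Y" using inY[of x] x by (meson DiffD1)
      then show False using x by (rule_tac DiffD2)
    qed
    then have "?P - Y = ?P \<inter> \<Union>{V. open V \<and> (\<forall>x'\<in>V. x' \<notin> Y)}" by (intro equalityI subsetI) auto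
    moreover have "open (\<Union>{V. open V \<and> (\<forall>x'\<in>V. x' \<notin> Y)})" by blast
    ultimately have "openin (top_of_set ?P) (?P - Y)" unfolding openin_open by blast
    moreover have "Y \<subseteq> ?P" unfolding Y_def by blast
    ultimately show ?thesis unfolding closedin_def by simp
  qed
  ultimately have "Y = ?P" using connected_plane_interior[of a b] ne unfolding connected_clopen by blast
  then have "\<forall>x\<in>interior_Q. Fn a b x = 0 \<longrightarrow> lift \<epsilon> x \<in> M" unfolding Y_def by blast
  then show ?thesis unfolding in_M_def using u y by blast
qed

text \<open>The point \<open>x\<close> carries the germ into the next cell. The point
  \<open>y\<close> guarantees that the reflected plane enters the interior there instead of only
  touching the boundary.\<close>

lemma in_M_side:
  assumes P: "in_M \<epsilon> a b" and ij: "ij \<in> index_pairs" and v: "v \<in> centres ij"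
    and x: "x \<in> Q" "Fn v 1 x = 0" "Fn a b x = 0"
    and y: "y \<in> interior_Q" "Fn (a - (2 * (a \<bullet> v - b)) *\<^sub>R v) (b - 2 * (a \<bullet> v - b)) y = 0"
  shows "in_M (orientation_preserving (lab ij) \<longleftrightarrow> \<not> \<epsilon>)
    (lab ij (a - (2 * (a \<bullet> v - b)) *\<^sub>R v)) (b - 2 * (a \<bullet> v - b))"
proof (rule germ_in_M)
  let ?k = "lab ij"
  note k = kdiag_sign_maps[of "code_digit code ij"]
  have va: "v \<in> all_centres" using ij v unfolding all_centres_def by blast
  show "plane_germ (orientation_preserving ?k \<longleftrightarrow> \<not> \<epsilon>)
    (?k (a - (2 * (a \<bullet> v - b)) *\<^sub>R v)) (b - 2 * (a \<bullet> v - b)) (?k x)"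
    by (rule plane_germ_side[OF in_M_germ[OF P x(1,3)] ij v x(2)])
  have "(x - v) \<bullet> (x - v) = 1" using Fn_sphere[OF centre_inner[OF va], of x] x(2) by simp
  then have "Fn (a - (2 * (a \<bullet> v - b)) *\<^sub>R v) (b - 2 * (a \<bullet> v - b)) x = Fn a b (inversion v x)"
    using Fn_inversion[OF centre_inner[OF va], of x a b] by simp
  also have "\<dots> = 0" using inversion_fixed[OF centre_inner[OF va] x(2)] x(3) by simp
  finally show "Fn (?k (a - (2 * (a \<bullet> v - b)) *\<^sub>R v)) (b - 2 * (a \<bullet> v - b)) (?k x) = 0"
    unfolding sign_maps_Fn[OF k] .
  show "?k y \<in> interior_Q" by (rule sign_maps_interior_Q[OF k y(1)])
  show "Fn (?k (a - (2 * (a \<bullet> v - b)) *\<^sub>R v)) (b - 2 * (a \<bullet> v - b)) (?k y) = 0"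
    unfolding sign_maps_Fn[OF k] by (rule y(2))
qed

text \<open>Embeddedness is used here: at a point of the cell, even on its boundary, each copy sees
  a single plane of \<open>M\<close>. The conflicts between hemispheres below all violate
  this.\<close>

lemma in_M_disjoint:
  assumes P: "in_M \<epsilon> a b" and P': "in_M \<epsilon> a' b'" and x: "x \<in> Q" "Fn a b x = 0" "Fn a' b' x = 0"
  shows "a' = a \<and> b' = b \<or> a' = - a \<and> b' = - b"
proof -
  obtain V where V: "open V" "x \<in> V" "\<And>y. y \<in> V \<Longrightarrow> y \<in> Q \<Longrightarrow> lift \<epsilon> y \<in> M \<longleftrightarrow> Fn a' b' y = 0"
    by (rule plane_germ_near[OF in_M_germ[OF P' x(1,3)]]) blast
  obtain y where y: "y \<in> interior_Q" "Fn a b y = 0" using P unfolding in_M_def by blast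
  obtain z where z: "z \<in> V" "z \<in> interior_Q" "Fn a b z = 0"
    using interior_Q_near[OF x(1) y(1) V(1,2)] y(2) x(2) by metis
  show ?thesis
  proof (rule hyperplane_germ_unique[of a b a' b' "V \<inter> interior_Q" z])
    show "unitfn a b" "unitfn a' b'" using P P' unfolding in_M_def by blast+
    show "open (V \<inter> interior_Q)" using V(1) open_interior_Q by blast
    show "z \<in> H4" by (rule interior_Q_H4[OF z(2)])
    fix u assume "u \<in> V \<inter> interior_Q" "Fn a b u = 0"
    then show "Fn a' b' u = 0" using V(3) P interior_Q_subset unfolding in_M_def by blast
  qed (use z in auto)
qed

end

section \<open>Upper half-space coordinates at the ideal vertices\<close>

text \<open>An orthonormal frame whose pairwise sums and differences are the centres of the sides; its
  first vector is then an ideal vertex of the 24-cell.\<close>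

definition frame :: "real^4 \<Rightarrow> real^4 \<Rightarrow> real^4 \<Rightarrow> real^4 \<Rightarrow> bool" where
  "frame u b1 b2 b3 \<longleftrightarrow>
     u \<bullet> u = 1 \<and> b1 \<bullet> b1 = 1 \<and> b2 \<bullet> b2 = 1 \<and> b3 \<bullet> b3 = 1 \<and>
     u \<bullet> b1 = 0 \<and> u \<bullet> b2 = 0 \<and> u \<bullet> b3 = 0 \<and> b1 \<bullet> b2 = 0 \<and> b1 \<bullet> b3 = 0 \<and> b2 \<bullet> b3 = 0 \<and>
     (\<forall>x. x = (x \<bullet> u) *\<^sub>R u + (x \<bullet> b1) *\<^sub>R b1 + (x \<bullet> b2) *\<^sub>R b2 + (x \<bullet> b3) *\<^sub>R b3) \<and>
     all_centres = {u + b1, u - b1, - u + b1, - u - b1, u + b2, u - b2, - u + b2, - u - b2,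
       u + b3, u - b3, - u + b3, - u - b3, b1 + b2, b1 - b2, - b1 + b2, - b1 - b2,
       b1 + b3, b1 - b3, - b1 + b3, - b1 - b3, b2 + b3, b2 - b3, - b2 + b3, - b2 - b3}"

lemma frame_inner:
  assumes "frame u b1 b2 b3"
  shows "u \<bullet> u = 1" "b1 \<bullet> b1 = 1" "b2 \<bullet> b2 = 1" "b3 \<bullet> b3 = 1"
    "u \<bullet> b1 = 0" "u \<bullet> b2 = 0" "u \<bullet> b3 = 0" "b1 \<bullet> b2 = 0" "b1 \<bullet> b3 = 0" "b2 \<bullet> b3 = 0"
    "b1 \<bullet> u = 0" "b2 \<bullet> u = 0" "b3 \<bullet> u = 0" "b2 \<bullet> b1 = 0" "b3 \<bullet> b1 = 0" "b3 \<bullet> b2 = 0"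
  using assms unfolding frame_def by (simp_all add: inner_commute)

lemma frame_expand:
  "frame u b1 b2 b3 \<Longrightarrow> x = (x \<bullet> u) *\<^sub>R u + (x \<bullet> b1) *\<^sub>R b1 + (x \<bullet> b2) *\<^sub>R b2 + (x \<bullet> b3) *\<^sub>R b3"
  unfolding frame_def by blast

lemma frame_centres:
  "frame u b1 b2 b3 \<Longrightarrow> all_centres = {u + b1, u - b1, - u + b1, - u - b1, u + b2, u - b2, - u + b2, - u - b2,
       u + b3, u - b3, - u + b3, - u - b3, b1 + b2, b1 - b2, - b1 + b2, - b1 - b2,
       b1 + b3, b1 - b3, - b1 + b3, - b1 - b3, b2 + b3, b2 - b3, - b2 + b3, - b2 - b3}"
  unfolding frame_def by blast

lemma frame_eqI:
  assumes "frame u b1 b2 b3" "\<And>c. x \<bullet> c = y \<bullet> c \<or> c \<notin> {u, b1, b2, b3}"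
  shows "x = y"
  using frame_expand[OF assms(1), of x] frame_expand[OF assms(1), of y] assms(2)[of u] assms(2)[of b1]
    assms(2)[of b2] assms(2)[of b3] by simp

lemma frame_swap12: "frame u b1 b2 b3 \<Longrightarrow> frame u b2 b1 b3"
  unfolding frame_def by (elim conjE, intro conjI) (simp_all add: inner_commute add_ac, auto simp: algebra_simps)

lemma frame_swap23: "frame u b1 b2 b3 \<Longrightarrow> frame u b1 b3 b2"
  unfolding frame_def by (elim conjE, intro conjI) (simp_all add: inner_commute add_ac, auto simp: algebra_simps)

lemma frame_swap01: "frame u b1 b2 b3 \<Longrightarrow> frame b1 u b2 b3"
  unfolding frame_def by (elim conjE, intro conjI) (simp_all add: inner_commute add_ac, auto simp: algebra_simps)

lemma frame_neg0: "frame u b1 b2 b3 \<Longrightarrow> frame (- u) b1 b2 b3"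
  unfolding frame_def by (elim conjE, intro conjI) (simp_all, auto simp: algebra_simps)

lemma frame_neg1: "frame u b1 b2 b3 \<Longrightarrow> frame u (- b1) b2 b3"
  using frame_swap01 frame_neg0 by blast

text \<open>A symmetry of the 24-cell exchanging axis vertices and half-integral ones: the sums and
  differences of the new vectors are the same 24 centres in another arrangement. It allows all ideal
  vertices to be treated alike.\<close>

lemma frame_half:
  assumes "frame u b1 b2 b3"
  shows "frame ((1/2) *\<^sub>R (u + b1 + b2 + b3)) ((1/2) *\<^sub>R (u + b1 - b2 - b3))
    ((1/2) *\<^sub>R (u - b1 + b2 - b3)) ((1/2) *\<^sub>R (u - b1 - b2 + b3))"
proof -
  let ?u = "(1/2) *\<^sub>R (u + b1 + b2 + b3)" and ?a = "(1/2) *\<^sub>R (u + b1 - b2 - b3)"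
    and ?b = "(1/2) *\<^sub>R (u - b1 + b2 - b3)" and ?c = "(1/2) *\<^sub>R (u - b1 - b2 + b3)"
  note i = frame_inner[OF assms]
  have comp: "x = (x \<bullet> ?u) *\<^sub>R ?u + (x \<bullet> ?a) *\<^sub>R ?a + (x \<bullet> ?b) *\<^sub>R ?b + (x \<bullet> ?c) *\<^sub>R ?c" for x
  proof -
    define X A B C where "X = x \<bullet> u" and "A = x \<bullet> b1" and "B = x \<bullet> b2" and "C = x \<bullet> b3"
    have x: "x = X *\<^sub>R u + A *\<^sub>R b1 + B *\<^sub>R b2 + C *\<^sub>R b3"
      unfolding X_def A_def B_def C_def by (rule frame_expand[OF assms])
    have "(x \<bullet> ?u) *\<^sub>R ?u + (x \<bullet> ?a) *\<^sub>R ?a + (x \<bullet> ?b) *\<^sub>R ?b + (x \<bullet> ?c) *\<^sub>R ?c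
      = X *\<^sub>R u + A *\<^sub>R b1 + B *\<^sub>R b2 + C *\<^sub>R b3"
    proof (rule frame_eqI[OF assms])
      fix c
      show "((x \<bullet> ?u) *\<^sub>R ?u + (x \<bullet> ?a) *\<^sub>R ?a + (x \<bullet> ?b) *\<^sub>R ?b + (x \<bullet> ?c) *\<^sub>R ?c) \<bullet> c
        = (X *\<^sub>R u + A *\<^sub>R b1 + B *\<^sub>R b2 + C *\<^sub>R b3) \<bullet> c \<or> c \<notin> {u, b1, b2, b3}"
        by (auto simp: inner_add inner_diff i X_def[symmetric] A_def[symmetric] B_def[symmetric] C_def[symmetric] field_simps)
    qed
    then show ?thesis using x by simp
  qed
  have s: "?u + ?a = u + b1" "?u - ?a = b2 + b3" "- ?u + ?a = - b2 - b3" "- ?u - ?a = - u - b1"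
    "?u + ?b = u + b2" "?u - ?b = b1 + b3" "- ?u + ?b = - b1 - b3" "- ?u - ?b = - u - b2"
    "?u + ?c = u + b3" "?u - ?c = b1 + b2" "- ?u + ?c = - b1 - b2" "- ?u - ?c = - u - b3"
    "?a + ?b = u - b3" "?a - ?b = b1 - b2" "- ?a + ?b = - b1 + b2" "- ?a - ?b = - u + b3"
    "?a + ?c = u - b2" "?a - ?c = b1 - b3" "- ?a + ?c = - b1 + b3" "- ?a - ?c = - u + b2"
    "?b + ?c = u - b1" "?b - ?c = b2 - b3" "- ?b + ?c = - b2 + b3" "- ?b - ?c = - u + b1"
    by (simp_all add: vec_eq_iff field_simps)
  have "all_centres = {?u + ?a, ?u - ?a, - ?u + ?a, - ?u - ?a, ?u + ?b, ?u - ?b, - ?u + ?b, - ?u - ?b,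
    ?u + ?c, ?u - ?c, - ?u + ?c, - ?u - ?c, ?a + ?b, ?a - ?b, - ?a + ?b, - ?a - ?b,
    ?a + ?c, ?a - ?c, - ?a + ?c, - ?a - ?c, ?b + ?c, ?b - ?c, - ?b + ?c, - ?b - ?c}"
    unfolding s frame_centres[OF assms] by (rule set_eqI) (simp only: insert_iff empty_iff, argo)
  then show ?thesis
    unfolding frame_def using comp
    by (intro conjI allI) (simp_all add: inner_add inner_diff i)
qed

lemma frame_sign_map:
  assumes k: "k \<in> sign_maps" and f: "frame u b1 b2 b3"
  shows "frame (k u) (k b1) (k b2) (k b3)"
proof -
  note l = sign_maps_linear[OF k]
  have "x = (x \<bullet> k u) *\<^sub>R k u + (x \<bullet> k b1) *\<^sub>R k b1 + (x \<bullet> k b2) *\<^sub>R k b2 + (x \<bullet> k b3) *\<^sub>R k b3" for x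
  proof -
    have i: "k x \<bullet> y = x \<bullet> k y" for y using sign_maps_inner[OF k, of "k x" y] by (simp add: sign_maps_invol[OF k])
    have "x = k (k x)" by (simp add: sign_maps_invol[OF k])
    also have "\<dots> = k ((k x \<bullet> u) *\<^sub>R u + (k x \<bullet> b1) *\<^sub>R b1 + (k x \<bullet> b2) *\<^sub>R b2 + (k x \<bullet> b3) *\<^sub>R b3)"
      using frame_expand[OF f, of "k x"] by simp
    finally show ?thesis by (simp add: linear_add[OF l] linear_scale[OF l] i)
  qed
  moreover have "all_centres = k ` all_centres"
    using sign_maps_all_centres[OF k] sign_maps_invol[OF k] by (metis image_eqI image_subsetI subsetI subset_antisym)
  then have "all_centres = k ` {u + b1, u - b1, - u + b1, - u - b1, u + b2, u - b2, - u + b2, - u - b2,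
       u + b3, u - b3, - u + b3, - u - b3, b1 + b2, b1 - b2, - b1 + b2, - b1 - b2,
       b1 + b3, b1 - b3, - b1 + b3, - b1 - b3, b2 + b3, b2 - b3, - b2 + b3, - b2 - b3}"
    unfolding frame_centres[OF f] .
  ultimately show ?thesis
    unfolding frame_def using frame_inner[OF f]
    by (intro conjI allI) (simp_all add: sign_maps_inner[OF k] linear_add[OF l] linear_diff[OF l] linear_neg[OF l])
qed

text \<open>Together with the last coordinate \<open>1/2 + 2 * (p1^2 + p2^2 + p3^2 + t^2)\<close>
  this is the unnormalized point of the hyperboloid model; by \<open>upv_inner\<close> its Lorentz
  square is \<open>- 4 * t^2\<close>. Hyperplanes are linear conditions on it.\<close>

definition upv :: "real^4 \<Rightarrow> real^4 \<Rightarrow> real^4 \<Rightarrow> real^4 \<Rightarrow> real \<Rightarrow> real \<Rightarrow> real \<Rightarrow> real \<Rightarrow> real^4" where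
  "upv u b1 b2 b3 p1 p2 p3 t = (2 * (p1^2 + p2^2 + p3^2 + t^2) - 1/2) *\<^sub>R u
     + (2 * p1) *\<^sub>R b1 + (2 * p2) *\<^sub>R b2 + (2 * p3) *\<^sub>R b3"

text \<open>Upper half-space coordinates at the ideal vertex \<open>u\<close>: the point of the ball at horizontal
  position \<open>p\<close> and height \<open>t\<close>.  The 24-cell is the part of the prism over the unit cube centred at
  the origin that lies above the hemispheres of the remaining 18 sides.\<close>

definition up :: "real^4 \<Rightarrow> real^4 \<Rightarrow> real^4 \<Rightarrow> real^4 \<Rightarrow> real \<Rightarrow> real \<Rightarrow> real \<Rightarrow> real \<Rightarrow> real^4" where
  "up u b1 b2 b3 p1 p2 p3 t =
     (1 / (1/2 + 2 * (p1^2 + p2^2 + p3^2 + t^2) + 2 * t)) *\<^sub>R upv u b1 b2 b3 p1 p2 p3 t"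

lemma upv_inner:
  assumes "frame u b1 b2 b3"
  shows "upv u b1 b2 b3 p1 p2 p3 t \<bullet> upv u b1 b2 b3 p1 p2 p3 t
    = (2 * (p1^2 + p2^2 + p3^2 + t^2) + 1/2)^2 - 4 * t^2"
  unfolding upv_def
  by (simp add: inner_add frame_inner[OF assms]) (simp add: power2_eq_square algebra_simps)

lemma up_inner:
  fixes p1 p2 p3 t :: real
  assumes f: "frame u b1 b2 b3" and t: "0 < t"
  defines "T \<equiv> p1^2 + p2^2 + p3^2 + t^2"
  shows "1 + up u b1 b2 b3 p1 p2 p3 t \<bullet> up u b1 b2 b3 p1 p2 p3 t = 2 * (1/2 + 2 * T) / (1/2 + 2 * T + 2 * t)"
    "1 - up u b1 b2 b3 p1 p2 p3 t \<bullet> up u b1 b2 b3 p1 p2 p3 t = 4 * t / (1/2 + 2 * T + 2 * t)"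
proof -
  define D where "D = 1/2 + 2 * T + 2 * t"
  have T: "0 \<le> T" by (simp add: T_def)
  have D: "0 < D" using t T by (simp add: D_def)
  have "up u b1 b2 b3 p1 p2 p3 t \<bullet> up u b1 b2 b3 p1 p2 p3 t = ((2 * T + 1/2)^2 - 4 * t^2) / (D * D)"
    unfolding up_def by (simp add: upv_inner[OF f] T_def[symmetric] D_def[symmetric])
  also have "(2 * T + 1/2)^2 - 4 * t^2 = (D - 4 * t) * D"
    by (simp add: D_def power2_eq_square algebra_simps)
  finally have x: "up u b1 b2 b3 p1 p2 p3 t \<bullet> up u b1 b2 b3 p1 p2 p3 t = (D - 4 * t) / D" using D by simp
  show "1 + up u b1 b2 b3 p1 p2 p3 t \<bullet> up u b1 b2 b3 p1 p2 p3 t = 2 * (1/2 + 2 * T) / (1/2 + 2 * T + 2 * t)"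
    unfolding x D_def[symmetric] using D by (simp add: divide_simps) (simp add: D_def)
  show "1 - up u b1 b2 b3 p1 p2 p3 t \<bullet> up u b1 b2 b3 p1 p2 p3 t = 4 * t / (1/2 + 2 * T + 2 * t)"
    unfolding x D_def[symmetric] using D by (simp add: divide_simps)
qed

lemma up_H4: "frame u b1 b2 b3 \<Longrightarrow> 0 < t \<Longrightarrow> up u b1 b2 b3 p1 p2 p3 t \<in> H4"
proof -
  assume f: "frame u b1 b2 b3" "0 < t"
  have "0 < 4 * t / (1/2 + 2 * (p1^2 + p2^2 + p3^2 + t^2) + 2 * t)"
    using f(2) by (simp add: add_nonneg_pos)
  then show ?thesis unfolding mem_H4 using up_inner(2)[OF f, of p1 p2 p3] by linarith
qed

lemma Fn_up:
  assumes f: "frame u b1 b2 b3" and t: "0 < t"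
  shows "\<exists>K>0. Fn a b (up u b1 b2 b3 p1 p2 p3 t) =
    K * (a \<bullet> upv u b1 b2 b3 p1 p2 p3 t - b * (1/2 + 2 * (p1^2 + p2^2 + p3^2 + t^2)))"
proof -
  define T where "T = p1^2 + p2^2 + p3^2 + t^2"
  define D where "D = 1/2 + 2 * T + 2 * t"
  have D: "0 < D" using t by (simp add: D_def T_def add_nonneg_pos)
  have "Fn a b (up u b1 b2 b3 p1 p2 p3 t) = 2 / D * (a \<bullet> upv u b1 b2 b3 p1 p2 p3 t - b * (1/2 + 2 * T))"
    unfolding Fn_def up_inner(1)[OF f t] unfolding T_def[symmetric] D_def[symmetric]
    unfolding up_def T_def[symmetric] D_def[symmetric] by (simp add: diff_divide_distrib right_diff_distrib)
  then show ?thesis using D unfolding T_def by (intro exI[of _ "2 / D"]) simp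
qed

lemma Fn_up_iff:
  assumes "frame u b1 b2 b3" "0 < t"
  shows "Fn a b (up u b1 b2 b3 p1 p2 p3 t) = 0 \<longleftrightarrow>
      a \<bullet> upv u b1 b2 b3 p1 p2 p3 t = b * (1/2 + 2 * (p1^2 + p2^2 + p3^2 + t^2))"
    "Fn a b (up u b1 b2 b3 p1 p2 p3 t) \<le> 0 \<longleftrightarrow>
      a \<bullet> upv u b1 b2 b3 p1 p2 p3 t \<le> b * (1/2 + 2 * (p1^2 + p2^2 + p3^2 + t^2))"
    "Fn a b (up u b1 b2 b3 p1 p2 p3 t) < 0 \<longleftrightarrow>
      a \<bullet> upv u b1 b2 b3 p1 p2 p3 t < b * (1/2 + 2 * (p1^2 + p2^2 + p3^2 + t^2))"
  using Fn_up[OF assms, of a b p1 p2 p3]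
  by (auto simp: mult_less_0_iff mult_le_0_iff)

lemma upv_inner_centres:
  assumes f: "frame u b1 b2 b3"
  shows "u \<bullet> upv u b1 b2 b3 p1 p2 p3 t = 2 * (p1^2 + p2^2 + p3^2 + t^2) - 1/2"
    "b1 \<bullet> upv u b1 b2 b3 p1 p2 p3 t = 2 * p1" "b2 \<bullet> upv u b1 b2 b3 p1 p2 p3 t = 2 * p2"
    "b3 \<bullet> upv u b1 b2 b3 p1 p2 p3 t = 2 * p3"
  unfolding upv_def by (simp_all add: inner_add frame_inner[OF f])

definition wall_ok :: "real \<Rightarrow> real \<Rightarrow> real \<Rightarrow> bool" where
  "wall_ok p1 p2 p3 \<longleftrightarrow> \<bar>p1\<bar> \<le> 1/2 \<and> \<bar>p2\<bar> \<le> 1/2 \<and> \<bar>p3\<bar> \<le> 1/2"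

text \<open>The six sides through \<open>u\<close> are the walls over the cube. The six sides
  through \<open>- u\<close> are hemispheres of radius 1/4 centred on the axes at distance 1/4 from
  the origin; the other twelve have radius 1/2 and are centred at the midpoints of the edges of the
  cube.\<close>

lemma up_Q_iff:
  fixes p1 p2 p3 t :: real
  assumes f: "frame u b1 b2 b3" and t: "0 < t"
  defines "T \<equiv> p1^2 + p2^2 + p3^2 + t^2"
  shows "up u b1 b2 b3 p1 p2 p3 t \<in> Q \<longleftrightarrow> wall_ok p1 p2 p3 \<and>
      \<bar>p1\<bar> \<le> 2 * T \<and> \<bar>p2\<bar> \<le> 2 * T \<and> \<bar>p3\<bar> \<le> 2 * T \<and>
      \<bar>p1\<bar> + \<bar>p2\<bar> \<le> 1/4 + T \<and> \<bar>p1\<bar> + \<bar>p3\<bar> \<le> 1/4 + T \<and> \<bar>p2\<bar> + \<bar>p3\<bar> \<le> 1/4 + T" (is ?A)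
    and "up u b1 b2 b3 p1 p2 p3 t \<in> interior_Q \<longleftrightarrow>
      \<bar>p1\<bar> < 1/2 \<and> \<bar>p2\<bar> < 1/2 \<and> \<bar>p3\<bar> < 1/2 \<and>
      \<bar>p1\<bar> < 2 * T \<and> \<bar>p2\<bar> < 2 * T \<and> \<bar>p3\<bar> < 2 * T \<and>
      \<bar>p1\<bar> + \<bar>p2\<bar> < 1/4 + T \<and> \<bar>p1\<bar> + \<bar>p3\<bar> < 1/4 + T \<and> \<bar>p2\<bar> + \<bar>p3\<bar> < 1/4 + T" (is ?B)
proof -
  note H = up_H4[OF f t, of p1 p2 p3]
  show ?A
    unfolding mem_Q frame_centres[OF f] using H
    by (simp add: Fn_up_iff[OF f t] inner_add_left inner_diff_left upv_inner_centres[OF f] T_def[symmetric] wall_ok_def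
        del: mem_ball mem_ball_0) argo
  show ?B
    unfolding interior_Q_def frame_centres[OF f] using H
    by (simp add: Fn_up_iff[OF f t] inner_add_left inner_diff_left upv_inner_centres[OF f] T_def[symmetric]
        del: mem_ball mem_ball_0) argo
qed

text \<open>All hemispheres bounding the cell have radius at most 1/2, so from height 1/2 on only
  the walls matter. This is the origin of the 1/4 in the later conditions on squared
  heights.\<close>

lemma up_high:
  assumes f: "frame u b1 b2 b3" and t: "1/2 \<le> t"
  shows "wall_ok p1 p2 p3 \<Longrightarrow> up u b1 b2 b3 p1 p2 p3 t \<in> Q"
    "\<bar>p1\<bar> < 1/2 \<Longrightarrow> \<bar>p2\<bar> < 1/2 \<Longrightarrow> \<bar>p3\<bar> < 1/2 \<Longrightarrow> up u b1 b2 b3 p1 p2 p3 t \<in> interior_Q"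
proof -
  define T where "T = p1^2 + p2^2 + p3^2 + t^2"
  have t0: "0 < t" using t by simp
  have tt: "1/4 \<le> t^2" using power_mono[OF t, of 2] by (simp add: power2_eq_square)
  have sq: "0 \<le> x^2" "0 \<le> (\<bar>x\<bar> - 1/2)^2" "(\<bar>x\<bar> - 1/2)^2 = x^2 - \<bar>x\<bar> + 1/4" for x :: real
  proof -
    show "0 \<le> x^2" "0 \<le> (\<bar>x\<bar> - 1/2)^2" by (rule zero_le_power2)+
    show "(\<bar>x\<bar> - 1/2)^2 = x^2 - \<bar>x\<bar> + 1/4" by (simp add: power2_eq_square algebra_simps)
  qed
  have a: "\<bar>x\<bar> \<le> x^2 + 1/4" for x :: real using sq[of x] by linarith
  have a2: "\<bar>x\<bar> < 2 * x^2 + 1/2" for x :: real using a[of x] sq(1)[of x] by linarith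
  have T2: "2 * T = 2 * p1^2 + 2 * p2^2 + 2 * p3^2 + 2 * t^2" by (simp add: T_def)
  have floors2: "\<bar>p1\<bar> < 2 * T" "\<bar>p2\<bar> < 2 * T" "\<bar>p3\<bar> < 2 * T"
    using a2[of p1] a2[of p2] a2[of p3] sq(1)[of p1] sq(1)[of p2] sq(1)[of p3] tt unfolding T2 by linarith+
  have floors: "\<bar>p1\<bar> + \<bar>p2\<bar> \<le> 1/4 + T" "\<bar>p1\<bar> + \<bar>p3\<bar> \<le> 1/4 + T" "\<bar>p2\<bar> + \<bar>p3\<bar> \<le> 1/4 + T"
    using a[of p1] a[of p2] a[of p3] sq(1)[of p1] sq(1)[of p2] sq(1)[of p3] tt unfolding T_def by linarith+
  show "wall_ok p1 p2 p3 \<Longrightarrow> up u b1 b2 b3 p1 p2 p3 t \<in> Q"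
    unfolding up_Q_iff(1)[OF f t0] T_def[symmetric] using floors floors2 by simp
  assume s: "\<bar>p1\<bar> < 1/2" "\<bar>p2\<bar> < 1/2" "\<bar>p3\<bar> < 1/2"
  have b: "\<bar>x\<bar> < x^2 + 1/4" if "\<bar>x\<bar> < 1/2" for x :: real
  proof -
    have "0 < (\<bar>x\<bar> - 1/2)^2" using that by simp
    then show ?thesis using sq(3)[of x] by linarith
  qed
  have "\<bar>p1\<bar> + \<bar>p2\<bar> < 1/4 + T" "\<bar>p1\<bar> + \<bar>p3\<bar> < 1/4 + T" "\<bar>p2\<bar> + \<bar>p3\<bar> < 1/4 + T"
    using b[OF s(1)] b[OF s(2)] b[OF s(3)] sq(1)[of p1] sq(1)[of p2] sq(1)[of p3] tt unfolding T_def by linarith+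
  then show "up u b1 b2 b3 p1 p2 p3 t \<in> interior_Q"
    unfolding up_Q_iff(2)[OF f t0] T_def[symmetric] using floors2 s by simp
qed

lemma up_surj:
  assumes f: "frame u b1 b2 b3" and x: "x \<in> H4"
  obtains p1 p2 p3 t where "0 < t" "x = up u b1 b2 b3 p1 p2 p3 t"
proof -
  define X where "X = x \<bullet> x"
  \<comment> \<open>This is the squared distance of \<open>x\<close> from \<open>u\<close>; the
    scalar factor in \<open>up\<close> turns out to be half of it.\<close>
  define l where "l = 1 + X - 2 * (x \<bullet> u)"
  have X: "X < 1" "0 \<le> X" using x unfolding mem_H4 X_def by simp_all
  have "l = (x - u) \<bullet> (x - u)" by (simp add: l_def X_def inner_diff inner_commute frame_inner(1)[OF f])
  moreover have "x \<noteq> u" using X frame_inner(1)[OF f] unfolding X_def by auto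
  ultimately have l: "0 < l" by simp
  define p1 p2 p3 t where "p1 = (x \<bullet> b1) / l" and "p2 = (x \<bullet> b2) / l" and "p3 = (x \<bullet> b3) / l"
    and "t = (1 - X) / (2 * l)"
  have t: "0 < t" using X l by (simp add: t_def)
  define T where "T = p1^2 + p2^2 + p3^2 + t^2"
  have "X = (x \<bullet> u)^2 + (x \<bullet> b1)^2 + (x \<bullet> b2)^2 + (x \<bullet> b3)^2"
    unfolding X_def by (subst (2) frame_expand[OF f, of x]) (simp add: inner_add_right power2_eq_square)
  then have "(x \<bullet> b1)^2 + (x \<bullet> b2)^2 + (x \<bullet> b3)^2 = X - (x \<bullet> u)^2" by simp
  moreover have "l^2 * T = (x \<bullet> b1)^2 + (x \<bullet> b2)^2 + (x \<bullet> b3)^2 + (1 - X)^2 / 4"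
    using l by (simp add: T_def p1_def p2_def p3_def t_def power_divide power_mult_distrib field_simps)
  ultimately have "l^2 * T = X - (x \<bullet> u)^2 + (1 - X)^2 / 4" by simp
  also have "\<dots> = l * (1 + X + 2 * (x \<bullet> u)) / 4"
    by (simp add: l_def power2_eq_square field_simps)
  finally have "l * (l * T) = l * ((1 + X + 2 * (x \<bullet> u)) / 4)" by (simp add: power2_eq_square)
  then have lT: "l * T = (1 + X + 2 * (x \<bullet> u)) / 4" using l by simp
  define D where "D = 1/2 + 2 * T + 2 * t"
  have lt: "l * t = (1 - X) / 2" using l by (simp add: t_def)
  have "l * D = l / 2 + 2 * (l * T) + 2 * (l * t)" unfolding D_def by (simp add: algebra_simps)
  also have "\<dots> = 2" unfolding lT lt by (simp add: l_def field_simps)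
  finally have lD: "l * D = 2" .
  have "D = 2 / l" using lD l by (simp add: eq_divide_eq mult.commute)
  then have D: "1 / D = l / 2" by simp
  have "l / 2 * (2 * T - 1/2) = l * T - l / 4" by (simp add: algebra_simps)
  then have c0: "l / 2 * (2 * T - 1/2) = x \<bullet> u" unfolding lT by (simp add: l_def field_simps)
  have "up u b1 b2 b3 p1 p2 p3 t = (l / 2) *\<^sub>R ((2 * T - 1/2) *\<^sub>R u + (2 * p1) *\<^sub>R b1 + (2 * p2) *\<^sub>R b2 + (2 * p3) *\<^sub>R b3)"
    unfolding up_def upv_def T_def[symmetric] D_def[symmetric] D ..
  also have "\<dots> = (l / 2 * (2 * T - 1/2)) *\<^sub>R u + (l * p1) *\<^sub>R b1 + (l * p2) *\<^sub>R b2 + (l * p3) *\<^sub>R b3"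
    by (simp add: scaleR_add_right)
  also have "\<dots> = x"
    unfolding c0 using l frame_expand[OF f, of x] by (simp add: p1_def p2_def p3_def)
  finally show ?thesis using that t by metis
qed

definition capa :: "real^4 \<Rightarrow> real^4 \<Rightarrow> real^4 \<Rightarrow> real^4 \<Rightarrow> real \<Rightarrow> real \<Rightarrow> real \<Rightarrow> real \<Rightarrow> real \<Rightarrow> real^4" where
  "capa u b1 b2 b3 d c1 c2 c3 R = (d * (1/2 + 2 * (R - (c1^2 + c2^2 + c3^2)))) *\<^sub>R u
     - (2 * d * c1) *\<^sub>R b1 - (2 * d * c2) *\<^sub>R b2 - (2 * d * c3) *\<^sub>R b3"

text \<open>\<open>Fn\<close> with coefficients \<open>capa\<close> and \<open>capb\<close> vanishes on the hemisphere with centre \<open>c\<close> and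
  squared radius \<open>R\<close> in the upper half-space coordinates at \<open>u\<close>.\<close>

definition capb :: "real \<Rightarrow> real \<Rightarrow> real \<Rightarrow> real \<Rightarrow> real \<Rightarrow> real" where
  "capb d c1 c2 c3 R = d * (2 * (R - (c1^2 + c2^2 + c3^2)) - 1/2)"

lemma cap_up_iff:
  assumes f: "frame u b1 b2 b3" and t: "0 < t" and d: "d \<noteq> 0"
  shows "Fn (capa u b1 b2 b3 d c1 c2 c3 R) (capb d c1 c2 c3 R) (up u b1 b2 b3 p1 p2 p3 t) = 0 \<longleftrightarrow>
    (p1 - c1)^2 + (p2 - c2)^2 + (p3 - c3)^2 + t^2 = R"
proof -
  define T where "T = p1^2 + p2^2 + p3^2 + t^2"
  define S where "S = R - (c1^2 + c2^2 + c3^2)"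
  have "capa u b1 b2 b3 d c1 c2 c3 R \<bullet> upv u b1 b2 b3 p1 p2 p3 t - capb d c1 c2 c3 R * (1/2 + 2 * T)
    = 2 * d * (T - S - 2 * (c1 * p1 + c2 * p2 + c3 * p3))"
    unfolding capa_def capb_def inner_diff_left inner_scaleR_left upv_inner_centres[OF f]
      S_def[symmetric] T_def[symmetric] by algebra
  also have "T - S - 2 * (c1 * p1 + c2 * p2 + c3 * p3) = (p1 - c1)^2 + (p2 - c2)^2 + (p3 - c3)^2 + t^2 - R"
    unfolding T_def S_def by algebra
  finally show ?thesis
    unfolding Fn_up_iff[OF f t] T_def[symmetric] using d by (metis eq_iff_diff_eq_0 mult_eq_0_iff zero_neq_numeral)
qed

text \<open>If \<open>a \<bullet> u - b\<close> vanished, the plane would pass through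
  \<open>u\<close> and be vertical. Otherwise the normalization of \<open>(a, b)\<close> ties the
  radius to \<open>d\<close>, whose sign only records the choice of the normal.\<close>

lemma cap_exists:
  assumes f: "frame u b1 b2 b3" and ab: "unitfn a b" and d0: "a \<bullet> u - b \<noteq> 0"
  obtains d c1 c2 c3 R where "d = a \<bullet> u - b" "4 * d^2 * R = 1" "0 < R"
    "a = capa u b1 b2 b3 d c1 c2 c3 R" "b = capb d c1 c2 c3 R"
proof -
  define d where "d = a \<bullet> u - b"
  define c1 c2 c3 R where "c1 = - (a \<bullet> b1) / (2 * d)" and "c2 = - (a \<bullet> b2) / (2 * d)"
    and "c3 = - (a \<bullet> b3) / (2 * d)" and "R = 1 / (4 * d^2)"
  have d: "d \<noteq> 0" using d0 by (simp add: d_def)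
  define C where "C = c1^2 + c2^2 + c3^2"
  have e: "a \<bullet> b1 = - 2 * d * c1" "a \<bullet> b2 = - 2 * d * c2" "a \<bullet> b3 = - 2 * d * c3"
    using d by (simp_all add: c1_def c2_def c3_def)
  have "a \<bullet> a = (a \<bullet> u)^2 + (a \<bullet> b1)^2 + (a \<bullet> b2)^2 + (a \<bullet> b3)^2"
    by (subst (2) frame_expand[OF f, of a]) (simp add: inner_add_right power2_eq_square)
  then have "(a \<bullet> u)^2 + 4 * d^2 * C - b^2 = 1"
    using ab unfolding unitfn_def e C_def by (simp add: power_mult_distrib algebra_simps)
  moreover have R: "4 * d^2 * R = 1" using d by (simp add: R_def)
  ultimately have "d * (a \<bullet> u + b) = d * (4 * d * (R - C))"
    unfolding d_def by (simp add: power2_eq_square algebra_simps)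
  then have s: "a \<bullet> u + b = 4 * d * (R - C)" using d by simp
  define m where "m = d * (R - C)"
  have m: "d * (1/2 + 2 * (R - C)) = d / 2 + 2 * m" "d * (2 * (R - C) - 1/2) = 2 * m - d / 2"
    unfolding m_def by algebra+
  have s': "a \<bullet> u + b = 4 * m" using s by (simp add: m_def)
  have "a \<bullet> u = d * (1/2 + 2 * (R - C))" "b = d * (2 * (R - C) - 1/2)"
    unfolding m using s' d_def by linarith+
  then have "a = capa u b1 b2 b3 d c1 c2 c3 R" "b = capb d c1 c2 c3 R"
    using frame_expand[OF f, of a] unfolding capa_def capb_def C_def e by simp_all
  moreover have "0 < R" using d by (simp add: R_def)
  ultimately show ?thesis using that d_def R by blast
qed

lemma cap_inner:
  assumes f: "frame u b1 b2 b3"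
  shows "capa u b1 b2 b3 d c1 c2 c3 R \<bullet> u = d * (1/2 + 2 * (R - (c1^2 + c2^2 + c3^2)))"
    "capa u b1 b2 b3 d c1 c2 c3 R \<bullet> b1 = - 2 * d * c1"
    "capa u b1 b2 b3 d c1 c2 c3 R \<bullet> b2 = - 2 * d * c2"
    "capa u b1 b2 b3 d c1 c2 c3 R \<bullet> b3 = - 2 * d * c3"
    "capa u b1 b2 b3 d c1 c2 c3 R \<bullet> u - capb d c1 c2 c3 R = d"
  unfolding capa_def capb_def by (simp_all add: inner_diff_left frame_inner[OF f] algebra_simps)

lemma cap_swap12: "capa u b1 b2 b3 d c1 c2 c3 R = capa u b2 b1 b3 d c2 c1 c3 R" "capb d c1 c2 c3 R = capb d c2 c1 c3 R"
  by (simp_all add: capa_def capb_def algebra_simps)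

lemma cap_swap23: "capa u b1 b2 b3 d c1 c2 c3 R = capa u b1 b3 b2 d c1 c3 c2 R" "capb d c1 c2 c3 R = capb d c1 c3 c2 R"
  by (simp_all add: capa_def capb_def algebra_simps)

lemma cap_neg1: "capa u b1 b2 b3 d c1 c2 c3 R = capa u (- b1) b2 b3 d (- c1) c2 c3 R" "capb d c1 c2 c3 R = capb d (- c1) c2 c3 R"
  by (simp_all add: capa_def capb_def)

lemma up_swap12: "up u b1 b2 b3 p1 p2 p3 t = up u b2 b1 b3 p2 p1 p3 t"
  by (simp add: up_def upv_def algebra_simps)

lemma up_swap23: "up u b1 b2 b3 p1 p2 p3 t = up u b1 b3 b2 p1 p3 p2 t"
  by (simp add: up_def upv_def algebra_simps)

lemma up_neg1: "up u b1 b2 b3 p1 p2 p3 t = up u (- b1) b2 b3 (- p1) p2 p3 t"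
  by (simp add: up_def upv_def)

lemma sign_map_cap: "k \<in> sign_maps \<Longrightarrow> k (capa u b1 b2 b3 d c1 c2 c3 R) = capa (k u) (k b1) (k b2) (k b3) d c1 c2 c3 R"
  using sign_maps_linear[of k] by (simp add: capa_def linear_diff linear_add linear_scale)

lemma sign_map_up: "k \<in> sign_maps \<Longrightarrow> k (up u b1 b2 b3 p1 p2 p3 t) = up (k u) (k b1) (k b2) (k b3) p1 p2 p3 t"
  using sign_maps_linear[of k] by (simp add: up_def upv_def linear_diff linear_add linear_scale)

text \<open>In these coordinates the side of \<open>u + b1\<close> is the wall
  \<open>p1 = 1/2\<close>. Reflecting in it moves the centre and leaves \<open>d\<close> and the
  radius unchanged.\<close>

lemma cap_reflect:
  fixes d c1 c2 c3 R :: real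
  assumes f: "frame u b1 b2 b3"
  defines "a \<equiv> capa u b1 b2 b3 d c1 c2 c3 R" and "b \<equiv> capb d c1 c2 c3 R" and "v \<equiv> u + b1"
  shows "a - (2 * (a \<bullet> v - b)) *\<^sub>R v = capa u b1 b2 b3 d (1 - c1) c2 c3 R"
    "b - 2 * (a \<bullet> v - b) = capb d (1 - c1) c2 c3 R"
proof -
  have av: "a \<bullet> v - b = d - 2 * d * c1"
    unfolding v_def inner_add_right a_def b_def using cap_inner(2,5)[OF f, of d c1 c2 c3 R] by simp
  have e: "d * (1/2 + 2 * (R - ((1 - c1)^2 + c2^2 + c3^2))) =
      d * (1/2 + 2 * (R - (c1^2 + c2^2 + c3^2))) - 2 * (d - 2 * d * c1)"
    "2 * d * (1 - c1) = 2 * d * c1 + 2 * (d - 2 * d * c1)"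
    "d * (2 * (R - ((1 - c1)^2 + c2^2 + c3^2)) - 1/2) = d * (2 * (R - (c1^2 + c2^2 + c3^2)) - 1/2) - 2 * (d - 2 * d * c1)"
    by algebra+
  show "a - (2 * (a \<bullet> v - b)) *\<^sub>R v = capa u b1 b2 b3 d (1 - c1) c2 c3 R"
    unfolding av unfolding capa_def e a_def v_def scaleR_diff_left[of "_" "2 * (d - 2 * d * c1)" u]
    by (simp only: scaleR_add_left scaleR_add_right scaleR_diff_left algebra_simps)
  show "b - 2 * (a \<bullet> v - b) = capb d (1 - c1) c2 c3 R"
    unfolding av unfolding capb_def e b_def by simp
qed

section \<open>Weighted heights\<close>

definition vertices :: "(real^4) set" where
  "vertices = {u. \<exists>b1 b2 b3. frame u b1 b2 b3}"

lemma finite_vertices: "finite vertices"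
proof -
  have "u \<in> (\<lambda>(v, w). (1/2) *\<^sub>R (v + w)) ` (all_centres \<times> all_centres)" if "frame u b1 b2 b3" for u b1 b2 b3
  proof (rule image_eqI[of _ _ "(u + b1, u - b1)"])
    show "(u + b1, u - b1) \<in> all_centres \<times> all_centres" unfolding frame_centres[OF that] by blast
  qed (simp add: vec_eq_iff)
  then show ?thesis
    using finite_subset[of vertices] finite_all_centres unfolding vertices_def by blast
qed

lemma frame_vertices:
  assumes "frame u b1 b2 b3"
  shows "u \<in> vertices" "- u \<in> vertices" "b1 \<in> vertices" "- b1 \<in> vertices" "b2 \<in> vertices" "- b2 \<in> vertices"
    "b3 \<in> vertices" "- b3 \<in> vertices"
  using assms frame_swap01 frame_swap12 frame_swap23 frame_neg0 unfolding vertices_def by blast+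

lemma frame_signs:
  assumes "frame u b1 b2 b3" "\<bar>s1\<bar> = 1" "\<bar>s2\<bar> = 1" "\<bar>s3\<bar> = 1"
  shows "frame u (s1 *\<^sub>R b1) (s2 *\<^sub>R b2) (s3 *\<^sub>R b3)"
proof -
  have n2: "frame u b (- c) d" if "frame u b c d" for b c d
    using frame_swap12[OF frame_neg1[OF frame_swap12[OF that]]] .
  have n3: "frame u b c (- d)" if "frame u b c d" for b c d
    using frame_swap23[OF n2[OF frame_swap23[OF that]]] .
  have s: "s1 = 1 \<or> s1 = -1" "s2 = 1 \<or> s2 = -1" "s3 = 1 \<or> s3 = -1" using assms(2-4) by linarith+
  then show ?thesis using assms(1) frame_neg1 n2 n3 by auto
qed

lemma frame_corner:
  assumes "frame u b1 b2 b3" "\<bar>s1\<bar> = 1" "\<bar>s2\<bar> = 1" "\<bar>s3\<bar> = 1"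
  shows "(1/2) *\<^sub>R (u + s1 *\<^sub>R b1 + s2 *\<^sub>R b2 + s3 *\<^sub>R b3) \<in> vertices"
  using frame_vertices(1)[OF frame_half[OF frame_signs[OF assms]]] .

text \<open>For a unit vector \<open>w\<close> the denominator is the squared distance from
  \<open>x\<close> to \<open>w\<close>, so level sets are horospheres at \<open>w\<close>. In upper
  half-space coordinates at \<open>w\<close> the value is twice the Euclidean height.\<close>

definition height :: "real^4 \<Rightarrow> real^4 \<Rightarrow> real" where
  "height w x = (1 - x \<bullet> x) / (1 + x \<bullet> x - 2 * (x \<bullet> w))"

lemma vertex_inner: "w \<in> vertices \<Longrightarrow> w \<bullet> w = 1"
  unfolding vertices_def using frame_inner(1) by blast

lemma height_denom_pos:
  assumes "w \<bullet> w = 1" "x \<in> H4"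
  shows "0 < 1 + x \<bullet> x - 2 * (x \<bullet> w)"
proof -
  have "1 + x \<bullet> x - 2 * (x \<bullet> w) = (x - w) \<bullet> (x - w)"
    using assms(1) by (simp add: inner_diff inner_commute)
  moreover have "x \<noteq> w" using assms unfolding mem_H4 by auto
  ultimately show ?thesis by simp
qed

lemma height_sign_map: "k \<in> sign_maps \<Longrightarrow> height (k w) (k x) = height w x"
  by (simp add: height_def sign_maps_inner)

lemma height_up:
  assumes f: "frame u b1 b2 b3" and t: "0 < t"
  shows "height w (up u b1 b2 b3 p1 p2 p3 t) =
    2 * t / (1/2 + 2 * (p1^2 + p2^2 + p3^2 + t^2) - w \<bullet> upv u b1 b2 b3 p1 p2 p3 t)"
proof -
  define T where "T = p1^2 + p2^2 + p3^2 + t^2"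
  define D where "D = 1/2 + 2 * T + 2 * t"
  have D: "0 < D" using t by (simp add: D_def T_def add_nonneg_pos)
  define L where "L = 1/2 + 2 * T - w \<bullet> upv u b1 b2 b3 p1 p2 p3 t"
  let ?x = "up u b1 b2 b3 p1 p2 p3 t"
  have "?x \<bullet> w = (w \<bullet> upv u b1 b2 b3 p1 p2 p3 t) / D"
    unfolding up_def T_def[symmetric] D_def[symmetric] by (simp add: inner_commute)
  then have e1: "1 + ?x \<bullet> ?x - 2 * (?x \<bullet> w) = 2 * L / D"
    unfolding up_inner(1)[OF f t] T_def[symmetric] D_def[symmetric] L_def
    using D by (simp add: diff_divide_distrib right_diff_distrib)
  have e2: "1 - ?x \<bullet> ?x = 2 * (2 * t) / D"
    unfolding up_inner(2)[OF f t] T_def[symmetric] D_def[symmetric] by simp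
  show ?thesis
    unfolding height_def T_def[symmetric] L_def[symmetric] e1 e2 using D by simp
qed

lemma height_up_self: "frame u b1 b2 b3 \<Longrightarrow> 0 < t \<Longrightarrow> height u (up u b1 b2 b3 p1 p2 p3 t) = 2 * t"
  by (simp add: height_up upv_inner_centres)

lemma continuous_height:
  assumes "w \<bullet> w = 1"
  shows "continuous_on Q (height w)"
proof -
  have "1 + x \<bullet> x - 2 * (x \<bullet> w) \<noteq> 0" if "x \<in> Q" for x
    using height_denom_pos[OF assms Q_in_H4[OF that]] by simp
  then show ?thesis unfolding height_def by (intro continuous_intros) auto
qed

lemma continuous_on_Max_family:
  fixes f :: "'b \<Rightarrow> real^4 \<Rightarrow> real"
  assumes "finite S" "S \<noteq> {}" "\<And>s. s \<in> S \<Longrightarrow> continuous_on A (f s)"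
  shows "continuous_on A (\<lambda>x. Max ((\<lambda>s. f s x) ` S))"
  using assms
proof (induction S rule: finite_ne_induct)
  case (insert s S)
  then have "continuous_on A (\<lambda>x. max (f s x) (Max ((\<lambda>s. f s x) ` S)))"
    by (intro continuous_on_max) auto
  then show ?case using insert by simp
qed simp

lemma centres_eq: "centres (i, j) = {e i + e j, e i - e j, - e i + e j, - e i - e j}"
proof -
  have "centres (i, j) = (\<Union>s\<in>{1, -1}. \<Union>t\<in>{1, -1}. {s *\<^sub>R e i + t *\<^sub>R e j})"
    unfolding centres_def prod.case by blast
  then show ?thesis by (auto simp: algebra_simps)
qed

lemma frame_e: "frame (e 1) (e 2) (e 3) (e 4)"
proof -
  have "x = (x \<bullet> e 1) *\<^sub>R e 1 + (x \<bullet> e 2) *\<^sub>R e 2 + (x \<bullet> e 3) *\<^sub>R e 3 + (x \<bullet> e 4) *\<^sub>R e 4" for x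
    by (simp add: vec_eq_iff forall_4 e_def inner_axis) (simp add: axis_def)
  moreover have "all_centres = {e 1 + e 2, e 1 - e 2, - e 1 + e 2, - e 1 - e 2, e 1 + e 3, e 1 - e 3, - e 1 + e 3, - e 1 - e 3,
       e 1 + e 4, e 1 - e 4, - e 1 + e 4, - e 1 - e 4, e 2 + e 3, e 2 - e 3, - e 2 + e 3, - e 2 - e 3,
       e 2 + e 4, e 2 - e 4, - e 2 + e 4, - e 2 - e 4, e 3 + e 4, e 3 - e 4, - e 3 + e 4, - e 3 - e 4}"
    unfolding all_centres_def index_pairs_eq by (simp only: UN_insert UN_empty centres_eq Un_empty_right) blast
  ultimately show ?thesis
    unfolding frame_def by (intro conjI allI) (simp_all add: e_inner)
qed

lemma up_tendsto:
  assumes f: "frame u b1 b2 b3" and "0 < t" "(P1 \<longlongrightarrow> p1) F" "(P2 \<longlongrightarrow> p2) F" "(P3 \<longlongrightarrow> p3) F" "(S \<longlongrightarrow> t) F"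
  shows "((\<lambda>x. up u b1 b2 b3 (P1 x) (P2 x) (P3 x) (S x)) \<longlongrightarrow> up u b1 b2 b3 p1 p2 p3 t) F"
proof -
  have "0 < 1/2 + 2 * (p1^2 + p2^2 + p3^2 + t^2) + 2 * t" using assms(2) by (simp add: add_nonneg_pos)
  then show ?thesis unfolding up_def upv_def by (intro tendsto_intros assms) auto
qed

text \<open>Labels are sign maps, so invariance of \<open>wt\<close> makes the largest weighted
  height a function on the glued manifold.\<close>

locale weighted_geodesic = closed_geodesic +
  fixes wt :: "real^4 \<Rightarrow> real"
  assumes wt_pos: "0 < wt w"
    and wt_sign_map: "k \<in> sign_maps \<Longrightarrow> wt (k w) = wt w"
    and wt_ratio: "wt u < 2 * wt w"
begin

lemma in_M_lift: "in_M \<epsilon> a b \<Longrightarrow> x \<in> Q \<Longrightarrow> Fn a b x = 0 \<Longrightarrow> lift \<epsilon> x \<in> M"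
  using plane_germ_near[OF in_M_germ] by metis

lemma max_height_exists:
  obtains \<epsilon> z u where "z \<in> Q" "lift \<epsilon> z \<in> M" "u \<in> vertices"
    "\<And>\<epsilon>' x w. x \<in> Q \<Longrightarrow> lift \<epsilon>' x \<in> M \<Longrightarrow> w \<in> vertices \<Longrightarrow> wt w * height w x \<le> wt u * height u z"
proof -
  define H where "H x = Max ((\<lambda>w. wt w * height w x) ` vertices)" for x
  have ne: "vertices \<noteq> {}" using frame_vertices(1)[OF frame_e] by blast
  have ge: "wt w * height w x \<le> H x" if "w \<in> vertices" for w x
    unfolding H_def using that finite_vertices by (intro Max_ge) auto
  have att: "\<exists>w\<in>vertices. H x = wt w * height w x" for x
  proof -
    have "H x \<in> (\<lambda>w. wt w * height w x) ` vertices"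
      unfolding H_def using ne finite_vertices by (intro Max_in) auto
    then show ?thesis by blast
  qed
  have kv: "k w \<in> vertices" if "k \<in> sign_maps" "w \<in> vertices" for k w
    using frame_sign_map[OF that(1)] that(2) unfolding vertices_def by blast
  have le: "H (k x) \<le> H x" if k: "k \<in> sign_maps" for k x
  proof -
    obtain w where w: "w \<in> vertices" "H (k x) = wt w * height w (k x)" using att by blast
    have "H (k x) = wt (k w) * height (k w) x"
      using w(2) wt_sign_map[OF k] height_sign_map[OF k, of "k w" x] by (simp add: sign_maps_invol[OF k])
    then show ?thesis using ge[OF kv[OF k w(1)]] by simp
  qed
  have inv: "H (k x) = H x" if k: "k \<in> sign_maps" for k x
    using le[OF k, of x] le[OF k, of "k x"] by (simp add: sign_maps_invol[OF k])
  have cont: "continuous_on Q H"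
    unfolding H_def
    by (intro continuous_on_Max_family finite_vertices ne continuous_on_mult_left continuous_height vertex_inner)
  obtain \<epsilon> z where z: "z \<in> Q" "lift \<epsilon> z \<in> M" "\<And>\<epsilon>' x. x \<in> Q \<Longrightarrow> lift \<epsilon>' x \<in> M \<Longrightarrow> H x \<le> H z"
    using invariant_attains_max[OF cont] inv by metis
  obtain u where u: "u \<in> vertices" "H z = wt u * height u z" using att by blast
  show ?thesis
  proof (rule that[OF z(1,2) u(1)])
    fix \<epsilon>' x w assume "x \<in> Q" "lift \<epsilon>' x \<in> M" "w \<in> vertices"
    then show "wt w * height w x \<le> wt u * height u z" using z(3) ge u(2) by (metis order_trans)
  qed
qed

text \<open>In coordinates at \<open>u\<close> both heights contain the factor \<open>2 * t\<close>;
  cancelling it leaves an inequality that is affine in \<open>upv\<close>.\<close>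

lemma dominance:
  assumes f: "frame u b1 b2 b3" and t: "0 < t" and w: "w \<in> vertices"
    and le: "wt w * height w (up u b1 b2 b3 p1 p2 p3 t) \<le> wt u * height u (up u b1 b2 b3 p1 p2 p3 t)"
  shows "wt w \<le> wt u * (1/2 + 2 * (p1^2 + p2^2 + p3^2 + t^2) - w \<bullet> upv u b1 b2 b3 p1 p2 p3 t)"
proof -
  let ?x = "up u b1 b2 b3 p1 p2 p3 t"
  define l where "l = 1/2 + 2 * (p1^2 + p2^2 + p3^2 + t^2) - w \<bullet> upv u b1 b2 b3 p1 p2 p3 t"
  have h: "height w ?x = 2 * t / l" unfolding l_def by (rule height_up[OF f t])
  have "0 < height w ?x"
    unfolding height_def using up_H4[OF f t] height_denom_pos[OF vertex_inner[OF w] up_H4[OF f t]]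
    unfolding mem_H4 by (intro divide_pos_pos) simp_all
  then have l: "0 < l" using h t by (simp add: zero_less_divide_iff)
  have "wt w * (2 * t / l) \<le> wt u * (2 * t)" using le unfolding h height_up_self[OF f t] .
  then have "wt w * (2 * t) \<le> wt u * l * (2 * t)" using l by (simp add: field_simps)
  then show ?thesis using t unfolding l_def[symmetric] by simp
qed

text \<open>This is the step for which the weights have to be within a factor two of each other.\<close>

lemma floors_strict:
  assumes f: "frame u b1 b2 b3" and t: "0 < t"
    and le: "\<And>w. w \<in> vertices \<Longrightarrow> wt w * height w (up u b1 b2 b3 p1 p2 p3 t) \<le> wt u * height u (up u b1 b2 b3 p1 p2 p3 t)"
  defines "T \<equiv> p1^2 + p2^2 + p3^2 + t^2"
  shows "\<bar>p1\<bar> < 2 * T" "\<bar>p2\<bar> < 2 * T" "\<bar>p3\<bar> < 2 * T"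
    "\<bar>p1\<bar> + \<bar>p2\<bar> < 1/4 + T" "\<bar>p1\<bar> + \<bar>p3\<bar> < 1/4 + T" "\<bar>p2\<bar> + \<bar>p3\<bar> < 1/4 + T"
proof -
  let ?p = "upv u b1 b2 b3 p1 p2 p3 t"
  have l: "1/2 < 1/2 + 2 * T - w \<bullet> ?p" if w: "w \<in> vertices" for w
  proof -
    have "wt u < 2 * wt w" by (rule wt_ratio)
    also have "2 * wt w \<le> 2 * (wt u * (1/2 + 2 * T - w \<bullet> ?p))"
      using dominance[OF f t w le[OF w]] unfolding T_def[symmetric] by (rule mult_left_mono) simp
    also have "\<dots> = wt u * (2 * (1/2 + 2 * T - w \<bullet> ?p))" by (simp only: mult.left_commute)
    finally have "1 < 2 * (1/2 + 2 * T - w \<bullet> ?p)" using wt_pos[of u] by simp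
    then show ?thesis by simp
  qed
  note fv = frame_vertices[OF f]
  have T: "0 < T" using t by (simp add: T_def add_nonneg_pos)
  show "\<bar>p1\<bar> < 2 * T" "\<bar>p2\<bar> < 2 * T" "\<bar>p3\<bar> < 2 * T"
    using l[OF fv(3)] l[OF fv(4)] l[OF fv(5)] l[OF fv(6)] l[OF fv(7)] l[OF fv(8)] T
    by (auto simp: upv_inner_centres[OF f] abs_less_iff)
  have s: "\<exists>s. \<bar>s\<bar> = 1 \<and> s * x = \<bar>x\<bar>" for x :: real
    by (rule exI[of _ "if x < 0 then -1 else 1"]) simp
  obtain s1 s2 s3 where s: "\<bar>s1\<bar> = 1" "\<bar>s2\<bar> = 1" "\<bar>s3\<bar> = 1" "s1 * p1 = \<bar>p1\<bar>" "s2 * p2 = \<bar>p2\<bar>" "s3 * p3 = \<bar>p3\<bar>"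
    using s by metis
  have "((1/2) *\<^sub>R (u + s1 *\<^sub>R b1 + s2 *\<^sub>R b2 + s3 *\<^sub>R b3)) \<bullet> ?p
    = (1/2) * (2 * T - 1/2) + s1 * p1 + s2 * p2 + s3 * p3"
    by (simp add: inner_add_left upv_inner_centres[OF f] T_def algebra_simps)
  then have "\<bar>p1\<bar> + \<bar>p2\<bar> + \<bar>p3\<bar> < 1/4 + T"
    using l[OF frame_corner[OF f s(1-3)]] unfolding s(4-6) by (simp add: field_simps)
  then show "\<bar>p1\<bar> + \<bar>p2\<bar> < 1/4 + T" "\<bar>p1\<bar> + \<bar>p3\<bar> < 1/4 + T" "\<bar>p2\<bar> + \<bar>p3\<bar> < 1/4 + T"
    by linarith+
qed

text \<open>A point at which the inequalities for the hemispheres are strict can be moved a little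
  along any path; only the walls have to be watched. \<open>R\<close> carries one more condition
  that holds for small parameters.\<close>

lemma up_move:
  assumes f: "frame u b1 b2 b3" and t: "0 < t"
    and lim: "(P1 \<longlongrightarrow> p1) (at_right 0)" "(P2 \<longlongrightarrow> p2) (at_right 0)" "(P3 \<longlongrightarrow> p3) (at_right 0)" "(S \<longlongrightarrow> t) (at_right 0)"
    and V: "open V" "up u b1 b2 b3 p1 p2 p3 t \<in> V"
    and fl: "\<bar>p1\<bar> < 2 * (p1^2 + p2^2 + p3^2 + t^2)" "\<bar>p2\<bar> < 2 * (p1^2 + p2^2 + p3^2 + t^2)"
      "\<bar>p3\<bar> < 2 * (p1^2 + p2^2 + p3^2 + t^2)" "\<bar>p1\<bar> + \<bar>p2\<bar> < 1/4 + (p1^2 + p2^2 + p3^2 + t^2)"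
      "\<bar>p1\<bar> + \<bar>p3\<bar> < 1/4 + (p1^2 + p2^2 + p3^2 + t^2)" "\<bar>p2\<bar> + \<bar>p3\<bar> < 1/4 + (p1^2 + p2^2 + p3^2 + t^2)"
    and ev: "eventually R (at_right (0::real))"
  obtains s where "0 < s" "s < 1" "R s" "0 < S s" "up u b1 b2 b3 (P1 s) (P2 s) (P3 s) (S s) \<in> V"
    "wall_ok (P1 s) (P2 s) (P3 s) \<Longrightarrow> up u b1 b2 b3 (P1 s) (P2 s) (P3 s) (S s) \<in> Q"
    "\<bar>P1 s\<bar> < 1/2 \<Longrightarrow> \<bar>P2 s\<bar> < 1/2 \<Longrightarrow> \<bar>P3 s\<bar> < 1/2 \<Longrightarrow> up u b1 b2 b3 (P1 s) (P2 s) (P3 s) (S s) \<in> interior_Q"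
proof -
  let ?T = "\<lambda>s. (P1 s)^2 + (P2 s)^2 + (P3 s)^2 + (S s)^2"
  have pos: "eventually (\<lambda>s. 0 < g s) (at_right (0::real))" if "(g \<longlongrightarrow> l) (at_right 0)" "0 < l" for g and l :: real
    using order_tendstoD(1)[OF that] .
  have tT: "(?T \<longlongrightarrow> p1^2 + p2^2 + p3^2 + t^2) (at_right 0)" by (intro tendsto_intros lim)
  have e1: "eventually (\<lambda>s. 0 < 2 * ?T s - \<bar>P1 s\<bar>) (at_right 0)"
    by (rule pos[OF tendsto_diff[OF tendsto_mult[OF tendsto_const tT] tendsto_rabs[OF lim(1)]]]) (use fl in simp)
  have e2: "eventually (\<lambda>s. 0 < 2 * ?T s - \<bar>P2 s\<bar>) (at_right 0)"
    by (rule pos[OF tendsto_diff[OF tendsto_mult[OF tendsto_const tT] tendsto_rabs[OF lim(2)]]]) (use fl in simp)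
  have e3: "eventually (\<lambda>s. 0 < 2 * ?T s - \<bar>P3 s\<bar>) (at_right 0)"
    by (rule pos[OF tendsto_diff[OF tendsto_mult[OF tendsto_const tT] tendsto_rabs[OF lim(3)]]]) (use fl in simp)
  have e4: "eventually (\<lambda>s. 0 < 1/4 + ?T s - (\<bar>P1 s\<bar> + \<bar>P2 s\<bar>)) (at_right 0)"
    by (rule pos[OF tendsto_diff[OF tendsto_add[OF tendsto_const tT]
      tendsto_add[OF tendsto_rabs[OF lim(1)] tendsto_rabs[OF lim(2)]]]]) (use fl in simp)
  have e5: "eventually (\<lambda>s. 0 < 1/4 + ?T s - (\<bar>P1 s\<bar> + \<bar>P3 s\<bar>)) (at_right 0)"
    by (rule pos[OF tendsto_diff[OF tendsto_add[OF tendsto_const tT]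
      tendsto_add[OF tendsto_rabs[OF lim(1)] tendsto_rabs[OF lim(3)]]]]) (use fl in simp)
  have e6: "eventually (\<lambda>s. 0 < 1/4 + ?T s - (\<bar>P2 s\<bar> + \<bar>P3 s\<bar>)) (at_right 0)"
    by (rule pos[OF tendsto_diff[OF tendsto_add[OF tendsto_const tT]
      tendsto_add[OF tendsto_rabs[OF lim(2)] tendsto_rabs[OF lim(3)]]]]) (use fl in simp)
  have e7: "eventually (\<lambda>s. 0 < S s) (at_right 0)" by (rule pos[OF lim(4) t])
  have e8: "eventually (\<lambda>s. up u b1 b2 b3 (P1 s) (P2 s) (P3 s) (S s) \<in> V) (at_right 0)"
    by (rule topological_tendstoD[OF up_tendsto[OF f t lim] V])
  have e9: "eventually (\<lambda>s::real. s \<in> {0<..<1}) (at_right 0)" by (rule eventually_at_right_real) simp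
  obtain s where s: "0 < 2 * ?T s - \<bar>P1 s\<bar>" "0 < 2 * ?T s - \<bar>P2 s\<bar>" "0 < 2 * ?T s - \<bar>P3 s\<bar>"
    "0 < 1/4 + ?T s - (\<bar>P1 s\<bar> + \<bar>P2 s\<bar>)" "0 < 1/4 + ?T s - (\<bar>P1 s\<bar> + \<bar>P3 s\<bar>)" "0 < 1/4 + ?T s - (\<bar>P2 s\<bar> + \<bar>P3 s\<bar>)"
    "0 < S s" "up u b1 b2 b3 (P1 s) (P2 s) (P3 s) (S s) \<in> V" "s \<in> {0<..<1}" "R s"
    using eventually_happens'[OF trivial_limit_at_right_real
      eventually_conj[OF e1 eventually_conj[OF e2 eventually_conj[OF e3 eventually_conj[OF e4 eventually_conj[OF e5
      eventually_conj[OF e6 eventually_conj[OF e7 eventually_conj[OF e8 eventually_conj[OF e9 ev]]]]]]]]]] by auto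
  show ?thesis
  proof (rule that[of s])
    show "wall_ok (P1 s) (P2 s) (P3 s) \<Longrightarrow> up u b1 b2 b3 (P1 s) (P2 s) (P3 s) (S s) \<in> Q"
      unfolding up_Q_iff(1)[OF f s(7)] using s(1-6) by simp
    show "\<bar>P1 s\<bar> < 1/2 \<Longrightarrow> \<bar>P2 s\<bar> < 1/2 \<Longrightarrow> \<bar>P3 s\<bar> < 1/2 \<Longrightarrow>
      up u b1 b2 b3 (P1 s) (P2 s) (P3 s) (S s) \<in> interior_Q"
      unfolding up_Q_iff(2)[OF f s(7)] using s(1-6) by simp
  qed (use s in auto)
qed

text \<open>Centre and position are interleaved so that permuting the frame permutes adjacent pairs.
  The weight \<open>W\<close> is a separate argument because \<open>u\<close> changes when a wall is
  crossed while its weight does not.\<close>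

definition cap_germ :: "bool \<Rightarrow> real^4 \<Rightarrow> real^4 \<Rightarrow> real^4 \<Rightarrow> real^4 \<Rightarrow> real \<Rightarrow> real \<Rightarrow> real \<Rightarrow> real \<Rightarrow> real \<Rightarrow>
    real \<Rightarrow> real \<Rightarrow> real \<Rightarrow> real \<Rightarrow> real \<Rightarrow> bool" where
  "cap_germ \<epsilon> u b1 b2 b3 W d R t c1 p1 c2 p2 c3 p3 \<longleftrightarrow> frame u b1 b2 b3 \<and> wt u = W \<and>
     (p1 - c1)^2 + (p2 - c2)^2 + (p3 - c3)^2 + t^2 = R \<and>
     plane_germ \<epsilon> (capa u b1 b2 b3 d c1 c2 c3 R) (capb d c1 c2 c3 R) (up u b1 b2 b3 p1 p2 p3 t)"

lemma cap_germ_swap12: "cap_germ \<epsilon> u b1 b2 b3 W d R t c1 p1 c2 p2 c3 p3 \<Longrightarrow> cap_germ \<epsilon> u b2 b1 b3 W d R t c2 p2 c1 p1 c3 p3"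
  unfolding cap_germ_def using frame_swap12[of u b1 b2 b3] cap_swap12(1)[of u b1 b2 b3 d c1 c2 c3 R] cap_swap12(2)[of d c1 c2 c3 R]
    up_swap12[of u b1 b2 b3 p1 p2 p3 t] by (simp add: add_ac)

lemma cap_germ_swap23: "cap_germ \<epsilon> u b1 b2 b3 W d R t c1 p1 c2 p2 c3 p3 \<Longrightarrow> cap_germ \<epsilon> u b1 b3 b2 W d R t c1 p1 c3 p3 c2 p2"
  unfolding cap_germ_def using frame_swap23[of u b1 b2 b3] cap_swap23(1)[of u b1 b2 b3 d c1 c2 c3 R] cap_swap23(2)[of d c1 c2 c3 R]
    up_swap23[of u b1 b2 b3 p1 p2 p3 t] by (simp add: add_ac)

text \<open>If the point lies on a wall and the centre beyond it, crossing the wall replaces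
  \<open>c1\<close> by \<open>1 - c1\<close>, which is on the near side. Relative to the new frame
  the position of the point stays the same.\<close>

lemma cap_germ_fold:
  assumes g: "cap_germ \<epsilon> u b1 b2 b3 W d R t c1 p1 c2 p2 c3 p3" and t: "0 < t" and p: "0 \<le> p1" "p1 \<le> 1/2"
  shows "\<exists>\<epsilon> u b1 b2 b3 c1. cap_germ \<epsilon> u b1 b2 b3 W d R t c1 p1 c2 p2 c3 p3 \<and> (p1 = 1/2 \<longrightarrow> c1 \<le> 1/2)"
proof (cases "p1 = 1/2 \<and> 1/2 < c1")
  case True
  have f: "frame u b1 b2 b3" and W: "wt u = W"
    and RR: "(p1 - c1)^2 + (p2 - c2)^2 + (p3 - c3)^2 + t^2 = R"
    and germ: "plane_germ \<epsilon> (capa u b1 b2 b3 d c1 c2 c3 R) (capb d c1 c2 c3 R) (up u b1 b2 b3 p1 p2 p3 t)"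
    using g unfolding cap_germ_def by blast+
  have "u + b1 \<in> all_centres" unfolding frame_centres[OF f] by blast
  then obtain ij where ij: "ij \<in> index_pairs" "u + b1 \<in> centres ij" unfolding all_centres_def by blast
  have z: "Fn (u + b1) 1 (up u b1 b2 b3 p1 p2 p3 t) = 0"
    unfolding Fn_up_iff[OF f t] using True by (simp add: inner_add_left upv_inner_centres[OF f])
  note k = kdiag_sign_maps[of "code_digit code ij"]
  have "(p1 - (1 - c1))^2 + (p2 - c2)^2 + (p3 - c3)^2 + t^2 = R"
  proof -
    have "(p1 - (1 - c1))^2 = (p1 - c1)^2"
      unfolding conjunct1[OF True] by (simp add: power2_eq_square algebra_simps)
    then show ?thesis using RR by simp
  qed
  then have "cap_germ (orientation_preserving (lab ij) \<longleftrightarrow> \<not> \<epsilon>) (lab ij u) (lab ij b1) (lab ij b2) (lab ij b3) W d R t (1 - c1) p1 c2 p2 c3 p3"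
    unfolding cap_germ_def
    using plane_germ_side[OF germ ij z, unfolded cap_reflect[OF f] sign_map_cap[OF k] sign_map_up[OF k]]
      frame_sign_map[OF k f] wt_sign_map[OF k, of u] W by blast
  then show ?thesis using True by (metis diff_le_eq less_eq_real_def linorder_not_le add_mono field_sum_of_halves)
next
  case False
  then show ?thesis using g by (meson not_le)
qed

text \<open>Folding in one coordinate affects neither the positions nor the other centre
  coordinates, so over an edge or a corner of the cube the walls can be treated one after the
  other.\<close>

lemma cap_germ_fold_all:
  assumes g: "cap_germ \<epsilon> u b1 b2 b3 W d R t c1 p1 c2 p2 c3 p3" and t: "0 < t"
    and p: "0 \<le> p1" "p1 \<le> 1/2" "0 \<le> p2" "p2 \<le> 1/2" "0 \<le> p3" "p3 \<le> 1/2"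
  obtains \<epsilon> u b1 b2 b3 c1 c2 c3 where "cap_germ \<epsilon> u b1 b2 b3 W d R t c1 p1 c2 p2 c3 p3"
    "p1 = 1/2 \<Longrightarrow> c1 \<le> 1/2" "p2 = 1/2 \<Longrightarrow> c2 \<le> 1/2" "p3 = 1/2 \<Longrightarrow> c3 \<le> 1/2"
proof -
  obtain \<epsilon>1 u1 x1 y1 z1 k1 where 1: "cap_germ \<epsilon>1 u1 x1 y1 z1 W d R t k1 p1 c2 p2 c3 p3" "p1 = 1/2 \<longrightarrow> k1 \<le> 1/2"
    using cap_germ_fold[OF g t p(1,2)] by blast
  obtain \<epsilon>2 u2 x2 y2 z2 k2 where 2: "cap_germ \<epsilon>2 u2 x2 y2 z2 W d R t k2 p2 k1 p1 c3 p3" "p2 = 1/2 \<longrightarrow> k2 \<le> 1/2"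
    using cap_germ_fold[OF cap_germ_swap12[OF 1(1)] t p(3,4)] by blast
  obtain \<epsilon>3 u3 x3 y3 z3 k3 where 3: "cap_germ \<epsilon>3 u3 x3 y3 z3 W d R t k3 p3 k1 p1 k2 p2" "p3 = 1/2 \<longrightarrow> k3 \<le> 1/2"
    using cap_germ_fold[OF cap_germ_swap23[OF cap_germ_swap12[OF cap_germ_swap23[OF 2(1)]]] t p(5,6)] by blast
  show ?thesis
    using that[OF cap_germ_swap23[OF cap_germ_swap12[OF 3(1)]]] 1(2) 2(2) 3(2) by blast
qed

end

lemma up_signs:
  assumes "\<bar>s1\<bar> = 1" "\<bar>s2\<bar> = 1" "\<bar>s3\<bar> = 1"
  shows "up u (s1 *\<^sub>R b1) (s2 *\<^sub>R b2) (s3 *\<^sub>R b3) (s1 * p1) (s2 * p2) (s3 * p3) t = up u b1 b2 b3 p1 p2 p3 t"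
proof -
  have "s1 = 1 \<or> s1 = -1" "s2 = 1 \<or> s2 = -1" "s3 = 1 \<or> s3 = -1" using assms by linarith+
  then show ?thesis by (elim disjE) (simp_all add: up_def upv_def)
qed

lemma up_surj_nonneg:
  assumes u: "u \<in> vertices" and x: "x \<in> H4"
  obtains b1 b2 b3 p1 p2 p3 t where "frame u b1 b2 b3" "0 < t" "x = up u b1 b2 b3 p1 p2 p3 t" "0 \<le> p1" "0 \<le> p2" "0 \<le> p3"
proof -
  obtain b1 b2 b3 where f: "frame u b1 b2 b3" using u unfolding vertices_def by blast
  obtain p1 p2 p3 t where t: "0 < t" "x = up u b1 b2 b3 p1 p2 p3 t" by (rule up_surj[OF f x]) blast
  have s: "\<exists>s. \<bar>s\<bar> = 1 \<and> 0 \<le> s * x" for x :: real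
    by (rule exI[of _ "if x < 0 then -1 else 1"]) simp
  obtain s1 s2 s3 where s: "\<bar>s1\<bar> = 1" "\<bar>s2\<bar> = 1" "\<bar>s3\<bar> = 1" "0 \<le> s1 * p1" "0 \<le> s2 * p2" "0 \<le> s3 * p3"
    using s by metis
  show ?thesis
    using that[OF frame_signs[OF f s(1-3)] t(1) _ s(4-6)] up_signs[OF s(1-3)] t(2) by simp
qed

lemma cap_determined:
  assumes f: "frame u b1 b2 b3" and d: "4 * d^2 * R = 1"
    and eq: "capa u b1 b2 b3 d c1' c2' c3' R = capa u b1 b2 b3 d c1 c2 c3 R \<and> capb d c1' c2' c3' R = capb d c1 c2 c3 R \<or>
      capa u b1 b2 b3 d c1' c2' c3' R = - capa u b1 b2 b3 d c1 c2 c3 R \<and> capb d c1' c2' c3' R = - capb d c1 c2 c3 R"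
  shows "c1' = c1" "c2' = c2" "c3' = c3"
proof -
  have d0: "d \<noteq> 0" using d by auto
  note i = cap_inner[OF f, of d c1 c2 c3 R] and i' = cap_inner[OF f, of d c1' c2' c3' R]
  have "capa u b1 b2 b3 d c1' c2' c3' R = capa u b1 b2 b3 d c1 c2 c3 R"
  proof (rule ccontr)
    assume "\<not> ?thesis"
    then have n: "capa u b1 b2 b3 d c1' c2' c3' R = - capa u b1 b2 b3 d c1 c2 c3 R"
      "capb d c1' c2' c3' R = - capb d c1 c2 c3 R" using eq by auto
    have "d = - d" using i(5) i'(5) unfolding n inner_minus_left by linarith
    then show False using d0 by simp
  qed
  then have "- 2 * d * c1' = - 2 * d * c1" "- 2 * d * c2' = - 2 * d * c2" "- 2 * d * c3' = - 2 * d * c3"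
    using i i' by metis+
  then show "c1' = c1" "c2' = c2" "c3' = c3" using d0 by simp_all
qed

context weighted_geodesic
begin

text \<open>At a point of maximal weighted height, the hypersurface is a hemisphere topped by the
  point: across a wall it is continued by folding.\<close>

lemma top_exists:
  obtains \<epsilon> a b u z where "in_M \<epsilon> a b" "u \<in> vertices" "a \<bullet> u - b \<noteq> 0" "z \<in> Q" "Fn a b z = 0"
    "height u z = 1 / \<bar>a \<bullet> u - b\<bar>"
    "\<And>\<epsilon>' a' b' x w. in_M \<epsilon>' a' b' \<Longrightarrow> x \<in> Q \<Longrightarrow> Fn a' b' x = 0 \<Longrightarrow> w \<in> vertices \<Longrightarrow>
      wt w * height w x \<le> wt u / \<bar>a \<bullet> u - b\<bar>"
proof -
  obtain \<epsilon>0 z0 u0 where z0: "z0 \<in> Q" "lift \<epsilon>0 z0 \<in> M" "u0 \<in> vertices" and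
    max0: "\<And>\<epsilon>' x w. x \<in> Q \<Longrightarrow> lift \<epsilon>' x \<in> M \<Longrightarrow> w \<in> vertices \<Longrightarrow> wt w * height w x \<le> wt u0 * height u0 z0"
    using max_height_exists by metis
  obtain x1 x2 x3 p1 p2 p3 t where f0: "frame u0 x1 x2 x3" and t: "0 < t"
    and z0u: "z0 = up u0 x1 x2 x3 p1 p2 p3 t" and p: "0 \<le> p1" "0 \<le> p2" "0 \<le> p3"
    by (rule up_surj_nonneg[OF z0(3) Q_in_H4[OF z0(1)]]) blast
  define W where "W = wt u0"
  have h0: "height u0 z0 = 2 * t" unfolding z0u by (rule height_up_self[OF f0 t])
  have mx: "wt w * height w x \<le> W * (2 * t)" if "x \<in> Q" "lift \<epsilon>' x \<in> M" "w \<in> vertices" for \<epsilon>' x w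
    using max0[OF that] unfolding h0 W_def .
  define T where "T = p1^2 + p2^2 + p3^2 + t^2"
  have wall: "p1 \<le> 1/2" "p2 \<le> 1/2" "p3 \<le> 1/2"
    using z0(1) unfolding z0u up_Q_iff(1)[OF f0 t] wall_ok_def by linarith+
  have fl: "\<bar>p1\<bar> < 2 * T" "\<bar>p2\<bar> < 2 * T" "\<bar>p3\<bar> < 2 * T"
    "\<bar>p1\<bar> + \<bar>p2\<bar> < 1/4 + T" "\<bar>p1\<bar> + \<bar>p3\<bar> < 1/4 + T" "\<bar>p2\<bar> + \<bar>p3\<bar> < 1/4 + T"
    unfolding T_def by (rule floors_strict[OF f0 t]; use max0[OF z0(1,2)] z0u in simp)+
  obtain a0 b0 where g0: "plane_germ \<epsilon>0 a0 b0 z0" "Fn a0 b0 z0 = 0"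
    by (rule plane_germ_exists[OF z0(1,2)]) blast
  have un0: "unitfn a0 b0" using g0(1) unfolding plane_germ_def by blast
  \<comment> \<open>A vertical plane would contain points of the cell above \<open>z0\<close>,
    against maximality.\<close>
  have d0: "a0 \<bullet> u0 - b0 \<noteq> 0"
  proof
    assume "a0 \<bullet> u0 - b0 = 0"
    then have ub: "a0 \<bullet> u0 = b0" by simp
    obtain V where V: "open V" "z0 \<in> V" "\<And>y. y \<in> V \<Longrightarrow> y \<in> Q \<Longrightarrow> lift \<epsilon>0 y \<in> M \<longleftrightarrow> Fn a0 b0 y = 0"
      by (rule plane_germ_near[OF g0(1)]) blast
    obtain s where s: "0 < s" "up u0 x1 x2 x3 p1 p2 p3 (t + s) \<in> V"
      "wall_ok p1 p2 p3 \<Longrightarrow> up u0 x1 x2 x3 p1 p2 p3 (t + s) \<in> Q"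
    proof (rule up_move[OF f0 t, of "\<lambda>s. p1" p1 "\<lambda>s. p2" p2 "\<lambda>s. p3" p3 "\<lambda>s. t + s" V "\<lambda>s. True"])
      show "((\<lambda>s. t + s) \<longlongrightarrow> t) (at_right 0)" by (auto intro!: tendsto_eq_intros)
    qed (use V z0u fl in \<open>auto simp: T_def\<close>)
    let ?y = "up u0 x1 x2 x3 p1 p2 p3 (t + s)"
    have ts: "0 < t + s" using t s(1) by simp
    have yQ: "?y \<in> Q" using s(3) p wall unfolding wall_ok_def by simp
    have e1: "upv u0 x1 x2 x3 p1 p2 p3 (t + s) = upv u0 x1 x2 x3 p1 p2 p3 t + (2 * ((t + s)^2 - t^2)) *\<^sub>R u0"
      unfolding upv_def by (simp add: algebra_simps)
    have e2: "a0 \<bullet> upv u0 x1 x2 x3 p1 p2 p3 t = b0 * (1/2 + 2 * (p1^2 + p2^2 + p3^2 + t^2))"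
      using g0(2) unfolding z0u Fn_up_iff(1)[OF f0 t] .
    have "Fn a0 b0 ?y = 0"
      unfolding Fn_up_iff(1)[OF f0 ts] e1 inner_add_right e2 inner_scaleR_right ub by (simp add: algebra_simps)
    then have "lift \<epsilon>0 ?y \<in> M" using V(3) s(2) yQ by blast
    then have "wt u0 * (2 * (t + s)) \<le> W * (2 * t)"
      using mx[OF yQ _ z0(3)] height_up_self[OF f0 ts, of p1 p2 p3] by metis
    then show False using s(1) wt_pos[of u0] by (simp add: W_def)
  qed
  obtain d c1 c2 c3 R where cap0: "4 * d^2 * R = 1" "0 < R" "a0 = capa u0 x1 x2 x3 d c1 c2 c3 R" "b0 = capb d c1 c2 c3 R"
    by (rule cap_exists[OF f0 un0 d0]) blast
  have dn: "d \<noteq> 0" using cap0(1) by auto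
  have "cap_germ \<epsilon>0 u0 x1 x2 x3 W d R t c1 p1 c2 p2 c3 p3"
    unfolding cap_germ_def
    using f0 g0 cap_up_iff[OF f0 t dn, of c1 c2 c3 R p1 p2 p3] unfolding cap0 z0u W_def by blast
  then obtain \<epsilon> u b1 b2 b3 k1 k2 k3 where germ': "cap_germ \<epsilon> u b1 b2 b3 W d R t k1 p1 k2 p2 k3 p3"
    "p1 = 1/2 \<Longrightarrow> k1 \<le> 1/2" "p2 = 1/2 \<Longrightarrow> k2 \<le> 1/2" "p3 = 1/2 \<Longrightarrow> k3 \<le> 1/2"
    by (rule cap_germ_fold_all[OF _ t p(1) wall(1) p(2) wall(2) p(3) wall(3)]) blast
  define a where "a = capa u b1 b2 b3 d k1 k2 k3 R"
  define b where "b = capb d k1 k2 k3 R"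
  define z where "z = up u b1 b2 b3 p1 p2 p3 t"
  have f: "frame u b1 b2 b3" and uW: "wt u = W" and RR: "(p1 - k1)^2 + (p2 - k2)^2 + (p3 - k3)^2 + t^2 = R"
    and germ: "plane_germ \<epsilon> a b z"
    using germ'(1) unfolding cap_germ_def a_def b_def z_def by blast+
  have uv: "u \<in> vertices" using frame_vertices(1)[OF f] .
  have zQ: "z \<in> Q" by (rule plane_germ_Q[OF germ])
  have Fz: "Fn a b z = 0"
    unfolding a_def b_def z_def cap_up_iff[OF f t dn] by (rule RR)
  obtain V where V: "open V" "z \<in> V" "\<And>y. y \<in> V \<Longrightarrow> y \<in> Q \<Longrightarrow> lift \<epsilon> y \<in> M \<longleftrightarrow> Fn a b y = 0"
    by (rule plane_germ_near[OF germ]) blast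
  \<comment> \<open>The squared horizontal distance of \<open>z\<close> from the top of its
    hemisphere; maximality will force it to be 0.\<close>
  define E where "E = (k1 - p1)^2 + (k2 - p2)^2 + (k3 - p3)^2"
  have E0: "0 \<le> E" by (simp add: E_def)
  have RE: "R = E + t^2" using RR by (simp add: E_def power2_commute)
  have walls: "eventually (\<lambda>s. \<bar>p + s * (k - p)\<bar> \<le> 1/2) (at_right 0)"
    if pk: "0 \<le> p" "p \<le> 1/2" "p = 1/2 \<Longrightarrow> k \<le> 1/2" for p k :: real
  proof -
    have lim: "((\<lambda>s. p + s * (k - p)) \<longlongrightarrow> p) (at_right 0)" by (auto intro!: tendsto_eq_intros)
    have lo: "eventually (\<lambda>s. - 1/2 < p + s * (k - p)) (at_right 0)"
      by (rule order_tendstoD(1)[OF lim]) (use pk in simp)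
    have hi: "eventually (\<lambda>s. p + s * (k - p) \<le> 1/2) (at_right 0)"
    proof (cases "p = 1/2")
      case True
      then have "k - p \<le> 0" using pk by simp
      have "eventually (\<lambda>s::real. 0 < s) (at_right 0)" by (rule eventually_at_right_less)
      then show ?thesis
      proof (rule eventually_mono)
        fix s :: real assume "0 < s"
        then have "s * (k - p) \<le> 0" using \<open>k - p \<le> 0\<close> by (simp add: mult_nonneg_nonpos)
        from add_mono[OF pk(2) this] show "p + s * (k - p) \<le> 1/2" by simp
      qed
    next
      case False
      then have "eventually (\<lambda>s. p + s * (k - p) < 1/2) (at_right 0)"
        by (intro order_tendstoD(2)[OF lim]) (use pk in simp)
      then show ?thesis by (rule eventually_mono) simp
    qed
    show ?thesis using eventually_conj[OF lo hi] by (rule eventually_mono) (rule abs_leI, simp_all)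
  qed
  have "E = 0"
  proof (rule ccontr)
    assume "E \<noteq> 0"
    then have Ep: "0 < E" using E0 by simp
    \<comment> \<open>The height over the point a fraction \<open>s\<close> of the way towards the
      centre, staying on the hemisphere, which rises on this path. After the folds the path does not
      leave through a wall.\<close>
    let ?S = "\<lambda>s. sqrt (R - (1 - s)^2 * E)"
    let ?P = "\<lambda>p k s. p + s * (k - p)"
    have ev: "eventually (\<lambda>s. wall_ok (?P p1 k1 s) (?P p2 k2 s) (?P p3 k3 s)) (at_right 0)"
      using eventually_conj[OF walls[OF p(1) wall(1) germ'(2)]
        eventually_conj[OF walls[OF p(2) wall(2) germ'(3)] walls[OF p(3) wall(3) germ'(4)]]]
      unfolding wall_ok_def .
    obtain s where s: "0 < s" "s < 1" "wall_ok (?P p1 k1 s) (?P p2 k2 s) (?P p3 k3 s)" "0 < ?S s"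
      "up u b1 b2 b3 (?P p1 k1 s) (?P p2 k2 s) (?P p3 k3 s) (?S s) \<in> V"
      "wall_ok (?P p1 k1 s) (?P p2 k2 s) (?P p3 k3 s) \<Longrightarrow>
        up u b1 b2 b3 (?P p1 k1 s) (?P p2 k2 s) (?P p3 k3 s) (?S s) \<in> Q"
    proof (rule up_move[OF f t _ _ _ _ V(1) V(2)[unfolded z_def] fl[unfolded T_def] ev])
      show "(?P p1 k1 \<longlongrightarrow> p1) (at_right 0)" "(?P p2 k2 \<longlongrightarrow> p2) (at_right 0)" "(?P p3 k3 \<longlongrightarrow> p3) (at_right 0)"
        by (auto intro!: tendsto_eq_intros)
      have "(?S \<longlongrightarrow> sqrt (R - (1 - 0)^2 * E)) (at_right 0)" by (intro tendsto_intros)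
      then show "(?S \<longlongrightarrow> t) (at_right 0)" using t by (simp add: RE)
    qed blast
    let ?y = "up u b1 b2 b3 (?P p1 k1 s) (?P p2 k2 s) (?P p3 k3 s) (?S s)"
    have yQ: "?y \<in> Q" by (rule s(6)[OF s(3)])
    have S2: "(?S s)^2 = R - (1 - s)^2 * E" using s(4) by simp
    have "(?P p1 k1 s - k1)^2 + (?P p2 k2 s - k2)^2 + (?P p3 k3 s - k3)^2 = (1 - s)^2 * E"
      unfolding E_def by algebra
    then have "Fn a b ?y = 0" unfolding a_def b_def cap_up_iff[OF f s(4) dn] S2 by simp
    then have "lift \<epsilon> ?y \<in> M" using V(3)[OF s(5) yQ] by blast
    then have "W * (2 * ?S s) \<le> W * (2 * t)"
      using mx[OF yQ _ uv] height_up_self[OF f s(4)] uW by metis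
    then have "?S s \<le> t" using wt_pos[of u] unfolding uW[symmetric] by simp
    then have "(?S s)^2 \<le> t^2" using s(4) by (intro power_mono) simp_all
    then have "E * (s * (2 - s)) \<le> 0" unfolding S2 RE by (simp add: power2_eq_square algebra_simps)
    moreover have "0 < E * (s * (2 - s))" using Ep s(1,2) by simp
    ultimately show False by simp
  qed
  then have kp: "k1 = p1" "k2 = p2" "k3 = p3"
    unfolding E_def by (simp_all add: add_nonneg_eq_0_iff)
  have Rt: "R = t^2" using RE \<open>E = 0\<close> by simp
  \<comment> \<open>The top may lie on a wall, so it is shifted along the hemisphere towards the
    axis of the prism to obtain an interior point.\<close>
  have "\<exists>y\<in>interior_Q. Fn a b y = 0"
  proof -
    let ?C = "p1^2 + p2^2 + p3^2"
    let ?S = "\<lambda>s. sqrt (R - s^2 * ?C)"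
    let ?P = "\<lambda>p s. (1 - s) * p"
    obtain s where s: "0 < s" "s < 1" "0 < ?S s"
      "\<bar>?P p1 s\<bar> < 1/2 \<Longrightarrow> \<bar>?P p2 s\<bar> < 1/2 \<Longrightarrow> \<bar>?P p3 s\<bar> < 1/2 \<Longrightarrow>
        up u b1 b2 b3 (?P p1 s) (?P p2 s) (?P p3 s) (?S s) \<in> interior_Q"
    proof (rule up_move[OF f t _ _ _ _ open_UNIV UNIV_I fl[unfolded T_def] always_eventually[OF allI[OF TrueI]]])
      show "(?P p1 \<longlongrightarrow> p1) (at_right 0)" "(?P p2 \<longlongrightarrow> p2) (at_right 0)" "(?P p3 \<longlongrightarrow> p3) (at_right 0)"
        by (auto intro!: tendsto_eq_intros)
      have "(?S \<longlongrightarrow> sqrt (R - 0^2 * ?C)) (at_right 0)" by (intro tendsto_intros)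
      then show "(?S \<longlongrightarrow> t) (at_right 0)" using t by (simp add: Rt)
    qed blast
    have w: "\<bar>?P p s\<bar> < 1/2" if "0 \<le> p" "p \<le> 1/2" for p
    proof (cases "p = 0")
      case False
      then have "(1 - s) * p < 1 * p" using s(1) that by (intro mult_strict_right_mono) auto
      moreover have "0 \<le> (1 - s) * p" using s(2) that by simp
      ultimately show ?thesis using that by simp
    qed simp
    have S2: "(?S s)^2 = R - s^2 * ?C" using s(3) by simp
    have "(?P p1 s - k1)^2 + (?P p2 s - k2)^2 + (?P p3 s - k3)^2 = s^2 * ?C"
      unfolding kp by algebra
    then have "Fn a b (up u b1 b2 b3 (?P p1 s) (?P p2 s) (?P p3 s) (?S s)) = 0"
      unfolding a_def b_def cap_up_iff[OF f s(3) dn] S2 by simp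
    then show ?thesis using s(4)[OF w[OF p(1) wall(1)] w[OF p(2) wall(2)] w[OF p(3) wall(3)]] by blast
  qed
  then have M: "in_M \<epsilon> a b" using germ_in_M[OF germ Fz] by blast
  have du: "a \<bullet> u - b = d" unfolding a_def b_def by (rule cap_inner(5)[OF f])
  have "(2 * \<bar>d\<bar> * t)^2 = 1" using cap0(1) Rt by (simp add: power_mult_distrib)
  then have "2 * \<bar>d\<bar> * t = 1" using t by (simp add: power2_eq_1_iff) (smt (verit) mult_nonneg_nonneg)
  then have dt: "2 * t = 1 / \<bar>d\<bar>" using dn by (simp add: field_simps)
  show ?thesis
  proof (rule that[OF M uv _ zQ Fz])
    show "a \<bullet> u - b \<noteq> 0" using du dn by simp
    show "height u z = 1 / \<bar>a \<bullet> u - b\<bar>" unfolding du z_def height_up_self[OF f t] dt ..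
    fix \<epsilon>' a' b' x w assume "in_M \<epsilon>' a' b'" "x \<in> Q" "Fn a' b' x = 0" "w \<in> vertices"
    then show "wt w * height w x \<le> wt u / \<bar>a \<bullet> u - b\<bar>"
      using mx[of x \<epsilon>' w] in_M_lift unfolding du uW dt by simp
  qed
qed

end

section \<open>Hemispheres reaching height 1/2, and heights in the projective model\<close>

lemma floors_high:
  fixes p1 p2 p3 t :: real
  assumes "1/2 < t"
  defines "T \<equiv> p1^2 + p2^2 + p3^2 + t^2"
  shows "\<bar>p1\<bar> < 2 * T" "\<bar>p2\<bar> < 2 * T" "\<bar>p3\<bar> < 2 * T"
    "\<bar>p1\<bar> + \<bar>p2\<bar> < 1/4 + T" "\<bar>p1\<bar> + \<bar>p3\<bar> < 1/4 + T" "\<bar>p2\<bar> + \<bar>p3\<bar> < 1/4 + T"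
proof -
  have tt: "1/4 < t^2" using power_strict_mono[OF assms(1), of 2] by (simp add: power2_eq_square)
  have a: "\<bar>x\<bar> \<le> x^2 + 1/4" for x :: real
  proof -
    have "0 \<le> (\<bar>x\<bar> - 1/2)^2" by (rule zero_le_power2)
    then show ?thesis by (simp add: power2_eq_square algebra_simps)
  qed
  note sq = zero_le_power2[of p1] zero_le_power2[of p2] zero_le_power2[of p3]
  have T2: "2 * T = 2 * p1^2 + 2 * p2^2 + 2 * p3^2 + 2 * t^2" by (simp add: T_def)
  show "\<bar>p1\<bar> + \<bar>p2\<bar> < 1/4 + T" "\<bar>p1\<bar> + \<bar>p3\<bar> < 1/4 + T" "\<bar>p2\<bar> + \<bar>p3\<bar> < 1/4 + T"
    using a[of p1] a[of p2] a[of p3] sq tt unfolding T_def by linarith+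
  have a2: "\<bar>x\<bar> < 2 * x^2 + 1/2" for x :: real using a[of x] zero_le_power2[of x] by linarith
  show "\<bar>p1\<bar> < 2 * T" "\<bar>p2\<bar> < 2 * T" "\<bar>p3\<bar> < 2 * T"
    using a2[of p1] a2[of p2] a2[of p3] sq tt unfolding T2 by linarith+
qed

lemma vertex_centre_inner: "w \<in> vertices \<Longrightarrow> v \<in> all_centres \<Longrightarrow> v \<bullet> w \<le> 1"
proof -
  assume "w \<in> vertices" and v: "v \<in> all_centres"
  then obtain b1 b2 b3 where f: "frame w b1 b2 b3" unfolding vertices_def by blast
  show "v \<bullet> w \<le> 1"
    using v unfolding frame_centres[OF f] by (auto simp: inner_add_left inner_diff_left frame_inner[OF f])
qed

text \<open>Geodesics are segments in projective coordinates; the formula is evaluated in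
  \<open>geodesic_constraint\<close> on the geodesic between two ideal vertices.\<close>

lemma height_unklein:
  assumes "y \<in> H4" "w \<bullet> w = 1"
  shows "(height w (unklein y))^2 * (1 - y \<bullet> w)^2 = 1 - y \<bullet> y" "0 < height w (unklein y)"
proof -
  define x where "x = unklein y"
  have x: "x \<in> H4" unfolding x_def by (rule unklein_in[OF assms(1)])
  have y: "y = klein x" unfolding x_def by (rule klein_unklein[OF assms(1), symmetric])
  define n where "n = x \<bullet> x"
  have n: "0 \<le> n" "n < 1" using x unfolding mem_H4 n_def by simp_all
  have D: "0 < 1 + n - 2 * (x \<bullet> w)" using height_denom_pos[OF assms(2) x] by (simp add: n_def)
  have "1 - y \<bullet> w = (1 + n - 2 * (x \<bullet> w)) / (1 + n)"
    unfolding y klein_def n_def[symmetric] using n by (simp add: field_simps)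
  then have "height w x * (1 - y \<bullet> w) = (1 - n) / (1 + n)"
    unfolding height_def n_def[symmetric] using D by simp
  then have "(height w x)^2 * (1 - y \<bullet> w)^2 = ((1 - n) / (1 + n))^2"
    by (simp add: power_mult_distrib[symmetric])
  also have "\<dots> = 1 - y \<bullet> y"
    unfolding y klein_def using n by (simp add: n_def[symmetric] power2_eq_square divide_simps) (simp add: algebra_simps)
  finally show "(height w (unklein y))^2 * (1 - y \<bullet> w)^2 = 1 - y \<bullet> y" unfolding x_def .
  show "0 < height w (unklein y)"
    unfolding height_def x_def[symmetric] n_def[symmetric] using D n by simp
qed

context weighted_geodesic
begin

text \<open>Shrinking the position towards the centre of the cube while staying on the hemisphere
  leaves the walls, and for small shifts the height stays large enough to keep the other sides
  away.\<close>

lemma cap_meets_interior: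
  assumes f: "frame u b1 b2 b3" and d: "4 * d^2 * R = 1" and p: "wall_ok p1 p2 p3" and t: "1/2 < t"
    and on: "(p1 - c1)^2 + (p2 - c2)^2 + (p3 - c3)^2 + t^2 = R"
  shows "\<exists>y\<in>interior_Q. Fn (capa u b1 b2 b3 d c1 c2 c3 R) (capb d c1 c2 c3 R) y = 0"
proof -
  have dn: "d \<noteq> 0" using d by auto
  have t0: "0 < t" using t by simp
  let ?P = "\<lambda>p s. (1 - s) * p"
  let ?S = "\<lambda>s. sqrt (R - ((?P p1 s - c1)^2 + (?P p2 s - c2)^2 + (?P p3 s - c3)^2))"
  obtain s where s: "0 < s" "s < 1" "0 < ?S s"
    "\<bar>?P p1 s\<bar> < 1/2 \<Longrightarrow> \<bar>?P p2 s\<bar> < 1/2 \<Longrightarrow> \<bar>?P p3 s\<bar> < 1/2 \<Longrightarrow>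
      up u b1 b2 b3 (?P p1 s) (?P p2 s) (?P p3 s) (?S s) \<in> interior_Q"
  proof (rule up_move[OF f t0, of "?P p1" p1 "?P p2" p2 "?P p3" p3 ?S UNIV "\<lambda>s. True"])
    show "(?P p1 \<longlongrightarrow> p1) (at_right 0)" "(?P p2 \<longlongrightarrow> p2) (at_right 0)" "(?P p3 \<longlongrightarrow> p3) (at_right 0)"
      by (auto intro!: tendsto_eq_intros)
    have "(?S \<longlongrightarrow> sqrt (R - (((1 - 0) * p1 - c1)^2 + ((1 - 0) * p2 - c2)^2 + ((1 - 0) * p3 - c3)^2))) (at_right 0)"
      by (intro tendsto_intros)
    moreover have "R - (((1 - 0) * p1 - c1)^2 + ((1 - 0) * p2 - c2)^2 + ((1 - 0) * p3 - c3)^2) = t^2"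
      using on by simp
    ultimately show "(?S \<longlongrightarrow> t) (at_right 0)" using t0 by simp
  qed (use floors_high[OF t] in auto)
  have w: "\<bar>?P p s\<bar> < 1/2" if "\<bar>p\<bar> \<le> 1/2" for p
  proof (cases "p = 0")
    case False
    have "\<bar>?P p s\<bar> = (1 - s) * \<bar>p\<bar>" using s(2) by (simp add: abs_mult)
    also have "\<dots> < 1 * \<bar>p\<bar>" using s(1) False by (intro mult_strict_right_mono) auto
    finally show ?thesis using that by simp
  qed simp
  have S2: "(?S s)^2 = R - ((?P p1 s - c1)^2 + (?P p2 s - c2)^2 + (?P p3 s - c3)^2)" using s(3) by simp
  have "Fn (capa u b1 b2 b3 d c1 c2 c3 R) (capb d c1 c2 c3 R) (up u b1 b2 b3 (?P p1 s) (?P p2 s) (?P p3 s) (?S s)) = 0"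
    unfolding cap_up_iff[OF f s(3) dn] S2 by simp
  then show ?thesis using s(4) w p unfolding wall_ok_def by blast
qed

text \<open>The hemisphere meets the wall above height 1/2, where the wall is part of the boundary
  of the cell, so the reflected hemisphere continues \<open>M\<close> in the next cell.\<close>

lemma cap_step:
  assumes f: "frame u b1 b2 b3" and d: "4 * d^2 * R = 1"
    and M: "in_M \<epsilon> (capa u b1 b2 b3 d c1 c2 c3 R) (capb d c1 c2 c3 R)"
    and ij: "ij \<in> index_pairs" "u + b1 \<in> centres ij" and p: "wall_ok (1/2) p2 p3"
    and t: "1/4 < R - ((1/2 - c1)^2 + (p2 - c2)^2 + (p3 - c3)^2)"
  shows "in_M (orientation_preserving (lab ij) \<longleftrightarrow> \<not> \<epsilon>)
    (capa (lab ij u) (lab ij b1) (lab ij b2) (lab ij b3) d (1 - c1) c2 c3 R) (capb d (1 - c1) c2 c3 R)"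
proof -
  note k = kdiag_sign_maps[of "code_digit code ij"]
  have dn: "d \<noteq> 0" using d by auto
  define t' where "t' = sqrt (R - ((1/2 - c1)^2 + (p2 - c2)^2 + (p3 - c3)^2))"
  have t': "1/2 < t'" unfolding t'_def by (rule real_less_rsqrt) (use t in \<open>simp add: power2_eq_square\<close>)
  then have t0: "0 < t'" by simp
  have t2: "t'^2 = R - ((1/2 - c1)^2 + (p2 - c2)^2 + (p3 - c3)^2)"
    unfolding t'_def using t by (intro real_sqrt_pow2) simp
  let ?x = "up u b1 b2 b3 (1/2) p2 p3 t'"
  have x: "?x \<in> Q" using up_high(1)[OF f _ p] t' by simp
  have xv: "Fn (u + b1) 1 ?x = 0"
    unfolding Fn_up_iff[OF f t0] by (simp add: inner_add_left upv_inner_centres[OF f])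
  have xc: "Fn (capa u b1 b2 b3 d c1 c2 c3 R) (capb d c1 c2 c3 R) ?x = 0"
    unfolding cap_up_iff[OF f t0 dn] t2 by simp
  have "(1/2 - (1 - c1))^2 = (1/2 - c1)^2" by (simp add: power2_eq_square algebra_simps)
  then obtain y where y: "y \<in> interior_Q" "Fn (capa u b1 b2 b3 d (1 - c1) c2 c3 R) (capb d (1 - c1) c2 c3 R) y = 0"
    using cap_meets_interior[OF f d p t', of "1 - c1" c2 c3] t2 by auto
  show ?thesis
    using in_M_side[OF M ij x xv xc, unfolded cap_reflect[OF f] sign_map_cap[OF k], OF y] .
qed

text \<open>Over a position equidistant from both centres the two hemispheres of equal radius have a
  common point. Its height of at least 1/2 puts it in the cell, where planes of \<open>M\<close>
  cannot cross.\<close>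

lemma cap_conflict:
  assumes f: "frame u b1 b2 b3" and d: "4 * d^2 * R = 1"
    and M: "in_M \<epsilon> (capa u b1 b2 b3 d c1 c2 c3 R) (capb d c1 c2 c3 R)"
    and M': "in_M \<epsilon> (capa u b1 b2 b3 d c1' c2' c3' R) (capb d c1' c2' c3' R)"
    and p: "wall_ok p1 p2 p3" and t: "1/4 \<le> R - ((p1 - c1)^2 + (p2 - c2)^2 + (p3 - c3)^2)"
    and eq: "(p1 - c1')^2 + (p2 - c2')^2 + (p3 - c3')^2 = (p1 - c1)^2 + (p2 - c2)^2 + (p3 - c3)^2"
  shows "c1' = c1" "c2' = c2" "c3' = c3"
proof -
  have dn: "d \<noteq> 0" using d by auto
  define t' where "t' = sqrt (R - ((p1 - c1)^2 + (p2 - c2)^2 + (p3 - c3)^2))"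
  have t': "1/2 \<le> t'" unfolding t'_def by (rule real_le_rsqrt) (use t in \<open>simp add: power2_eq_square\<close>)
  then have t0: "0 < t'" by simp
  have t2: "t'^2 = R - ((p1 - c1)^2 + (p2 - c2)^2 + (p3 - c3)^2)"
    unfolding t'_def using t by (intro real_sqrt_pow2) simp
  let ?x = "up u b1 b2 b3 p1 p2 p3 t'"
  have x: "?x \<in> Q" by (rule up_high(1)[OF f t' p])
  have "Fn (capa u b1 b2 b3 d c1 c2 c3 R) (capb d c1 c2 c3 R) ?x = 0"
    "Fn (capa u b1 b2 b3 d c1' c2' c3' R) (capb d c1' c2' c3' R) ?x = 0"
    unfolding cap_up_iff[OF f t0 dn] t2 eq by simp_all
  from in_M_disjoint[OF M M' x this] show "c1' = c1" "c2' = c2" "c3' = c3"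
    by (rule cap_determined[OF f d])+
qed

lemma sq_le_1: "\<bar>x\<bar> \<le> 1 \<Longrightarrow> x^2 \<le> (1::real)"
  by (simp add: abs_square_le_1)

section \<open>Conflicts between hemispheres\<close>

text \<open>Opposite walls with the same label give a translation by 2.\<close>

lemma opposite_walls_conflict:
  assumes f: "frame u b1 b2 b3" and d: "4 * d^2 * R = 1"
    and M: "in_M \<epsilon> (capa u b1 b2 b3 d c1 c2 c3 R) (capb d c1 c2 c3 R)"
    and ij: "ij \<in> index_pairs" "u + b1 \<in> centres ij" and kl: "kl \<in> index_pairs" "u - b1 \<in> centres kl"
    and lab: "lab kl = lab ij" and c: "wall_ok c1 c2 c3" and R: "5/4 < R"
  shows False
proof -
  note k = kdiag_sign_maps[of "code_digit code ij"]
  note lin = sign_maps_linear[OF k]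
  have p: "wall_ok (1/2) c2 c3" "wall_ok (- c1) c2 c3" using c unfolding wall_ok_def by auto
  have "(1/2 - c1)^2 \<le> 1" "(1/2 + c1)^2 \<le> 1"
    using c unfolding wall_ok_def by (auto intro!: sq_le_1 simp: abs_le_iff)
  then have t: "1/4 < R - ((1/2 - c1)^2 + (c2 - c2)^2 + (c3 - c3)^2)"
    "1/4 < R - ((1/2 - - c1)^2 + (c2 - c2)^2 + (c3 - c3)^2)" using R by simp_all
  note M1 = cap_step[OF f d M ij p(1) t(1)]
  have uv: "u + - b1 \<in> centres kl" using kl(2) by simp
  have M': "in_M \<epsilon> (capa u (- b1) b2 b3 d (- c1) c2 c3 R) (capb d (- c1) c2 c3 R)"
    using M cap_neg1(1)[of u b1 b2 b3 d c1 c2 c3 R] cap_neg1(2)[of d c1 c2 c3 R] by metis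
  have "in_M (orientation_preserving (lab ij) \<longleftrightarrow> \<not> \<epsilon>)
    (capa (lab ij u) (- lab ij b1) (lab ij b2) (lab ij b3) d (1 + c1) c2 c3 R) (capb d (1 + c1) c2 c3 R)"
    using cap_step[OF frame_neg1[OF f] d M' kl(1) uv p(1) t(2)] unfolding lab linear_neg[OF lin] by simp
  then have M2: "in_M (orientation_preserving (lab ij) \<longleftrightarrow> \<not> \<epsilon>)
    (capa (lab ij u) (lab ij b1) (lab ij b2) (lab ij b3) d (- (1 + c1)) c2 c3 R) (capb d (- (1 + c1)) c2 c3 R)"
    using cap_neg1(1)[of "lab ij u" "- lab ij b1" "lab ij b2" "lab ij b3" d "1 + c1" c2 c3 R]
      cap_neg1(2)[of d "1 + c1" c2 c3 R] by simp
  \<comment> \<open>In the frame moved by the label the two continuations have first centre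
    coordinates \<open>1 - c1\<close> and \<open>- 1 - c1\<close>. The midpoint \<open>- c1\<close>
    is over the cube, at distance 1 from both, which leaves squared height \<open>R - 1\<close>;
    hence 5/4.\<close>
  have "- (1 + c1) = 1 - c1"
    by (rule cap_conflict(1)[OF frame_sign_map[OF k f] d M1 M2 p(2)]) (use R in \<open>simp_all add: power2_eq_square algebra_simps\<close>)
  then show False by simp
qed

text \<open>A wall whose label is the reflection in the parallel middle plane gives a translation by 1.\<close>

lemma folding_wall_conflict_aux:
  assumes f: "frame u b1 b2 b3" and d: "4 * d^2 * R = 1"
    and M: "in_M \<epsilon> (capa u b1 b2 b3 d c1 c2 c3 R) (capb d c1 c2 c3 R)"
    and ij: "ij \<in> index_pairs" "u - b1 \<in> centres ij"
    and lab: "lab ij u = u" "lab ij b1 = - b1" "lab ij b2 = b2" "lab ij b3 = b3" "\<not> orientation_preserving (lab ij)"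
    and c: "- 1 \<le> c1" "c1 \<le> 0" and p: "\<bar>p2\<bar> \<le> 1/2" "\<bar>p3\<bar> \<le> 1/2" and R: "1/2 < R - ((p2 - c2)^2 + (p3 - c3)^2)"
  shows False
proof -
  note k = kdiag_sign_maps[of "code_digit code ij"]
  note lin = sign_maps_linear[OF k]
  have "\<bar>c1 + 1/2\<bar> \<le> 1/2" by (rule abs_leI) (use c in linarith)+
  then have w: "wall_ok (1/2) p2 p3" "wall_ok (c1 + 1/2) p2 p3" using p unfolding wall_ok_def by simp_all
  have "\<bar>2 * (1/2 - - c1)\<bar> \<le> 1" by (rule abs_leI) (use c in simp_all)
  from sq_le_1[OF this] have "(1/2 - - c1)^2 \<le> 1/4" by (simp add: power2_eq_square algebra_simps)
  then have t: "1/4 < R - ((1/2 - - c1)^2 + (p2 - c2)^2 + (p3 - c3)^2)" using R by linarith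
  have uv: "u + - b1 \<in> centres ij" using ij(2) by simp
  have M': "in_M \<epsilon> (capa u (- b1) b2 b3 d (- c1) c2 c3 R) (capb d (- c1) c2 c3 R)"
    using M cap_neg1(1)[of u b1 b2 b3 d c1 c2 c3 R] cap_neg1(2)[of d c1 c2 c3 R] by metis
  \<comment> \<open>The label reverses orientation, so the copy remains \<epsilon>. It takes the
    frame with \<open>- b1\<close> to the one with \<open>b1\<close>, where the first centre
    coordinate is \<open>1 - - c1\<close>.\<close>
  have M2: "in_M \<epsilon> (capa u b1 b2 b3 d (1 + c1) c2 c3 R) (capb d (1 + c1) c2 c3 R)"
    using cap_step[OF frame_neg1[OF f] d M' ij(1) uv w(1) t] lab by (simp add: linear_neg[OF lin])
  have e: "(c1 + 1/2 - c1)^2 = 1/4" "(c1 + 1/2 - (1 + c1))^2 = 1/4"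
    by (simp_all add: power2_eq_square algebra_simps)
  \<comment> \<open>The test position \<open>c1 + 1/2\<close> is midway between the first
    coordinates of the two centres and costs 1/4 of squared height.\<close>
  have "1 + c1 = c1"
    by (rule cap_conflict(1)[OF f d M M2 w(2)]) (use R e in linarith)+
  then show False by simp
qed

text \<open>The bound on \<open>c1\<close> is 1 and not 1/2, so that the lemma also serves at a
  vertex over whose cube the top need not lie. The sign of \<open>c1\<close> decides which of the
  two opposite walls is crossed.\<close>

lemma folding_wall_conflict:
  assumes f: "frame u b1 b2 b3" and d: "4 * d^2 * R = 1"
    and M: "in_M \<epsilon> (capa u b1 b2 b3 d c1 c2 c3 R) (capb d c1 c2 c3 R)"
    and ij: "ij \<in> index_pairs" "u - b1 \<in> centres ij" "u + b1 \<in> centres ij"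
    and lab: "lab ij u = u" "lab ij b1 = - b1" "lab ij b2 = b2" "lab ij b3 = b3" "\<not> orientation_preserving (lab ij)"
    and c: "\<bar>c1\<bar> \<le> 1" and p: "\<bar>p2\<bar> \<le> 1/2" "\<bar>p3\<bar> \<le> 1/2" and R: "1/2 < R - ((p2 - c2)^2 + (p3 - c3)^2)"
  shows False
proof (cases "c1 \<le> 0")
  case True
  then show ?thesis
    using folding_wall_conflict_aux[OF f d M ij(1,2) lab _ _ p R] c by linarith
next
  case False
  note k = kdiag_sign_maps[of "code_digit code ij"]
  have M': "in_M \<epsilon> (capa u (- b1) b2 b3 d (- c1) c2 c3 R) (capb d (- c1) c2 c3 R)"
    using M cap_neg1(1)[of u b1 b2 b3 d c1 c2 c3 R] cap_neg1(2)[of d c1 c2 c3 R] by metis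
  have l1: "lab ij (- b1) = - (- b1)" using lab(2) by (simp add: linear_neg[OF sign_maps_linear[OF k]])
  have "u - - b1 \<in> centres ij" using ij(3) by simp
  from folding_wall_conflict_aux[OF frame_neg1[OF f] d M' ij(1) this lab(1) l1 lab(3-5) _ _ p R]
  show ?thesis using False c by linarith
qed

text \<open>Two steps across walls on each side give the translation by the sum of the two directions
  doubled.\<close>

lemma diagonal_walls_conflict:
  assumes f: "frame u b1 b2 b3" and d: "4 * d^2 * R = 1"
    and M: "in_M \<epsilon> (capa u b1 b2 b3 d c1 c2 c3 R) (capb d c1 c2 c3 R)"
    and ij: "ij \<in> index_pairs" "u + b1 \<in> centres ij" and ij': "ij' \<in> index_pairs" "u + b2 \<in> centres ij'"
    and kl: "kl \<in> index_pairs" "u - b1 \<in> centres kl" and kl': "kl' \<in> index_pairs" "u - b2 \<in> centres kl'"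
    and lab: "\<And>x. lab kl' (lab kl x) = lab ij' (lab ij x)"
    and op: "orientation_preserving (lab ij)" "orientation_preserving (lab ij')"
      "orientation_preserving (lab kl)" "orientation_preserving (lab kl')"
    and c: "wall_ok c1 c2 c3" and R: "9/4 < R"
  shows False
proof -
  \<comment> \<open>Cross the first wall, then the image of the second. Both labels preserve
    orientation, so the copy changes twice. The second crossing is tested over the edge of the cube
    where both coordinates are 1/2.\<close>
  have two: "in_M \<epsilon> (capa (lab j' (lab j u)) (lab j' (lab j a1)) (lab j' (lab j a2)) (lab j' (lab j b3)) d (1 - g1) (1 - g2) c3 R)
      (capb d (1 - g1) (1 - g2) c3 R)"
    if f: "frame u a1 a2 b3" and M: "in_M \<epsilon> (capa u a1 a2 b3 d g1 g2 c3 R) (capb d g1 g2 c3 R)"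
      and j: "j \<in> index_pairs" "u + a1 \<in> centres j" "orientation_preserving (lab j)"
      and j': "j' \<in> index_pairs" "u + a2 \<in> centres j'" "orientation_preserving (lab j')"
      and g: "\<bar>g1\<bar> \<le> 1/2" "\<bar>g2\<bar> \<le> 1/2" for a1 a2 g1 g2 j j'
  proof -
    note k = kdiag_sign_maps[of "code_digit code j"]
    note lin = sign_maps_linear[OF k]
    have c3: "\<bar>c3\<bar> \<le> 1/2" using c unfolding wall_ok_def by simp
    have s: "(1/2 - g1)^2 \<le> 1" "(1/2 - g2)^2 \<le> 1" "(1/2 - (1 - g1))^2 \<le> 1"
      using g by (auto intro!: sq_le_1 simp: abs_le_iff)
    have "in_M (\<not> \<epsilon>) (capa (lab j u) (lab j a1) (lab j a2) (lab j b3) d (1 - g1) g2 c3 R) (capb d (1 - g1) g2 c3 R)"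
      using cap_step[OF f d M j(1,2), of g2 c3] j(3) g c3 s(1) R unfolding wall_ok_def by simp
    then have M1: "in_M (\<not> \<epsilon>) (capa (lab j u) (lab j a2) (lab j a1) (lab j b3) d g2 (1 - g1) c3 R) (capb d g2 (1 - g1) c3 R)"
      using cap_swap12(1)[of "lab j u" "lab j a1" "lab j a2" "lab j b3" d "1 - g1" g2 c3 R]
        cap_swap12(2)[of d "1 - g1" g2 c3 R] by metis
    have v: "lab j u + lab j a2 \<in> centres j'"
      using sign_maps_centres[OF k j'(2)] by (simp add: linear_add[OF lin])
    have "in_M \<epsilon> (capa (lab j' (lab j u)) (lab j' (lab j a2)) (lab j' (lab j a1)) (lab j' (lab j b3)) d (1 - g2) (1 - g1) c3 R)
      (capb d (1 - g2) (1 - g1) c3 R)"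
      using cap_step[OF frame_swap12[OF frame_sign_map[OF k f]] d M1 j'(1) v, of "1/2" c3] j'(3) c3 s(2,3) R
      unfolding wall_ok_def by simp
    then show ?thesis
      using cap_swap12(1)[of "lab j' (lab j u)" "lab j' (lab j a2)" "lab j' (lab j a1)" "lab j' (lab j b3)" d "1 - g2" "1 - g1" c3 R]
        cap_swap12(2)[of d "1 - g2" "1 - g1" c3 R] by metis
  qed
  let ?k = "\<lambda>x. lab ij' (lab ij x)"
  have k: "?k \<in> sign_maps" by (rule sign_maps_comp[OF kdiag_sign_maps kdiag_sign_maps])
  have cc: "\<bar>c1\<bar> \<le> 1/2" "\<bar>c2\<bar> \<le> 1/2" "\<bar>c3\<bar> \<le> 1/2" using c unfolding wall_ok_def by simp_all
  note M1 = two[OF f M ij op(1) ij' op(2) cc(1,2)]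
  have n: "capa v (- x) (- y) z d (- g1) (- g2) c3 R = capa v x y z d g1 g2 c3 R" for v x y z g1 g2
    by (simp add: capa_def)
  have nb: "capb d (- g1) (- g2) c3 R = capb d g1 g2 c3 R" for g1 g2 by (simp add: capb_def)
  have f': "frame u (- b1) (- b2) b3"
    by (rule frame_neg1[OF frame_swap12[OF frame_neg1[OF frame_swap12[OF f]]]])
  have "in_M \<epsilon> (capa (lab kl' (lab kl u)) (lab kl' (lab kl (- b1))) (lab kl' (lab kl (- b2))) (lab kl' (lab kl b3)) d
      (1 - - c1) (1 - - c2) c3 R) (capb d (1 - - c1) (1 - - c2) c3 R)"
    by (rule two[OF f' _ kl(1) _ op(3) kl'(1) _ op(4)]) (use M kl(2) kl'(2) cc in \<open>simp_all add: n nb\<close>)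
  then have "in_M \<epsilon> (capa (?k u) (- ?k b1) (- ?k b2) (?k b3) d (1 + c1) (1 + c2) c3 R) (capb d (1 + c1) (1 + c2) c3 R)"
    unfolding lab by (simp add: linear_neg[OF sign_maps_linear[OF k]])
  then have M2: "in_M \<epsilon> (capa (?k u) (?k b1) (?k b2) (?k b3) d (- (1 + c1)) (- (1 + c2)) c3 R) (capb d (- (1 + c1)) (- (1 + c2)) c3 R)"
    using n[of "?k u" "?k b1" "?k b2" "?k b3" "- (1 + c1)" "- (1 + c2)"] nb[of "- (1 + c1)" "- (1 + c2)"]
    by (simp add: add.commute)
  have w: "wall_ok (- c1) (- c2) c3" using cc unfolding wall_ok_def by simp
  \<comment> \<open>The two centres differ by 2 in each of two coordinates, so their midpoint is at
    squared distance 2 from both; with the 1/4 for the height this is the bound 9/4.\<close>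
  have "- (1 + c1) = 1 - c1"
    by (rule cap_conflict(1)[OF frame_sign_map[OF k f] d M1 M2 w]) (use R in \<open>simp_all add: power2_eq_square algebra_simps\<close>)
  then show False by simp
qed

text \<open>The plane separates \<open>w1\<close> from \<open>w2\<close> and meets the geodesic
  between them, which runs in the cell. With \<open>A\<close>, \<open>B\<close>, \<open>g\<close> as
  in the proof, the squared height at \<open>w1\<close> of the intersection point is
  \<open>2 * B / (g * A)\<close>; bounding the weighted height by \<open>H\<close> gives the
  inequality.\<close>

lemma geodesic_constraint:
  assumes w: "w1 \<in> vertices" "w2 \<in> vertices" and neg: "(a \<bullet> w1 - b) * (a \<bullet> w2 - b) < 0"
    and H: "\<And>x w. x \<in> Q \<Longrightarrow> Fn a b x = 0 \<Longrightarrow> w \<in> vertices \<Longrightarrow> wt w * height w x \<le> H"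
  shows "(wt w1)^2 * (2 * \<bar>a \<bullet> w2 - b\<bar>) \<le> H^2 * ((1 - w1 \<bullet> w2) * \<bar>a \<bullet> w1 - b\<bar>)"
proof -
  define A B g where "A = \<bar>a \<bullet> w1 - b\<bar>" and "B = \<bar>a \<bullet> w2 - b\<bar>" and "g = 1 - w1 \<bullet> w2"
  have AB: "0 < A" "0 < B" using neg unfolding A_def B_def by auto
  note n = vertex_inner[OF w(1)] vertex_inner[OF w(2)]
  have "w1 \<noteq> w2" using neg by (metis not_square_less_zero)
  then have "0 < (w1 - w2) \<bullet> (w1 - w2)" by simp
  then have g: "0 < g" using n by (simp add: g_def inner_diff inner_commute)
  \<comment> \<open>The zero of the affine function of the plane on the segment from
    \<open>w1\<close> to \<open>w2\<close>.\<close>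
  define y where "y = (1 / (A + B)) *\<^sub>R (B *\<^sub>R w1 + A *\<^sub>R w2)"
  have s: "0 < A + B" using AB by simp
  have "y \<bullet> y = (B^2 + A^2 + 2 * A * B * (w1 \<bullet> w2)) / (A + B)^2"
    unfolding y_def by (simp add: inner_add n inner_commute[of w2 w1] power2_eq_square algebra_simps add_divide_distrib)
  also have "B^2 + A^2 + 2 * A * B * (w1 \<bullet> w2) = (A + B)^2 - 2 * A * B * g"
    unfolding g_def by (simp add: power2_eq_square algebra_simps)
  finally have yy: "1 - y \<bullet> y = 2 * A * B * g / (A + B)^2" using s by (simp add: diff_divide_distrib)
  have "0 < 1 - y \<bullet> y" unfolding yy using AB g by simp
  then have yH: "y \<in> H4" unfolding mem_H4 by simp
  have lin: "v \<bullet> y = (B * (v \<bullet> w1) + A * (v \<bullet> w2)) / (A + B)" for v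
    unfolding y_def by (simp add: inner_add_right)
  have "unklein y \<in> Q"
    unfolding mem_Q
  proof (intro conjI ballI)
    show "unklein y \<in> H4" by (rule unklein_in[OF yH])
    fix v assume v: "v \<in> all_centres"
    have "B * (v \<bullet> w1) \<le> B * 1" "A * (v \<bullet> w2) \<le> A * 1"
      using AB vertex_centre_inner[OF w(1) v] vertex_centre_inner[OF w(2) v] by (intro mult_left_mono; simp)+
    then show "Fn v 1 (unklein y) \<le> 0"
      unfolding Fn_klein_iff klein_unklein[OF yH] lin using s by (simp add: divide_le_eq)
  qed
  moreover have "Fn a b (unklein y) = 0"
  proof -
    have "B * (a \<bullet> w1 - b) + A * (a \<bullet> w2 - b) = 0"
    proof (cases "0 < a \<bullet> w1 - b")
      case True
      then have "a \<bullet> w2 - b < 0" using neg by (simp add: mult_less_0_iff)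
      then show ?thesis using True unfolding A_def B_def by (simp add: abs_of_pos abs_of_neg algebra_simps)
    next
      case False
      then have "a \<bullet> w1 - b < 0" "0 < a \<bullet> w2 - b" using neg by (auto simp: mult_less_0_iff)
      then show ?thesis unfolding A_def B_def by (simp add: abs_of_pos abs_of_neg algebra_simps)
    qed
    then have "B * (a \<bullet> w1) + A * (a \<bullet> w2) = b * (A + B)" by (simp add: algebra_simps)
    then show ?thesis unfolding Fn_klein_iff klein_unklein[OF yH] lin using s by simp
  qed
  ultimately have "wt w1 * height w1 (unklein y) \<le> H" using H w(1) by blast
  moreover note h = height_unklein[OF yH n(1)]
  ultimately have "(wt w1 * height w1 (unklein y))^2 \<le> H^2"
    using wt_pos[of w1] by (intro power_mono) simp_all
  then have "(wt w1)^2 * ((height w1 (unklein y))^2 * (1 - y \<bullet> w1)^2) \<le> H^2 * (1 - y \<bullet> w1)^2"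
    by (simp add: power_mult_distrib mult_right_mono mult.assoc[symmetric])
  then have le: "(wt w1)^2 * (2 * A * B * g / (A + B)^2) \<le> H^2 * (1 - y \<bullet> w1)^2" unfolding h yy .
  have "1 - y \<bullet> w1 = A * g / (A + B)"
    unfolding inner_commute[of y] lin n g_def using s by (simp add: field_simps)
  then have "(1 - y \<bullet> w1)^2 = (A * g)^2 / (A + B)^2" by (simp add: power_divide)
  with le have "(wt w1)^2 * (2 * A * B * g) / (A + B)^2 \<le> H^2 * (A * g)^2 / (A + B)^2" by simp
  then have "(wt w1)^2 * (2 * A * B * g) \<le> H^2 * (A * g)^2" using s by (simp add: divide_le_cancel)
  then have "(wt w1)^2 * (2 * B) * (A * g) \<le> H^2 * (g * A) * (A * g)" by (simp add: power2_eq_square mult_ac)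
  then have "(wt w1)^2 * (2 * B) \<le> H^2 * (g * A)" using AB g by (simp only: mult_le_cancel_right_pos mult_pos_pos)
  then show ?thesis unfolding A_def B_def g_def .
qed

text \<open>A plane through \<open>w\<close> is vertical in the coordinates at \<open>w\<close>.
  Going straight up from one of its points stays in the cell and in the plane, and the height at
  \<open>w\<close> exceeds every bound.\<close>

lemma avoids_vertices:
  assumes M: "in_M \<epsilon> a b" and w: "w \<in> vertices"
    and H: "\<And>x w. x \<in> Q \<Longrightarrow> Fn a b x = 0 \<Longrightarrow> w \<in> vertices \<Longrightarrow> wt w * height w x \<le> H"
  shows "a \<bullet> w - b \<noteq> 0"
proof
  assume "a \<bullet> w - b = 0"
  then have ub: "a \<bullet> w = b" by simp
  obtain b1 b2 b3 where f: "frame w b1 b2 b3" using w unfolding vertices_def by blast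
  obtain y where y: "y \<in> interior_Q" "Fn a b y = 0" using M unfolding in_M_def by blast
  obtain p1 p2 p3 t where t: "0 < t" and yu: "y = up w b1 b2 b3 p1 p2 p3 t"
    by (rule up_surj[OF f interior_Q_H4[OF y(1)]]) blast
  define s where "s = t + \<bar>H\<bar> / wt w + 1"
  have pos: "0 \<le> \<bar>H\<bar> / wt w" using wt_pos[of w] by simp
  have s: "t \<le> s" "0 < s" using t pos by (simp_all add: s_def)
  let ?x = "up w b1 b2 b3 p1 p2 p3 s"
  have "t^2 \<le> s^2" using s t by (intro power_mono) simp_all
  then have m: "p1^2 + p2^2 + p3^2 + t^2 \<le> p1^2 + p2^2 + p3^2 + s^2" by simp
  have mono: "wall_ok p1 p2 p3 \<and> \<bar>p1\<bar> \<le> 2 * B \<and> \<bar>p2\<bar> \<le> 2 * B \<and> \<bar>p3\<bar> \<le> 2 * B \<and>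
      \<bar>p1\<bar> + \<bar>p2\<bar> \<le> 1/4 + B \<and> \<bar>p1\<bar> + \<bar>p3\<bar> \<le> 1/4 + B \<and> \<bar>p2\<bar> + \<bar>p3\<bar> \<le> 1/4 + B"
    if "wall_ok p1 p2 p3 \<and> \<bar>p1\<bar> \<le> 2 * A \<and> \<bar>p2\<bar> \<le> 2 * A \<and> \<bar>p3\<bar> \<le> 2 * A \<and>
      \<bar>p1\<bar> + \<bar>p2\<bar> \<le> 1/4 + A \<and> \<bar>p1\<bar> + \<bar>p3\<bar> \<le> 1/4 + A \<and> \<bar>p2\<bar> + \<bar>p3\<bar> \<le> 1/4 + A" "A \<le> B" for A B
    using that by auto
  have xQ: "?x \<in> Q"
    unfolding up_Q_iff(1)[OF f s(2)]
    by (rule mono[OF interior_Q_subset[OF y(1), unfolded yu up_Q_iff(1)[OF f t]] m])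
  have e1: "upv w b1 b2 b3 p1 p2 p3 s = upv w b1 b2 b3 p1 p2 p3 t + (2 * (s^2 - t^2)) *\<^sub>R w"
    unfolding upv_def by (simp add: algebra_simps)
  have e2: "a \<bullet> upv w b1 b2 b3 p1 p2 p3 t = b * (1/2 + 2 * (p1^2 + p2^2 + p3^2 + t^2))"
    using y(2) unfolding yu Fn_up_iff(1)[OF f t] .
  have "Fn a b ?x = 0"
    unfolding Fn_up_iff(1)[OF f s(2)] e1 inner_add_right e2 inner_scaleR_right ub by (simp add: algebra_simps)
  from H[OF xQ this w] have "wt w * (2 * s) \<le> H" unfolding height_up_self[OF f s(2)] .
  moreover have "wt w * s = wt w * t + \<bar>H\<bar> + wt w" unfolding s_def using wt_pos[of w] by (simp add: field_simps)
  moreover have "0 < wt w * t" using wt_pos[of w] t by simp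
  ultimately show False using wt_pos[of w] by linarith
qed

end

section \<open>Lower bounds for the radius\<close>

text \<open>The outcome of \<open>top_exists\<close>. Everything below concerns this one hemisphere
  over the maximizing vertex \<open>u\<close>, with its top \<open>z\<close> in the cell.\<close>

locale top_cap = weighted_geodesic +
  fixes \<epsilon> :: bool and a :: "real^4" and b :: real and u z :: "real^4"
  assumes in_M: "in_M \<epsilon> a b" and u_vertex: "u \<in> vertices" and d_ne: "a \<bullet> u - b \<noteq> 0"
    and z_Q: "z \<in> Q" and z_plane: "Fn a b z = 0" and z_height: "height u z = 1 / \<bar>a \<bullet> u - b\<bar>"
    and max_height: "\<And>\<epsilon>' a' b' x w. in_M \<epsilon>' a' b' \<Longrightarrow> x \<in> Q \<Longrightarrow> Fn a' b' x = 0 \<Longrightarrow> w \<in> vertices \<Longrightarrow>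
      wt w * height w x \<le> wt u / \<bar>a \<bullet> u - b\<bar>"
begin

definition rad :: real where
  "rad = 1 / (4 * (a \<bullet> u - b)^2)"

text \<open>The same hemisphere read in different frames at \<open>u\<close>. The centre is over the
  cube because it is the horizontal position of the top, which lies in the cell.\<close>

definition at_frame :: "real^4 \<Rightarrow> real^4 \<Rightarrow> real^4 \<Rightarrow> real \<Rightarrow> real \<Rightarrow> real \<Rightarrow> bool" where
  "at_frame b1 b2 b3 c1 c2 c3 \<longleftrightarrow> frame u b1 b2 b3 \<and> wall_ok c1 c2 c3 \<and>
     a = capa u b1 b2 b3 (a \<bullet> u - b) c1 c2 c3 rad \<and> b = capb (a \<bullet> u - b) c1 c2 c3 rad \<and>
     z = up u b1 b2 b3 c1 c2 c3 (sqrt rad)"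

text \<open>The signed distance function to the plane at the ideal vertices, normalized to 1 at \<open>u\<close>; it is
  positive at the vertices outside the hemisphere.\<close>

definition sig :: "real^4 \<Rightarrow> real" where
  "sig w = (a \<bullet> w - b) / (a \<bullet> u - b)"

lemma rad_pos: "0 < rad"
  using d_ne by (simp add: rad_def)

lemma rad_d: "4 * (a \<bullet> u - b)^2 * rad = 1"
  using d_ne by (simp add: rad_def)

text \<open>The prescribed height of \<open>z\<close> at \<open>u\<close> is twice the radius, so
  \<open>z\<close> is the top and its horizontal position is the centre.\<close>

lemma at_frame_exists:
  assumes f: "frame u b1 b2 b3"
  obtains c1 c2 c3 where "at_frame b1 b2 b3 c1 c2 c3"
proof -
  define d where "d = a \<bullet> u - b"
  have un: "unitfn a b" using in_M unfolding in_M_def by blast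
  obtain c1 c2 c3 R where c: "4 * d^2 * R = 1" "0 < R" "a = capa u b1 b2 b3 d c1 c2 c3 R" "b = capb d c1 c2 c3 R"
    by (rule cap_exists[OF f un d_ne]) (use d_def in blast)
  have dn: "d \<noteq> 0" using c(1) by auto
  have R: "R = rad" unfolding rad_def d_def[symmetric] using c(1) dn by (simp add: field_simps)
  obtain p1 p2 p3 t where t: "0 < t" and z: "z = up u b1 b2 b3 p1 p2 p3 t"
    by (rule up_surj[OF f Q_in_H4[OF z_Q]]) blast
  have "2 * t = 1 / \<bar>d\<bar>" using z_height unfolding z height_up_self[OF f t] d_def .
  then have "(2 * t)^2 = 1 / d^2" by (simp add: power_divide)
  then have tR: "t^2 = R" unfolding R rad_def d_def[symmetric] by (simp add: power_mult_distrib)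
  have "(p1 - c1)^2 + (p2 - c2)^2 + (p3 - c3)^2 + t^2 = R"
    using z_plane unfolding z by (subst (asm) c(3), subst (asm) c(4)) (simp only: cap_up_iff[OF f t dn])
  then have "(p1 - c1)^2 + ((p2 - c2)^2 + (p3 - c3)^2) = 0" using tR by simp
  then have p: "p1 = c1" "p2 = c2" "p3 = c3"
    by (simp_all add: add_nonneg_eq_0_iff)
  have "wall_ok c1 c2 c3" using z_Q unfolding z p up_Q_iff(1)[OF f t] by blast
  moreover have "z = up u b1 b2 b3 c1 c2 c3 (sqrt R)" using z p t unfolding tR[symmetric] by simp
  ultimately show ?thesis using that f c(3,4) unfolding at_frame_def d_def[symmetric] R by blast
qed

lemma at_frame_swap12: "at_frame b1 b2 b3 c1 c2 c3 \<Longrightarrow> at_frame b2 b1 b3 c2 c1 c3"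
  unfolding at_frame_def wall_ok_def
  using frame_swap12[of u b1 b2 b3] cap_swap12(1)[of u b1 b2 b3 "a \<bullet> u - b" c1 c2 c3 rad]
    cap_swap12(2)[of "a \<bullet> u - b" c1 c2 c3 rad] up_swap12[of u b1 b2 b3 c1 c2 c3 "sqrt rad"] by metis

lemma at_frame_swap23: "at_frame b1 b2 b3 c1 c2 c3 \<Longrightarrow> at_frame b1 b3 b2 c1 c3 c2"
  unfolding at_frame_def wall_ok_def
  using frame_swap23[of u b1 b2 b3] cap_swap23(1)[of u b1 b2 b3 "a \<bullet> u - b" c1 c2 c3 rad]
    cap_swap23(2)[of "a \<bullet> u - b" c1 c2 c3 rad] up_swap23[of u b1 b2 b3 c1 c2 c3 "sqrt rad"] by metis

lemma at_frame_neg1: "at_frame b1 b2 b3 c1 c2 c3 \<Longrightarrow> at_frame (- b1) b2 b3 (- c1) c2 c3"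
  unfolding at_frame_def wall_ok_def abs_minus_cancel
  using frame_neg1[of u b1 b2 b3] cap_neg1(1)[of u b1 b2 b3 "a \<bullet> u - b" c1 c2 c3 rad]
    cap_neg1(2)[of "a \<bullet> u - b" c1 c2 c3 rad] up_neg1[of u b1 b2 b3 c1 c2 c3 "sqrt rad"] by metis

lemma at_frame_frame: "at_frame b1 b2 b3 c1 c2 c3 \<Longrightarrow> frame u b1 b2 b3"
  unfolding at_frame_def by blast

lemma at_frame_in_M: "at_frame b1 b2 b3 c1 c2 c3 \<Longrightarrow>
   in_M \<epsilon> (capa u b1 b2 b3 (a \<bullet> u - b) c1 c2 c3 rad) (capb (a \<bullet> u - b) c1 c2 c3 rad)"
  using in_M unfolding at_frame_def by metis

lemma at_frame_walls: "at_frame b1 b2 b3 c1 c2 c3 \<Longrightarrow> \<bar>c1\<bar> \<le> 1/2 \<and> \<bar>c2\<bar> \<le> 1/2 \<and> \<bar>c3\<bar> \<le> 1/2"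
  unfolding at_frame_def wall_ok_def by blast

lemma at_frame_nonneg:
  assumes "at_frame b1 b2 b3 c1 c2 c3"
  obtains x1 x2 x3 k1 k2 k3 where "at_frame x1 x2 x3 k1 k2 k3" "0 \<le> k1" "0 \<le> k2" "0 \<le> k3"
    "x1 = b1 \<or> x1 = - b1" "x2 = b2 \<or> x2 = - b2" "x3 = b3 \<or> x3 = - b3"
proof -
  have s: "\<exists>x k. at_frame x b c k l m \<and> 0 \<le> k \<and> (x = b' \<or> x = - b')" if "at_frame b' b c k' l m" for b b' c k' l m
  proof (cases "0 \<le> k'")
    case True
    then show ?thesis using that by blast
  next
    case False
    then have "at_frame (- b') b c (- k') l m \<and> 0 \<le> - k'" using at_frame_neg1[OF that] by simp
    then show ?thesis by blast
  qed
  obtain x1 k1 where 1: "at_frame x1 b2 b3 k1 c2 c3" "0 \<le> k1" "x1 = b1 \<or> x1 = - b1" using s[OF assms] by blast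
  obtain x2 k2 where 2: "at_frame x2 x1 b3 k2 k1 c3" "0 \<le> k2" "x2 = b2 \<or> x2 = - b2"
    using s[OF at_frame_swap12[OF 1(1)]] by blast
  obtain x3 k3 where 3: "at_frame x3 x1 x2 k3 k1 k2" "0 \<le> k3" "x3 = b3 \<or> x3 = - b3"
    using s[OF at_frame_swap12[OF at_frame_swap23[OF at_frame_swap12[OF 2(1)]]]] by blast
  show ?thesis
    using that[OF at_frame_swap23[OF at_frame_swap12[OF 3(1)]]] 1 2 3 by blast
qed

lemma sig_ne_0: "w \<in> vertices \<Longrightarrow> sig w \<noteq> 0"
  using avoids_vertices[OF in_M _ max_height[OF in_M]] d_ne unfolding sig_def by simp

text \<open>Normalizing at \<open>u\<close> cancels \<open>d\<close> and leaves only
  \<open>rad\<close>. With \<open>w2 = u\<close> a vertex inside the hemisphere must be deep; with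
  \<open>w2\<close> inside, a vertex \<open>w1\<close> outside must keep a distance.\<close>

lemma sig_constraint:
  assumes w: "w1 \<in> vertices" "w2 \<in> vertices" and neg: "sig w1 * sig w2 < 0"
  shows "(wt w1)^2 * \<bar>sig w2\<bar> \<le> 2 * (wt u)^2 * rad * (1 - w1 \<bullet> w2) * \<bar>sig w1\<bar>"
proof -
  define d where "d = a \<bullet> u - b"
  have d: "d \<noteq> 0" using d_ne by (simp add: d_def)
  have s: "a \<bullet> w - b = d * sig w" for w using d by (simp add: sig_def d_def)
  have "(a \<bullet> w1 - b) * (a \<bullet> w2 - b) = d^2 * (sig w1 * sig w2)" unfolding s by (simp add: power2_eq_square)
  then have "(a \<bullet> w1 - b) * (a \<bullet> w2 - b) < 0" using neg d by (simp add: mult_pos_neg)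
  from geodesic_constraint[OF w this max_height[OF in_M]]
  have "(wt w1)^2 * (2 * \<bar>a \<bullet> w2 - b\<bar>) \<le> (wt u / \<bar>d\<bar>)^2 * ((1 - w1 \<bullet> w2) * \<bar>a \<bullet> w1 - b\<bar>)"
    unfolding d_def by blast
  then have "(wt w1)^2 * (2 * \<bar>d * sig w2\<bar>) \<le> (wt u / \<bar>d\<bar>)^2 * ((1 - w1 \<bullet> w2) * \<bar>d * sig w1\<bar>)"
    unfolding s[of w1] s[of w2] .
  moreover have "(wt u / \<bar>d\<bar>)^2 = 4 * (wt u)^2 * rad"
    unfolding rad_def d_def[symmetric] by (simp add: power_divide)
  ultimately have "\<bar>d\<bar> * (2 * ((wt w1)^2 * \<bar>sig w2\<bar>)) \<le> \<bar>d\<bar> * (2 * (2 * (wt u)^2 * rad * (1 - w1 \<bullet> w2) * \<bar>sig w1\<bar>))"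
    by (simp add: abs_mult mult_ac)
  then show ?thesis using d by (simp add: mult_ac)
qed

lemma sig_self: "sig u = 1"
  using d_ne by (simp add: sig_def)

lemma sig_frame:
  assumes "at_frame b1 b2 b3 c1 c2 c3"
  defines "C \<equiv> c1^2 + c2^2 + c3^2"
  shows "sig (x *\<^sub>R u + y1 *\<^sub>R b1 + y2 *\<^sub>R b2 + y3 *\<^sub>R b3) =
    x * (1/2 + 2 * (rad - C)) - 2 * (y1 * c1 + y2 * c2 + y3 * c3) + 1/2 - 2 * (rad - C)"
proof -
  define d where "d = a \<bullet> u - b"
  have d: "d \<noteq> 0" using d_ne by (simp add: d_def)
  define r where "r = rad"
  have f: "frame u b1 b2 b3" and e: "a = capa u b1 b2 b3 d c1 c2 c3 r" "b = capb d c1 c2 c3 r"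
    using assms unfolding at_frame_def d_def r_def by blast+
  have "a \<bullet> (x *\<^sub>R u + y1 *\<^sub>R b1 + y2 *\<^sub>R b2 + y3 *\<^sub>R b3) - b =
    d * (x * (1/2 + 2 * (r - C)) - 2 * (y1 * c1 + y2 * c2 + y3 * c3) + 1/2 - 2 * (r - C))"
    by (subst e(1), subst e(2), unfold inner_add_right inner_scaleR_right cap_inner[OF f] capb_def C_def) algebra
  then show ?thesis unfolding sig_def d_def[symmetric] r_def[symmetric] using d by simp
qed

text \<open>The vertex is the point of height 0 at a corner of the cube, and the value is the power
  of that corner: its squared distance from the centre minus \<open>rad\<close>.\<close>

lemma sig_corner:
  assumes "at_frame b1 b2 b3 c1 c2 c3"
  shows "sig ((1/2) *\<^sub>R (u + s1 *\<^sub>R b1 + s2 *\<^sub>R b2 + s3 *\<^sub>R b3)) =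
    3/4 + (c1^2 + c2^2 + c3^2) - (s1 * c1 + s2 * c2 + s3 * c3) - rad"
proof -
  have "(1/2) *\<^sub>R (u + s1 *\<^sub>R b1 + s2 *\<^sub>R b2 + s3 *\<^sub>R b3) =
    (1/2) *\<^sub>R u + (s1/2) *\<^sub>R b1 + (s2/2) *\<^sub>R b2 + (s3/2) *\<^sub>R b3"
    by (simp add: scaleR_add_right)
  then show ?thesis by (simp only: sig_frame[OF assms]) (simp add: field_simps)
qed

text \<open>These vertices are the points of height 0 at three face centres and at the centre of the
  cube. Up to the factors 2 and 4 the value is again the power of the point.\<close>

lemma sig_faces:
  assumes "at_frame b1 b2 b3 c1 c2 c3"
  shows "sig b1 = 2 * (1/4 + (c1^2 + c2^2 + c3^2) - c1 - rad)"
    "sig b2 = 2 * (1/4 + (c1^2 + c2^2 + c3^2) - c2 - rad)"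
    "sig b3 = 2 * (1/4 + (c1^2 + c2^2 + c3^2) - c3 - rad)"
    "sig (- u) = 4 * ((c1^2 + c2^2 + c3^2) - rad)"
  using sig_frame[OF assms, of 0 1 0 0] sig_frame[OF assms, of 0 0 1 0] sig_frame[OF assms, of 0 0 0 1]
    sig_frame[OF assms, of "-1" 0 0 0] by simp_all

lemma top_dominance:
  assumes at: "at_frame b1 b2 b3 c1 c2 c3" and w: "w \<in> vertices"
  shows "wt w \<le> wt u * (1/2 + 2 * (c1^2 + c2^2 + c3^2 + rad) - w \<bullet> upv u b1 b2 b3 c1 c2 c3 (sqrt rad))"
proof -
  have f: "frame u b1 b2 b3" and z: "z = up u b1 b2 b3 c1 c2 c3 (sqrt rad)" using at unfolding at_frame_def by blast+
  have t: "0 < sqrt rad" using rad_pos by simp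
  have "wt w * height w z \<le> wt u * height u z"
    using max_height[OF in_M z_Q z_plane w] unfolding z_height by simp
  from dominance[OF f t w this[unfolded z]] show ?thesis using rad_pos by simp
qed

text \<open>If the nearest face centres were outside together with the nearest corner, the radius
  would be bounded above (\<open>T1\<close>). Comparing heights at the top with \<open>- u\<close>
  (\<open>T2\<close>) and with the corner (\<open>T3\<close>) bounds it below, and the three bounds
  are incompatible.\<close>

lemma face_inside:
  assumes at: "at_frame b1 b2 b3 c1 c2 c3" and c: "0 \<le> c1" "0 \<le> c2" "0 \<le> c3"
    and out: "0 < sig ((1/2) *\<^sub>R (u + b1 + b2 + b3))" and wu: "wt (- u) = wt u"
  shows "sig b1 < 0 \<or> sig b2 < 0 \<or> sig b3 < 0"
proof (rule ccontr)
  assume no: "\<not> ?thesis"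
  note f = at_frame_frame[OF at]
  note fv = frame_vertices[OF f]
  have pos: "0 < sig b1" "0 < sig b2" "0 < sig b3"
    using no sig_ne_0[OF fv(3)] sig_ne_0[OF fv(5)] sig_ne_0[OF fv(7)] by auto
  define C where "C = c1^2 + c2^2 + c3^2"
  define S where "S = c1 + c2 + c3"
  define x where "x = max c1 (max c2 c3)"
  have x: "c1 \<le> x" "c2 \<le> x" "c3 \<le> x" "0 \<le> x" "x \<le> 1/2" "x = c1 \<or> x = c2 \<or> x = c3"
    using c at_frame_walls[OF at] unfolding x_def by auto
  have CxS: "C \<le> x * S"
    unfolding C_def S_def power2_eq_square distrib_left
    using mult_right_mono[OF x(1) c(1)] mult_right_mono[OF x(2) c(2)] mult_right_mono[OF x(3) c(3)] by simp
  have T1: "C + rad < 2 * C - x + 1/4"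
    using pos x(6) unfolding sig_faces[OF at] C_def[symmetric] by auto
  have "1 \<le> 4 * (C + rad)"
    using top_dominance[OF at fv(2)] wt_pos[of u] unfolding wu
    by (simp add: upv_inner_centres[OF f] C_def rad_pos less_imp_le)
  then have T2: "1/4 \<le> C + rad" by simp
  have cv: "(1/2) *\<^sub>R (u + b1 + b2 + b3) \<in> vertices" using frame_vertices(1)[OF frame_half[OF f]] .
  have "wt u < 2 * wt ((1/2) *\<^sub>R (u + b1 + b2 + b3))" by (rule wt_ratio)
  also have "\<dots> \<le> wt u * (2 * (3/4 + (C + rad) - S))"
    using top_dominance[OF at cv] rad_pos
    by (simp add: inner_add_left upv_inner_centres[OF f] C_def S_def field_simps)
  finally have "1 < 2 * (3/4 + (C + rad) - S)" using wt_pos[of u] by simp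
  then have T3: "S - 1/4 < C + rad" by (simp add: field_simps)
  have xS: "x < 2 * (x * S)" using T1 T2 CxS by linarith
  then have "0 < x" using x(4) by (cases "x = 0") auto
  then have S: "1/2 < S" using xS by simp
  \<comment> \<open>Together with \<open>C \<le> x * S\<close> this contradicts the combination of
    \<open>T1\<close> and \<open>T3\<close>.\<close>
  have "(1 - 2 * x) * (1/2) \<le> (1 - 2 * x) * S" using S x(5) by (intro mult_left_mono) simp_all
  then have "1/2 - x \<le> S - 2 * (x * S)" by (simp add: algebra_simps)
  then show False using T1 T3 CxS by linarith
qed

text \<open>\<open>E\<close> is half the depth of \<open>b1\<close> inside the hemisphere. The
  bounds are the geodesic inequality for \<open>b1\<close> against \<open>u\<close>, the nearest
  corner against \<open>b1\<close>, and \<open>b3\<close> against \<open>b1\<close>.\<close>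

lemma face_bounds:
  assumes at: "at_frame b1 b2 b3 c1 c2 c3" and inside: "sig b1 < 0"
    and out: "0 < sig ((1/2) *\<^sub>R (u + b1 + b2 + b3))"
  defines "E \<equiv> rad - (1/4 + (c1^2 + c2^2 + c3^2) - c1)"
  shows "0 < E" "(wt b1)^2 \<le> 4 * (wt u)^2 * rad * E"
    "2 * (wt ((1/2) *\<^sub>R (u + b1 + b2 + b3)))^2 * E \<le> (wt u)^2 * rad * (1/2 - c2 - c3 - E)"
    "0 < sig b3 \<Longrightarrow> (wt b3)^2 * E \<le> 2 * (wt u)^2 * rad * (c1 - c3 - E)"
proof -
  note f = at_frame_frame[OF at]
  note fv = frame_vertices[OF f]
  have s1: "sig b1 = - 2 * E" unfolding sig_faces[OF at] E_def by simp
  show E: "0 < E" using inside unfolding s1 by simp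
  have a1: "\<bar>sig b1\<bar> = 2 * E" unfolding s1 using E by simp
  show "(wt b1)^2 \<le> 4 * (wt u)^2 * rad * E"
    using sig_constraint[OF fv(3) fv(1)] inside unfolding sig_self a1 by (simp add: frame_inner[OF f])
  have cv: "(1/2) *\<^sub>R (u + b1 + b2 + b3) \<in> vertices" using frame_vertices(1)[OF frame_half[OF f]] .
  have sc: "sig ((1/2) *\<^sub>R (u + b1 + b2 + b3)) = 1/2 - c2 - c3 - E"
    using sig_corner[OF at, of 1 1 1] unfolding E_def by simp
  have i: "((1/2) *\<^sub>R (u + b1 + b2 + b3)) \<bullet> b1 = 1/2" by (simp add: inner_add_left frame_inner[OF f])
  show "2 * (wt ((1/2) *\<^sub>R (u + b1 + b2 + b3)))^2 * E \<le> (wt u)^2 * rad * (1/2 - c2 - c3 - E)"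
    using sig_constraint[OF cv fv(3) mult_pos_neg[OF out inside]] out unfolding a1 i sc by simp
  assume p3: "0 < sig b3"
  define q where "q = c1 - c3 - E"
  have s3: "sig b3 = 2 * q" unfolding sig_faces[OF at] E_def q_def by simp
  then have "\<bar>sig b3\<bar> = 2 * q" using p3 by simp
  with sig_constraint[OF fv(7) fv(3) mult_pos_neg[OF p3 inside]]
  have "(wt b3)^2 * (2 * E) \<le> 2 * (wt u)^2 * rad * (2 * q)"
    unfolding a1 by (simp add: frame_inner[OF f])
  then show "(wt b3)^2 * E \<le> 2 * (wt u)^2 * rad * (c1 - c3 - E)" unfolding q_def[symmetric] by (simp add: mult_ac)
qed

end

section \<open>Radius bounds when \<open>u\<close> has the smallest weight\<close>

lemma radius_face_contradiction:
  fixes E R g :: real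
  assumes "0 < R" "R \<le> 3/4" "0 < E" "1 \<le> 4 * R * E" "2 * E \<le> R * (1/2 - g - E)" "0 \<le> g"
  shows False
proof -
  have "R * (1/2 - g - E) \<le> R * (1/2 - E)" using assms by (intro mult_left_mono) simp_all
  then have "2 * E + R * E \<le> R / 2" using assms(5) by (simp add: algebra_simps)
  moreover have "1/4 \<le> R * E" using assms(4) by simp
  moreover have "R * E \<le> 3/4 * E" using assms by (intro mult_right_mono) simp_all
  ultimately show False using assms(2) by linarith
qed

text \<open>Eliminating \<open>A\<close> and \<open>B\<close> gives
  \<open>R + 1 \<le> R * R\<close>, so \<open>R\<close> is at least the golden ratio, beyond the 5/4
  that opposite walls ask for. \<open>A\<close> and \<open>B\<close> stand for the depth of an
  inside vertex and the value of \<open>sig\<close> at an outside neighbour.\<close>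

lemma golden_bound:
  fixes R A B :: real
  assumes "0 < R" "1 \<le> R * A" "A \<le> R * B" "A + B \<le> 1"
  shows "5/4 < R"
proof -
  have "R * A + R * B \<le> R" using assms(1,4) mult_left_mono[of "A + B" 1 R] by (simp add: distrib_left)
  then have "1 + A \<le> R" using assms by linarith
  then have "R * 1 + R * A \<le> R * R" using assms(1) mult_left_mono[of "1 + A" R R] by (simp add: distrib_left)
  then have "R + 1 \<le> R * R" using assms(2) by linarith
  then show ?thesis
  proof (rule_tac ccontr)
    assume "R + 1 \<le> R * R" "\<not> 5/4 < R"
    then have "R * R \<le> 5/4 * R" using assms(1) by (intro mult_right_mono) simp_all
    then show False using \<open>R + 1 \<le> R * R\<close> \<open>\<not> 5/4 < R\<close> by linarith
  qed
qed

context top_cap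
begin

text \<open>Otherwise \<open>rad \<le> 3/4\<close> and some face centre is inside. Its inequalities
  against \<open>u\<close> and against the corner are incompatible for so small a radius.\<close>

lemma corner_inside:
  assumes at: "at_frame b1 b2 b3 c1 c2 c3" and c: "0 \<le> c1" "0 \<le> c2" "0 \<le> c3"
    and wt: "\<And>w. wt u \<le> wt w" "wt (- u) = wt u"
  shows "sig ((1/2) *\<^sub>R (u + b1 + b2 + b3)) < 0"
proof (rule ccontr)
  assume nt: "\<not> ?thesis"
  note f = at_frame_frame[OF at]
  let ?v = "(1/2) *\<^sub>R (u + b1 + b2 + b3)"
  have cv: "?v \<in> vertices" using frame_vertices(1)[OF frame_half[OF f]] .
  have out: "0 < sig ?v" using nt sig_ne_0[OF cv] by linarith
  have cc: "c1 \<le> 1/2" "c2 \<le> 1/2" "c3 \<le> 1/2" using at_frame_walls[OF at] by auto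
  \<comment> \<open>With coordinates between 0 and 1/2 the value of \<open>sig\<close> at the
    nearest corner is at most \<open>3/4 - rad\<close>.\<close>
  have "x^2 \<le> x" if "0 \<le> x" "x \<le> 1/2" for x :: real
    using mult_right_mono[of x 1 x] that by (simp add: power2_eq_square)
  from this[OF c(1) cc(1)] this[OF c(2) cc(2)] this[OF c(3) cc(3)]
  have R: "rad \<le> 3/4" using out sig_corner[OF at, of 1 1 1] by simp
  have w2: "(wt u)^2 \<le> (wt w)^2" for w using wt(1) wt_pos[of u] by (intro power_mono) simp_all
  have wp: "0 < (wt u)^2" using wt_pos[of u] by simp
  have False if at': "at_frame x1 x2 x3 k1 k2 k3" "sig x1 < 0" "0 < sig ((1/2) *\<^sub>R (u + x1 + x2 + x3))" "0 \<le> k2" "0 \<le> k3"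
    for x1 x2 x3 k1 k2 k3
  proof -
    define E where "E = rad - (1/4 + (k1^2 + k2^2 + k3^2) - k1)"
    note fb = face_bounds[OF at'(1-3), folded E_def]
    have "(wt u)^2 * 1 \<le> (wt u)^2 * (4 * rad * E)" using order_trans[OF w2 fb(2)] by (simp add: mult_ac)
    then have 1: "1 \<le> 4 * rad * E" using wp by (simp only: mult_le_cancel_left_pos)
    have "(wt u)^2 * (2 * E) \<le> 2 * (wt ((1/2) *\<^sub>R (u + x1 + x2 + x3)))^2 * E"
      using mult_right_mono[OF w2, of "2 * E"] fb(1) by (simp add: mult_ac)
    then have "(wt u)^2 * (2 * E) \<le> (wt u)^2 * (rad * (1/2 - (k2 + k3) - E))" using fb(3) by (simp add: mult_ac diff_diff_eq)
    then have 2: "2 * E \<le> rad * (1/2 - (k2 + k3) - E)" using wp by (simp only: mult_le_cancel_left_pos)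
    show False by (rule radius_face_contradiction[OF rad_pos R fb(1) 1 2]) (use at' in simp)
  qed note key = this
  have e: "u + b1 + b2 + b3 = u + b2 + b1 + b3" "u + b1 + b2 + b3 = u + b3 + b1 + b2" by (simp_all add: add_ac)
  from face_inside[OF at c out wt(2)] show False
    using key[OF at _ out c(2,3)] key[OF at_frame_swap12[OF at] _ out[unfolded e(1)] c(1,3)]
      key[OF at_frame_swap12[OF at_frame_swap23[OF at]] _ out[unfolded e(2)] c(1,2)] by blast
qed

lemma corner_edge_bound:
  assumes w: "w \<in> vertices" "w' \<in> vertices" "w \<bullet> w' = 1/2" and s: "sig w < 0" "0 < sig w'"
  shows "(wt w')^2 * - sig w \<le> (wt u)^2 * rad * sig w'"
  using sig_constraint[OF w(2,1) mult_pos_neg[OF s(2,1)]] s w(3)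
  by (simp add: inner_commute[of w' w] mult_ac)

text \<open>The nearest corner of the cube is inside. If the opposite corner is inside as well, the
  radius is large. Otherwise a path of edges between them leaves the hemisphere somewhere;
  \<open>sig\<close> changes by at most 1 along an edge, and \<open>golden_bound\<close>
  applies.\<close>

lemma radius_bound:
  assumes wt: "\<And>w. wt u \<le> wt w" "wt (- u) = wt u"
  shows "5/4 < rad"
proof -
  obtain y1 y2 y3 where "frame u y1 y2 y3" using u_vertex unfolding vertices_def by blast
  then obtain l1 l2 l3 where "at_frame y1 y2 y3 l1 l2 l3" by (rule at_frame_exists)
  then obtain b1 b2 b3 c1 c2 c3 where at: "at_frame b1 b2 b3 c1 c2 c3" and c: "0 \<le> c1" "0 \<le> c2" "0 \<le> c3"
    using at_frame_nonneg by metis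
  note f = at_frame_frame[OF at]
  define C where "C = c1^2 + c2^2 + c3^2"
  define K where "K s1 s2 s3 = (1/2) *\<^sub>R (u + s1 *\<^sub>R b1 + s2 *\<^sub>R b2 + s3 *\<^sub>R b3)" for s1 s2 s3 :: real
  have Kv: "K s1 s2 s3 \<in> vertices" if "\<bar>s1\<bar> = 1" "\<bar>s2\<bar> = 1" "\<bar>s3\<bar> = 1" for s1 s2 s3
    unfolding K_def by (rule frame_corner[OF f that])
  have Ks: "sig (K s1 s2 s3) = 3/4 + C - (s1 * c1 + s2 * c2 + s3 * c3) - rad" for s1 s2 s3
    unfolding K_def C_def by (rule sig_corner[OF at])
  have Ki: "K s1 s2 s3 \<bullet> K r1 r2 r3 = (1 + s1 * r1 + s2 * r2 + s3 * r3) / 4" "K s1 s2 s3 \<bullet> u = 1/2" for s1 s2 s3 r1 r2 r3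
    unfolding K_def by (simp_all add: inner_add_left inner_add_right frame_inner[OF f])
  have w2: "(wt u)^2 \<le> (wt w)^2" for w using wt(1) wt_pos[of u] by (intro power_mono) simp_all
  have wp: "0 < (wt u)^2" using wt_pos[of u] by simp
  have in0: "sig (K 1 1 1) < 0" using corner_inside[OF at c wt] unfolding K_def by simp
  have inner: "1 \<le> rad * - sig w" if "w \<in> vertices" "w \<bullet> u = 1/2" "sig w < 0" for w
  proof -
    have "(wt w)^2 \<le> (wt u)^2 * (rad * - sig w)"
      using sig_constraint[OF that(1) u_vertex] that(2,3) by (simp add: sig_self mult_ac)
    then have "(wt u)^2 * 1 \<le> (wt u)^2 * (rad * - sig w)" using w2[of w] by simp
    then show ?thesis using wp by (simp only: mult_le_cancel_left_pos)
  qed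
  have edge: "5/4 < rad" if w: "w \<in> vertices" "w' \<in> vertices" "w \<bullet> w' = 1/2" "w \<bullet> u = 1/2"
    and s: "sig w < 0" "0 < sig w'" "sig w' - sig w \<le> 1" for w w'
  proof -
    have "(wt u)^2 * - sig w \<le> (wt w')^2 * - sig w" using w2[of w'] s(1) by (intro mult_right_mono) simp_all
    also have "\<dots> \<le> (wt u)^2 * rad * sig w'" by (rule corner_edge_bound[OF w(1-3) s(1,2)])
    finally have "(wt u)^2 * - sig w \<le> (wt u)^2 * (rad * sig w')" by (simp only: mult.assoc)
    then have "- sig w \<le> rad * sig w'" using wp by (simp only: mult_le_cancel_left_pos)
    then show ?thesis by (rule golden_bound[OF rad_pos inner[OF w(1,4) s(1)]]) (use s(3) in simp)
  qed
  have cc: "c1 \<le> 1/2" "c2 \<le> 1/2" "c3 \<le> 1/2" using at_frame_walls[OF at] by auto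
  have v: "K 1 1 1 \<in> vertices" "K (-1) 1 1 \<in> vertices" "K (-1) (-1) 1 \<in> vertices" "K (-1) (-1) (-1) \<in> vertices"
    by (auto intro!: Kv)
  show ?thesis
  proof (cases "sig (K (-1) (-1) (-1)) < 0")
    case True
    have "1 \<le> rad * - sig (K (-1) (-1) (-1))" by (rule inner[OF v(4) Ki(2) True])
    also have "\<dots> \<le> rad * (rad - 3/4)"
    proof (intro mult_left_mono)
      have "0 \<le> C" by (simp add: C_def)
      then show "- sig (K (-1) (-1) (-1)) \<le> rad - 3/4" unfolding Ks using c by simp
    qed (use rad_pos in simp)
    finally have r: "1 \<le> rad * (rad - 3/4)" .
    show ?thesis
    proof (rule ccontr)
      assume n: "\<not> ?thesis"
      then have "rad * (rad - 3/4) \<le> rad * (1/2)" using rad_pos by (intro mult_left_mono) simp_all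
      then show False using r n by linarith
    qed
  next
    case False
    then have o3: "0 < sig (K (-1) (-1) (-1))" using sig_ne_0[OF v(4)] by simp
    consider "0 < sig (K (-1) 1 1)" | "sig (K (-1) 1 1) < 0" "0 < sig (K (-1) (-1) 1)" | "sig (K (-1) (-1) 1) < 0"
      using sig_ne_0[OF v(2)] sig_ne_0[OF v(3)] by linarith
    then show ?thesis
    proof cases
      case 1
      then show ?thesis by (intro edge[OF v(1,2) _ _ in0 1]) (use cc in \<open>simp_all add: Ki Ks\<close>)
    next
      case 2
      then show ?thesis by (intro edge[OF v(2,3) _ _ 2]) (use cc in \<open>simp_all add: Ki Ks\<close>)
    next
      case 3
      then show ?thesis by (intro edge[OF v(3,4) _ _ 3 o3]) (use cc in \<open>simp_all add: Ki Ks\<close>)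
    qed
  qed
qed

end

section \<open>Inequalities for weights in the ratio 19 to 10\<close>

lemma heavy_face_contradiction:
  fixes E R g q :: real
  assumes "0 < R" "R \<le> 1/2" "0 < E" "1 \<le> 4 * R * E" "2 * q * E \<le> R * (1/2 - g - E)" "0 \<le> g" "0 < q"
  shows False
proof -
  have "4 * R * E \<le> 2 * E" using assms by (intro mult_right_mono) simp_all
  then have "1/2 - g - E \<le> 0" using assms by linarith
  then have "R * (1/2 - g - E) \<le> 0" using assms(1) by (simp add: mult_nonneg_nonpos)
  moreover have "0 < 2 * q * E" using assms by simp
  ultimately show False using assms(5) by linarith
qed

text \<open>The inside face centre may weigh as little as 10/19 of \<open>u\<close>, hence the
  factor 100/361. Comparison with an outside face centre as heavy as \<open>u\<close> gives
  \<open>2 * E \<le> c1\<close>; this caps \<open>R\<close> and raises \<open>E\<close> until the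
  second bound fails.\<close>

lemma light_face_contradiction:
  fixes E R c1 c2 c3 :: real
  assumes R: "0 < R" "R \<le> 1/2" and E: "0 < E" "E = R - (1/4 + (c1^2 + c2^2 + c3^2) - c1)"
    and c: "c1 \<le> 1/2" "0 \<le> c2" "0 \<le> c3"
    and b: "100/361 \<le> 4 * R * E" "2 * (100/361) * E \<le> R * (1/2 - (c2 + c3) - E)" "E \<le> 2 * R * (c1 - c3 - E)"
  shows False
proof -
  define g where "g = c2 + c3"
  have "4 * R * E \<le> 2 * E" using R E by (intro mult_right_mono) simp_all
  then have E1: "50/361 \<le> E" using b(1) by linarith
  have "0 < R * (1/2 - g - E)" using b(2) E(1) unfolding g_def by linarith
  then have h: "0 < 1/2 - g - E" using R(1) by (simp add: zero_less_mult_iff)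
  have "0 < 2 * R * (c1 - c3 - E)" using b(3) E(1) by linarith
  then have h': "0 < c1 - c3 - E" using R(1) by (simp add: zero_less_mult_iff)
  have "2 * R * (c1 - c3 - E) \<le> 1 * (c1 - c3 - E)" using R h' by (intro mult_right_mono) simp_all
  then have "E \<le> c1 - c3 - E" using b(3) unfolding mult_1 by (rule order_trans[rotated])
  then have p: "2 * E \<le> c1" using c(3) by linarith
  have "R * (1/2 - g - E) \<le> 1/2 * (1/2 - g - E)" using R h by (intro mult_right_mono) simp_all
  then have "400/361 * E \<le> 1/2 - g - E" using b(2) unfolding g_def by (simp add: field_simps)
  then have g: "g \<le> 21/100" using E1 by linarith
  have g0: "0 \<le> g" using c unfolding g_def by simp
  have "g * g \<le> 21/100 * (21/100)" using g g0 by (intro mult_mono) simp_all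
  moreover have "c2^2 + c3^2 \<le> g * g" using c unfolding g_def by (simp add: power2_eq_square algebra_simps)
  ultimately have cc: "c2^2 + c3^2 \<le> 441/10000" by linarith
  define y where "y = 1/2 - c1"
  have y: "0 \<le> y" "y \<le> 1/2" using c(1) p E(1) unfolding y_def by linarith+
  have "y * y \<le> 1/2 * y" using y by (intro mult_right_mono) simp_all
  moreover have "R = E + y * y + (c2^2 + c3^2)" unfolding E(2) y_def by (simp add: power2_eq_square algebra_simps)
  moreover have "2 * E \<le> 1/2 - y" using p unfolding y_def by simp
  \<comment> \<open>The bound is 1/4, from \<open>E + y * y\<close>, plus 441/10000.\<close>
  ultimately have R2: "R \<le> 2941/10000" using cc by linarith
  have "R * E \<le> 2941/10000 * E" using R2 E(1) by (intro mult_right_mono) simp_all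
  then have E2: "23/100 \<le> E" using b(1) by linarith
  have "R * (1/2 - g - E) \<le> 2941/10000 * (1/2 - g - E)" using R2 h by (intro mult_right_mono) simp_all
  then have "200/361 * E \<le> 2941/10000 * (1/2 - E)"
    using b(2) g0 unfolding g_def[symmetric] by (simp add: field_simps)
  then show False using E2 by (simp add: field_simps)
qed

text \<open>For an inside corner next to a heavy outside corner; 361/100 is the square of
  19/10.\<close>

lemma edge_contradiction:
  fixes A B R :: real
  assumes "0 < R" "R \<le> 9/4" "1 \<le> R * A" "361/100 * A \<le> R * B" "A + B \<le> 1" "0 < A" "0 < B"
  shows False
proof -
  have "R * A \<le> 9/4 * A" "R * B \<le> 9/4 * B" using assms by (auto intro!: mult_right_mono)
  then show False using assms by linarith
qed

text \<open>For two heavy corners across a diagonal of a face of the cube. These vertices are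
  orthogonal, which doubles the factor on the right, and \<open>sig\<close> differs by at most
  2.\<close>

lemma diagonal_contradiction:
  fixes A B R :: real
  assumes "0 < R" "R \<le> 9/4" "361/100 \<le> R * A" "361/100 * A \<le> 2 * R * B" "A + B \<le> 2" "0 < A" "0 < B"
  shows False
proof -
  have "R * A \<le> 9/4 * A" "R * B \<le> 9/4 * B" using assms by (auto intro!: mult_right_mono)
  then show False using assms by linarith
qed

text \<open>For an inside corner of depth \<open>A\<close> whose three neighbours are outside. From
  \<open>R \<le> 9/4\<close> come \<open>A \<ge> 4/9\<close> and at least 4/9 of \<open>A\<close>
  for each neighbour, so every \<open>y\<close> is at least 8/25. The centre is then so close to the
  corner that \<open>R\<close> falls below 5/4.\<close>

lemma star_contradiction:
  fixes A B1 B2 B3 R y1 y2 y3 :: real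
  assumes R: "0 < R" "R \<le> 9/4" and A: "1 \<le> R * A" "0 < A" and AB: "A \<le> R * B1" "A \<le> R * B2" "A \<le> R * B3"
    and B: "0 < B1" "0 < B2" "0 < B3"
    and y: "A + B1 = 2 * y1" "A + B2 = 2 * y2" "A + B3 = 2 * y3" "y1 \<le> 1/2" "y2 \<le> 1/2" "y3 \<le> 1/2"
    and RA: "R = A + ((1/2 - y1)^2 + (1/2 - y2)^2 + (1/2 - y3)^2)"
  shows False
proof -
  have "5/4 < R" by (rule golden_bound[OF R(1) A(1) AB(1)]) (use y in linarith)
  have "R * A \<le> 9/4 * A" "R * B1 \<le> 9/4 * B1" "R * B2 \<le> 9/4 * B2" "R * B3 \<le> 9/4 * B3"
    using R A B by (auto intro!: mult_right_mono)
  then have A4: "4/9 \<le> A" and b: "4/9 * A \<le> B1" "4/9 * A \<le> B2" "4/9 * A \<le> B3" using A AB by linarith+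
  have sq: "(1/2 - x)^2 \<le> 1/10" if "8/25 \<le> x" "x \<le> 1/2" for x :: real
  proof -
    have "(1/2 - x) * (1/2 - x) \<le> 9/50 * (9/50)" using that by (intro mult_mono) simp_all
    then show ?thesis unfolding power2_eq_square by linarith
  qed
  have "8/25 \<le> y1" "8/25 \<le> y2" "8/25 \<le> y3" using A4 b y by linarith+
  from sq[OF this(1) y(4)] sq[OF this(2) y(5)] sq[OF this(3) y(6)]
  have "R \<le> A + 3/10" unfolding RA by simp
  moreover have "A \<le> 9/13" using b(1) y(1,4) by linarith
  ultimately show False using \<open>5/4 < R\<close> by linarith
qed

context top_cap
begin

text \<open>The weights are chosen so that the hypotheses hold for \<open>u = \<plusminus>e 2\<close> and \<open>u = \<plusminus>e 4\<close> in the
  manifold \<open>N_mfd 23\<close>.\<close>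

lemma heavy_radius_bound:
  assumes f: "frame u b1 b2 b3" and wt: "\<And>w. 10 * wt u \<le> 19 * wt w" "wt (- u) = wt u" "wt b3 = wt u" "wt (- b3) = wt u"
  shows "1/2 < rad"
proof (rule ccontr)
  assume "\<not> ?thesis"
  then have R: "rad \<le> 1/2" by simp
  obtain l1 l2 l3 where "at_frame b1 b2 b3 l1 l2 l3" by (rule at_frame_exists[OF f])
  then obtain x1 x2 x3 c1 c2 c3 where at: "at_frame x1 x2 x3 c1 c2 c3" and c: "0 \<le> c1" "0 \<le> c2" "0 \<le> c3"
    and x3: "x3 = b3 \<or> x3 = - b3" by (rule at_frame_nonneg) blast
  note fx = at_frame_frame[OF at]
  have w3: "wt x3 = wt u" using x3 wt by auto
  have cc: "c1 \<le> 1/2" "c2 \<le> 1/2" "c3 \<le> 1/2" using at_frame_walls[OF at] by auto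
  have wp: "0 < (wt u)^2" using wt_pos[of u] by simp
  have w2: "100/361 * (wt u)^2 \<le> (wt w)^2" for w
  proof -
    have "(10 * wt u)^2 \<le> (19 * wt w)^2" using wt(1) wt_pos[of u] by (intro power_mono) simp_all
    then show ?thesis by (simp add: power_mult_distrib)
  qed
  let ?v = "(1/2) *\<^sub>R (u + x1 + x2 + x3)"
  have cv: "?v \<in> vertices" using frame_vertices(1)[OF frame_half[OF fx]] .
  have vu: "?v \<bullet> u = 1/2" by (simp add: inner_add_left frame_inner[OF fx])
  have sv: "sig ?v = (1/2 - c1)^2 + (1/2 - c2)^2 + (1/2 - c3)^2 - rad"
    using sig_corner[OF at, of 1 1 1] by (simp add: power2_eq_square algebra_simps)
  \<comment> \<open>With squared radius at most 1/2 no corner can be as deep as the inequality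
    against \<open>u\<close> demands of an inside vertex.\<close>
  have out: "0 < sig ?v"
  proof (rule ccontr)
    assume "\<not> ?thesis"
    then have neg: "sig ?v < 0" using sig_ne_0[OF cv] by linarith
    have "(wt ?v)^2 \<le> (wt u)^2 * (rad * - sig ?v)"
      using sig_constraint[OF cv u_vertex] neg vu by (simp add: sig_self mult_ac)
    then have "(wt u)^2 * (100/361) \<le> (wt u)^2 * (rad * - sig ?v)" using w2[of ?v] by simp
    then have "100/361 \<le> rad * - sig ?v" using wp by (simp only: mult_le_cancel_left_pos)
    also have "\<dots> \<le> 1/2 * (1/2)"
    proof (intro mult_mono)
      have "0 \<le> (1/2 - c1)^2 + (1/2 - c2)^2 + (1/2 - c3)^2" by simp
      then show "- sig ?v \<le> 1/2" using R unfolding sv by linarith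
    qed (use R neg in simp_all)
    finally show False by simp
  qed
  have heavy: False if at': "at_frame y1 y2 y3 k1 k2 k3" "sig y1 < 0" "0 < sig ((1/2) *\<^sub>R (u + y1 + y2 + y3))"
    "0 \<le> k2" "0 \<le> k3" "wt y1 = wt u" for y1 y2 y3 k1 k2 k3
  proof -
    define E where "E = rad - (1/4 + (k1^2 + k2^2 + k3^2) - k1)"
    note fb = face_bounds[OF at'(1-3), folded E_def]
    have "(wt u)^2 * 1 \<le> (wt u)^2 * (4 * rad * E)" using fb(2) unfolding at'(6) by (simp add: mult_ac)
    then have 1: "1 \<le> 4 * rad * E" using wp by (simp only: mult_le_cancel_left_pos)
    have "(wt u)^2 * (2 * (100/361) * E) \<le> 2 * (wt ((1/2) *\<^sub>R (u + y1 + y2 + y3)))^2 * E"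
      using mult_right_mono[OF w2[of "(1/2) *\<^sub>R (u + y1 + y2 + y3)"], of "2 * E"] fb(1) by (simp add: mult_ac)
    also have "\<dots> \<le> (wt u)^2 * (rad * (1/2 - (k2 + k3) - E))" using fb(3) by (simp only: mult.assoc diff_diff_eq add.assoc)
    finally have "(wt u)^2 * (2 * (100/361) * E) \<le> (wt u)^2 * (rad * (1/2 - (k2 + k3) - E))" .
    then have 2: "2 * (100/361) * E \<le> rad * (1/2 - (k2 + k3) - E)" using wp by (simp only: mult_le_cancel_left_pos)
    show False by (rule heavy_face_contradiction[OF rad_pos R fb(1) 1 2]) (use at' in simp_all)
  qed
  have light: False if at': "at_frame y1 y2 y3 k1 k2 k3" "sig y1 < 0" "0 < sig ((1/2) *\<^sub>R (u + y1 + y2 + y3))"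
    "0 \<le> k2" "0 \<le> k3" "wt y3 = wt u" "0 < sig y3" for y1 y2 y3 k1 k2 k3
  proof -
    define E where "E = rad - (1/4 + (k1^2 + k2^2 + k3^2) - k1)"
    note fb = face_bounds[OF at'(1-3), folded E_def]
    have "(wt u)^2 * (100/361) \<le> (wt u)^2 * (4 * rad * E)" using fb(2) w2[of y1] by (simp add: mult_ac)
    then have 1: "100/361 \<le> 4 * rad * E" using wp by (simp only: mult_le_cancel_left_pos)
    have "(wt u)^2 * (2 * (100/361) * E) \<le> 2 * (wt ((1/2) *\<^sub>R (u + y1 + y2 + y3)))^2 * E"
      using mult_right_mono[OF w2[of "(1/2) *\<^sub>R (u + y1 + y2 + y3)"], of "2 * E"] fb(1) by (simp add: mult_ac)
    also have "\<dots> \<le> (wt u)^2 * (rad * (1/2 - (k2 + k3) - E))" using fb(3) by (simp only: mult.assoc diff_diff_eq add.assoc)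
    finally have "(wt u)^2 * (2 * (100/361) * E) \<le> (wt u)^2 * (rad * (1/2 - (k2 + k3) - E))" .
    then have 2: "2 * (100/361) * E \<le> rad * (1/2 - (k2 + k3) - E)" using wp by (simp only: mult_le_cancel_left_pos)
    have "(wt u)^2 * E \<le> (wt u)^2 * (2 * rad * (k1 - k3 - E))" using fb(4)[OF at'(7)] unfolding at'(6) by (simp only: mult_ac)
    then have 3: "E \<le> 2 * rad * (k1 - k3 - E)" using wp by (simp only: mult_le_cancel_left_pos)
    have "k1 \<le> 1/2" using at_frame_walls[OF at'(1)] by auto
    then show False by (rule light_face_contradiction[OF rad_pos R fb(1) E_def _ at'(4,5) 1 2 3])
  qed
  have e: "u + x1 + x2 + x3 = u + x2 + x1 + x3" "u + x1 + x2 + x3 = u + x3 + x1 + x2" by (simp_all add: add_ac)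
  \<comment> \<open>\<open>x3\<close> has the weight of \<open>u\<close> and is therefore outside by
    \<open>heavy\<close>. The inside face centre is then \<open>x1\<close> or \<open>x2\<close>, and
    \<open>light\<close> compares it with \<open>x3\<close>.\<close>
  have s3: "0 < sig x3"
    using heavy[OF at_frame_swap12[OF at_frame_swap23[OF at]] _ out[unfolded e(2)] c(1,2) w3]
      sig_ne_0[OF frame_vertices(7)[OF fx]] linorder_neqE[of "sig x3" 0] by blast
  from face_inside[OF at c out wt(2)] show False
    using light[OF at _ out c(2,3) w3 s3] light[OF at_frame_swap12[OF at] _ out[unfolded e(1)] c(1,3) w3 s3] less_asym[OF s3] by blast
qed

lemma inner_frame:
  assumes "at_frame b1 b2 b3 c1 c2 c3"
  shows "a \<bullet> (x *\<^sub>R u + y1 *\<^sub>R b1 + y2 *\<^sub>R b2 + y3 *\<^sub>R b3) =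
    (a \<bullet> u - b) * (x * (1/2 + 2 * (rad - (c1^2 + c2^2 + c3^2))) - 2 * (y1 * c1 + y2 * c2 + y3 * c3))"
proof -
  define d where "d = a \<bullet> u - b"
  define r where "r = rad"
  have f: "frame u b1 b2 b3" and e: "a = capa u b1 b2 b3 d c1 c2 c3 r"
    using assms unfolding at_frame_def d_def r_def by blast+
  have "a \<bullet> (x *\<^sub>R u + y1 *\<^sub>R b1 + y2 *\<^sub>R b2 + y3 *\<^sub>R b3) =
    d * (x * (1/2 + 2 * (r - (c1^2 + c2^2 + c3^2))) - 2 * (y1 * c1 + y2 * c2 + y3 * c3))"
    by (subst e, unfold inner_add_right inner_scaleR_right cap_inner[OF f]) algebra
  then show ?thesis unfolding d_def r_def .
qed

text \<open>The folding conflict seen from an ideal vertex \<open>w\<close> inside the hemisphere.\<close>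

lemma folding_conflict_at:
  assumes f: "frame w x y y'" and A: "sig w = - A" "0 < A"
    and i: "a \<bullet> x = (a \<bullet> u - b) * p" "a \<bullet> y = (a \<bullet> u - b) * q" "a \<bullet> y' = (a \<bullet> u - b) * q'"
    and ij: "ij \<in> index_pairs" "w - x \<in> centres ij" "w + x \<in> centres ij"
    and lab: "lab ij w = w" "lab ij x = - x" "lab ij y = y" "lab ij y' = y'" "\<not> orientation_preserving (lab ij)"
    and p: "\<bar>p\<bar> \<le> 2 * A" and R: "A^2 / 2 < rad - ((A - q)^2 + (A - q')^2) / 4"
  shows False
proof -
  define d where "d = a \<bullet> u - b"
  have d: "d \<noteq> 0" using d_ne by (simp add: d_def)
  have un: "unitfn a b" using in_M unfolding in_M_def by blast
  have dw: "a \<bullet> w - b = - (d * A)" using A d unfolding sig_def d_def[symmetric] by (simp add: field_simps)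
  then have "a \<bullet> w - b \<noteq> 0" using d A(2) by simp
  then obtain d' c1 c2 c3 R' where c: "d' = a \<bullet> w - b" "4 * d'^2 * R' = 1" "0 < R'"
    "a = capa w x y y' d' c1 c2 c3 R'" "b = capb d' c1 c2 c3 R'"
    by (rule cap_exists[OF f un]) blast
  have d': "d' = - (d * A)" using c(1) dw by simp
  have "4 * d^2 * rad = 1" unfolding d_def by (rule rad_d)
  then have "4 * d^2 * rad = 4 * d^2 * (A^2 * R')" using c(2) unfolding d' by (simp add: power_mult_distrib mult_ac)
  \<comment> \<open>The signed distance at \<open>w\<close> is \<open>- A\<close> times that at
    \<open>u\<close>, so seen from \<open>w\<close> the squared radius is divided by
    \<open>A^2\<close>.\<close>
  then have RR: "rad = A^2 * R'" using d by simp
  have ci: "a \<bullet> x = - 2 * d' * c1" "a \<bullet> y = - 2 * d' * c2" "a \<bullet> y' = - 2 * d' * c3"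
    using cap_inner(2-4)[OF f, of d' c1 c2 c3 R'] c(4) by metis+
  have "d * p = d * (2 * A * c1)" "d * q = d * (2 * A * c2)" "d * q' = d * (2 * A * c3)"
    using ci i unfolding d_def[symmetric] unfolding d' by (simp_all add: mult.assoc)
  then have pq: "p = 2 * A * c1" "q = 2 * A * c2" "q' = 2 * A * c3" using d by simp_all
  have M': "in_M \<epsilon> (capa w x y y' d' c1 c2 c3 R') (capb d' c1 c2 c3 R')" using in_M c(4,5) by metis
  have "2 * A * \<bar>c1\<bar> \<le> 2 * A * 1" using p A(2) unfolding pq by (simp add: abs_mult)
  then have c1: "\<bar>c1\<bar> \<le> 1" using A(2) by (simp only: mult_le_cancel_left_pos)
  \<comment> \<open>The fold at \<open>w\<close> is tested over positions whose last two coordinates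
    are 1/2.\<close>
  have "((A - q)^2 + (A - q')^2) / 4 = A^2 * ((1/2 - c2)^2 + (1/2 - c3)^2)"
    unfolding pq by (simp add: power2_eq_square field_simps)
  then have "A^2 * (1/2) < A^2 * (R' - ((1/2 - c2)^2 + (1/2 - c3)^2))"
    using R unfolding RR by (simp add: right_diff_distrib)
  then have "1/2 < R' - ((1/2 - c2)^2 + (1/2 - c3)^2)" using A(2) by simp
  then show False
    by (intro folding_wall_conflict[OF f c(2) M' ij lab c1, of "1/2" "1/2"]) simp_all
qed

end

lemma sign_maps_neg: "uminus \<in> sign_maps"
  unfolding sign_maps_def by (rule CollectI, rule exI[of _ "\<lambda>_. True"]) (simp add: fun_eq_iff vec_eq_iff)

context top_cap
begin

lemma inside_bound:
  assumes "w \<in> vertices" "w \<bullet> u = 1/2" "sig w < 0"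
  shows "(wt w)^2 \<le> (wt u)^2 * (rad * - sig w)"
  using sig_constraint[OF assms(1) u_vertex] assms(2,3) by (simp add: sig_self mult_ac)

text \<open>The \<open>v\<close>s are four alternate corners of the cube at \<open>u\<close>, of
  which \<open>v2\<close> and \<open>v4\<close> are heavy. The hemisphere cannot separate these two
  (\<open>diag\<close>). If both were outside, so would be the four other corners, each adjacent to
  one of them (\<open>near\<close>), and then \<open>v1\<close> and \<open>v3\<close>
  (\<open>star\<close>), against \<open>corner_inside\<close>.\<close>

lemma half_inside:
  assumes f: "frame v1 v2 v3 v4" and u: "u = (1/2) *\<^sub>R (v1 + v2 + v3 + v4)"
    and wt: "wt v2 = 19/10" "wt v4 = 19/10" "wt u = 1" "wt (- u) = 1" "\<And>w. 1 \<le> wt w" and R: "rad \<le> 9/4"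
    and at: "at_frame b1 b2 b3 c1 c2 c3"
    and b: "b1 = (1/2) *\<^sub>R (v1 + v2 - v3 - v4)" "b2 = (1/2) *\<^sub>R (v1 - v2 + v3 - v4)" "b3 = (1/2) *\<^sub>R (v1 - v2 - v3 + v4)"
  shows "sig v2 < 0 \<and> sig v4 < 0"
proof -
  note fu = at_frame_frame[OF at]
  define C where "C = c1^2 + c2^2 + c3^2"
  define K where "K s1 s2 s3 = (1/2) *\<^sub>R (u + s1 *\<^sub>R b1 + s2 *\<^sub>R b2 + s3 *\<^sub>R b3)" for s1 s2 s3 :: real
  have Kv: "K s1 s2 s3 \<in> vertices" if "\<bar>s1\<bar> = 1" "\<bar>s2\<bar> = 1" "\<bar>s3\<bar> = 1" for s1 s2 s3
    unfolding K_def by (rule frame_corner[OF fu that])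
  have Ks: "sig (K s1 s2 s3) = 3/4 + C - (s1 * c1 + s2 * c2 + s3 * c3) - rad" for s1 s2 s3
    unfolding K_def C_def by (rule sig_corner[OF at])
  have Ki: "K s1 s2 s3 \<bullet> K r1 r2 r3 = (1 + s1 * r1 + s2 * r2 + s3 * r3) / 4" "K s1 s2 s3 \<bullet> u = 1/2" for s1 s2 s3 r1 r2 r3
    unfolding K_def by (simp_all add: inner_add_left inner_add_right frame_inner[OF fu])
  have v: "v1 = K 1 1 1" "v2 = K 1 (-1) (-1)" "v3 = K (-1) 1 (-1)" "v4 = K (-1) (-1) 1"
    unfolding K_def u b by (simp_all add: vec_eq_iff field_simps)
  have cc: "c1 \<le> 1/2" "c2 \<le> 1/2" "c3 \<le> 1/2" "- 1/2 \<le> c1" "- 1/2 \<le> c2" "- 1/2 \<le> c3"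
    using at_frame_walls[OF at] by auto
  have wpos: "1 \<le> (wt w)^2" for w using wt(5)[of w] by (simp add: one_le_power)
  have inner: "1 \<le> rad * - sig w" if "w \<in> vertices" "w \<bullet> u = 1/2" "sig w < 0" for w
    using inside_bound[OF that] wpos[of w] wt(3) by simp
  have edge: "(wt w')^2 * - sig w \<le> rad * sig w'" if "w \<in> vertices" "w' \<in> vertices" "w \<bullet> w' = 1/2" "sig w < 0" "0 < sig w'" for w w'
    using corner_edge_bound[OF that] wt(3) by simp
  have edge1: "- sig w \<le> rad * sig w'" if "w \<in> vertices" "w' \<in> vertices" "w \<bullet> w' = 1/2" "sig w < 0" "0 < sig w'" for w w'
    using order_trans[OF mult_right_mono[OF wpos[of w'], of "- sig w"] edge[OF that]] that(4) by simp
  have diag: False if w: "w \<in> vertices" "w' \<in> vertices" "w \<bullet> u = 1/2" "w \<bullet> w' = 0" and h: "wt w = 19/10" "wt w' = 19/10"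
    and s: "sig w < 0" "0 < sig w'" "sig w' - sig w \<le> 2" for w w'
  proof (rule diagonal_contradiction[OF rad_pos R])
    show "361/100 \<le> rad * - sig w" using inside_bound[OF w(1,3) s(1)] wt(3) h(1) by (simp add: power2_eq_square)
    show "361/100 * - sig w \<le> 2 * rad * sig w'"
      using sig_constraint[OF w(2,1) mult_pos_neg[OF s(2,1)]] s w(4) h wt(3)
      by (simp add: inner_commute[of w' w] power2_eq_square)
  qed (use s in simp_all)
  have near: False if w: "w \<in> vertices" "w' \<in> vertices" "w \<bullet> u = 1/2" "w \<bullet> w' = 1/2" and h: "wt w' = 19/10"
    and s: "sig w < 0" "0 < sig w'" "sig w' - sig w \<le> 1" for w w'
  proof (rule edge_contradiction[OF rad_pos R inner[OF w(1,3) s(1)]])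
    show "361/100 * - sig w \<le> rad * sig w'" using edge[OF w(1,2,4) s(1,2)] h by (simp add: power2_eq_square)
  qed (use s in simp_all)
  have star: False if r: "\<bar>r1\<bar> = 1" "\<bar>r2\<bar> = 1" "\<bar>r3\<bar> = 1" and s: "sig (K r1 r2 r3) < 0" "0 < sig (K (- r1) r2 r3)"
    "0 < sig (K r1 (- r2) r3)" "0 < sig (K r1 r2 (- r3))" for r1 r2 r3
  proof -
    have rr: "r1 * r1 = 1" "r2 * r2 = 1" "r3 * r3 = 1" using r by (auto simp: abs_if split: if_splits)
    have K: "K r1 r2 r3 \<in> vertices" "K (- r1) r2 r3 \<in> vertices" "K r1 (- r2) r3 \<in> vertices" "K r1 r2 (- r3) \<in> vertices"
      using r by (auto intro!: Kv)
    have le: "r1 * c1 \<le> 1/2" "r2 * c2 \<le> 1/2" "r3 * c3 \<le> 1/2"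
      using r cc by (auto simp: abs_if split: if_splits)
    have "(1/2 - r * c)^2 = 1/4 + c^2 - r * c" if "\<bar>r\<bar> = 1" for r c :: real
    proof -
      have "r = 1 \<or> r = -1" using that by linarith
      then show ?thesis by (auto simp: power2_eq_square algebra_simps)
    qed
    note sq = this[OF r(1)] this[OF r(2)] this[OF r(3)]
    show False
      by (rule star_contradiction[OF rad_pos R inner[OF K(1) Ki(2) s(1)] _ edge1[OF K(1,2) _ s(1,2)] edge1[OF K(1,3) _ s(1,3)]
          edge1[OF K(1,4) _ s(1,4)] _ _ _ _ _ _ le]) (use s rr in \<open>simp_all add: Ki Ks sq C_def\<close>)
  qed
  have vv: "v2 \<in> vertices" "v4 \<in> vertices" "v2 \<bullet> u = 1/2" "v4 \<bullet> u = 1/2" "v2 \<bullet> v4 = 0" "v4 \<bullet> v2 = 0"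
    unfolding v by (auto intro!: Kv simp: Ki)
  have s24: "sig v2 - sig v4 = 2 * c3 - 2 * c1" unfolding v Ks by simp
  show ?thesis
  proof (rule ccontr)
    assume nt: "\<not> ?thesis"
    have "\<not> (sig v2 < 0 \<and> 0 < sig v4)"
      using diag[OF vv(1,2,3,5) wt(1,2)] s24 cc by force
    moreover have "\<not> (sig v4 < 0 \<and> 0 < sig v2)"
      using diag[OF vv(2,1,4,6) wt(2,1)] s24 cc by force
    ultimately have out: "0 < sig v2" "0 < sig v4" using nt sig_ne_0[OF vv(1)] sig_ne_0[OF vv(2)] by linarith+
    have half: "0 < sig (K r1 r2 r3)" if r: "\<bar>r1\<bar> = 1" "\<bar>r2\<bar> = 1" "\<bar>r3\<bar> = 1"
      and w: "w = v2 \<or> w = v4" "K r1 r2 r3 \<bullet> w = 1/2" "sig w - sig (K r1 r2 r3) \<le> 1" for r1 r2 r3 w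
    proof (rule ccontr)
      assume "\<not> ?thesis"
      then have "sig (K r1 r2 r3) < 0" using sig_ne_0[OF Kv[OF r]] by linarith
      then show False using near[OF Kv[OF r] _ Ki(2) w(2)] w vv wt(1,2) out by auto
    qed
    have h: "0 < sig (K (-1) (-1) (-1))" "0 < sig (K 1 1 (-1))" "0 < sig (K 1 (-1) 1)" "0 < sig (K (-1) 1 1)"
      using cc half[of "-1" "-1" "-1" v2] half[of 1 1 "-1" v2] half[of 1 "-1" 1 v2] half[of "-1" 1 1 v4]
      unfolding v by (simp_all add: Ki Ks)
    have o1: "0 < sig v1"
      using star[of 1 1 1] h sig_ne_0[OF frame_vertices(1)[OF f]] unfolding v(1) by force
    have o3: "0 < sig v3"
      using star[of "-1" 1 "-1"] h sig_ne_0[OF frame_vertices(5)[OF f]] unfolding v(3) by force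
    have all: "0 < sig (K r1 r2 r3)" if "r1 = 1 \<or> r1 = -1" "r2 = 1 \<or> r2 = -1" "r3 = 1 \<or> r3 = -1" for r1 r2 r3
      using that h o1 o3 out unfolding v by auto
    obtain x1 x2 x3 k1 k2 k3 where x: "at_frame x1 x2 x3 k1 k2 k3" "0 \<le> k1" "0 \<le> k2" "0 \<le> k3"
      and xb: "x1 = b1 \<or> x1 = - b1" "x2 = b2 \<or> x2 = - b2" "x3 = b3 \<or> x3 = - b3"
      by (rule at_frame_nonneg[OF at])
    obtain r1 where r1: "r1 = 1 \<or> r1 = -1" "x1 = r1 *\<^sub>R b1" using xb(1) by (metis scaleR_one scaleR_minus1_left)
    obtain r2 where r2: "r2 = 1 \<or> r2 = -1" "x2 = r2 *\<^sub>R b2" using xb(2) by (metis scaleR_one scaleR_minus1_left)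
    obtain r3 where r3: "r3 = 1 \<or> r3 = -1" "x3 = r3 *\<^sub>R b3" using xb(3) by (metis scaleR_one scaleR_minus1_left)
    have "sig (K r1 r2 r3) < 0"
      using corner_inside[OF x] wt unfolding K_def r1(2) r2(2) r3(2) by simp
    then show False using all[OF r1(1) r2(1) r3(1)] by linarith
  qed
qed

text \<open>The fold is made at the heavy vertex \<open>w\<close>, of depth \<open>A\<close>, in the
  direction of the corner \<open>x\<close>. Its condition reduces to
  \<open>A^2 / 2 < A + (1/2 - c1)^2\<close>, for which \<open>A < 2\<close> is enough.\<close>

lemma half_folding:
  assumes at: "at_frame b1 b2 b3 c1 c2 c3" and c1: "0 \<le> c1" and R: "rad \<le> 9/4"
    and f: "frame w x y y'" and w: "w = (1/2) *\<^sub>R (u + b1 - b2 - b3)" "x = (1/2) *\<^sub>R (u + b1 + b2 + b3)"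
      "y = (1/2) *\<^sub>R (u - b1 + b2 - b3)" "y' = (1/2) *\<^sub>R (u - b1 - b2 + b3)"
    and s: "sig w < 0" "sig y' < 0" and wt: "wt w = 19/10" "wt y' = 19/10" "wt u = 1"
    and ij: "ij \<in> index_pairs" "w - x \<in> centres ij" "w + x \<in> centres ij"
    and lab: "lab ij w = w" "lab ij x = - x" "lab ij y = y" "lab ij y' = y'" "\<not> orientation_preserving (lab ij)"
  shows False
proof -
  note fu = at_frame_frame[OF at]
  note fv = frame_vertices[OF f]
  define C where "C = c1^2 + c2^2 + c3^2"
  define A where "A = - sig w"
  have wu: "w \<bullet> u = 1/2" "y' \<bullet> u = 1/2" unfolding w by (simp_all add: inner_add_left inner_diff_left frame_inner[OF fu])
  have sw: "sig w = 3/4 + C - (c1 - c2 - c3) - rad" "sig y' = 3/4 + C - (- c1 - c2 + c3) - rad"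
    using sig_corner[OF at, of 1 "-1" "-1"] sig_corner[OF at, of "-1" "-1" 1] unfolding w C_def by simp_all
  have big: "8/5 \<le> - sig v" if v: "v \<in> vertices" "v \<bullet> u = 1/2" "sig v < 0" "wt v = 19/10" for v
  proof -
    have "361/100 \<le> rad * - sig v" using inside_bound[OF v(1-3)] v(4) wt(3) by (simp add: power2_eq_square)
    also have "\<dots> \<le> 9/4 * - sig v" using R v(3) by (intro mult_right_mono) simp_all
    finally show ?thesis by simp
  qed
  have A: "8/5 \<le> A" "8/5 \<le> - sig y'" unfolding A_def
    using big[OF fv(1) wu(1) s(1) wt(1)] big[OF fv(7) wu(2) s(2) wt(2)] by auto
  \<comment> \<open>The depths of \<open>w\<close> and \<open>y'\<close> add up to
    \<open>2 * rad - 3/2 - 2 * (C + c2)\<close>, which is at most 7/2. As \<open>y'\<close> has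
    depth at least 8/5, the depth of \<open>w\<close> is below 2.\<close>
  have "0 \<le> c1^2 + (1/2 + c2)^2 + c3^2" by simp
  then have "0 \<le> C + c2 + 1/4" unfolding C_def by (simp add: power2_eq_square algebra_simps)
  then have A2: "A < 2" using A(2) R unfolding sw A_def by linarith
  have rA: "rad = A + 3/4 + C - c1 + c2 + c3" unfolding A_def sw by simp
  have "a \<bullet> x = (a \<bullet> u - b) * (1/4 + (rad - C) - c1 - c2 - c3)"
    "a \<bullet> y = (a \<bullet> u - b) * (1/4 + (rad - C) + c1 - c2 + c3)"
    "a \<bullet> y' = (a \<bullet> u - b) * (1/4 + (rad - C) + c1 + c2 - c3)"
    using inner_frame[OF at, of "1/2" "1/2" "1/2" "1/2"] inner_frame[OF at, of "1/2" "-1/2" "1/2" "-1/2"]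
      inner_frame[OF at, of "1/2" "-1/2" "-1/2" "1/2"]
    unfolding w C_def[symmetric] by (simp_all add: scaleR_add_right scaleR_diff_right algebra_simps)
  then have i: "a \<bullet> x = (a \<bullet> u - b) * (A + 1 - 2 * c1)" "a \<bullet> y = (a \<bullet> u - b) * (A + 1 + 2 * c3)"
    "a \<bullet> y' = (a \<bullet> u - b) * (A + 1 + 2 * c2)" unfolding rA by simp_all
  have c: "c1 \<le> 1/2" using at_frame_walls[OF at] by auto
  have AA: "A * A < A * 2" using A(1) A2 by (intro mult_strict_left_mono) simp_all
  have "rad - ((A - (A + 1 + 2 * c3))^2 + (A - (A + 1 + 2 * c2))^2) / 4 = A + (1/2 - c1)^2"
    unfolding rA C_def by (simp add: power2_eq_square field_simps)
  moreover have "A^2 / 2 < A + (1/2 - c1)^2"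
    using AA zero_le_power2[of "1/2 - c1"] unfolding power2_eq_square[of A] by linarith
  ultimately have RR: "A^2 / 2 < rad - ((A - (A + 1 + 2 * c3))^2 + (A - (A + 1 + 2 * c2))^2) / 4" by simp
  \<comment> \<open>For \<open>c1\<close> between 0 and 1/2 the coordinate
    \<open>A + 1 - 2 * c1\<close> lies between \<open>A\<close> and \<open>A + 1\<close>, hence
    within \<open>2 * A\<close>.\<close>
  show False
    by (rule folding_conflict_at[OF f _ _ i ij lab _ RR]) (use A c c1 in \<open>auto simp: A_def\<close>)
qed

lemma opposite_conflict:
  assumes wt: "\<And>w. wt u \<le> wt w" and f: "frame u b1 b2 b3"
    and ij: "ij \<in> index_pairs" "u + b1 \<in> centres ij" and kl: "kl \<in> index_pairs" "u - b1 \<in> centres kl" and lab: "lab kl = lab ij"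
  shows False
proof -
  obtain c1 c2 c3 where at: "at_frame b1 b2 b3 c1 c2 c3" by (rule at_frame_exists[OF f])
  have "wt (- u) = wt u" using wt_sign_map[OF sign_maps_neg] .
  then show False
    using opposite_walls_conflict[OF f rad_d at_frame_in_M[OF at] ij kl lab] at radius_bound wt
    unfolding at_frame_def by blast
qed

end

section \<open>The four manifolds\<close>

lemma det_kdiag: "det (matrix (kdiag d)) =
    (if odd d then -1 else 1) * (if odd (d div 2) then -1 else 1) *
    (if odd (d div 4) then -1 else 1) * (if odd (d div 8) then -1 else 1)"
proof -
  have "kdiag d (axis j 1) $ i = 0" if "i \<noteq> j" for i j :: 4
    using that exhaust_4[of i] by (auto simp: kdiag_nth axis_def)
  then have "matrix (kdiag d) $ i $ j = 0" if "i \<noteq> j" for i j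
    using that by (simp add: matrix_def)
  then have "det (matrix (kdiag d)) = prod (\<lambda>i. matrix (kdiag d) $ i $ i) UNIV" by (rule det_diagonal)
  also have "\<dots> = prod (\<lambda>i. kdiag d (axis i 1) $ i) {1, 2, 3, 4}" by (simp add: matrix_def UNIV_4[symmetric])
  also have "\<dots> = kdiag d (axis 1 1) $ 1 * (kdiag d (axis 2 1) $ 2 * (kdiag d (axis 3 1) $ 3 * kdiag d (axis 4 1) $ 4))" by simp
  finally show ?thesis unfolding kdiag_nth axis_nth mult_1_right mult.assoc .
qed

lemma kdiag_orientation:
  "orientation_preserving (kdiag d) \<longleftrightarrow> even (d + d div 2 + d div 4 + d div 8)"
  unfolding orthogonal_orientation(1)[OF sign_maps_orthogonal[OF kdiag_sign_maps]] det_kdiag by auto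

lemma kdiag_id: "kdiag d = (\<lambda>x. x) \<Longrightarrow> even d \<and> even (d div 2) \<and> even (d div 4) \<and> even (d div 8)"
  using kdiag_nth[of d "\<chi> i. 1"] by (auto split: if_splits)

text \<open>Inner products with centres are -1, 0 or 1, and so are sums and differences of two
  coordinates. Hence all coordinates are 1/2 in absolute value or all are integers, and in the
  latter case the norm leaves a single one.\<close>

lemma vertex_cases:
  assumes "u \<in> vertices"
  obtains (axis) m s where "m \<in> {1, 2, 3, 4::nat}" "\<bar>s\<bar> = 1" "u = s *\<^sub>R e m"
  | (half) s1 s2 s3 s4 where "\<bar>s1\<bar> = 1" "\<bar>s2\<bar> = 1" "\<bar>s3\<bar> = 1" "\<bar>s4\<bar> = 1"
      "u = (1/2) *\<^sub>R (s1 *\<^sub>R e 1 + s2 *\<^sub>R e 2 + s3 *\<^sub>R e 3 + s4 *\<^sub>R e 4)"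
proof -
  obtain b1 b2 b3 where f: "frame u b1 b2 b3" using assms unfolding vertices_def by blast
  have ci: "v \<bullet> u \<in> {-1, 0, 1}" if "v \<in> all_centres" for v
    using that unfolding frame_centres[OF f]
    by (auto simp: inner_add_left inner_diff_left frame_inner[OF f])
  define x where "x i = e i \<bullet> u" for i
  have "e i + e j \<in> all_centres \<and> e i - e j \<in> all_centres" if "(i, j) \<in> index_pairs" for i j
    using that centres_eq[of i j] unfolding all_centres_def by blast
  then have xx: "x i + x j \<in> {-1, 0, 1} \<and> x i - x j \<in> {-1, 0, 1}" if "(i, j) \<in> index_pairs" for i j
    using ci[of "e i + e j"] ci[of "e i - e j"] that unfolding x_def inner_add_left inner_diff_left by blast
  have ux: "u = x 1 *\<^sub>R e 1 + x 2 *\<^sub>R e 2 + x 3 *\<^sub>R e 3 + x 4 *\<^sub>R e 4"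
    using frame_expand[OF frame_e, of u] unfolding x_def by (simp add: inner_commute)
  have "u \<bullet> u = 1" by (rule frame_inner(1)[OF f])
  then have n: "(x 1)^2 + (x 2)^2 + (x 3)^2 + (x 4)^2 = 1"
    by (subst (asm) ux, subst (asm) ux) (simp add: inner_add_left inner_add_right e_inner power2_eq_square)
  note xs = xx[of 1 2] xx[of 1 3] xx[of 1 4]
  show ?thesis
  proof (cases "\<bar>x 1\<bar> = 1/2")
    case True
    have p: "\<bar>2 * q\<bar> = 1" if "p + q \<in> {-1, 0, 1} \<and> p - q \<in> {-1, 0, 1}" "\<bar>p\<bar> = 1/2" for p q :: real
      using that by auto
    have "\<bar>2 * x 1\<bar> = 1" "\<bar>2 * x 2\<bar> = 1" "\<bar>2 * x 3\<bar> = 1" "\<bar>2 * x 4\<bar> = 1"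
      using True p[OF xs(1) True] p[OF xs(2) True] p[OF xs(3) True] unfolding index_pairs_eq by simp_all
    moreover have "u = (1/2) *\<^sub>R ((2 * x 1) *\<^sub>R e 1 + (2 * x 2) *\<^sub>R e 2 + (2 * x 3) *\<^sub>R e 3 + (2 * x 4) *\<^sub>R e 4)"
      by (subst ux) (simp add: scaleR_add_right)
    ultimately show ?thesis by (rule half)
  next
    case False
    have p: "p \<in> {-1, 0, 1} \<and> q \<in> {-1, 0, 1}" if "p + q \<in> {-1, 0, 1} \<and> p - q \<in> {-1, 0, 1}" "\<bar>p\<bar> \<noteq> 1/2" for p q :: real
      using that by auto
    have "x 1 \<in> {-1, 0, 1}" "x 2 \<in> {-1, 0, 1}" "x 3 \<in> {-1, 0, 1}" "x 4 \<in> {-1, 0, 1}"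
      using p[OF xs(1) False] p[OF xs(2) False] p[OF xs(3) False] unfolding index_pairs_eq by blast+
    then have "(\<bar>x 1\<bar> = 1 \<and> x 2 = 0 \<and> x 3 = 0 \<and> x 4 = 0) \<or> (\<bar>x 2\<bar> = 1 \<and> x 1 = 0 \<and> x 3 = 0 \<and> x 4 = 0) \<or>
      (\<bar>x 3\<bar> = 1 \<and> x 1 = 0 \<and> x 2 = 0 \<and> x 4 = 0) \<or> (\<bar>x 4\<bar> = 1 \<and> x 1 = 0 \<and> x 2 = 0 \<and> x 3 = 0)"
      using n by (elim insertE emptyE) simp_all
    then show ?thesis
      using axis[of 1 "x 1"] axis[of 2 "x 2"] axis[of 3 "x 3"] axis[of 4 "x 4"] ux by auto
  qed
qed

lemma census_digits:
  "code_digit (census_code 23) (1, 2) = 1" "code_digit (census_code 23) (1, 3) = 5" "code_digit (census_code 23) (2, 3) = 6"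
  "code_digit (census_code 23) (1, 4) = 9" "code_digit (census_code 23) (2, 4) = 10" "code_digit (census_code 23) (3, 4) = 4"
  "code_digit (census_code 71) (1, 3) = 3" "code_digit (census_code 71) (2, 4) = 3"
  "code_digit (census_code 1091) (1, 4) = 15" "code_digit (census_code 1091) (2, 3) = 15"
  "code_digit (census_code 1092) (1, 4) = 15" "code_digit (census_code 1092) (2, 3) = 15"
  unfolding code_digit_def census_code_def by simp_all

lemma census_nontrivial:
  assumes "n \<in> {23, 71, 1091, 1092}" "ij \<in> index_pairs"
  shows "kdiag (code_digit (census_code n) ij) \<noteq> (\<lambda>x. x)"
proof
  assume "kdiag (code_digit (census_code n) ij) = (\<lambda>x. x)"
  note k = kdiag_id[OF this]
  from assms show False
    unfolding index_pairs_eq by (elim insertE emptyE) (use k in \<open>simp_all add: code_digit_def census_code_def\<close>)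
qed

lemma signed_in_centres:
  assumes "\<bar>s\<bar> = 1" "\<bar>t\<bar> = 1"
  shows "s *\<^sub>R e i + t *\<^sub>R e j \<in> centres (i, j)"
proof -
  have "s = 1 \<or> s = -1" "t = 1 \<or> t = -1" using assms by linarith+
  then show ?thesis unfolding centres_eq by auto
qed

lemma axis_frames:
  "frame (e 2) (e 1) (e 3) (e 4)" "frame (e 3) (e 4) (e 1) (e 2)" "frame (e 4) (e 3) (e 1) (e 2)"
  using frame_e frame_swap01 frame_swap12 frame_swap23 by blast+

lemma frame_sign0: "frame u b1 b2 b3 \<Longrightarrow> \<bar>s\<bar> = 1 \<Longrightarrow> frame (s *\<^sub>R u) b1 b2 b3"
  using frame_neg0[of u b1 b2 b3] by (cases "s = 1") (auto simp: abs_if split: if_splits)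

lemma (in weighted_geodesic) top_cap_exists: "\<exists>\<epsilon> a b u z. top_cap code M wt \<epsilon> a b u z"
proof -
  obtain \<epsilon> a b u z where t: "in_M \<epsilon> a b" "u \<in> vertices" "a \<bullet> u - b \<noteq> 0" "z \<in> Q" "Fn a b z = 0"
    "height u z = 1 / \<bar>a \<bullet> u - b\<bar>"
    "\<And>\<epsilon>' a' b' x w. in_M \<epsilon>' a' b' \<Longrightarrow> x \<in> Q \<Longrightarrow> Fn a' b' x = 0 \<Longrightarrow> w \<in> vertices \<Longrightarrow>
      wt w * height w x \<le> wt u / \<bar>a \<bullet> u - b\<bar>"
    using top_exists by metis
  have "top_cap code M wt \<epsilon> a b u z" by unfold_locales (use t in blast)+
  then show ?thesis by blast
qed

context top_cap
begin

text \<open>At an axis vertex opposite walls belong to the same index pair, so they carry the same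
  label whatever the code is.\<close>

lemma axis_conflict:
  assumes wt: "\<And>w. wt u \<le> wt w" and m: "m \<in> {1, 2, 3, 4::nat}" and s: "\<bar>s\<bar> = 1" and u: "u = s *\<^sub>R e m"
  shows False
proof -
  have c: "u + e j \<in> centres (m, j) \<and> u - e j \<in> centres (m, j)" "u + e j \<in> centres (j, m) \<and> u - e j \<in> centres (j, m)" for j
    using signed_in_centres[OF s, of 1 m j] signed_in_centres[OF s, of "-1" m j]
      signed_in_centres[OF _ s, of 1 j m] signed_in_centres[OF _ s, of "-1" j m] unfolding u by (simp_all add: add.commute)
  consider "m = 1" | "m = 2" | "m = 3" | "m = 4" using m by auto
  then show False
  proof cases
    case 1
    show False
      by (rule opposite_conflict[OF wt frame_sign0[OF frame_e s, folded u[unfolded 1]], of "(1, 2)" "(1, 2)"])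
        (use c 1 in \<open>auto simp: index_pairs_eq\<close>)
  next
    case 2
    show False
      by (rule opposite_conflict[OF wt frame_sign0[OF axis_frames(1) s, folded u[unfolded 2]], of "(1, 2)" "(1, 2)"])
        (use c 2 in \<open>auto simp: index_pairs_eq\<close>)
  next
    case 3
    show False
      by (rule opposite_conflict[OF wt frame_sign0[OF axis_frames(2) s, folded u[unfolded 3]], of "(3, 4)" "(3, 4)"])
        (use c 3 in \<open>auto simp: index_pairs_eq\<close>)
  next
    case 4
    show False
      by (rule opposite_conflict[OF wt frame_sign0[OF axis_frames(3) s, folded u[unfolded 4]], of "(3, 4)" "(3, 4)"])
        (use c 4 in \<open>auto simp: index_pairs_eq\<close>)
  qed
qed

text \<open>At a half-integral vertex opposite walls belong to complementary index pairs, so the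
  translation by 2 needs a code with equal labels at two such pairs.\<close>

lemma half_conflict:
  assumes wt: "\<And>w. wt u \<le> wt w" and f: "frame x1 x2 x3 x4" and u: "u = (1/2) *\<^sub>R (x1 + x2 + x3 + x4)"
    and ij: "ij \<in> index_pairs" "x1 + x2 \<in> centres ij" and kl: "kl \<in> index_pairs" "x3 + x4 \<in> centres kl" and lab: "lab kl = lab ij"
  shows False
proof -
  have "u + (1/2) *\<^sub>R (x1 + x2 - x3 - x4) = x1 + x2" "u - (1/2) *\<^sub>R (x1 + x2 - x3 - x4) = x3 + x4"
    unfolding u by (simp_all add: vec_eq_iff field_simps)
  then show False
    using opposite_conflict[OF wt frame_half[OF f, folded u], of ij kl] ij kl lab by simp
qed

text \<open>A label that is the reflection along \<open>b1\<close> turns one crossing into a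
  translation by 1. For this a squared radius above 1/2 is enough, which is what
  \<open>heavy_radius_bound\<close> supplies.\<close>

lemma heavy_axis_conflict:
  assumes wt: "\<And>w. 10 * wt u \<le> 19 * wt w" "wt b3 = wt u" and f: "frame u b1 b2 b3"
    and ij: "ij \<in> index_pairs" "u - b1 \<in> centres ij" "u + b1 \<in> centres ij"
    and lab: "lab ij u = u" "lab ij b1 = - b1" "lab ij b2 = b2" "lab ij b3 = b3" "\<not> orientation_preserving (lab ij)"
  shows False
proof -
  obtain c1 c2 c3 where at: "at_frame b1 b2 b3 c1 c2 c3" by (rule at_frame_exists[OF f])
  have n: "wt (- w) = wt w" for w using wt_sign_map[OF sign_maps_neg] .
  have "1/2 < rad" by (rule heavy_radius_bound[OF f]) (use wt n in auto)
  then show False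
    using folding_wall_conflict[OF f rad_d at_frame_in_M[OF at] ij lab, of c2 c3] at_frame_walls[OF at] by auto
qed

end

lemma half_frame:
  assumes "\<bar>s1\<bar> = 1" "\<bar>s2\<bar> = 1" "\<bar>s3\<bar> = 1" "\<bar>s4\<bar> = 1"
  shows "frame (s1 *\<^sub>R e 1) (s2 *\<^sub>R e 2) (s3 *\<^sub>R e 3) (s4 *\<^sub>R e 4)"
  using frame_sign0[OF frame_signs[OF frame_e assms(2-4)] assms(1)] .

lemma constant_weight_conflict:
  assumes n: "n \<in> {71, 1091, 1092}" and M: "closed_geodesic (census_code n) M"
  shows False
proof -
  interpret closed_geodesic "census_code n" M by fact
  have "weighted_geodesic (census_code n) M (\<lambda>_. 1)" by unfold_locales simp_all
  then obtain \<epsilon> a b u z where "top_cap (census_code n) M (\<lambda>_. 1) \<epsilon> a b u z"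
    using weighted_geodesic.top_cap_exists by blast
  then interpret top_cap "census_code n" M "\<lambda>_. 1" \<epsilon> a b u z .
  from u_vertex show False
  proof (cases rule: vertex_cases)
    case (axis m s)
    show False by (rule axis_conflict[OF _ axis]) simp
  next
    case (half s1 s2 s3 s4)
    note f = half_frame[OF half(1-4)]
    note c = signed_in_centres[OF half(1,3), of 1 3] signed_in_centres[OF half(2,4), of 2 4]
      signed_in_centres[OF half(1,4), of 1 4] signed_in_centres[OF half(2,3), of 2 3]
    have ip: "(1, 3) \<in> index_pairs" "(2, 4) \<in> index_pairs" "(1, 4) \<in> index_pairs" "(2, 3) \<in> index_pairs"
      unfolding index_pairs_eq by simp_all
    have u: "u = (1/2) *\<^sub>R (s1 *\<^sub>R e 1 + s3 *\<^sub>R e 3 + s2 *\<^sub>R e 2 + s4 *\<^sub>R e 4)"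
      "u = (1/2) *\<^sub>R (s1 *\<^sub>R e 1 + s4 *\<^sub>R e 4 + s2 *\<^sub>R e 2 + s3 *\<^sub>R e 3)"
      using half(5) by (simp_all add: add_ac)
    \<comment> \<open>The coinciding digit at complementary pairs is 3 for \<open>n = 71\<close> and
      F for the other two codes.\<close>
    show False
    proof (cases "n = 71")
      case True
      then have "lab (2, 4) = lab (1, 3)" by (simp only: census_digits)
      then show False by (intro half_conflict[OF _ frame_swap12[OF f] u(1) ip(1) c(1) ip(2) c(2)]) simp_all
    next
      case False
      then have "n = 1091 \<or> n = 1092" using n by blast
      then have "lab (2, 3) = lab (1, 4)" by (elim disjE) (simp_all only: census_digits)
      then show False
        by (intro half_conflict[OF _ frame_swap12[OF frame_swap23[OF f]] u(2) ip(3) c(3) ip(4) c(4)]) simp_all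
    qed
  qed
qed

text \<open>In \<open>N_mfd 23\<close> the vertices \<open>\<plusminus>e 2\<close> and \<open>\<plusminus>e 4\<close> are given a larger weight, so that
  a hemisphere of squared radius at most \<open>9/4\<close> seen from a vertex with half-integral coordinates
  contains two of them.\<close>

definition wt23 :: "real^4 \<Rightarrow> real" where
  "wt23 w = (if \<bar>w $ 2\<bar> = 1 \<or> \<bar>w $ 4\<bar> = 1 then 19/10 else 1)"

lemma wt23_sign_map: "k \<in> sign_maps \<Longrightarrow> wt23 (k w) = wt23 w"
  unfolding sign_maps_def wt23_def by (auto split: if_splits)

lemma wt23_axis:
  assumes "\<bar>s\<bar> = 1"
  shows "wt23 (s *\<^sub>R e 1) = 1" "wt23 (s *\<^sub>R e 2) = 19/10" "wt23 (s *\<^sub>R e 3) = 1" "wt23 (s *\<^sub>R e 4) = 19/10"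
  using assms by (simp_all add: wt23_def e_def axis_def)

lemma wt23_le: "1 \<le> wt23 w" "10 * wt23 v \<le> 19 * wt23 w"
  by (simp_all add: wt23_def)

lemma kdiag_axis:
  "kdiag 1 (s *\<^sub>R e 1) = - (s *\<^sub>R e 1)" "kdiag 1 (s *\<^sub>R e 2) = s *\<^sub>R e 2" "kdiag 1 (s *\<^sub>R e 3) = s *\<^sub>R e 3" "kdiag 1 (s *\<^sub>R e 4) = s *\<^sub>R e 4"
  "kdiag 4 (s *\<^sub>R e 1) = s *\<^sub>R e 1" "kdiag 4 (s *\<^sub>R e 2) = s *\<^sub>R e 2" "kdiag 4 (s *\<^sub>R e 3) = - (s *\<^sub>R e 3)" "kdiag 4 (s *\<^sub>R e 4) = s *\<^sub>R e 4"
  by (simp_all add: vec_eq_iff forall_4 kdiag_nth e_def axis_def)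

lemma frame_rotate: "frame u b1 b2 b3 \<Longrightarrow> frame b3 b2 u b1"
  using frame_swap01 frame_swap12 frame_swap23 by blast

text \<open>In code 23 complementary pairs never share a digit. The labels at 12 and 34 are the
  reflections in the first and the third coordinate, which fold at the heavy vertices; the other
  four labels preserve orientation and give the diagonal translation.\<close>

lemma varying_weight_conflict:
  assumes M: "closed_geodesic (census_code 23) M"
  shows False
proof -
  interpret closed_geodesic "census_code 23" M by fact
  have "weighted_geodesic (census_code 23) M wt23"
    by unfold_locales (auto simp: wt23_sign_map, auto simp: wt23_def)
  then obtain \<epsilon> a b u z where "top_cap (census_code 23) M wt23 \<epsilon> a b u z"
    using weighted_geodesic.top_cap_exists by blast
  then interpret top_cap "census_code 23" M wt23 \<epsilon> a b u z .
  have ip: "(1, 2) \<in> index_pairs" "(3, 4) \<in> index_pairs" "(1, 3) \<in> index_pairs" "(1, 4) \<in> index_pairs"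
    "(2, 4) \<in> index_pairs" "(2, 3) \<in> index_pairs"
    unfolding index_pairs_eq by simp_all
  have rev: "\<not> orientation_preserving (kdiag 1)" "\<not> orientation_preserving (kdiag 4)"
    unfolding kdiag_orientation by simp_all
  have pres: "orientation_preserving (kdiag 5)" "orientation_preserving (kdiag 6)"
    "orientation_preserving (kdiag 9)" "orientation_preserving (kdiag 10)"
    unfolding kdiag_orientation by simp_all
  note ka = kdiag_axis[of 1, unfolded scaleR_one]
  have pm: "v - w \<in> centres ij \<and> v + w \<in> centres ij"
    if "v = s *\<^sub>R e i" "w = t *\<^sub>R e j" "\<bar>s\<bar> = 1" "\<bar>t\<bar> = 1" "ij = (i, j) \<or> ij = (j, i)" for v w s t i j ij
    using that signed_in_centres[of s t i j] signed_in_centres[of s "- t" i j]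
      signed_in_centres[of t s j i] signed_in_centres[of "- t" s j i] by (auto simp: add.commute)
  from u_vertex show False
  proof (cases rule: vertex_cases)
    case (axis m s)
    consider "m = 1 \<or> m = 3" | "m = 2" | "m = 4" using axis(1) by blast
    then show False
    proof cases
      case 1
      then have "wt23 u = 1" using wt23_axis[OF axis(2)] axis(3) by auto
      then show False by (intro axis_conflict[OF _ axis]) (simp add: wt23_le)
    next
      case 2
      have u: "u = s *\<^sub>R e 2" using axis(3) 2 by simp
      show False
        by (rule heavy_axis_conflict[OF wt23_le(2) _ frame_sign0[OF axis_frames(1) axis(2), folded u] ip(1)])
          (use pm[OF u, of "e 1" 1 1 "(1, 2)"] axis(2) wt23_axis[of 1] in
            \<open>simp_all only: census_digits u kdiag_axis ka rev wt23_axis[OF axis(2)] scaleR_one abs_one not_False_eq_True simp_thms\<close>)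
    next
      case 3
      have u: "u = s *\<^sub>R e 4" using axis(3) 3 by simp
      show False
        by (rule heavy_axis_conflict[OF wt23_le(2) _ frame_sign0[OF axis_frames(3) axis(2), folded u] ip(2)])
          (use pm[OF u, of "e 3" 1 3 "(3, 4)"] axis(2) wt23_axis[of 1] in
            \<open>simp_all only: census_digits u kdiag_axis ka rev wt23_axis[OF axis(2)] scaleR_one abs_one not_False_eq_True simp_thms\<close>)
    qed
  next
    case (half s1 s2 s3 s4)
    define v1 v2 v3 v4 where v: "v1 = s1 *\<^sub>R e 1" "v2 = s2 *\<^sub>R e 2" "v3 = s3 *\<^sub>R e 3" "v4 = s4 *\<^sub>R e 4"
    have f: "frame v1 v2 v3 v4" unfolding v by (rule half_frame[OF half(1-4)])
    have u: "u = (1/2) *\<^sub>R (v1 + v2 + v3 + v4)" unfolding v by (rule half(5))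
    define b1 b2 b3 where b: "b1 = (1/2) *\<^sub>R (v1 + v2 - v3 - v4)" "b2 = (1/2) *\<^sub>R (v1 - v2 + v3 - v4)"
      "b3 = (1/2) *\<^sub>R (v1 - v2 - v3 + v4)"
    have fu: "frame u b1 b2 b3" unfolding u b by (rule frame_half[OF f])
    obtain c1 c2 c3 where at: "at_frame b1 b2 b3 c1 c2 c3" by (rule at_frame_exists[OF fu])
    have wu: "wt23 u = 1" "wt23 (- u) = 1"
      using half(1-4) unfolding half(5) by (auto simp: wt23_def e_def axis_def)
    have wv: "wt23 v2 = 19/10" "wt23 v4 = 19/10" unfolding v using wt23_axis half by blast+
    have op: "u + b2 = v1 + v3" "u - b2 = v2 + v4" "u + b3 = v1 + v4" "u - b3 = v2 + v3"
      unfolding u b by (simp_all add: vec_eq_iff field_simps)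
    have R: "rad \<le> 9/4"
    proof (rule ccontr)
      assume "\<not> ?thesis"
      then have R: "9/4 < rad" by simp
      have at': "at_frame b2 b3 b1 c2 c3 c1" by (rule at_frame_swap23[OF at_frame_swap12[OF at]])
      have w: "wall_ok c2 c3 c1" using at' unfolding at_frame_def by blast
      \<comment> \<open>Both words are \<open>kdiag 12\<close>: adding binary digits without carry,
        6 with 10 and 9 with 5 give 12.\<close>
      have l: "kdiag 6 (kdiag 10 x) = kdiag 9 (kdiag 5 x)" for x
        by (simp add: vec_eq_iff forall_4 kdiag_nth)
      show False
        by (rule diagonal_walls_conflict[OF at_frame_frame[OF at'] rad_d at_frame_in_M[OF at'] ip(3) _ ip(4) _ ip(5) _ ip(6) _ _ _ _ _ _ w R])
          (simp_all only: op census_digits l pres v, simp_all add: signed_in_centres half)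
    qed
    have in24: "sig v2 < 0" "sig v4 < 0"
      using half_inside[OF f u wv wu wt23_le(1) R at b] by blast+
    have k1: "kdiag 1 v1 = - v1" "kdiag 1 v2 = v2" "kdiag 1 v3 = v3" "kdiag 1 v4 = v4"
      "kdiag 4 v1 = v1" "kdiag 4 v2 = v2" "kdiag 4 v3 = - v3" "kdiag 4 v4 = v4"
      unfolding v by (rule kdiag_axis)+
    note c = pm[OF v(2) v(1) half(2,1), of "(1, 2)"] pm[OF v(4) v(3) half(4,3), of "(3, 4)"]
    show False
    proof (cases "0 \<le> c1")
      case True
      show False
        by (rule half_folding[OF at True R frame_swap01[OF f] _ _ _ _ in24 wv wu(1) ip(1)])
          (use c in \<open>simp_all only: census_digits k1 rev not_False_eq_True simp_thms\<close>, simp_all add: u b vec_eq_iff field_simps)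
    next
      case False
      \<comment> \<open>Reversing \<open>b1\<close> and \<open>b3\<close> makes the first centre
        coordinate positive and exchanges the heavy vertices: the fold is now at \<open>v4\<close>
        in the direction of \<open>v3\<close>, with label 4.\<close>
      have at': "at_frame (- b1) b2 (- b3) (- c1) c2 (- c3)"
        by (rule at_frame_neg1[OF at, THEN at_frame_swap12, THEN at_frame_swap23, THEN at_frame_swap12, THEN at_frame_neg1,
            THEN at_frame_swap12, THEN at_frame_swap23, THEN at_frame_swap12])
      show False
        by (rule half_folding[OF at' _ R frame_rotate[OF f] _ _ _ _ in24(2,1) wv(2,1) wu(1) ip(2)])
          (use c False in \<open>simp_all only: census_digits k1 rev not_False_eq_True simp_thms\<close>, simp_all add: u b vec_eq_iff field_simps)
    qed
  qed
qed

theorem theorem1p1: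
  fixes n :: nat
  assumes "n \<in> {23, 71, 1091, 1092}"
  shows "\<not> (\<exists>M. closed_embedded_totally_geodesic (W_mfd n) M)"
proof
  assume "\<exists>M. closed_embedded_totally_geodesic (W_mfd n) M"
  then obtain M where M: "closed_embedded_totally_geodesic (orientation_double_cover (glued_manifold (census_code n))) M"
    unfolding W_mfd_def N_mfd_def by blast
  have "closed_geodesic (census_code n) M"
    by unfold_locales (use census_nontrivial[OF assms] M in auto)
  then show False
    using assms constant_weight_conflict[of n M] varying_weight_conflict[of M] by (cases "n = 23") auto
qed

end
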